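(* Consider the regression model $Y_i=f_o(X_i)+\varepsilon_i$, $i=1,\dots,n$, described in the context, with $\mu_X$ equal to Lebesgue measure on $[0,1]$. Let $s$ be a positive integer, and suppose $f_o\in W^s_\infty[0,1]=\{g:\|D^sg\|_{L_\infty[0,1]}<\infty\}$ and $\|f_o\|_\infty<M$, where $M$ is a known constant. Let $J=\{(k,q,L):k,q,L\text{ integers},\ k\ge0,\ q\ge1,\ L\ge1\}$. For $j=(k,q,L)\in J$ let $m_j=k+q$ and, for $i\in\{1,\dots,m_j\}$, let $B_{j,i}$ be the normalized B-spline (of order $q$) associated with the knots $y_i,\dots,y_{i+q}$, where $$(y_1,\dots,y_{2q+k})=(\underbrace{0,\dots,0}_{q\text{ times}},\tfrac1{1+k},\dots,\tfrac k{1+k},\underbrace{1,\dots,1}_{q\text{ times}}).$$ For $\theta=(\theta_1,\dots,\theta_{m_j})\in\mathbb R^{m_j}$ let $f_{\theta,j}=\sum_{i=1}^{m_j}\theta_iB_{j,i}$, and define $$\Theta_j=\{\theta\in\mathbb R^{m_j}:\|D^rf_{\theta,j}\|_{L_\infty[0,1]}\le L\ \ \forall r\in\{0,1,\dots,q-1\}\ \text{ and }\ \|f_{\theta,j}\|_\infty\le M\}.$$ Put $$A_j=9.64\sqrt q\,(2q+1)9^{q-1}+0.06,\qquad C_j=m_j+L,$$ $$\eta_j=\frac{4m_j}{c_{1,M,\sigma}(1-4\gamma)}\log(1072.5A_j)+C_j\max\left(1,\frac8{c_{1,M,\sigma}(1-4\gamma)}\right),$$ $$a_j=\alpha\exp\left(-\left(1+\frac1{2\sigma^2}+\frac{0.0056}\sigma\right)\eta_j\right),$$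 where $\alpha$ is the normalizing constant such that $\sum_{j\in J}a_j=1$, and $c_{1,M,\sigma}$ and $\gamma$ are the constants given in the context. Let $\pi_j$ be the (normalized) Lebesgue measure on $\Theta_j$, let $\tilde\pi_j$ be the prior on regression functions induced by $\pi_j$ via $\theta\mapsto f_{\theta,j}$, and let $\tilde\pi=\sum_{j\in J}a_j\tilde\pi_j$. Then there is a sequence $s_n\propto n^{-s/(1+2s)}$ such that the posterior probability $$\tilde\pi\bigl(\tilde B_{L_2(\mu_X)}(s_n)^c\mid(X_1,Y_1),\dots,(X_n,Y_n)\bigr)$$ converges to zero in $P_{f_o}^n$-probability as $n\to\infty$.
   Context: Regression model. The pairs $(X_i,Y_i)$ are i.i.d., $Y_i=f_o(X_i)+\varepsilon_i$, $X_i$ and $\varepsilon_i$ independent, $X_i\sim\mu_X$, $\varepsilon_i\sim N(0,\sigma^2)$ with known $\sigma^2>0$. For a regression function $f$, $p_f(x,y)=\frac1{\sqrt{2\pi}\sigma}e^{-(y-f(x))^2/(2\sigma^2)}$ is the density of $(X_i,Y_i)$ with respect to $\mu_X\times$ Lebesgue measure. $P_{f_o}^n$ is the joint law of the data under the true $f_o$. Constants. $c_{1,M,\sigma}=\min\left(\frac{1-\exp(-M^2/(2\sigma^2))}{2M^2},\frac1{2\sigma^2}\right)$; $c_{2,c_0,M}=2(c_0+2M)$ with $c_0=2\sigma$; $\gamma\in(0,0.25)$ is defined by $0.0056=\frac{0.13}{c_{2,c_0,M}\sqrt{c_{1,M,\sigma}}}\cdot\frac\gamma{\sqrt{1-4\gamma}}$.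 $\|\cdot\|_{L_\infty[0,1]}$ is the essential sup norm with respect to Lebesgue measure, $\|\cdot\|_\infty$ the sup norm, $D^r$ the $r$-th derivative. $s_n\propto t_n$ means $s_n=Kt_n$ for a positive constant $K$ independent of $n$. Normalized B-splines: $B_{j,i}=N_i^q$, where $N_i^1=\mathbb 1_{[y_i,y_{i+1})}$ and $N_i^p(x)=\frac{x-y_i}{y_{i+p-1}-y_i}N_i^{p-1}(x)+\frac{y_{i+p}-x}{y_{i+p}-y_{i+1}}N_{i+1}^{p-1}(x)$ for $p\ge2$ (terms with zero denominator are taken as $0$; values at $x=1$ are left limits). $\tilde B_{L_2(\mu_X)}(s)=\{f:\|f-f_o\|_{L_2(\mu_X)}\le s\}$ (among the functions $f_{\theta,j}$), and the posterior probability of its complement is $$\frac{\sum_ja_j\int_{\{\theta\in\Theta_j:\|f_{\theta,j}-f_o\|_{L_2(\mu_X)}>s\}}\prod_{i=1}^np_{f_{\theta,j}}(X_i,Y_i)\,d\pi_j(\theta)}{\sum_ja_j\int_{\Theta_j}\prod_{i=1}^np_{f_{\theta,j}}(X_i,Y_i)\,d\pi_j(\theta)} .$$ *)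

theory Defs
  imports "HOL-Probability.Probability"
begin

definition mu_X :: "real measure" where
  "mu_X = restrict_space lborel {0..1}"

definition sup_norm :: "(real \<Rightarrow> real) \<Rightarrow> ereal" where
  "sup_norm f = (SUP x\<in>{0..1}. ereal \<bar>f x\<bar>)"

text \<open>Completed Lebesgue measure is used here, because \<open>esssup\<close> is infinite on non-measurable
  functions, and \<open>Dr r f\<close> below has junk values on a null set.\<close>
definition Linf_norm :: "(real \<Rightarrow> real) \<Rightarrow> ereal" where
  "Linf_norm f = esssup (lebesgue_on {0..1}) (\<lambda>x. ereal \<bar>f x\<bar>)"

definition L2_norm :: "(real \<Rightarrow> real) \<Rightarrow> real" where
  "L2_norm f = sqrt (\<integral>x. (f x)\<^sup>2 \<partial>mu_X)"

text \<open>\<open>Dr r f\<close> is only ever used almost everywhere on the open unit interval, so values of \<open>f\<close>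
  outside the unit interval and the behaviour at its end points are irrelevant.\<close>
definition Dr :: "nat \<Rightarrow> (real \<Rightarrow> real) \<Rightarrow> real \<Rightarrow> real" where
  "Dr r f = (deriv ^^ r) f"

definition abs_continuous_on :: "real set \<Rightarrow> (real \<Rightarrow> real) \<Rightarrow> bool" where
  "abs_continuous_on S f \<longleftrightarrow>
     (\<forall>\<epsilon>>0. \<exists>\<delta>>0. \<forall>(N::nat) a b.
        (\<forall>i<N. a i \<le> b i \<and> {a i..b i} \<subseteq> S) \<longrightarrow>
        disjoint_family_on (\<lambda>i. {a i<..<b i}) {..<N} \<longrightarrow>
        (\<Sum>i<N. b i - a i) < \<delta> \<longrightarrow>
        (\<Sum>i<N. \<bar>f (b i) - f (a i)\<bar>) < \<epsilon>)"

text \<open>The Sobolev space \<open>W\<^sup>s\<^sub>\<infinity>[0,1]\<close> for \<open>s \<ge> 1\<close>, with its members taken as continuous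
  functions. Absolute continuity of the derivative of order \<open>s - 1\<close> makes the almost everywhere
  derivative \<open>Dr s g\<close> agree with the weak one; it also forces \<open>Dr (s - 1) g\<close>, and hence the lower
  derivatives, to extend continuously to the closed interval.\<close>
definition W_inf :: "nat \<Rightarrow> (real \<Rightarrow> real) set" where
  "W_inf s = {g. continuous_on {0..1} g \<and>
     (\<forall>r<s - 1. \<forall>x\<in>{0<..<1}. Dr r g differentiable at x) \<and>
     abs_continuous_on {0<..<1} (Dr (s - 1) g) \<and>
     (AE x in lebesgue_on {0..1}. Dr (s - 1) g differentiable at x) \<and>
     Linf_norm (Dr s g) < \<infinity>}"

text \<open>The terms with zero denominator vanish because of \<open>x / 0 = 0\<close>.\<close>
fun N_spline :: "(nat \<Rightarrow> real) \<Rightarrow> nat \<Rightarrow> nat \<Rightarrow> real \<Rightarrow> real" where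
  "N_spline y 0 i x = 0"
| "N_spline y (Suc 0) i x = indicator {y i..<y (i + 1)} x"
| "N_spline y (Suc (Suc p)) i x =
     (x - y i) / (y (i + Suc p) - y i) * N_spline y (Suc p) i x +
     (y (i + Suc (Suc p)) - x) / (y (i + Suc (Suc p)) - y (i + 1)) * N_spline y (Suc p) (i + 1) x"

text \<open>Knots are numbered from \<open>1\<close> to \<open>2 * q + k\<close>.\<close>
definition knot :: "nat \<Rightarrow> nat \<Rightarrow> nat \<Rightarrow> real" where
  "knot k q i = (if i \<le> q then 0 else if i \<le> q + k then real (i - q) / (1 + real k) else 1)"

definition B_spline :: "nat \<Rightarrow> nat \<Rightarrow> nat \<Rightarrow> real \<Rightarrow> real" where
  "B_spline k q i x =
     (if x = 1 then Lim (at_left 1) (N_spline (knot k q) q i) else N_spline (knot k q) q i x)"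

type_synonym idx = "nat \<times> nat \<times> nat"

definition Jset :: "idx set" where
  "Jset = {(k, q, L). q \<ge> 1 \<and> L \<ge> 1}"

fun mdim :: "idx \<Rightarrow> nat" where
  "mdim (k, q, L) = k + q"

fun f_spline :: "idx \<Rightarrow> (nat \<Rightarrow> real) \<Rightarrow> real \<Rightarrow> real" where
  "f_spline (k, q, L) \<theta> x = (\<Sum>i=1..k + q. \<theta> i * B_spline k q i x)"

text \<open>Vectors in \<open>\<real>\<^sup>d\<close> are extensional functions on \<open>{1..d}\<close>.\<close>
definition lebesgue_R :: "nat \<Rightarrow> (nat \<Rightarrow> real) measure" where
  "lebesgue_R d = (\<Pi>\<^sub>M i\<in>{1..d}. lborel)"

fun Theta :: "real \<Rightarrow> idx \<Rightarrow> (nat \<Rightarrow> real) set" where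
  "Theta M (k, q, L) = {\<theta> \<in> space (lebesgue_R (k + q)).
     (\<forall>r\<in>{0..q - 1}. Linf_norm (Dr r (f_spline (k, q, L) \<theta>)) \<le> ereal (real L)) \<and>
     sup_norm (f_spline (k, q, L) \<theta>) \<le> ereal M}"

definition pi_prior :: "real \<Rightarrow> idx \<Rightarrow> (nat \<Rightarrow> real) measure" where
  "pi_prior M j = uniform_measure (lebesgue_R (mdim j)) (Theta M j)"

definition c1 :: "real \<Rightarrow> real \<Rightarrow> real" where
  "c1 M \<sigma> = min ((1 - exp (- M\<^sup>2 / (2 * \<sigma>\<^sup>2))) / (2 * M\<^sup>2)) (1 / (2 * \<sigma>\<^sup>2))"

definition c2 :: "real \<Rightarrow> real \<Rightarrow> real" where
  "c2 c0 M = 2 * (c0 + 2 * M)"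

definition gamma_eq :: "real \<Rightarrow> real \<Rightarrow> real \<Rightarrow> bool" where
  "gamma_eq M \<sigma> g \<longleftrightarrow> 0 < g \<and> g < 0.25 \<and>
     0.0056 = 0.13 / (c2 (2 * \<sigma>) M * sqrt (c1 M \<sigma>)) * (g / sqrt (1 - 4 * g))"

definition gamma_cst :: "real \<Rightarrow> real \<Rightarrow> real" where
  "gamma_cst M \<sigma> = (THE g. gamma_eq M \<sigma> g)"

fun A_coef :: "idx \<Rightarrow> real" where
  "A_coef (k, q, L) = 9.64 * sqrt (real q) * (2 * real q + 1) * 9 ^ (q - 1) + 0.06"

fun C_coef :: "idx \<Rightarrow> real" where
  "C_coef (k, q, L) = real (mdim (k, q, L)) + real L"

definition eta_coef :: "real \<Rightarrow> real \<Rightarrow> idx \<Rightarrow> real" where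
  "eta_coef M \<sigma> j =
     4 * real (mdim j) / (c1 M \<sigma> * (1 - 4 * gamma_cst M \<sigma>)) * ln (1072.5 * A_coef j) +
     C_coef j * max 1 (8 / (c1 M \<sigma> * (1 - 4 * gamma_cst M \<sigma>)))"

definition weight0 :: "real \<Rightarrow> real \<Rightarrow> idx \<Rightarrow> real" where
  "weight0 M \<sigma> j = exp (- (1 + 1 / (2 * \<sigma>\<^sup>2) + 0.0056 / \<sigma>) * eta_coef M \<sigma> j)"

definition alpha_cst :: "real \<Rightarrow> real \<Rightarrow> real" where
  "alpha_cst M \<sigma> = 1 / (\<Sum>\<^sub>\<infinity>j\<in>Jset. weight0 M \<sigma> j)"

definition weight :: "real \<Rightarrow> real \<Rightarrow> idx \<Rightarrow> real" where
  "weight M \<sigma> j = alpha_cst M \<sigma> * weight0 M \<sigma> j"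

definition p_dens :: "real \<Rightarrow> (real \<Rightarrow> real) \<Rightarrow> real \<times> real \<Rightarrow> real" where
  "p_dens \<sigma> f = (\<lambda>(x, y). normal_density (f x) \<sigma> y)"

definition data_space :: "nat \<Rightarrow> (nat \<Rightarrow> real \<times> real) measure" where
  "data_space n = (\<Pi>\<^sub>M i\<in>{1..n}. mu_X \<Otimes>\<^sub>M borel)"

definition joint_law ::
  "'w measure \<Rightarrow> (nat \<Rightarrow> 'w \<Rightarrow> real) \<Rightarrow> (nat \<Rightarrow> 'w \<Rightarrow> real) \<Rightarrow> nat \<Rightarrow> (nat \<Rightarrow> real \<times> real) measure"
  where "joint_law \<Omega> X Y n = distr \<Omega> (data_space n) (\<lambda>w. \<lambda>i\<in>{1..n}. (X i w, Y i w))"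

text \<open>The posterior probability, given the data \<open>z\<close>, of the regression functions at
  \<open>L\<^sub>2\<close>-distance larger than \<open>s\<close> from \<open>f\<^sub>o\<close>.\<close>
definition posterior_far ::
  "real \<Rightarrow> real \<Rightarrow> (real \<Rightarrow> real) \<Rightarrow> nat \<Rightarrow> real \<Rightarrow> (nat \<Rightarrow> real \<times> real) \<Rightarrow> real" where
  "posterior_far M \<sigma> f\<^sub>o n s z =
     (\<Sum>\<^sub>\<infinity>j\<in>Jset. weight M \<sigma> j *
        (LINT \<theta>:{\<theta> \<in> Theta M j. L2_norm (\<lambda>x. f_spline j \<theta> x - f\<^sub>o x) > s}|pi_prior M j.
           (\<Prod>i=1..n. p_dens \<sigma> (f_spline j \<theta>) (z i)))) /
     (\<Sum>\<^sub>\<infinity>j\<in>Jset. weight M \<sigma> j *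
        (LINT \<theta>:Theta M j|pi_prior M j. (\<Prod>i=1..n. p_dens \<sigma> (f_spline j \<theta>) (z i))))"

definition tendsto_zero_in_prob :: "(nat \<Rightarrow> 'b measure) \<Rightarrow> (nat \<Rightarrow> 'b \<Rightarrow> real) \<Rightarrow> bool" where
  "tendsto_zero_in_prob P Z \<longleftrightarrow>
     (\<forall>n. Z n \<in> borel_measurable (P n)) \<and>
     (\<forall>\<delta>>0. (\<lambda>n. measure (P n) {z \<in> space (P n). \<bar>Z n z\<bar> > \<delta>}) \<longlonglongrightarrow> 0)"

lemma c1_pos: "0 < M \<Longrightarrow> 0 < \<sigma> \<Longrightarrow> 0 < c1 M \<sigma>"
  by (simp add: c1_def)

lemma gamma_eq_ex1:
  assumes "0 < M" "0 < \<sigma>"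
  shows "\<exists>!g. gamma_eq M \<sigma> g"
proof -
  define K where "K = 0.13 / (c2 (2 * \<sigma>) M * sqrt (c1 M \<sigma>))"
  have K: "K > 0" using assms c1_pos[OF assms] by (simp add: K_def c2_def)
  define t where "t = 0.0056 / K"
  have t: "t > 0" using K by (simp add: t_def)
  define u where "u = sqrt (4 * t\<^sup>2 + 1)"
  have u: "u\<^sup>2 = 4 * t\<^sup>2 + 1" "u > 0" by (auto simp: u_def intro: add_nonneg_pos)
  have u2: "u > 2 * t"
    by (rule power2_less_imp_less) (use u in \<open>auto simp: power2_eq_square\<close>)
  define g0 where "g0 = t * (u - 2 * t)"
  have pos: "g0 > 0" using t u2 by (simp add: g0_def)
  have sq: "1 - 4 * g0 = (u - 2 * t)\<^sup>2"
    using u(1) by (simp add: g0_def power2_eq_square algebra_simps)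
  have iff: "gamma_eq M \<sigma> g \<longleftrightarrow> 0 < g \<and> g < 1/4 \<and> g / sqrt (1 - 4 * g) = t" for g
  proof -
    have "0.0056 = K * (g / sqrt (1 - 4 * g)) \<longleftrightarrow> g / sqrt (1 - 4 * g) = t"
      unfolding t_def using K by (auto simp: field_simps)
    then show ?thesis by (simp add: gamma_eq_def K_def)
  qed
  have ex: "gamma_eq M \<sigma> g0"
  proof -
    have "0 < 1 - 4 * g0" using sq u2 by simp
    moreover have "g0 / sqrt (1 - 4 * g0) = t"
      unfolding sq using u2 by (simp add: g0_def)
    ultimately show ?thesis using pos by (simp add: iff)
  qed
  have less: False
    if "gamma_eq M \<sigma> a" "gamma_eq M \<sigma> b" "a < b" for a b
  proof -
    have "sqrt (1 - 4 * b) < sqrt (1 - 4 * a)" "0 < sqrt (1 - 4 * b)"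
      using that by (auto simp: iff)
    then have "a / sqrt (1 - 4 * a) < b / sqrt (1 - 4 * b)"
      using that by (intro frac_less) (auto simp: iff)
    then show False using that by (simp add: iff)
  qed
  show ?thesis
    using ex less by (metis linorder_neqE_linordered_idom)
qed

lemma gamma_eq_gamma:
  assumes "0 < M" "0 < \<sigma>"
  shows "gamma_eq M \<sigma> (gamma_cst M \<sigma>)"
  unfolding gamma_cst_def by (rule theI') (rule gamma_eq_ex1[OF assms])

lemma weight0_le:
  assumes "0 < M" "0 < \<sigma>" "(k, q, L) \<in> Jset"
  shows "weight0 M \<sigma> (k, q, L) \<le> exp (-1) ^ k * (exp (-1) ^ q * exp (-1) ^ L)"
proof -
  let ?d = "c1 M \<sigma> * (1 - 4 * gamma_cst M \<sigma>)"
  have d: "?d > 0" using c1_pos[OF assms(1,2)] gamma_eq_gamma[OF assms(1,2)]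
    by (simp add: gamma_eq_def)
  have "0 \<le> 9.64 * sqrt (real q) * (2 * real q + 1) * 9 ^ (q - 1)" by simp
  then have "A_coef (k, q, L) \<ge> 0.06" by (simp only: A_coef.simps)
  then have "1072.5 * 0.06 \<le> 1072.5 * A_coef (k, q, L)"
    by (intro mult_left_mono) auto
  moreover have "1 \<le> 1072.5 * (0.06 :: real)" by simp
  ultimately have "1072.5 * A_coef (k, q, L) \<ge> 1" by (rule order_trans[rotated])
  then have "ln (1072.5 * A_coef (k, q, L)) \<ge> 0" by (rule ln_ge_zero)
  then have 1: "4 * real (mdim (k, q, L)) / ?d * ln (1072.5 * A_coef (k, q, L)) \<ge> 0"
    using d by (intro mult_nonneg_nonneg divide_nonneg_pos) auto
  have 2: "C_coef (k, q, L) * 1 \<le> C_coef (k, q, L) * max 1 (8 / ?d)"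
    by (intro mult_left_mono) auto
  have e: "real k + real q + real L \<le> eta_coef M \<sigma> (k, q, L)"
    using 1 2 by (simp add: eta_coef_def del: A_coef.simps)
  have c: "1 \<le> 1 + 1 / (2 * \<sigma>\<^sup>2) + 0.0056 / \<sigma>" using assms by simp
  have "1 * (real k + real q + real L) \<le> (1 + 1 / (2 * \<sigma>\<^sup>2) + 0.0056 / \<sigma>) * eta_coef M \<sigma> (k, q, L)"
    using e c by (intro mult_mono) auto
  then have "weight0 M \<sigma> (k, q, L) \<le> exp (- (real k + real q + real L))"
    unfolding weight0_def by (simp only: exp_le_cancel_iff minus_mult_left[symmetric]) simp
  also have "\<dots> = exp (-1) ^ k * (exp (-1) ^ q * exp (-1) ^ L)"
    by (simp add: exp_of_nat_mult[symmetric] exp_add[symmetric])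
  finally show ?thesis .
qed

lemma summable_on_times_nonneg:
  fixes f :: "'a \<Rightarrow> real" and g :: "'b \<Rightarrow> real"
  assumes "f summable_on UNIV" "g summable_on UNIV" "\<And>x. f x \<ge> 0" "\<And>y. g y \<ge> 0"
  shows "(\<lambda>(x, y). f x * g y) summable_on UNIV"
proof -
  have "(\<lambda>(x, y). f x * g y) summable_on Sigma UNIV (\<lambda>_. UNIV)"
  proof (rule summable_on_SigmaI)
    show "((\<lambda>y. (\<lambda>(x, y). f x * g y) (x, y)) has_sum f x * infsum g UNIV) UNIV" for x
      by (simp add: has_sum_cmult_right has_sum_infsum assms)
    show "(\<lambda>x. f x * infsum g UNIV) summable_on UNIV"
      by (intro summable_on_cmult_left assms)
  qed (use assms in auto)
  then show ?thesis by simp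
qed

lemma weight_has_sum_1:
  assumes "0 < M" "0 < \<sigma>"
  shows "(weight M \<sigma> has_sum 1) Jset"
proof -
  let ?e = "\<lambda>k::nat. exp (-1) ^ k :: real"
  have s: "?e summable_on UNIV"
    by (subst summable_on_UNIV_nonneg_real_iff) (auto intro: summable_geometric)
  have s2: "(\<lambda>(q, L). ?e q * ?e L) summable_on UNIV"
    by (intro summable_on_times_nonneg s) auto
  have s3: "(\<lambda>(k, p). ?e k * (\<lambda>(q, L). ?e q * ?e L) p) summable_on UNIV"
    by (intro summable_on_times_nonneg s s2) auto
  have s4: "weight0 M \<sigma> summable_on Jset"
  proof (rule summable_on_comparison_test)
    show "(\<lambda>(k, p). ?e k * (\<lambda>(q, L). ?e q * ?e L) p) summable_on Jset"
      by (rule summable_on_subset_banach[OF s3]) auto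
  qed (use weight0_le[OF assms] in \<open>auto simp: weight0_def\<close>)
  have p: "0 < infsum (weight0 M \<sigma>) Jset"
  proof -
    have "sum (weight0 M \<sigma>) {(0,1,1)} \<le> infsum (weight0 M \<sigma>) Jset"
      by (intro finite_sum_le_infsum s4) (auto simp: Jset_def weight0_def)
    then show ?thesis by (simp add: weight0_def) (smt (verit) exp_gt_zero)
  qed
  have "((\<lambda>j. alpha_cst M \<sigma> * weight0 M \<sigma> j) has_sum (alpha_cst M \<sigma> * infsum (weight0 M \<sigma>) Jset)) Jset"
    by (intro has_sum_cmult_right has_sum_infsum s4)
  moreover have "alpha_cst M \<sigma> * infsum (weight0 M \<sigma>) Jset = 1" using p by (simp add: alpha_cst_def)
  ultimately show ?thesis by (simp add: weight_def[abs_def])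
qed

end

theory Submission
  imports Defs
begin

text \<open>
  Write \<open>t = n powr (1 / (1 + 2 s))\<close>; the target is a posterior tail of order \<open>exp (- t)\<close> outside
  a ball of squared radius proportional to \<open>t / n\<close>.

  Denominator of the posterior. Take splines of order \<open>s + 1\<close> with \<open>s N\<close> cells, where \<open>N\<close> is about \<open>t\<close>,
  and a smoothness bound \<open>L\<close> that does not depend on \<open>n\<close>. Hermite interpolation of \<open>f\<^sub>o\<close> at the ends of
  blocks of \<open>s\<close> cells gives a spline at distance \<open>O(1 / N ^ s)\<close> that lies in the parameter set together
  with a box of coefficients around it. The parameter set is covered by \<open>exp (O(N))\<close> translates of this
  box, because Taylor expansion from knot to knot leaves boundedly many choices for the integer parts
  of the scaled derivatives; so the box has prior mass at least \<open>exp (- O(N))\<close>. The inequality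
  \<open>l / \<tau>\<^sup>2 + 1 / l \<ge> 2 / \<tau>\<close>, integrated over the box, and Markov's inequality for the inverse likelihood
  ratio show that the denominator exceeds \<open>exp (- O(t))\<close> except with probability \<open>exp (- t)\<close>.

  Numerator. Models with \<open>C_coef j\<close> larger than a multiple of \<open>t\<close> have negligible weight. In each of
  the others, the distant parameters are cut into cubes in \<open>L\<^sub>2\<close>-orthonormal coordinates, and every cube
  is tested with the square root of the likelihood ratio of one of its members. A summand \<open>a N\<^sub>c\<close> of the
  numerator does not exceed the denominator \<open>D\<close>, so its share of the posterior is at most
  \<open>sqrt a * T + sqrt a * N\<^sub>c / (D * T)\<close> for the test statistic \<open>T\<close>. Both terms have exponentially small
  expectation, and their sum over all cubes is a product of geometric series, one for each coordinate.
\<close>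

subsection \<open>Splines and their derivatives\<close>

text \<open>A factor log n in any exponent would spoil the rate, so everything has to be O(t). With
  \<open>N\<close> of order \<open>t\<close> and n = t^(1+2s), the squared approximation error
  N^(-2s) costs n N^(-2s) = O(t). The delicate quantity is the prior mass: comparing a box of side
  N^(-s) with a sup-norm ball of coefficients would cost N log N. The derivative bounds inside
  \<open>Theta\<close> remove the logarithm. For order \<open>s + 1\<close> they bound even the top
  derivative, a step function, by \<open>L\<close>. For the same reason the approximating spline
  needs bounded derivatives up to order s besides a small error. A block of s cells provides exactly
  the s free jumps of the top derivative that s interpolation conditions require, and exact
  interpolation at the block ends keeps errors from accumulating. On the testing side a model counts
  through its dimension, which \<open>C_coef\<close> dominates. The square root of the weight arises
  from balancing the two errors of a test: both keep the factor exp(-C_j/2), which is summable over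
  the models.\<close>

lemma N_spline_measurable [measurable]: "N_spline y p i \<in> borel_measurable borel"
\<comment> \<open>The claim concerns the whole function, so the point argument of the induction rule
  is filled with a dummy.\<close>
proof (induction y p i "0::real" rule: N_spline.induct)
  case (3 y p i)
  have 1: "N_spline y (Suc (Suc p)) i = (\<lambda>x. (x - y i) / (y (i + Suc p) - y i) * N_spline y (Suc p) i x +
     (y (i + Suc (Suc p)) - x) / (y (i + Suc (Suc p)) - y (i + 1)) * N_spline y (Suc p) (i + 1) x)"
    by (rule ext) simp
  show ?case unfolding 1 using 3 by measurable
qed (auto simp: N_spline.simps[abs_def])

text \<open>The knots are arbitrary here, so the weights of the recursion need not be convex. Some
  finite bound suffices: it places the B-splines among the bounded functions, for which L2 inner
  products exist.\<close>

lemma N_spline_bounded: "\<exists>C\<ge>0. \<forall>x\<in>{0..1}. \<bar>N_spline y p i x\<bar> \<le> C"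
proof (induction y p i "0::real" rule: N_spline.induct)
  case (2 y i)
  show ?case by (intro exI[of _ 1]) (auto simp: indicator_def)
next
  case (3 y p i)
  then obtain C D where CD: "C \<ge> 0" "D \<ge> 0" "\<And>x. x\<in>{0..1} \<Longrightarrow> \<bar>N_spline y (Suc p) i x\<bar> \<le> C"
    "\<And>x. x\<in>{0..1} \<Longrightarrow> \<bar>N_spline y (Suc p) (i+1) x\<bar> \<le> D" by auto
  define a where "a = (1 + \<bar>y i\<bar>) / \<bar>y (i + Suc p) - y i\<bar>"
  define b where "b = (1 + \<bar>y (i + Suc (Suc p))\<bar>) / \<bar>y (i + Suc (Suc p)) - y (i + 1)\<bar>"
  have ab: "a \<ge> 0" "b \<ge> 0" by (auto simp: a_def b_def)
  have "\<bar>N_spline y (Suc (Suc p)) i x\<bar> \<le> a * C + b * D" if "x \<in> {0..1}" for x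
  proof -
    have "\<bar>(x - y i) / (y (i + Suc p) - y i) * N_spline y (Suc p) i x\<bar> \<le> a * C"
      unfolding a_def abs_mult abs_divide using CD that
      by (intro mult_mono divide_right_mono) auto
    moreover have "\<bar>(y (i + Suc (Suc p)) - x) / (y (i + Suc (Suc p)) - y (i + 1)) * N_spline y (Suc p) (i + 1) x\<bar> \<le> b * D"
      unfolding b_def abs_mult abs_divide using CD that
      by (intro mult_mono divide_right_mono) auto
    ultimately show ?thesis unfolding N_spline.simps by linarith
  qed
  moreover have "a * C + b * D \<ge> 0" using CD ab by simp
  ultimately show ?case by blast
qed auto

lemma tendsto_linear_div:
  fixes a c :: real
  assumes "(f \<longlongrightarrow> l) F"
  shows "((\<lambda>z. (f z - a) / c) \<longlongrightarrow> (l - a) / c) F" "((\<lambda>z. (a - f z) / c) \<longlongrightarrow> (a - l) / c) F"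
  unfolding divide_inverse by (intro tendsto_mult tendsto_diff tendsto_const assms)+

text \<open>The order-one indicators are half-open on the right, and the recursion keeps right
  continuity even at multiple knots. This is what later turns almost-everywhere bounds into bounds
  at every point of [0,1).\<close>

lemma N_spline_right_cont: "((N_spline y p i) \<longlongrightarrow> N_spline y p i x) (at_right x)"
proof (induction y p i x rule: N_spline.induct)
  case (2 y i x)
  consider "x < y i" | "y i \<le> x" "x < y (i+1)" | "y i \<le> x" "y (i+1) \<le> x" by linarith
  then show ?case
  proof cases
    case 1
    have "\<forall>\<^sub>F z in at_right x. N_spline y (Suc 0) i z = 0"
      using eventually_at_right_less[of x] order_tendstoD(2)[OF tendsto_ident_at 1]
      by (rule eventually_mono[OF eventually_conj]) auto
    then show ?thesis using 1 by (simp add: tendsto_eventually)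
  next
    case 2
    have "\<forall>\<^sub>F z in at_right x. N_spline y (Suc 0) i z = 1"
      using eventually_at_right_less[of x] order_tendstoD(2)[OF tendsto_ident_at 2(2)]
      by (rule eventually_mono[OF eventually_conj]) (use 2 in auto)
    then show ?thesis using 2 by (simp add: tendsto_eventually)
  next
    case 3
    have "\<forall>\<^sub>F z in at_right x. N_spline y (Suc 0) i z = 0"
      using eventually_at_right_less[of x]
      by (rule eventually_mono) (use 3 in auto)
    then show ?thesis using 3 by (simp add: tendsto_eventually)
  qed
next
  case (3 y p i x)
  show ?case unfolding N_spline.simps[abs_def]
    by (intro tendsto_add tendsto_mult tendsto_linear_div tendsto_ident_at 3)
qed simp

text \<open>Makes \<open>Lim (at_left 1)\<close> in \<open>B_spline\<close> an actual limit instead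
  of an arbitrary value.\<close>

lemma N_spline_left_lim: "\<exists>l. ((N_spline y p i) \<longlongrightarrow> l) (at_left (x::real))"
proof (induction y p i x rule: N_spline.induct)
  case (2 y i x)
  consider "x \<le> y i" | "y i < x" "x \<le> y (i+1)" | "y i < x" "y (i+1) < x" by linarith
  then show ?case
  proof cases
    case 1
    have "\<forall>\<^sub>F z in at_left x. N_spline y (Suc 0) i z = 0"
      unfolding eventually_at_filter by (rule always_eventually) (use 1 in auto)
    then show ?thesis by (blast intro: tendsto_eventually)
  next
    case 2
    have "\<forall>\<^sub>F z in at_left x. N_spline y (Suc 0) i z = 1"
      using order_tendstoD(1)[OF tendsto_ident_at[of x UNIV] 2(1)] unfolding eventually_at_filter
      by (rule eventually_mono) (use 2 in auto)
    then show ?thesis by (blast intro: tendsto_eventually)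
  next
    case 3
    have "\<forall>\<^sub>F z in at_left x. N_spline y (Suc 0) i z = 0"
      using order_tendstoD(1)[OF tendsto_ident_at 3(2)]
      by (rule eventually_mono) (use 3 in auto)
    then show ?thesis by (blast intro: tendsto_eventually)
  qed
next
  case (3 y p i x)
  then obtain l m where "(N_spline y (Suc p) i \<longlongrightarrow> l) (at_left x)" "(N_spline y (Suc p) (i+1) \<longlongrightarrow> m) (at_left x)" by blast
  then show ?case unfolding N_spline.simps[abs_def]
    by (intro exI[of _ "(x - y i) / (y (i + Suc p) - y i) * l + (y (i + Suc (Suc p)) - x) / (y (i + Suc (Suc p)) - y (i + 1)) * m"]
      tendsto_add tendsto_mult tendsto_linear_div tendsto_ident_at)
qed auto

text \<open>Up to the factor p this is the B-spline of integral one. Order 0 and coinciding knots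
  give 0 (the latter through division by zero), so the derivative formula below has no exceptional
  cases.\<close>

definition Q_spline :: "(nat \<Rightarrow> real) \<Rightarrow> nat \<Rightarrow> nat \<Rightarrow> real \<Rightarrow> real" where
  "Q_spline y p i x = N_spline y p i x / (y (i + p) - y i)"

lemma N_spline_Q: "p \<ge> 1 \<Longrightarrow> N_spline y (Suc p) i x =
    (x - y i) * Q_spline y p i x + (y (i + Suc p) - x) * Q_spline y p (i + 1) x"
  by (cases p) (auto simp: Q_spline_def)

text \<open>Differentiating the recursion written with \<open>Q_spline\<close> leaves (x - y_i) Q_i'
  and (y_(i+p+1) - x) Q_(i+1)'. The induction hypothesis and the recursion one order lower turn each
  of them into a difference of two Q-splines (\<open>e1\<close>, \<open>e2\<close>), and the
  lower-order terms cancel in the sum.\<close>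

lemma N_spline_has_derivative:
  assumes "mono y" "x \<notin> range y" "p \<ge> 1"
  shows "(N_spline y p i has_real_derivative
    real (p - 1) * (Q_spline y (p - 1) i x - Q_spline y (p - 1) (i + 1) x)) (at x)"
  using assms(3)
proof (induction p arbitrary: i rule: nat_induct_at_least)
  case base
  have ne: "x \<noteq> y i" "x \<noteq> y (i+1)" using assms(2) by auto
  have "\<exists>c. \<forall>\<^sub>F z in nhds x. N_spline y 1 i z = c"
  proof -
    consider "x < y i" | "y i < x" "x < y (i+1)" | "y i < x" "y (i+1) < x" using ne by linarith
    then show ?thesis
    proof cases
      case 1
      have "\<forall>\<^sub>F z in nhds x. N_spline y 1 i z = 0"
        using order_tendstoD(2)[OF tendsto_ident_at[of x UNIV] 1] 1 ne
        by (auto simp: eventually_at_filter elim: eventually_mono)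
      then show ?thesis by blast
    next
      case 2
      have "\<forall>\<^sub>F z in nhds x. z \<in> {y i<..<y (i+1)}"
        by (rule eventually_nhds_in_open) (use 2 in auto)
      then have "\<forall>\<^sub>F z in nhds x. N_spline y 1 i z = 1"
        by (rule eventually_mono) auto
      then show ?thesis by blast
    next
      case 3
      have "\<forall>\<^sub>F z in nhds x. z \<in> {y (i+1)<..}"
        by (rule eventually_nhds_in_open) (use 3 in auto)
      then have "\<forall>\<^sub>F z in nhds x. N_spline y 1 i z = 0"
        by (rule eventually_mono) auto
      then show ?thesis by blast
    qed
  qed
  then obtain c where "\<forall>\<^sub>F z in nhds x. N_spline y 1 i z = c" by blast
  then have "(N_spline y 1 i has_real_derivative 0) (at x)"
    by (subst DERIV_cong_ev[OF refl _ refl]) auto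
  then show ?case by (simp del: N_spline.simps)
next
  case (Suc p)
  define D where "D i = real (p - 1) * (Q_spline y (p - 1) i x - Q_spline y (p - 1) (i + 1) x)" for i
  have IH: "(N_spline y p i has_real_derivative D i) (at x)" for i using Suc.IH by (simp add: D_def)
  have dQ: "(Q_spline y p i has_real_derivative D i / (y (i + p) - y i)) (at x)" for i
    unfolding Q_spline_def[abs_def] by (intro DERIV_cdivide IH)
  have fn: "N_spline y (Suc p) i = (\<lambda>x. (x - y i) * Q_spline y p i x + (y (i + Suc p) - x) * Q_spline y p (i + 1) x)"
    using N_spline_Q[OF Suc.hyps] by auto
  have der: "(N_spline y (Suc p) i has_real_derivative
     Q_spline y p i x + (x - y i) * (D i / (y (i + p) - y i))
     + (- Q_spline y p (i+1) x + (y (i + Suc p) - x) * (D (i+1) / (y (i + 1 + p) - y (i+1))))) (at x)"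
    unfolding fn by (rule derivative_eq_intros dQ refl | simp add: mult_ac)+
  \<comment> \<open>Coinciding knots make both sides zero. The case \<open>p = 1\<close> is separate
    because \<open>N_spline_Q\<close> does not reach order 0; there the factor \<open>p - 1\<close>
    vanishes.\<close>
  have e1: "(x - y i) * (D i / (y (i + p) - y i)) = real (p - 1) * (Q_spline y p i x - Q_spline y (p - 1) (i + 1) x)" for i
  proof (cases "y (i + p) = y i")
    case True
    have "y (i + 1) = y i" "y (i+1+(p-1)) = y i"
      using monoD[OF assms(1), of i "i+1"] monoD[OF assms(1), of "i+1" "i+p"] True Suc.hyps by auto
    then show ?thesis using True by (simp add: Q_spline_def)
  next
    case False
    show ?thesis
    proof (cases "p = 1")
      case True then show ?thesis by (simp add: D_def)
    next
      case f2: False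
      then have p: "p - 1 \<ge> 1" "Suc (p - 1) = p" using Suc.hyps by auto
      have N: "N_spline y p i x = (x - y i) * Q_spline y (p-1) i x + (y (i + p) - x) * Q_spline y (p-1) (i + 1) x"
        using N_spline_Q[OF p(1), of y i x] p(2) by simp
      have Q: "Q_spline y p i x = N_spline y p i x / (y (i + p) - y i)" by (simp add: Q_spline_def)
      have "(x - y i) * D i = real (p-1) * (N_spline y p i x - (y (i+p) - y i) * Q_spline y (p-1) (i+1) x)"
        unfolding D_def N by (simp add: algebra_simps)
      then show ?thesis unfolding Q using False by (simp add: field_simps)
    qed
  qed
  have e2: "(y (i + p) - x) * (D i / (y (i + p) - y i)) = real (p - 1) * (Q_spline y (p - 1) i x - Q_spline y p i x)" for i
  proof (cases "y (i + p) = y i")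
    case True
    have "y (i+(p-1)) = y i"
      using monoD[OF assms(1), of i "i+(p-1)"] monoD[OF assms(1), of "i+(p-1)" "i+p"] True Suc.hyps by auto
    then show ?thesis using True by (simp add: Q_spline_def)
  next
    case False
    show ?thesis
    proof (cases "p = 1")
      case True then show ?thesis by (simp add: D_def)
    next
      case f2: False
      then have p: "p - 1 \<ge> 1" "Suc (p - 1) = p" using Suc.hyps by auto
      have N: "N_spline y p i x = (x - y i) * Q_spline y (p-1) i x + (y (i + p) - x) * Q_spline y (p-1) (i + 1) x"
        using N_spline_Q[OF p(1), of y i x] p(2) by simp
      have Q: "Q_spline y p i x = N_spline y p i x / (y (i + p) - y i)" by (simp add: Q_spline_def)
      have "(y (i+p) - x) * D i = real (p-1) * ((y (i+p) - y i) * Q_spline y (p-1) i x - N_spline y p i x)"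
        unfolding D_def N by (simp add: algebra_simps)
      then show ?thesis unfolding Q using False by (simp add: field_simps)
    qed
  qed
  have "Q_spline y p i x + (x - y i) * (D i / (y (i + p) - y i))
     + (- Q_spline y p (i+1) x + (y (i + Suc p) - x) * (D (i+1) / (y (i + 1 + p) - y (i+1))))
     = (1 + real (p-1)) * (Q_spline y p i x - Q_spline y p (i + 1) x)"
    using e1[of i] e2[of "i+1"] by (simp add: algebra_simps)
  also have "1 + real (p - 1) = real p" using Suc.hyps by auto
  finally show ?case using der by simp
qed

section \<open>Uniform knots and derivatives of splines\<close>

lemma mono_knot: "mono (knot k q)"
proof (rule monoI)
  fix i j :: nat assume ij: "i \<le> j"
  have "real (j - q) / (1 + real k) \<le> 1" if "j \<le> q + k" for j
    using that by simp
  then show "knot k q i \<le> knot k q j"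
    using ij by (auto simp: knot_def intro!: divide_right_mono)
qed

lemma knot_bounds: "0 \<le> knot k q i" "knot k q i \<le> 1"
  using monoD[OF mono_knot, of 0 i k q] monoD[OF mono_knot, of i "i + (q + k + 1)" k q] by (auto simp: knot_def)

text \<open>Raising the order repeats each end knot once more, so the knots are merely shifted by
  one index. This lets the derivative of a spline of order q + 1 be read as a spline of order q over
  its own knots.\<close>

lemma knot_Suc: "knot k (Suc q) (Suc i) = knot k q i"
  by (auto simp: knot_def)

lemma knot_less:
  assumes "1 \<le> i" "i \<le> k + q" "q \<ge> 1"
  shows "knot k q i < knot k q (i + q)"
proof -
  have "real (i - q) / (1 + real k) < 1" using assms by simp
  then show ?thesis using assms
    by (auto simp: knot_def intro!: divide_strict_right_mono)
qed

lemma N_spline_knot_Suc: "N_spline (knot k (Suc q)) p (Suc i) x = N_spline (knot k q) p i x"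
proof (induction "knot k q" p i x rule: N_spline.induct)
  case (3 p i x)
  have a: "knot k (Suc q) (Suc (i + n)) = knot k q (i + n)" "knot k (Suc q) (Suc i) = knot k q i" for n
    by (rule knot_Suc)+
  show ?case using 3 a(1)[of 1] a(1)[of "Suc p"] a(1)[of "Suc (Suc p)"] a(2)
    by simp
qed (simp_all add: knot_Suc)

text \<open>The spline of order \<open>q\<close> with coefficients \<open>c\<close>, without the adjustment at the right end point.\<close>
definition spl :: "nat \<Rightarrow> nat \<Rightarrow> (nat \<Rightarrow> real) \<Rightarrow> real \<Rightarrow> real" where
  "spl k q c x = (\<Sum>i=1..k + q. c i * N_spline (knot k q) q i x)"

text \<open>Coefficients of the derivative of a spline of order \<open>q + 1\<close>.\<close>
definition dcoef :: "nat \<Rightarrow> nat \<Rightarrow> (nat \<Rightarrow> real) \<Rightarrow> nat \<Rightarrow> real" where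
  "dcoef k q c i = real q * (c (Suc i) - c i) / (knot k q (i + q) - knot k q i)"

text \<open>All breakpoints together with 0 and 1, whatever the order: one finite exceptional set
  for every derivative identity.\<close>

definition grid :: "nat \<Rightarrow> real set" where
  "grid k = (\<lambda>i. real i / (1 + real k)) ` {0..k + 1}"

lemma finite_grid: "finite (grid k)" by (simp add: grid_def)

lemma range_knot: "range (knot k q) \<subseteq> grid k"
proof
  fix x assume "x \<in> range (knot k q)"
  then obtain i where x: "x = knot k q i" by auto
  consider "i \<le> q" | "q < i" "i \<le> q + k" | "i > q + k" by linarith
  then show "x \<in> grid k"
  proof cases
    case 1 then show ?thesis unfolding x knot_def grid_def by (intro image_eqI[of _ _ 0]) auto
  next
    case 2 then show ?thesis unfolding x knot_def grid_def by (intro image_eqI[of _ _ "i-q"]) auto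
  next
    case 3 then show ?thesis unfolding x knot_def grid_def by (intro image_eqI[of _ _ "k+1"]) auto
  qed
qed

text \<open>Summation by parts. The two boundary terms vanish because the outermost Q-splines of
  order q live on q + 1 equal knots, all 0 or all 1.\<close>

lemma spl_deriv:
  assumes "x \<notin> grid k" "q \<ge> 1"
  shows "(spl k (Suc q) c has_real_derivative spl k q (dcoef k q c) x) (at x)"
proof -
  let ?y = "knot k (Suc q)"
  have xn: "x \<notin> range ?y" using assms(1) range_knot by blast
  have "(spl k (Suc q) c has_real_derivative
     (\<Sum>i=1..k + Suc q. c i * (real (Suc q - 1) * (Q_spline ?y (Suc q - 1) i x - Q_spline ?y (Suc q - 1) (i + 1) x)))) (at x)"
    unfolding spl_def[abs_def] by (intro DERIV_sum DERIV_cmult N_spline_has_derivative mono_knot xn) simp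
  also have "(\<Sum>i=1..k + Suc q. c i * (real (Suc q - 1) * (Q_spline ?y (Suc q - 1) i x - Q_spline ?y (Suc q - 1) (i + 1) x)))
     = real q * (\<Sum>i=1..Suc (k+q). c i * (Q_spline ?y q i x - Q_spline ?y q (Suc i) x))"
    unfolding sum_distrib_left by (intro sum.cong) (simp_all add: mult_ac)
  also have "(\<Sum>i=1..Suc (k+q). c i * (Q_spline ?y q i x - Q_spline ?y q (Suc i) x))
      = c 1 * Q_spline ?y q 1 x - c (Suc (k+q)) * Q_spline ?y q (Suc (Suc (k+q))) x
        + (\<Sum>i=1..k+q. (c (Suc i) - c i) * Q_spline ?y q (Suc i) x)"
  proof -
    have "(\<Sum>i=1..Suc m. c i * (Q i - Q (Suc i))) = c 1 * Q (1::nat) - c (Suc m) * Q (Suc (Suc m))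
       + (\<Sum>i=1..m. (c (Suc i) - c i) * Q (Suc i))" for m and Q :: "nat \<Rightarrow> real"
      by (induction m) (auto simp: algebra_simps)
    from this[where Q="\<lambda>i. Q_spline ?y q i x"] show ?thesis .
  qed
  also have "Q_spline ?y q 1 x = 0" using assms(2) by (simp add: Q_spline_def knot_def)
  also have "Q_spline ?y q (Suc (Suc (k+q))) x = 0" by (simp add: Q_spline_def knot_def)
  also have "real q * (c 1 * 0 - c (Suc (k + q)) * 0 + (\<Sum>i = 1..k + q. (c (Suc i) - c i) * Q_spline ?y q (Suc i) x))
     = spl k q (dcoef k q c) x"
  proof -
    have "Q_spline ?y q (Suc i) x = N_spline (knot k q) q i x / (knot k q (i+q) - knot k q i)" for i
      using knot_Suc[of k q "i+q"] by (simp add: Q_spline_def N_spline_knot_Suc knot_Suc)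
    then show ?thesis by (simp add: spl_def dcoef_def sum_distrib_left mult_ac)
  qed
  finally show ?thesis .
qed

text \<open>The order argument of \<open>dcoef\<close> is the order of the derivative: step r leads
  from order q - r to order q - (r + 1).\<close>

fun dcoefs :: "nat \<Rightarrow> nat \<Rightarrow> nat \<Rightarrow> (nat \<Rightarrow> real) \<Rightarrow> nat \<Rightarrow> real" where
  "dcoefs k q 0 c = c"
| "dcoefs k q (Suc r) c = dcoef k (q - Suc r) (dcoefs k q r c)"

definition dspl :: "nat \<Rightarrow> nat \<Rightarrow> nat \<Rightarrow> (nat \<Rightarrow> real) \<Rightarrow> real \<Rightarrow> real" where
  "dspl k q r c = spl k (q - r) (dcoefs k q r c)"

lemma dspl_deriv:
  assumes "x \<notin> grid k" "Suc r < q"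
  shows "(dspl k q r c has_real_derivative dspl k q (Suc r) c x) (at x)"
proof -
  have "q - r = Suc (q - Suc r)" using assms(2) by simp
  then show ?thesis unfolding dspl_def
    using spl_deriv[OF assms(1), of "q - Suc r" "dcoefs k q r c"] assms(2) by simp
qed

lemma f_spline_eq_spl:
  assumes "x \<noteq> 1"
  shows "f_spline (k, q, L) \<theta> x = spl k q \<theta> x"
  using assms by (simp add: spl_def B_spline_def)

lemma Dr_f_spline:
  assumes "x \<notin> grid k" "r < q"
  shows "Dr r (f_spline (k, q, L) \<theta>) x = dspl k q r \<theta> x"
  using assms
proof (induction r arbitrary: x)
  case 0
  have "1 \<in> grid k" unfolding grid_def by (intro image_eqI[of _ _ "k+1"]) auto
  then have "x \<noteq> 1" using 0 by auto
  then show ?case by (simp add: Dr_def dspl_def f_spline_eq_spl del: f_spline.simps)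
next
  case (Suc r)
  \<comment> \<open>An iterated \<open>deriv\<close> needs the lower identity in a whole
    neighbourhood; the complement of the finite grid supplies one.\<close>
  have "open (- grid k)" using finite_imp_closed[OF finite_grid] by (simp add: open_Compl)
  then have ev: "\<forall>\<^sub>F z in nhds x. z \<in> - grid k" using Suc.prems by (intro eventually_nhds_in_open) auto
  have "\<forall>\<^sub>F z in nhds x. Dr r (f_spline (k,q,L) \<theta>) z = dspl k q r \<theta> z"
    using ev by (rule eventually_mono) (use Suc in \<open>auto simp del: f_spline.simps\<close>)
  then have "deriv (Dr r (f_spline (k,q,L) \<theta>)) x = deriv (dspl k q r \<theta>) x"
    by (rule deriv_cong_ev) simp
  also have "\<dots> = dspl k q (Suc r) \<theta> x"
    by (rule DERIV_imp_deriv) (rule dspl_deriv[OF Suc.prems])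
  finally show ?case by (simp add: Dr_def del: f_spline.simps)
qed

lemma spl_right_cont: "(spl k q c \<longlongrightarrow> spl k q c x) (at_right x)"
  unfolding spl_def by (intro tendsto_sum tendsto_mult tendsto_const N_spline_right_cont)

text \<open>A strict violation at x persists on an interval to the right of x, which meets the dense
  set \<open>T\<close>. Applied with sets of full measure, with the rationals, and with the open
  interval.\<close>

lemma right_cont_bound:
  fixes g :: "real \<Rightarrow> real"
  assumes rc: "\<And>x. x \<in> {0..<1} \<Longrightarrow> (g \<longlongrightarrow> g x) (at_right x)"
    and dense: "\<And>a b. 0 \<le> a \<Longrightarrow> a < b \<Longrightarrow> b \<le> 1 \<Longrightarrow> \<exists>x\<in>T. a < x \<and> x < b"
    and T: "\<And>x. x \<in> T \<Longrightarrow> 0 < x \<Longrightarrow> x < 1 \<Longrightarrow> \<bar>g x\<bar> \<le> L"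
    and x: "x \<in> {0..<1}"
  shows "\<bar>g x\<bar> \<le> L"
proof (rule ccontr)
  assume "\<not> ?thesis"
  then have "L < \<bar>g x\<bar>" by simp
  then have "\<forall>\<^sub>F z in at_right x. L < \<bar>g z\<bar>"
    using order_tendstoD(1)[OF tendsto_rabs[OF rc[OF x]]] by blast
  then obtain b where b: "b > x" "\<And>z. z > x \<Longrightarrow> z < b \<Longrightarrow> L < \<bar>g z\<bar>"
    unfolding eventually_at_right_field by blast
  obtain z where "z \<in> T" "x < z" "z < min b 1"
    using dense[of x "min b 1"] x b(1) by auto
  then show False using T[of z] b(2)[of z] x by auto
qed

section \<open>Pointwise form and measurability of the parameter set\<close>

lemma spl_measurable [measurable]: "spl k q c \<in> borel_measurable borel"
  unfolding spl_def[abs_def] by measurable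

lemma dspl_measurable [measurable]: "dspl k q r c \<in> borel_measurable borel"
  unfolding dspl_def by measurable

lemma B_spline_measurable [measurable]: "B_spline k q i \<in> borel_measurable borel"
  unfolding B_spline_def[abs_def] by measurable

lemma Dr_f_spline_measurable:
  assumes "r < q"
  shows "Dr r (f_spline (k, q, L) \<theta>) \<in> borel_measurable borel"
  by (rule measurable_discrete_difference[OF dspl_measurable[of k q r \<theta>], of "grid k"])
    (use Dr_f_spline[OF _ assms] finite_grid in \<open>auto simp: countable_finite simp del: f_spline.simps\<close>)

text \<open>\<open>Dr r\<close> is identified with \<open>dspl\<close> off the grid, which is a null
  set, and a set of full measure is dense; right continuity of \<open>dspl\<close> then carries the
  bound to all points. The point 1 is left out because the half-open pieces vanish there.\<close>

lemma Linf_norm_Dr_f_spline_le_iff: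
  assumes "r < q"
  shows "Linf_norm (Dr r (f_spline (k, q, L) \<theta>)) \<le> ereal B \<longleftrightarrow> (\<forall>x\<in>{0..<1}. \<bar>dspl k q r \<theta> x\<bar> \<le> B)"
proof
  let ?f = "Dr r (f_spline (k, q, L) \<theta>)"
  have "(\<lambda>x. ereal \<bar>?f x\<bar>) \<in> borel_measurable borel"
    using Dr_f_spline_measurable[OF assms] by measurable
  then have meas: "(\<lambda>x. ereal \<bar>?f x\<bar>) \<in> borel_measurable (lebesgue_on {0..1})"
    by (intro measurable_restrict_space1 measurable_completion) simp
  have one: "1 \<in> grid k" unfolding grid_def by (intro image_eqI[of _ _ "k+1"]) auto
  {
    assume *: "\<forall>x\<in>{0..<1}. \<bar>dspl k q r \<theta> x\<bar> \<le> B"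
    have "grid k \<in> null_sets lebesgue"
      using finite_imp_null_set_lborel[OF finite_grid, of k] null_sets_completionI by blast
    then have "AE x in lebesgue. x \<notin> grid k" by (rule AE_not_in)
    then have "AE x in lebesgue_on {0..1}. x \<notin> grid k"
      by (subst AE_restrict_space_iff) auto
    then have "AE x in lebesgue_on {0..1}. ereal \<bar>?f x\<bar> \<le> ereal B"
      using AE_space
    proof eventually_elim
      case (elim x)
      then have "x \<in> {0..<1}" using one by (auto simp: order_le_less)
      then show ?case using * Dr_f_spline[OF elim(1) assms] by simp
    qed
    then show "Linf_norm ?f \<le> ereal B"
      unfolding Linf_norm_def by (rule esssup_I[OF meas])
  }
  {
    assume le: "Linf_norm ?f \<le> ereal B"
    have "AE x in lebesgue_on {0..1}. ereal \<bar>?f x\<bar> \<le> ereal B"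
      using esssup_AE[of "\<lambda>x. ereal \<bar>?f x\<bar>" "lebesgue_on {0..1}"]
    proof eventually_elim
      case (elim x)
      then show ?case using le unfolding Linf_norm_def by (rule order_trans)
    qed
    then have AE1: "AE x in lebesgue. x \<in> {0..1} \<longrightarrow> \<bar>?f x\<bar> \<le> B"
      by (subst (asm) AE_restrict_space_iff) auto
    have "grid k \<in> null_sets lebesgue"
      using finite_imp_null_set_lborel[OF finite_grid, of k] null_sets_completionI by blast
    then have AE2: "AE x in lebesgue. x \<notin> grid k" by (rule AE_not_in)
    define T where "T = {x. \<bar>dspl k q r \<theta> x\<bar> \<le> B}"
    have T: "AE x in lebesgue. x \<in> {0..1} \<longrightarrow> x \<in> T"
      using AE1 AE2 by eventually_elim (use Dr_f_spline[OF _ assms] in \<open>auto simp: T_def\<close>)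
    \<comment> \<open>An interval missing \<open>T\<close> would be a null set, since
      \<open>T\<close> has full measure in [0,1].\<close>
    have dense: "\<exists>x\<in>T. a < x \<and> x < b" if "0 \<le> a" "a < b" "b \<le> 1" for a b
    proof (rule ccontr)
      assume no: "\<not> ?thesis"
      have "AE x in lebesgue. x \<notin> {a<..<b}"
        using T by eventually_elim (use no that in auto)
      then have "{a<..<b} \<in> null_sets lebesgue"
        by (subst (asm) AE_iff_null_sets[symmetric]) auto
      then have "emeasure lborel {a<..<b} = 0" by (auto simp: null_sets_def)
      then show False using that by simp
    qed
    have "\<bar>dspl k q r \<theta> x\<bar> \<le> B" if "x \<in> {0..<1}" for x
      by (rule right_cont_bound[OF _ dense _ that]) (auto simp: dspl_def T_def spl_right_cont)
    then show "\<forall>x\<in>{0..<1}. \<bar>dspl k q r \<theta> x\<bar> \<le> B" by blast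
  }
qed

lemma sup_norm_le_iff: "sup_norm f \<le> ereal M \<longleftrightarrow> (\<forall>x\<in>{0..1}. \<bar>f x\<bar> \<le> M)"
  by (simp add: sup_norm_def SUP_le_iff)

text \<open>Replaces the definition from here on. The sup norm includes the end point 1, where
  \<open>f_spline\<close> is a left limit, so that part is not expressed by \<open>dspl\<close>. For
  \<open>q = 0\<close> the range \<open>{0..q - 1}\<close> would still contain 0, hence the
  hypothesis.\<close>

lemma Theta_iff:
  assumes "q \<ge> 1"
  shows "\<theta> \<in> Theta M (k, q, L) \<longleftrightarrow> \<theta> \<in> space (lebesgue_R (k + q)) \<and>
     (\<forall>r<q. \<forall>x\<in>{0..<1}. \<bar>dspl k q r \<theta> x\<bar> \<le> real L) \<and> (\<forall>x\<in>{0..1}. \<bar>f_spline (k, q, L) \<theta> x\<bar> \<le> M)"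
proof -
  have "(\<forall>r\<in>{0..q - 1}. Linf_norm (Dr r (f_spline (k, q, L) \<theta>)) \<le> ereal (real L))
     \<longleftrightarrow> (\<forall>r<q. \<forall>x\<in>{0..<1}. \<bar>dspl k q r \<theta> x\<bar> \<le> real L)"
    using assms Linf_norm_Dr_f_spline_le_iff[of _ q k L \<theta> "real L"] by (auto simp del: f_spline.simps)
  then show ?thesis by (simp add: sup_norm_le_iff del: f_spline.simps)
qed

lemma lebesgue_R_component [measurable]: "i \<in> {1..d} \<Longrightarrow> (\<lambda>\<theta>. \<theta> i) \<in> borel_measurable (lebesgue_R d)"
  unfolding lebesgue_R_def by simp

lemma dcoefs_measurable:
  assumes "r < q" "i \<in> {1..k + q - r}"
  shows "(\<lambda>\<theta>. dcoefs k q r \<theta> i) \<in> borel_measurable (lebesgue_R (k + q))"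
  using assms
proof (induction r arbitrary: i)
  case (Suc r)
  have [measurable]: "(\<lambda>\<theta>. dcoefs k q r \<theta> i) \<in> borel_measurable (lebesgue_R (k + q))"
    "(\<lambda>\<theta>. dcoefs k q r \<theta> (Suc i)) \<in> borel_measurable (lebesgue_R (k + q))"
    using Suc by auto
  show ?case unfolding dcoefs.simps dcoef_def by measurable
qed simp

lemma dspl_measurable_coef:
  assumes "r < q"
  shows "(\<lambda>\<theta>. dspl k q r \<theta> x) \<in> borel_measurable (lebesgue_R (k + q))"
  unfolding dspl_def spl_def
  by (intro borel_measurable_sum borel_measurable_times borel_measurable_const dcoefs_measurable[OF assms])
    (use assms in auto)

lemma f_spline_measurable_pair:
  "(\<lambda>(\<theta>, x). f_spline j \<theta> x) \<in> borel_measurable (lebesgue_R (mdim j) \<Otimes>\<^sub>M borel)"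
proof -
  obtain k q L where j: "j = (k, q, L)" by (cases j) auto
  have [measurable]: "(\<lambda>p. fst p i) \<in> borel_measurable (lebesgue_R (k + q) \<Otimes>\<^sub>M borel)" if "i \<in> {1..k+q}" for i
    by (rule measurable_compose[OF measurable_fst lebesgue_R_component[OF that]])
  show ?thesis unfolding j split_beta f_spline.simps mdim.simps
    by measurable
qed

lemma f_spline_measurable [measurable]: "f_spline j \<theta> \<in> borel_measurable borel"
proof -
  obtain k q L where j: "j = (k, q, L)" by (cases j) auto
  show ?thesis unfolding j f_spline.simps[abs_def] by measurable
qed

lemma f_spline_measurable_coef: "(\<lambda>\<theta>. f_spline j \<theta> x) \<in> borel_measurable (lebesgue_R (mdim j))"
proof -
  have "(\<lambda>\<theta>. (\<lambda>(\<theta>, x). f_spline j \<theta> x) (\<theta>, x)) \<in> borel_measurable (lebesgue_R (mdim j))"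
    by (rule measurable_compose[OF _ f_spline_measurable_pair]) simp
  then show ?thesis by simp
qed

lemma rat_dense_01: "0 \<le> a \<Longrightarrow> a < b \<Longrightarrow> b \<le> 1 \<Longrightarrow> \<exists>x\<in>{0..<1} \<inter> \<rat>. a < x \<and> x < (b::real)"
  using Rats_dense_in_real[of a b] by force

text \<open>By right continuity it is enough to test the bounds at the rational points of [0,1) and,
  for the sup norm, at 1. These are countably many measurable conditions.\<close>

lemma Theta_measurable:
  assumes "j \<in> Jset"
  shows "Theta M j \<in> sets (lebesgue_R (mdim j))"
proof -
  obtain k q L where j: "j = (k, q, L)" "q \<ge> 1" using assms by (cases j) (auto simp: Jset_def)
  let ?R = "lebesgue_R (k + q)" and ?T = "{0..<1} \<inter> \<rat> :: real set"
  have cnt: "countable ?T" using countable_rat by blast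
  have "Theta M (k, q, L) = {\<theta> \<in> space ?R. (\<forall>r\<in>{..<q}. \<forall>x\<in>?T. \<bar>dspl k q r \<theta> x\<bar> \<le> real L) \<and>
      (\<forall>x\<in>?T. \<bar>f_spline (k, q, L) \<theta> x\<bar> \<le> M) \<and> \<bar>f_spline (k, q, L) \<theta> 1\<bar> \<le> M}" (is "_ = ?S")
  proof (rule set_eqI)
    fix \<theta>
    have 1: "(\<forall>x\<in>?T. \<bar>spl k p c x\<bar> \<le> B) \<longleftrightarrow> (\<forall>x\<in>{0..<1}. \<bar>spl k p c x\<bar> \<le> B)" for p c B
      using right_cont_bound[of "spl k p c" ?T B] spl_right_cont rat_dense_01 by blast
    have 2: "(\<forall>x\<in>?T. \<bar>f_spline (k,q,L) \<theta> x\<bar> \<le> M) \<longleftrightarrow> (\<forall>x\<in>{0..<1}. \<bar>f_spline (k,q,L) \<theta> x\<bar> \<le> M)"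
      using 1[of q \<theta> M] f_spline_eq_spl[of _ k q L \<theta>] by (auto simp del: f_spline.simps)
    have 3: "(\<forall>x\<in>{0..1}. P x) \<longleftrightarrow> (\<forall>x\<in>{0..<1}. P x) \<and> P 1" for P :: "real \<Rightarrow> bool"
      by (auto simp: order_le_less)
    show "\<theta> \<in> Theta M (k, q, L) \<longleftrightarrow> \<theta> \<in> ?S"
      unfolding Theta_iff[OF j(2)] mem_Collect_eq 2 3 dspl_def using 1 by (auto simp del: f_spline.simps)
  qed
  also have "?S \<in> sets ?R"
  proof -
    have [measurable]: "(\<lambda>\<theta>. f_spline (k, q, L) \<theta> x) \<in> borel_measurable ?R" for x
      using f_spline_measurable_coef[of "(k,q,L)"] by (simp del: f_spline.simps)
    have "{\<theta> \<in> space ?R. \<forall>r\<in>{..<q}. \<forall>x\<in>?T. \<bar>dspl k q r \<theta> x\<bar> \<le> real L} \<in> sets ?R"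
    proof (intro sets.sets_Collect_countable_All' cnt countable_finite)
      fix r x assume "r \<in> {..<q}"
      then have [measurable]: "(\<lambda>\<theta>. dspl k q r \<theta> x) \<in> borel_measurable ?R" by (intro dspl_measurable_coef) simp
      show "{\<theta> \<in> space ?R. \<bar>dspl k q r \<theta> x\<bar> \<le> real L} \<in> sets ?R" by measurable
    qed simp
    moreover have "{\<theta> \<in> space ?R. \<forall>x\<in>?T. \<bar>f_spline (k, q, L) \<theta> x\<bar> \<le> M} \<in> sets ?R"
    proof (intro sets.sets_Collect_countable_All' cnt)
      fix x show "{\<theta> \<in> space ?R. \<bar>f_spline (k, q, L) \<theta> x\<bar> \<le> M} \<in> sets ?R" by measurable
    qed
    moreover have "{\<theta> \<in> space ?R. \<bar>f_spline (k, q, L) \<theta> 1\<bar> \<le> M} \<in> sets ?R" by measurable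
    ultimately show ?thesis by (intro sets.sets_Collect_conj)
  qed
  finally show ?thesis using j by simp
qed

section \<open>Linearity, continuity and end point values of splines\<close>

lemma dcoefs_linear: "dcoefs k q r (\<lambda>i. c i + t * d i) i = dcoefs k q r c i + t * dcoefs k q r d i"
proof (induction r arbitrary: i)
  case (Suc r)
  have e: "dcoefs k q r (\<lambda>i. c i + t * d i) = (\<lambda>i. dcoefs k q r c i + t * dcoefs k q r d i)"
    using Suc by auto
  show ?case unfolding dcoefs.simps e dcoef_def by (simp add: divide_inverse algebra_simps)
qed simp

lemma dspl_linear: "dspl k q r (\<lambda>i. c i + t * d i) x = dspl k q r c x + t * dspl k q r d x"
  unfolding dspl_def spl_def dcoefs_linear
  by (simp add: sum.distrib sum_distrib_left algebra_simps)

lemma dcoefs_cong: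
  assumes "\<And>i. i \<in> {1..k+q} \<Longrightarrow> c i = d i" "r < q" "i \<in> {1..k + q - r}"
  shows "dcoefs k q r c i = dcoefs k q r d i"
  using assms(2,3)
proof (induction r arbitrary: i)
  case (Suc r)
  have "dcoefs k q r c i = dcoefs k q r d i" "dcoefs k q r c (Suc i) = dcoefs k q r d (Suc i)"
    using Suc by auto
  then show ?case by (simp add: dcoef_def)
qed (use assms in auto)

lemma dspl_cong:
  assumes "\<And>i. i \<in> {1..k+q} \<Longrightarrow> c i = d i" "r < q"
  shows "dspl k q r c x = dspl k q r d x"
  unfolding dspl_def spl_def
  by (intro sum.cong refl arg_cong2[where f="(*)"] dcoefs_cong) (use assms in auto)

text \<open>Order one means step functions. Knots are numbered from 1, so cell l, counted from 0,
  carries coefficient l + 1.\<close>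

lemma spl_1:
  assumes "l \<le> k" "real l / (1 + real k) \<le> x" "x < (1 + real l) / (1 + real k)"
  shows "spl k (Suc 0) c x = c (Suc l)"
proof -
  have kn: "knot k (Suc 0) i = (real i - 1) / (1 + real k)" if "1 \<le> i" "i \<le> k + 2" for i
    using that by (auto simp: knot_def of_nat_diff)
  have xl: "real l \<le> x * (1 + real k)" "x * (1 + real k) < 1 + real l"
    using assms(2,3) by (simp_all add: field_simps)
  have "c i * N_spline (knot k (Suc 0)) (Suc 0) i x = (if i = Suc l then c (Suc l) else 0)" if "i \<in> {1..k + Suc 0}" for i
  proof -
    have "x \<in> {knot k (Suc 0) i..<knot k (Suc 0) (i + 1)} \<longleftrightarrow> real i - 1 \<le> x * (1 + real k) \<and> x * (1 + real k) < real i"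
      using that kn[of i] kn[of "i+1"] by (simp add: pos_divide_le_eq pos_less_divide_eq)
    also have "\<dots> \<longleftrightarrow> i = Suc l"
    proof
      assume "real i - 1 \<le> x * (1 + real k) \<and> x * (1 + real k) < real i"
      then have "real i - 1 < 1 + real l" "real l < real i" using xl by linarith+
      then show "i = Suc l" by linarith
    qed (use xl in auto)
    finally show ?thesis by (auto simp: indicator_def)
  qed
  then have "spl k (Suc 0) c x = (\<Sum>i=1..k + Suc 0. if i = Suc l then c (Suc l) else 0)"
    unfolding spl_def by (intro sum.cong) auto
  also have "\<dots> = c (Suc l)" using assms(1) by simp
  finally show ?thesis .
qed

text \<open>The B-spline of order two. Three distinct knots give a continuous hat; a double knot
  leaves a jump at that knot only, whence the two exclusions.\<close>

lemma isCont_hat: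
  fixes a b c x :: real
  assumes "a \<le> b" "b \<le> c" "a = b \<Longrightarrow> x \<noteq> a" "b = c \<Longrightarrow> x \<noteq> c"
  shows "isCont (\<lambda>x. (x - a) / (b - a) * indicator {a..<b} x + (c - x) / (c - b) * indicator {b..<c} x) x"
    (is "isCont ?h x")
proof -
  have "a < b \<or> a = b" "b < c \<or> b = c" "x < a \<or> x = a \<or> a < x" "x < c \<or> x = c \<or> c < x"
    using assms(1,2) by auto
  then consider "a < b" "b < c" | "a = b" "b < c" "x < a" | "a = b" "b < c" "x > a"
    | "a < b" "b = c" "x < c" | "a < b" "b = c" "x > c" | "a = b" "b = c"
    using assms(3,4) by blast
  then show ?thesis
  proof cases
    case 1
    \<comment> \<open>As a maximum and minimum of affine functions the hat is continuous without
      inspection of the three knots.\<close>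
    have "?h z = max 0 (min ((z - a) / (b - a)) ((c - z) / (c - b)))" for z
    proof -
      define u where "u = (z - a) / (b - a)"
      define v where "v = (c - z) / (c - b)"
      have "z = b \<Longrightarrow> u = 1 \<and> v = 1" "z = c \<Longrightarrow> v = 0" "u \<le> 1 \<longleftrightarrow> z \<le> b" "1 \<le> v \<longleftrightarrow> z \<le> b" "0 \<le> u \<longleftrightarrow> a \<le> z" "0 \<le> v \<longleftrightarrow> z \<le> c"
        using 1 by (simp_all add: u_def v_def pos_divide_le_eq pos_le_divide_eq)
      then show ?thesis unfolding u_def[symmetric] v_def[symmetric]
        using 1 by (auto simp: indicator_def)
    qed
    then show ?thesis using 1 by (auto intro!: continuous_intros)
  next
    case 2
    have "\<forall>\<^sub>F z in nhds x. z \<in> {..<a}" by (rule eventually_nhds_in_open) (use 2 in auto)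
    then have "\<forall>\<^sub>F z in nhds x. ?h z = 0" by (rule eventually_mono) (use 2 in auto)
    then show ?thesis by (subst isCont_cong) auto
  next
    case 3
    have "\<forall>\<^sub>F z in nhds x. z \<in> {a<..}" by (rule eventually_nhds_in_open) (use 3 in auto)
    then have "\<forall>\<^sub>F z in nhds x. ?h z = max 0 ((c - z) / (c - b))"
      by (rule eventually_mono) (use 3 in \<open>auto simp: indicator_def max_def field_simps\<close>)
    then show ?thesis using 3 by (subst isCont_cong) (auto intro!: continuous_intros)
  next
    case 4
    have "\<forall>\<^sub>F z in nhds x. z \<in> {..<c}" by (rule eventually_nhds_in_open) (use 4 in auto)
    then have "\<forall>\<^sub>F z in nhds x. ?h z = max 0 ((z - a) / (b - a))"
      by (rule eventually_mono) (use 4 in \<open>auto simp: indicator_def max_def field_simps\<close>)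
    then show ?thesis using 4 by (subst isCont_cong) (auto intro!: continuous_intros)
  next
    case 5
    have "\<forall>\<^sub>F z in nhds x. z \<in> {c<..}" by (rule eventually_nhds_in_open) (use 5 in auto)
    then have "\<forall>\<^sub>F z in nhds x. ?h z = 0" by (rule eventually_mono) (use 5 in auto)
    then show ?thesis by (subst isCont_cong) auto
  qed simp
qed

lemma knot_eq_Suc:
  assumes "knot k q i = knot k q (Suc i)"
  shows "knot k q i = 0 \<or> knot k q i = 1"
proof (rule ccontr)
  assume n: "\<not> ?thesis"
  then have i: "q < i" "i \<le> q + k" by (auto simp: knot_def split: if_splits)
  then have "real (i - q) / (1 + real k) < real (Suc i - q) / (1 + real k)"
    by (intro divide_strict_right_mono) auto
  moreover have "real (i - q) / (1 + real k) < 1" using i by simp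
  ultimately show False using assms i by (auto simp: knot_def split: if_splits)
qed

text \<open>Multiple knots sit only at 0 and 1, so the hats of order two are continuous inside the
  interval; the recursion multiplies by affine functions and preserves this.\<close>

lemma N_spline_isCont:
  assumes "0 < x" "x < 1" "p \<ge> 2"
  shows "isCont (N_spline (knot k q) p i) x"
  using assms(3)
proof (induction p arbitrary: i rule: nat_induct_at_least)
  case base
  let ?a = "knot k q i" and ?b = "knot k q (i+1)" and ?c = "knot k q (i+2)"
  have "isCont (\<lambda>x. (x - ?a) / (?b - ?a) * indicator {?a..<?b} x + (?c - x) / (?c - ?b) * indicator {?b..<?c} x) x"
    by (rule isCont_hat)
      (use monoD[OF mono_knot, of i "i+1" k q] monoD[OF mono_knot, of "i+1" "i+2" k q]
         knot_eq_Suc[of k q i] knot_eq_Suc[of k q "i+1"] assms in auto)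
  moreover have "N_spline (knot k q) 2 i = (\<lambda>x. (x - ?a) / (?b - ?a) * indicator {?a..<?b} x + (?c - x) / (?c - ?b) * indicator {?b..<?c} x)"
    by (rule ext) (simp add: numeral_2_eq_2)
  ultimately show ?case by simp
next
  case (Suc p)
  obtain p' where p: "p = Suc p'" using Suc.hyps by (cases p) auto
  have "(N_spline (knot k q) (Suc p') i \<longlongrightarrow> N_spline (knot k q) (Suc p') i x) (at x)" for i
    using Suc.IH[of i] by (simp add: isCont_def p)
  then have IH: "isCont (N_spline (knot k q) (Suc p') i) x" for i unfolding isCont_def by blast
  have step: "isCont (\<lambda>z. (z - a) / c * f z + (b - z) / d * g z) x" if "isCont f x" "isCont g x"
    for a b c d and f g :: "real \<Rightarrow> real"
    unfolding divide_inverse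
    by (intro continuous_add continuous_mult continuous_diff continuous_ident continuous_const that)
  have fn: "N_spline (knot k q) (Suc p) i = (\<lambda>x. (x - knot k q i) / (knot k q (i + Suc p') - knot k q i) * N_spline (knot k q) (Suc p') i x +
     (knot k q (i + Suc (Suc p')) - x) / (knot k q (i + Suc (Suc p')) - knot k q (i + 1)) * N_spline (knot k q) (Suc p') (i + 1) x)"
    unfolding p by (rule ext) (rule N_spline.simps(3))
  show ?case unfolding fn by (rule step[OF IH IH])
qed

lemma spl_continuous_on:
  assumes "p \<ge> 2"
  shows "continuous_on {0..<1} (spl k p c)"
  unfolding continuous_on_def
proof
  fix x :: real assume x: "x \<in> {0..<1}"
  show "(spl k p c \<longlongrightarrow> spl k p c x) (at x within {0..<1})"
  proof (cases "x = 0")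
    case True
    \<comment> \<open>Within \<open>{0..<1}\<close> the point 0 is approached from the right only,
      so right continuity is enough.\<close>
    have "at x within {0..<1} \<le> at_right x" unfolding True le_filter_def eventually_at_filter
      by (auto elim: eventually_mono)
    then show ?thesis using spl_right_cont by (rule tendsto_mono)
  next
    case False
    have "isCont (N_spline (knot k p) p i) x" for i
      by (rule N_spline_isCont) (use x False assms in auto)
    then have "isCont (spl k p c) x" unfolding spl_def[abs_def] isCont_def
      by (intro tendsto_sum tendsto_mult tendsto_const)
    then show ?thesis unfolding isCont_def by (rule tendsto_within_subset) simp
  qed
qed

text \<open>The last zero knot has number q, so only the cell starting there contains the point 0,
  and each order keeps exactly one spline alive. Consequently the first coefficient of every derived
  spline is its value at 0.\<close>

lemma N_spline_at_0:
  assumes "1 \<le> p" "p \<le> q" "1 \<le> i"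
  shows "N_spline (knot k q) p i 0 = (if i + p = q + 1 then 1 else 0)"
  using assms
proof (induction p arbitrary: i rule: nat_induct_at_least)
  case base
  have "N_spline (knot k q) 1 i 0 = (if knot k q i \<le> 0 \<and> 0 < knot k q (i + 1) then 1 else 0)"
    by (simp add: indicator_def)
  also have "knot k q i \<le> 0 \<longleftrightarrow> i \<le> q" by (auto simp: knot_def divide_le_0_iff)
  also have "0 < knot k q (i + 1) \<longleftrightarrow> q \<le> i" by (auto simp: knot_def)
  finally show ?case by auto
next
  case (Suc p)
  obtain p' where p: "p = Suc p'" using Suc.hyps by (cases p) auto
  have 1: "N_spline (knot k q) (Suc p') i 0 = (if i + Suc p' = q + 1 then 1 else 0)"
    "N_spline (knot k q) (Suc p') (i+1) 0 = (if i + 1 + Suc p' = q + 1 then 1 else 0)"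
    using Suc p by auto
  show ?case
  proof (cases "i + Suc p' = q + 1")
    case True
    then have "knot k q i = 0" using Suc.prems p by (auto simp: knot_def)
    then show ?thesis using 1 True p by simp
  next
    case False
    show ?thesis
    proof (cases "i + Suc p = q + 1")
      case True
      then have "knot k q (i+1) = 0" "knot k q (i + Suc (Suc p')) > 0" using p by (auto simp: knot_def)
      then show ?thesis using 1 False True p by simp
    qed (use 1 False p in simp)
  qed
qed

lemma spl_at_0: "p \<ge> 1 \<Longrightarrow> spl k p c 0 = c 1"
proof -
  assume p: "p \<ge> 1"
  have "spl k p c 0 = (\<Sum>i=1..k+p. if i = 1 then c 1 else 0)"
    unfolding spl_def by (intro sum.cong refl) (use p in \<open>auto simp: N_spline_at_0\<close>)
  also have "\<dots> = c 1" using p by simp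
  finally show ?thesis .
qed

subsection \<open>Taylor expansion and truncated powers\<close>

text \<open>\<open>F r\<close> stands for the derivative of order r. Continuity is not demanded of
  the top function \<open>F s\<close>, and it is tied to its predecessor off a finite set only,
  which admits step functions.\<close>

definition dchain :: "nat \<Rightarrow> real \<Rightarrow> real \<Rightarrow> (nat \<Rightarrow> real \<Rightarrow> real) \<Rightarrow> bool" where
  "dchain s u v F \<longleftrightarrow> (\<forall>r<s. continuous_on {u..v} (F r) \<and>
     (\<exists>K. finite K \<and> (\<forall>x\<in>{u<..<v} - K. (F r has_real_derivative F (Suc r) x) (at x))))"

lemma dchainD:
  assumes "dchain s u v F" "r < s"
  shows "continuous_on {u..v} (F r)"
    and "\<exists>K. finite K \<and> (\<forall>x\<in>{u<..<v} - K. (F r has_real_derivative F (Suc r) x) (at x))"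
  using assms unfolding dchain_def by simp_all

text \<open>Integration from the top: equal top functions and equal data at u propagate down one
  order at a time. This identifies splines on a cell with Taylor polynomials and splines on a block
  with the local Hermite solution.\<close>

lemma dchain_unique:
  assumes F: "dchain s u v F" and R: "dchain s u v R"
    and K: "finite K" "\<And>x. x \<in> {u<..<v} - K \<Longrightarrow> F s x = R s x"
    and init: "\<And>r. r < s \<Longrightarrow> F r u = R r u"
    and r: "r < s" and x: "x \<in> {u..v}"
  shows "F r x = R r x"
proof -
  \<comment> \<open>Counted by d = s - r. For d = 0 equality is available off a finite set only, so
    this weaker form is carried along as the invariant.\<close>
  have main: "\<exists>K. finite K \<and> (\<forall>x\<in>{u<..<v} - K. F (s - d) x = R (s - d) x)" "0 < d \<Longrightarrow> \<forall>x\<in>{u..v}. F (s - d) x = R (s - d) x"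
    if "d \<le> s" for d
  proof -
    have "(\<exists>K. finite K \<and> (\<forall>x\<in>{u<..<v} - K. F (s - d) x = R (s - d) x)) \<and> (0 < d \<longrightarrow> (\<forall>x\<in>{u..v}. F (s - d) x = R (s - d) x))"
      using that
    proof (induction d)
      case 0
      then show ?case using K by auto
    next
      case (Suc d)
      let ?r = "s - Suc d"
      have r: "?r < s" "Suc ?r = s - d" using Suc.prems by auto
      have "\<exists>K. finite K \<and> (\<forall>x\<in>{u<..<v} - K. F (Suc ?r) x = R (Suc ?r) x)"
        unfolding r(2) by (rule Suc.IH[OF Suc_leD[OF Suc.prems], THEN conjunct1])
      then obtain K0 where K0: "finite K0" "\<forall>x\<in>{u<..<v} - K0. F (Suc ?r) x = R (Suc ?r) x"
        by (elim exE conjE)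
      from dchainD(2)[OF F r(1)] obtain K1
        where K1: "finite K1" "\<forall>x\<in>{u<..<v} - K1. (F ?r has_real_derivative F (Suc ?r) x) (at x)"
        by (elim exE conjE)
      from dchainD(2)[OF R r(1)] obtain K2
        where K2: "finite K2" "\<forall>x\<in>{u<..<v} - K2. (R ?r has_real_derivative R (Suc ?r) x) (at x)"
        by (elim exE conjE)
      have "F ?r x - R ?r x = 0" if x: "x \<in> {u..v}" for x
      proof (rule has_derivative_zero_unique_strong_interval[of "K0 \<union> K1 \<union> K2 \<union> {u, v}" u v "\<lambda>x. F ?r x - R ?r x"])
        show "continuous_on {u..v} (\<lambda>x. F ?r x - R ?r x)"
          by (intro continuous_on_diff dchainD(1)[OF F r(1)] dchainD(1)[OF R r(1)])
        show "F ?r u - R ?r u = 0" using init[OF r(1)] by simp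
        fix z assume z: "z \<in> {u..v} - (K0 \<union> K1 \<union> K2 \<union> {u, v})"
        then have "((\<lambda>x. F ?r x - R ?r x) has_real_derivative F (Suc ?r) z - R (Suc ?r) z) (at z)"
          by (intro DERIV_diff K1(2)[rule_format] K2(2)[rule_format]) auto
        then have "((\<lambda>x. F ?r x - R ?r x) has_real_derivative 0) (at z)"
          using K0(2)[rule_format, of z] z by simp
        then show "((\<lambda>x. F ?r x - R ?r x) has_derivative (\<lambda>h. 0)) (at z within {u..v})"
          unfolding has_field_derivative_def by (auto intro: has_derivative_at_withinI simp: lambda_zero)
      qed (use K0 K1 K2 x in auto)
      then show ?case by (auto intro!: exI[of _ "{}"])
    qed
    then show "\<exists>K. finite K \<and> (\<forall>x\<in>{u<..<v} - K. F (s - d) x = R (s - d) x)" "0 < d \<Longrightarrow> \<forall>x\<in>{u..v}. F (s - d) x = R (s - d) x"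
      by auto
  qed
  show ?thesis using main(2)[of "s - r"] r x by auto
qed

lemma dchain_dspl:
  assumes "0 \<le> u" "v < 1"
  shows "dchain s u v (\<lambda>r. dspl k (Suc s) r \<theta>)"
  unfolding dchain_def
proof (intro allI impI conjI)
  fix r assume r: "r < s"
  show "continuous_on {u..v} (dspl k (Suc s) r \<theta>)"
    unfolding dspl_def by (rule continuous_on_subset[OF spl_continuous_on]) (use r assms in auto)
  show "\<exists>K. finite K \<and> (\<forall>x\<in>{u<..<v} - K. (dspl k (Suc s) r \<theta> has_real_derivative dspl k (Suc s) (Suc r) \<theta> x) (at x))"
    using finite_grid dspl_deriv[of _ k r "Suc s" \<theta>] r by (intro exI[of _ "grid k"]) auto
qed

text \<open>The derivative of order r of the Taylor polynomial of degree s with derivatives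
  \<open>A 0\<close>, ..., \<open>A s\<close> at 0.\<close>

definition tay :: "nat \<Rightarrow> (nat \<Rightarrow> real) \<Rightarrow> nat \<Rightarrow> real \<Rightarrow> real" where
  "tay s A r x = (\<Sum>i\<le>s - r. A (r + i) * (x ^ i / fact i))"

lemma tay_at_0 [simp]: "tay s A r 0 = A r"
proof -
  have "tay s A r 0 = (\<Sum>i\<le>s - r. if i = 0 then A r else 0)"
    unfolding tay_def by (intro sum.cong) auto
  then show ?thesis by simp
qed

lemma tay_top [simp]: "tay s A s x = A s"
  by (simp add: tay_def)

lemma power_div_fact_deriv:
  "((\<lambda>x. (x - u) ^ Suc i / fact (Suc i)) has_real_derivative (x - u) ^ i / fact i) (at (x::real))"
proof -
  have "((\<lambda>x. (x - u) ^ Suc i) has_real_derivative (1 + of_nat i) * (1 * (x - u) ^ i)) (at x)"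
    by (rule DERIV_power_Suc) (auto intro!: derivative_eq_intros)
  from DERIV_cdivide[OF this, of "fact (Suc i)"] show ?thesis
    by (simp add: fact_Suc del: of_nat_Suc power_Suc) (simp add: add.commute)
qed

lemma tay_deriv:
  assumes "r < s"
  shows "((\<lambda>x. tay s A r (x - u)) has_real_derivative tay s A (Suc r) (x - u)) (at x)"
proof -
  have s: "s - r = Suc (s - Suc r)" using assms by simp
  have e: "tay s A r y = A r + (\<Sum>i\<le>s - Suc r. A (Suc r + i) * (y ^ Suc i / fact (Suc i)))" for y
    unfolding tay_def s by (subst sum.atMost_Suc_shift) simp
  note d = power_div_fact_deriv
  show ?thesis unfolding e unfolding tay_def
    using DERIV_add[OF DERIV_const[of "A r"] DERIV_sum[of "{..s - Suc r}", OF DERIV_cmult[OF d]]]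
    by simp
qed

lemma tay_continuous: "continuous_on X (\<lambda>x. tay s A r (x - u))"
  unfolding tay_def divide_inverse by (intro continuous_intros)

lemma dchain_tay: "dchain s u v (\<lambda>r x. tay s A r (x - u))"
  unfolding dchain_def using tay_deriv tay_continuous by (auto intro!: exI[of _ "{}"])

text \<open>The sum stays below e. It is the origin of the constant 3 in the bounds for Taylor
  polynomials below.\<close>

lemma sum_inverse_fact_le: "(\<Sum>i\<le>m. 1 / fact i) \<le> (3::real)"
proof -
  have sm: "summable (\<lambda>i. inverse (fact i) * (1::real) ^ i)" by (rule summable_exp)
  have "(\<Sum>i\<le>m. 1 / fact i) = (\<Sum>i\<le>m. inverse (fact i) * (1::real) ^ i)" by (simp add: divide_inverse)
  also have "\<dots> \<le> (\<Sum>i. inverse (fact i) * (1::real) ^ i)" by (rule sum_le_suminf[OF sm]) auto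
  also have "\<dots> = exp 1" by (simp add: exp_def)
  also have "\<dots> \<le> 3" by (rule exp_le)
  finally show ?thesis .
qed

lemma dspl_top:
  assumes "l \<le> k" "real l / (1 + real k) \<le> x" "x < (1 + real l) / (1 + real k)"
  shows "dspl k (Suc s) s \<theta> x = dcoefs k (Suc s) s \<theta> (Suc l)"
  using spl_1[OF assms] by (simp add: dspl_def)

lemma dspl_at_0: "r \<le> s \<Longrightarrow> dspl k (Suc s) r \<theta> 0 = dcoefs k (Suc s) r \<theta> 1"
  by (simp add: dspl_def spl_at_0)

text \<open>On one cell a spline of order s + 1 is a polynomial of degree s. Its derivatives of
  order below s are continuous, so the formula reaches the right end of the cell; the top derivative
  may jump there.\<close>

lemma dspl_taylor:
  assumes l: "l \<le> k" and x: "real l / (1 + real k) \<le> x" "x \<le> (1 + real l) / (1 + real k)" "x < 1"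
    and r: "r < s \<or> r = s \<and> x < (1 + real l) / (1 + real k)"
  shows "dspl k (Suc s) r \<theta> x = tay s (\<lambda>a. dspl k (Suc s) a \<theta> (real l / (1 + real k))) r (x - real l / (1 + real k))"
proof (cases "r < s")
  case True
  let ?u = "real l / (1 + real k)"
  show ?thesis
  proof (rule dchain_unique[OF dchain_dspl dchain_tay, of ?u x "{}" k s \<theta> _ r x, simplified])
    fix z assume "?u < z \<and> z < x"
    then show "dspl k (Suc s) s \<theta> z = dspl k (Suc s) s \<theta> ?u"
      using l x by (simp add: dspl_top[of l] divide_strict_right_mono)
  qed (use x True in auto)
next
  case False
  then show ?thesis using r x l by (simp add: dspl_top[of l] divide_strict_right_mono)
qed

section \<open>Coefficients recovered from derivative data\<close>

lemma dcoefs_Suc_order: "dcoefs k (Suc q) (Suc r) c = dcoefs k q r (dcoef k q c)"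
proof (induction r)
  case (Suc r)
  have "dcoefs k (Suc q) (Suc (Suc r)) c = dcoef k (q - Suc r) (dcoefs k (Suc q) (Suc r) c)" by simp
  then show ?case unfolding Suc.IH by simp
qed simp

text \<open>The k + q coefficients correspond to q - 1 derivative values at 0 and one value of the
  top derivative on each of the k + 1 cells. Each order is recovered from its derivative by summing
  differences.\<close>

lemma ex_coefs:
  assumes "q \<ge> 1"
  shows "\<exists>\<theta>. (\<forall>r<q - 1. dcoefs k q r \<theta> 1 = \<beta> r) \<and> (\<forall>i\<in>{1..k + 1}. dcoefs k q (q - 1) \<theta> i = g i)"
  using assms
proof (induction q arbitrary: \<beta> rule: nat_induct_at_least)
  case base
  then show ?case by (intro exI[of _ g]) simp
next
  case (Suc q)
  obtain c where c': "(\<forall>r<q - 1. dcoefs k q r c 1 = \<beta> (Suc r)) \<and> (\<forall>i\<in>{1..k + 1}. dcoefs k q (q - 1) c i = g i)"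
    using Suc.IH[of "\<lambda>r. \<beta> (Suc r)"] by (rule exE)
  note c = c'[THEN conjunct1, rule_format] c'[THEN conjunct2, rule_format]
  define gap where "gap i = knot k q (i + q) - knot k q i" for i
  \<comment> \<open>Inverts \<open>dcoef\<close> by summation starting from index 1; index 0 holds a
    dummy value. By \<open>knot_less\<close> the gaps are nonzero.\<close>
  define \<theta> where "\<theta> = rec_nat 0 (\<lambda>i t. if i = 0 then \<beta> 0 else t + c i * gap i / real q)"
  have \<theta>1: "\<theta> 1 = \<beta> 0" by (simp add: \<theta>_def)
  have \<theta>S: "\<theta> (Suc i) = \<theta> i + c i * gap i / real q" if "i \<ge> 1" for i using that by (simp add: \<theta>_def)
  have eq: "dcoef k q \<theta> i = c i" if "i \<in> {1..k + q}" for i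
  proof -
    have g: "gap i \<noteq> 0" using knot_less[of i k q] that Suc.hyps by (simp add: gap_def)
    have "\<theta> (Suc i) - \<theta> i = c i * gap i / real q" using \<theta>S[of i] that by simp
    then have "dcoef k q \<theta> i = real q * (c i * gap i / real q) / gap i" by (simp only: dcoef_def gap_def)
    then show ?thesis using g Suc.hyps by simp
  qed
  have 1: "dcoefs k (Suc q) (Suc r) \<theta> i = dcoefs k q r c i" if "r < q" "i \<in> {1..k + q - r}" for r i
    unfolding dcoefs_Suc_order by (rule dcoefs_cong[OF eq that])
  show ?case
  proof (intro exI[of _ \<theta>] conjI allI impI ballI)
    fix r assume r: "r < Suc q - 1"
    show "dcoefs k (Suc q) r \<theta> 1 = \<beta> r"
    proof (cases r)
      case 0 then show ?thesis using \<theta>1 by simp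
    next
      case (Suc r')
      then have "dcoefs k (Suc q) r \<theta> 1 = dcoefs k q r' c 1" using 1[of r' 1] r by simp
      then show ?thesis using c(1)[of r'] r Suc by simp
    qed
  next
    fix i assume i: "i \<in> {1..k + 1}"
    have "dcoefs k (Suc q) (Suc (q - 1)) \<theta> i = dcoefs k q (q - 1) c i"
      by (rule 1) (use i Suc.hyps in auto)
    then show "dcoefs k (Suc q) (Suc q - 1) \<theta> i = g i" using c(2)[OF i] Suc.hyps by simp
  qed
qed

text \<open>The same summation with bounds. The constant may depend on k and q: it serves to show
  that a box of derivative values has finite volume.\<close>

lemma coefs_bounded:
  assumes "q \<ge> 1" "R \<ge> 0"
  shows "\<exists>B\<ge>0. \<forall>\<theta>. (\<forall>r<q. \<bar>dcoefs k q r \<theta> 1\<bar> \<le> R) \<longrightarrow> (\<forall>i\<in>{1..k + 1}. \<bar>dcoefs k q (q - 1) \<theta> i\<bar> \<le> R) \<longrightarrow>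
     (\<forall>i\<in>{1..k + q}. \<bar>\<theta> i\<bar> \<le> B)"
  using assms(1)
proof (induction q rule: nat_induct_at_least)
  case base
  then show ?case using assms(2) by (intro exI[of _ R]) auto
next
  case (Suc q)
  obtain B where B': "B \<ge> 0 \<and> (\<forall>\<theta>. (\<forall>r<q. \<bar>dcoefs k q r \<theta> 1\<bar> \<le> R) \<longrightarrow> (\<forall>i\<in>{1..k + 1}. \<bar>dcoefs k q (q - 1) \<theta> i\<bar> \<le> R) \<longrightarrow>
     (\<forall>i\<in>{1..k + q}. \<bar>\<theta> i\<bar> \<le> B))"
    using Suc.IH by (rule exE)
  have B: "B \<ge> 0" using B' by (rule conjunct1)
  have B2: "\<bar>\<theta> i\<bar> \<le> B" if "\<forall>r<q. \<bar>dcoefs k q r \<theta> 1\<bar> \<le> R" "\<forall>i\<in>{1..k + 1}. \<bar>dcoefs k q (q - 1) \<theta> i\<bar> \<le> R" "i \<in> {1..k + q}" for \<theta> i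
    using B'[THEN conjunct2, THEN spec, THEN mp, OF that(1), THEN mp, OF that(2)] that(3) by (rule bspec)
  have "\<bar>\<theta> i\<bar> \<le> R + real (k + Suc q) * B"
    if 1: "\<forall>r<Suc q. \<bar>dcoefs k (Suc q) r \<theta> 1\<bar> \<le> R" and 2: "\<forall>i\<in>{1..k + 1}. \<bar>dcoefs k (Suc q) (Suc q - 1) \<theta> i\<bar> \<le> R"
      and i: "i \<in> {1..k + Suc q}" for \<theta> i
  proof -
    have q: "Suc (q - 1) = q" using Suc.hyps by simp
    have a: "\<forall>r<q. \<bar>dcoefs k q r (dcoef k q \<theta>) 1\<bar> \<le> R"
      using 1 unfolding dcoefs_Suc_order[symmetric] by blast
    have b: "\<forall>i\<in>{1..k + 1}. \<bar>dcoefs k q (q - 1) (dcoef k q \<theta>) i\<bar> \<le> R"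
      using 2 dcoefs_Suc_order[of k q "q - 1" \<theta>] q by simp
    have st: "\<bar>\<theta> (Suc i) - \<theta> i\<bar> \<le> B" if i: "i \<in> {1..k + q}" for i
    proof -
      let ?g = "knot k q (i + q) - knot k q i"
      have g: "?g > 0" "?g \<le> 1" using knot_less[of i k q] i Suc.hyps knot_bounds[of k q "i+q"] knot_bounds[of k q i] by auto
      have "\<theta> (Suc i) - \<theta> i = dcoef k q \<theta> i * (?g / real q)" using g Suc.hyps by (simp add: dcoef_def)
      then have "\<bar>\<theta> (Suc i) - \<theta> i\<bar> = \<bar>dcoef k q \<theta> i\<bar> * (?g / real q)" using g by (simp add: abs_mult)
      also have "\<dots> \<le> B * 1" by (intro mult_mono B2[OF a b i]) (use g B Suc.hyps in \<open>auto simp: divide_le_eq\<close>)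
      finally show ?thesis by simp
    qed
    have "j \<le> k + q \<Longrightarrow> \<bar>\<theta> (Suc j)\<bar> \<le> R + real j * B" for j
    proof (induction j)
      case 0
      then show ?case using 1 by auto
    next
      case (Suc j)
      have "\<bar>\<theta> (Suc (Suc j)) - \<theta> (Suc j)\<bar> \<le> B" using st[of "Suc j"] Suc.prems by simp
      then show ?case using Suc by (simp add: algebra_simps)
    qed
    from this[of "i - 1"] i have "\<bar>\<theta> i\<bar> \<le> R + real (i - 1) * B" by auto
    also have "\<dots> \<le> R + real (k + Suc q) * B" using i B by (intro add_left_mono mult_right_mono) auto
    finally show ?thesis .
  qed
  moreover have "0 \<le> R + real (k + Suc q) * B" using assms B by simp
  ultimately show ?case by (intro exI[of _ "R + real (k + Suc q) * B"] conjI allI impI ballI)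
qed

text \<open>Lagrange basis polynomial for the nodes 0, ..., s.\<close>

definition lagr :: "nat \<Rightarrow> nat \<Rightarrow> real poly" where
  "lagr s t = (\<Prod>u\<in>{0..s} - {t}. smult (1 / (real t - real u)) [:- real u, 1:])"

lemma poly_lagr:
  assumes "t \<le> s" "t' \<le> s"
  shows "poly (lagr s t) (real t') = (if t = t' then 1 else 0)"
proof (cases "t = t'")
  case True
  have "poly (lagr s t) (real t') = (\<Prod>u\<in>{0..s} - {t}. 1)"
    unfolding lagr_def poly_prod by (rule prod.cong) (auto simp: True diff_divide_distrib[symmetric])
  then show ?thesis using True by simp
next
  case False
  then have "poly (lagr s t) (real t') = 0"
    unfolding lagr_def poly_prod using assms by (subst prod_zero_iff) (auto intro!: bexI[of _ t'])
  then show ?thesis using False by simp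
qed

lemma degree_lagr: "t \<le> s \<Longrightarrow> degree (lagr s t) \<le> s"
proof -
  assume t: "t \<le> s"
  have "degree (lagr s t) \<le> sum (degree \<circ> (\<lambda>u. smult (1 / (real t - real u)) [:- real u, 1:])) ({0..s} - {t})"
    unfolding lagr_def by (rule degree_prod_sum_le) simp
  also have "\<dots> \<le> (\<Sum>u\<in>{0..s} - {t}. 1)" by (rule sum_mono) simp
  also have "\<dots> = s" using t by simp
  finally show ?thesis .
qed

lemma lagrange_monom:
  assumes "p \<le> s"
  shows "monom 1 p = (\<Sum>t\<le>s. smult (real t ^ p) (lagr s t))"
proof (rule poly_eqI_degree[of "real ` {..s}"])
  fix x assume "x \<in> real ` {..s}"
  then obtain t' where t': "x = real t'" "t' \<le> s" by auto
  have "poly (\<Sum>t\<le>s. smult (real t ^ p) (lagr s t)) x = (\<Sum>t\<le>s. if t = t' then real t' ^ p else 0)"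
    unfolding poly_sum t' by (intro sum.cong) (auto simp: poly_lagr t'(2))
  then show "poly (monom 1 p) x = poly (\<Sum>t\<le>s. smult (real t ^ p) (lagr s t)) x"
    using t' by (simp add: poly_monom)
next
  have c: "card (real ` {..s}) = Suc s" by (subst card_image) auto
  show "degree (monom (1::real) p) < card (real ` {..s})"
    unfolding c using degree_monom_le[of "1::real" p] assms by simp
  have "degree (\<Sum>t\<le>s. smult (real t ^ p) (lagr s t)) \<le> s"
    by (rule degree_sum_le) (auto simp: degree_lagr)
  then show "degree (\<Sum>t\<le>s. smult (real t ^ p) (lagr s t)) < card (real ` {..s})" unfolding c by simp
qed

text \<open>The coefficients of the Lagrange basis invert the Vandermonde matrix: interpolating x^p
  at 0, ..., s and comparing coefficients gives the dual relation \<open>delta\<close>. As p is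
  positive, the node 0 contributes nothing. The constant D depends on s alone.\<close>

lemma vandermonde_solve:
  "\<exists>D\<ge>0. \<forall>e B. (\<forall>p\<in>{1..s}. \<bar>e p\<bar> \<le> B) \<longrightarrow> 
     (\<exists>d :: nat \<Rightarrow> real. (\<forall>p\<in>{1..s}. (\<Sum>t=1..s. d t * real t ^ p) = e p) \<and> (\<forall>t\<in>{1..s}. \<bar>d t\<bar> \<le> D * B))"
proof -
  define D where "D = (\<Sum>t=1..s. \<Sum>q=1..s. \<bar>coeff (lagr s t) q\<bar>)"
  have D: "D \<ge> 0" unfolding D_def by (intro sum_nonneg) auto
  have delta: "(\<Sum>t=1..s. real t ^ p * coeff (lagr s t) q) = (if p = q then 1 else 0)" if "p \<in> {1..s}" for p q
  proof -
    have "coeff (monom 1 p) q = (\<Sum>t\<le>s. real t ^ p * coeff (lagr s t) q)"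
      using lagrange_monom[of p s] that by (simp add: coeff_sum)
    also have "\<dots> = (\<Sum>t=1..s. real t ^ p * coeff (lagr s t) q)"
      by (rule sum.mono_neutral_right) (use that in \<open>auto simp: Suc_le_eq\<close>)
    finally show ?thesis by (simp add: coeff_monom)
  qed
  have "\<exists>d. (\<forall>p\<in>{1..s}. (\<Sum>t=1..s. d t * real t ^ p) = e p) \<and> (\<forall>t\<in>{1..s}. \<bar>d t\<bar> \<le> D * B)"
    if e: "\<forall>p\<in>{1..s}. \<bar>e p\<bar> \<le> B" for e B
  proof -
    define d where "d t = (\<Sum>q=1..s. e q * coeff (lagr s t) q)" for t
    have "(\<Sum>t=1..s. d t * real t ^ p) = e p" if p: "p \<in> {1..s}" for p
    proof -
      have "(\<Sum>t=1..s. d t * real t ^ p) = (\<Sum>q=1..s. e q * (\<Sum>t=1..s. real t ^ p * coeff (lagr s t) q))"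
        unfolding d_def sum_distrib_left sum_distrib_right by (subst sum.swap) (simp add: mult_ac)
      also have "\<dots> = (\<Sum>q=1..s. if q = p then e p else 0)"
        using delta[OF p] by (intro sum.cong) auto
      also have "\<dots> = e p" using p by simp
      finally show ?thesis .
    qed
    moreover have "\<bar>d t\<bar> \<le> D * B" if t: "t \<in> {1..s}" for t
    proof -
      have B: "B \<ge> 0" using e t by force
      have "\<bar>d t\<bar> \<le> (\<Sum>q=1..s. \<bar>e q\<bar> * \<bar>coeff (lagr s t) q\<bar>)"
        unfolding d_def by (rule order_trans[OF sum_abs]) (simp add: abs_mult)
      also have "\<dots> \<le> (\<Sum>q=1..s. B * \<bar>coeff (lagr s t) q\<bar>)" using e by (intro sum_mono mult_right_mono) auto
      also have "\<dots> = B * (\<Sum>q=1..s. \<bar>coeff (lagr s t) q\<bar>)" by (simp add: sum_distrib_left)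
      also have "(\<Sum>q=1..s. \<bar>coeff (lagr s t) q\<bar>) \<le> D"
        unfolding D_def using t by (intro member_le_sum[of t "{1..s}" "\<lambda>t. \<Sum>q=1..s. \<bar>coeff (lagr s t) q\<bar>"]) (auto intro: sum_nonneg)
      finally have "\<bar>d t\<bar> \<le> B * D" using B by (simp add: mult_left_mono)
      then show ?thesis by (simp add: mult.commute)
    qed
    ultimately show ?thesis by blast
  qed
  then show ?thesis using D by blast
qed

text \<open>The truncated power divided by p!. For \<open>p = 0\<close> it is the step function with
  value 1 at 0, right continuous like the splines of order one.\<close>

definition tpow :: "nat \<Rightarrow> real \<Rightarrow> real" where
  "tpow p x = (if 0 \<le> x then x ^ p / fact p else 0)"

lemma tpow_deriv:
  assumes "x \<noteq> 0"
  shows "(tpow (Suc p) has_real_derivative tpow p x) (at x)"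
proof (cases "x > 0")
  case True
  have d: "((\<lambda>x. x ^ Suc p / fact (Suc p)) has_real_derivative x ^ p / fact p) (at x)"
    using power_div_fact_deriv[of 0 p x] by simp
  have "\<forall>\<^sub>F z in nhds x. z \<in> {0<..}" by (rule eventually_nhds_in_open) (use True in auto)
  then have "\<forall>\<^sub>F z in nhds x. tpow (Suc p) z = z ^ Suc p / fact (Suc p)"
    by (rule eventually_mono) (simp add: tpow_def)
  then have "(tpow (Suc p) has_real_derivative x ^ p / fact p) (at x)"
    using d by (subst DERIV_cong_ev[OF refl _ refl]) auto
  then show ?thesis using True by (simp add: tpow_def)
next
  case False
  have "\<forall>\<^sub>F z in nhds x. z \<in> {..<0}" by (rule eventually_nhds_in_open) (use False assms in auto)
  then have "\<forall>\<^sub>F z in nhds x. tpow (Suc p) z = 0"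
    by (rule eventually_mono) (simp add: tpow_def)
  then have "(tpow (Suc p) has_real_derivative 0) (at x)"
    by (subst DERIV_cong_ev[OF refl _ refl]) auto
  then show ?thesis using False assms by (simp add: tpow_def)
qed

lemma tpow_continuous: "p \<ge> 1 \<Longrightarrow> continuous_on X (tpow p)"
proof -
  assume "p \<ge> 1"
  then have "tpow p = (\<lambda>x. max 0 x ^ p / fact p)" by (auto simp: tpow_def fun_eq_iff max_def)
  then show ?thesis by (auto simp: divide_inverse intro!: continuous_intros)
qed

lemma tpow_bound: "x \<le> y \<Longrightarrow> 0 \<le> y \<Longrightarrow> \<bar>tpow p x\<bar> \<le> y ^ p"
proof -
  assume xy: "x \<le> y" "0 \<le> y"
  have "x ^ p / fact p \<le> y ^ p" if "0 \<le> x"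
  proof -
    have "x ^ p / fact p \<le> x ^ p / 1" using that by (intro divide_left_mono) (auto simp: fact_ge_1)
    also have "\<dots> \<le> y ^ p" using that xy by (simp add: power_mono)
    finally show ?thesis .
  qed
  then show ?thesis using xy by (auto simp: tpow_def)
qed

subsection \<open>The Sobolev class\<close>

text \<open>A gauge argument. A tagged division is split by its tags. At tags where g is
  differentiable the derivative bound controls the increments up to e. The other tags lie in a null
  set, covered by an open set of measure below \<delta>, where absolute continuity makes the
  increments sum to less than e.\<close>

lemma abs_continuous_Lipschitz:
  fixes g :: "real \<Rightarrow> real"
  assumes ac: "abs_continuous_on {0<..<1} g"
    and ae: "AE x in lebesgue_on {0..1}. g differentiable at x \<and> \<bar>deriv g x\<bar> \<le> C"
    and ab: "0 < a" "a \<le> b" "b < 1" and C: "C \<ge> 0"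
  shows "\<bar>g b - g a\<bar> \<le> C * (b - a)"
proof -
  define good where "good x \<longleftrightarrow> g differentiable at x \<and> \<bar>deriv g x\<bar> \<le> C" for x
  have "AE x in lebesgue. x \<in> {0..1} \<longrightarrow> good x"
    using ae unfolding good_def by (subst (asm) AE_restrict_space_iff) auto
  then obtain N where N': "N \<in> null_sets lebesgue" "{x \<in> space lebesgue. \<not> (x \<in> {0..1} \<longrightarrow> good x)} \<subseteq> N"
    unfolding eventually_ae_filter by blast
  have N: "N \<in> null_sets lebesgue" "\<And>x. x \<in> {0..1} \<Longrightarrow> x \<notin> N \<Longrightarrow> good x"
    using N' by auto
  have eps: "\<bar>g b - g a\<bar> \<le> C * (b - a) + e * (b - a + 1)" if e: "e > 0" for e
  proof -
    obtain \<delta> where \<delta>: "\<delta> > 0" and ac\<delta>': "\<forall>(n::nat) u v. (\<forall>i<n. u i \<le> v i \<and> {u i..v i} \<subseteq> {0<..<1}) \<longrightarrow>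
        disjoint_family_on (\<lambda>i. {u i<..<v i}) {..<n} \<longrightarrow> (\<Sum>i<n. v i - u i) < \<delta> \<longrightarrow>
        (\<Sum>i<n. \<bar>g (v i) - g (u i)\<bar>) < e"
      using ac[unfolded abs_continuous_on_def, THEN spec, THEN mp, OF e] by (elim exE conjE)
    note ac\<delta> = ac\<delta>'[THEN spec, THEN spec, THEN spec, THEN mp, THEN mp, THEN mp]
    obtain T where T: "open T" "N \<subseteq> T" "T - N \<in> lmeasurable" "emeasure lebesgue (T - N) < ennreal \<delta>"
      by (rule sets_lebesgue_outer_open[OF null_setsD2[OF N(1)] \<delta>])
    have eT: "emeasure lebesgue T < ennreal \<delta>"
      using T N(1) emeasure_Diff_null_set[OF N(1), of T] by auto
    \<comment> \<open>\<open>R x d\<close> says that the radius d is small enough at x. At a good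
      point the increment over an interval through x is compared with the derivative from both
      sides, which requires u \<le> x \<le> v.\<close>
    define R where "R x d \<longleftrightarrow> d > 0 \<and> (x \<in> N \<longrightarrow> ball x d \<subseteq> T) \<and>
       (x \<in> {a..b} - N \<longrightarrow> (\<forall>u v. u \<le> x \<longrightarrow> x \<le> v \<longrightarrow> {u..v} \<subseteq> ball x d \<longrightarrow> \<bar>g v - g u\<bar> \<le> (C + e) * (v - u)))" for x d
    have "\<exists>d>0. (x \<in> N \<longrightarrow> ball x d \<subseteq> T) \<and>
       (x \<in> {a..b} - N \<longrightarrow> (\<forall>u v. u \<le> x \<longrightarrow> x \<le> v \<longrightarrow> {u..v} \<subseteq> ball x d \<longrightarrow> \<bar>g v - g u\<bar> \<le> (C + e) * (v - u)))" for x
    proof (cases "x \<in> N")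
      case True
      then obtain d where "d > 0" "ball x d \<subseteq> T" using T(1,2) openE by blast
      then show ?thesis using True by auto
    next
      case False
      show ?thesis
      proof (cases "x \<in> {a..b}")
        case True
        then have gd: "g differentiable at x" "\<bar>deriv g x\<bar> \<le> C" using N(2)[of x] False ab by (auto simp: good_def)
        then have "(g has_derivative (\<lambda>h. deriv g x * h)) (at x)"
          using DERIV_deriv_iff_real_differentiable[of g x] unfolding has_field_derivative_def by auto
        from this[unfolded has_derivative_at_alt, THEN conjunct2, THEN spec, THEN mp, OF e]
        obtain d where d: "d > 0" and d': "\<forall>y. norm (y - x) < d \<longrightarrow> norm (g y - g x - deriv g x * (y - x)) \<le> e * norm (y - x)"
          by (elim exE conjE)
        have "\<bar>g v - g u\<bar> \<le> (C + e) * (v - u)" if "u \<le> x" "x \<le> v" "{u..v} \<subseteq> ball x d" for u v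
        proof -
          have "u \<in> {u..v}" "v \<in> {u..v}" using that by auto
          then have "u \<in> ball x d" "v \<in> ball x d" using that(3) by (blast intro: subsetD)+
          then have "\<bar>g u - g x - deriv g x * (u - x)\<bar> \<le> e * (x - u)" "\<bar>g v - g x - deriv g x * (v - x)\<bar> \<le> e * (v - x)"
            using d'[THEN spec, of u] d'[THEN spec, of v] that by (auto simp: dist_real_def abs_minus_commute)
          moreover have "\<bar>deriv g x * (v - u)\<bar> \<le> C * (v - u)"
            unfolding abs_mult using gd that by (intro mult_mono) auto
          moreover have "g v - g u = (g v - g x - deriv g x * (v - x)) - (g u - g x - deriv g x * (u - x)) + deriv g x * (v - u)"
            by (simp add: algebra_simps)
          ultimately show ?thesis unfolding distrib_right right_diff_distrib by linarith
        qed
        then show ?thesis using d False by (intro exI[of _ d]) simp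
      next
        case F2: False
        then show ?thesis using False by (intro exI[of _ 1]) auto
      qed
    qed
    then have "\<forall>x. \<exists>d. R x d" unfolding R_def by (intro allI)
    from choice[OF this] obtain d where dR: "\<forall>x. R x (d x)" ..
    have d: "d x > 0" "x \<in> N \<Longrightarrow> ball x (d x) \<subseteq> T"
       "x \<in> {a..b} - N \<Longrightarrow> u \<le> x \<Longrightarrow> x \<le> v \<Longrightarrow> {u..v} \<subseteq> ball x (d x) \<Longrightarrow> \<bar>g v - g u\<bar> \<le> (C + e) * (v - u)" for x u v
      using dR[THEN spec, of x] unfolding R_def by simp_all
    have gauge: "gauge (\<lambda>x. ball x (d x))" using d(1) by (auto simp: gauge_def)
    obtain p where p: "p tagged_division_of {a..b}" "(\<lambda>x. ball x (d x)) fine p"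
      using fine_division_exists_real[OF gauge] by blast
    have fin: "finite p" using p(1) by (rule tagged_division_of_finite)
    have K0: "snd z = {Inf (snd z)..Sup (snd z)} \<and> Inf (snd z) \<le> fst z \<and> fst z \<le> Sup (snd z) \<and>
        {Inf (snd z)..Sup (snd z)} \<subseteq> {a..b} \<and> {Inf (snd z)..Sup (snd z)} \<subseteq> ball (fst z) (d (fst z))" if "z \<in> p" for z
    proof -
      obtain x k where z: "z = (x, k)" by (cases z)
      have xk: "(x, k) \<in> p" using that z by simp
      obtain u v where k: "k = cbox u v" using tagged_division_ofD(4)[OF p(1) xk] by blast
      have "x \<in> k" "k \<subseteq> {a..b}" "k \<subseteq> ball x (d x)"
        using tagged_division_ofD(2,3)[OF p(1) xk] p(2) xk by (auto simp: fine_def)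
      moreover from this have "u \<le> v" using k by auto
      ultimately show ?thesis using k z by auto
    qed
    have K: "Inf (snd z) \<le> fst z \<and> fst z \<le> Sup (snd z) \<and>
        {Inf (snd z)..Sup (snd z)} \<subseteq> {a..b} \<and> {Inf (snd z)..Sup (snd z)} \<subseteq> ball (fst z) (d (fst z))" if "z \<in> p" for z
      using K0[OF that] by (rule conjunct2)
    let ?I = "\<lambda>z. Inf (snd z) :: real" and ?S = "\<lambda>z. Sup (snd z) :: real"
    define p1 where "p1 = {z \<in> p. fst z \<in> N}"
    define p2 where "p2 = {z \<in> p. fst z \<notin> N}"
    have "(\<Sum>z\<in>p. g (?S z) - g (?I z)) = g b - g a"
      using additive_tagged_division_1[OF ab(2) p(1), of g] by (simp add: case_prod_beta)
    moreover have pp: "p = p1 \<union> p2" "p1 \<inter> p2 = {}" "finite p1" "finite p2" using fin by (auto simp: p1_def p2_def)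
    ultimately have split: "g b - g a = (\<Sum>z\<in>p1. g (?S z) - g (?I z)) + (\<Sum>z\<in>p2. g (?S z) - g (?I z))"
      using sum.union_disjoint[OF pp(3,4,2)] by metis
    have "\<bar>\<Sum>z\<in>p2. g (?S z) - g (?I z)\<bar> \<le> (\<Sum>z\<in>p2. (C + e) * (?S z - ?I z))"
    proof (rule order_trans[OF sum_abs], rule sum_mono)
      fix z assume z: "z \<in> p2"
      then have "z \<in> p" "fst z \<notin> N" by (auto simp: p2_def)
      then show "\<bar>g (?S z) - g (?I z)\<bar> \<le> (C + e) * (?S z - ?I z)"
        using K[of z] by (intro d(3)[of "fst z"]) auto
    qed
    also have "\<dots> \<le> (\<Sum>z\<in>p. (C + e) * (?S z - ?I z))"
    proof (rule sum_mono2[OF fin])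
      fix z assume "z \<in> p - p2"
      then have "?I z \<le> ?S z" using K[of z] by auto
      then show "0 \<le> (C + e) * (?S z - ?I z)" using C e by simp
    qed (auto simp: p2_def)
    also have "\<dots> = (C + e) * (b - a)"
      using additive_tagged_division_1[OF ab(2) p(1), of "\<lambda>x. x"] by (simp add: case_prod_beta sum_distrib_left[symmetric])
    finally have s2: "\<bar>\<Sum>z\<in>p2. g (?S z) - g (?I z)\<bar> \<le> (C + e) * (b - a)" .
    \<comment> \<open>Absolute continuity speaks of finite sequences of intervals, so the pieces
      with exceptional tags are enumerated.\<close>
    obtain h where h: "bij_betw h {..<card p1} p1"
      using ex_bij_betw_nat_finite[OF pp(3)] by (auto simp: atLeast0LessThan)
    have hp: "h i \<in> p" "fst (h i) \<in> N" if "i < card p1" for i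
      using bij_betwE[OF h] that by (auto simp: p1_def)
    have disj: "disjoint_family_on (\<lambda>i. {?I (h i)<..<?S (h i)}) {..<card p1}"
      unfolding disjoint_family_on_def
    proof (intro ballI impI)
      fix i j assume ij: "i \<in> {..<card p1}" "j \<in> {..<card p1}" "i \<noteq> j"
      then have ne: "h i \<noteq> h j" using h by (auto simp: bij_betw_def inj_on_def)
      obtain x k where 1: "h i = (x, k)" by (cases "h i")
      obtain x' k' where 2: "h j = (x', k')" by (cases "h j")
      have "interior k \<inter> interior k' = {}"
        using tagged_division_ofD(5)[OF p(1), of x k x' k'] hp[of i] hp[of j] ij ne 1 2 by auto
      moreover have int: "interior (snd (h i)) = {?I (h i)<..<?S (h i)}" if "i < card p1" for i
        using arg_cong[OF K0[OF hp(1)[OF that], THEN conjunct1], of interior]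
        unfolding interior_atLeastAtMost_real .
      moreover have "snd (h i) = k" "snd (h j) = k'" using 1 2 by simp_all
      ultimately show "{?I (h i)<..<?S (h i)} \<inter> {?I (h j)<..<?S (h j)} = {}"
        using int[of i] int[of j] ij by simp
    qed
    have le: "?I (h i) \<le> ?S (h i)" if "i < card p1" for i
      using K[OF hp(1)[OF that]] by linarith
    \<comment> \<open>The open pieces are disjoint and lie in \<open>T\<close> by the choice of the
      gauge, so their lengths add up to at most the measure of \<open>T\<close>.\<close>
    have len: "(\<Sum>i<card p1. ?S (h i) - ?I (h i)) < \<delta>"
    proof -
      have "ennreal (\<Sum>i<card p1. ?S (h i) - ?I (h i)) = (\<Sum>i<card p1. ennreal (?S (h i) - ?I (h i)))"
        by (rule sum_ennreal[symmetric]) (use le in simp)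
      also have "\<dots> = (\<Sum>i<card p1. emeasure lebesgue {?I (h i)<..<?S (h i)})"
        by (intro sum.cong refl) (use le in simp)
      also have "\<dots> = emeasure lebesgue (\<Union>i<card p1. {?I (h i)<..<?S (h i)})"
        by (rule sum_emeasure[OF _ disj]) auto
      also have "\<dots> \<le> emeasure lebesgue T"
      proof (rule emeasure_mono)
        show "(\<Union>i<card p1. {?I (h i)<..<?S (h i)}) \<subseteq> T"
        proof (intro UN_least)
          fix i assume "i \<in> {..<card p1}"
          then have "{?I (h i)..?S (h i)} \<subseteq> T" using K[of "h i"] hp[of i] d(2)[of "fst (h i)"] by auto
          then show "{?I (h i)<..<?S (h i)} \<subseteq> T" by force
        qed
      qed (use T(1) in auto)
      finally show ?thesis using eT \<delta> by (meson ennreal_leI le_less_trans linorder_not_less)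
    qed
    have "(\<Sum>i<card p1. \<bar>g (?S (h i)) - g (?I (h i))\<bar>) < e"
    proof (rule ac\<delta>[OF _ disj len], intro allI impI)
      fix i assume "i < card p1"
      then have "{?I (h i)..?S (h i)} \<subseteq> {a..b}" "?I (h i) \<le> ?S (h i)" using K[OF hp(1)] le by simp_all
      moreover have "{a..b} \<subseteq> {0<..<1}" using ab by auto
      ultimately show "?I (h i) \<le> ?S (h i) \<and> {?I (h i)..?S (h i)} \<subseteq> {0<..<1}" by blast
    qed
    also have "(\<Sum>i<card p1. \<bar>g (?S (h i)) - g (?I (h i))\<bar>) = (\<Sum>z\<in>p1. \<bar>g (?S z) - g (?I z)\<bar>)"
      by (rule sum.reindex_bij_betw[OF h])
    finally have "\<bar>\<Sum>z\<in>p1. g (?S z) - g (?I z)\<bar> \<le> e"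
      using sum_abs[of "\<lambda>z. g (?S z) - g (?I z)" p1] by linarith
    then show ?thesis using s2 unfolding split by (simp add: algebra_simps)
  qed
  show ?thesis
  proof (rule field_le_epsilon)
    fix e :: real assume "e > 0"
    then have "\<bar>g b - g a\<bar> \<le> C * (b - a) + (e / (b - a + 1)) * (b - a + 1)" using ab by (intro eps) auto
    then show "\<bar>g b - g a\<bar> \<le> C * (b - a) + e" using ab by simp
  qed
qed

lemma W_inf_derivatives:
  assumes s: "s \<ge> 1" and f: "f \<in> W_inf s"
  obtains C where "C \<ge> 0"
    "\<And>r x. Suc r < s \<Longrightarrow> x \<in> {0<..<1} \<Longrightarrow> (Dr r f has_real_derivative Dr (Suc r) f x) (at x)"
    "\<And>x y. 0 < x \<Longrightarrow> x \<le> y \<Longrightarrow> y < 1 \<Longrightarrow> \<bar>Dr (s - 1) f y - Dr (s - 1) f x\<bar> \<le> C * (y - x)"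
proof -
  have W: "\<forall>r<s - 1. \<forall>x\<in>{0<..<1}. Dr r f differentiable at x" "abs_continuous_on {0<..<1} (Dr (s - 1) f)"
     "AE x in lebesgue_on {0..1}. Dr (s - 1) f differentiable at x" "Linf_norm (Dr s f) < \<infinity>"
    using f by (simp_all add: W_inf_def)
  have Dr_Suc: "Dr (Suc r) f x = deriv (Dr r f) x" for r x by (simp add: Dr_def)
  obtain C where C: "C \<ge> 0" "Linf_norm (Dr s f) \<le> ereal C"
  proof (cases "Linf_norm (Dr s f)")
    case (real c)
    then show ?thesis by (intro that[of "max c 0"]) auto
  qed (use W(4) that[of 0] in auto)
  have "AE x in lebesgue_on {0..1}. ereal \<bar>Dr s f x\<bar> \<le> Linf_norm (Dr s f)"
    unfolding Linf_norm_def by (rule esssup_AE)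
  with W(3) have "AE x in lebesgue_on {0..1}. Dr (s - 1) f differentiable at x \<and> \<bar>deriv (Dr (s - 1) f) x\<bar> \<le> C"
  proof eventually_elim
    case (elim x)
    have "ereal \<bar>Dr s f x\<bar> \<le> ereal C" using elim(2) C(2) by (rule order_trans)
    then show ?case using elim(1) Dr_Suc[of "s - 1" x] s by simp
  qed
  from abs_continuous_Lipschitz[OF W(2) this]
  have "\<bar>Dr (s - 1) f y - Dr (s - 1) f x\<bar> \<le> C * (y - x)" if "0 < x" "x \<le> y" "y < 1" for x y
    using that C(1) by blast
  moreover have "(Dr r f has_real_derivative Dr (Suc r) f x) (at x)" if "Suc r < s" "x \<in> {0<..<1}" for r x
  proof -
    have "Dr r f differentiable at x" using W(1) that by auto
    then show ?thesis unfolding Dr_Suc by (simp add: DERIV_deriv_iff_real_differentiable)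
  qed
  ultimately show ?thesis using that C(1) by blast
qed

text \<open>\<open>E r\<close> is the derivative of order r, extended to 0 by its right limit; the
  limit exists because all derivatives below s are Lipschitz. The entry of order s is set to 0, so
  the expansion has degree s - 1 and the Lipschitz bound of the last derivative yields the
  remainder. Factorials are dropped from it.\<close>

lemma W_inf_Taylor:
  assumes s: "s \<ge> 1" and f: "f \<in> W_inf s"
  shows "\<exists>E C. C \<ge> 0 \<and> (\<forall>x\<in>{0<..<1}. E 0 x = f x) \<and>
    (\<forall>r<s. \<forall>x\<in>{0..<1}. \<bar>E r x\<bar> \<le> C) \<and>
    (\<forall>r x y. r < s \<longrightarrow> 0 \<le> x \<longrightarrow> x \<le> y \<longrightarrow> y < 1 \<longrightarrow>
       \<bar>E r y - tay s (\<lambda>a. if a < s then E a x else 0) r (y - x)\<bar> \<le> C * (y - x) ^ (s - r))"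
proof -
  obtain C where C: "C \<ge> 0"
    and der: "\<And>r x. Suc r < s \<Longrightarrow> x \<in> {0<..<1} \<Longrightarrow> (Dr r f has_real_derivative Dr (Suc r) f x) (at x)"
    and lip: "\<And>x y. 0 < x \<Longrightarrow> x \<le> y \<Longrightarrow> y < 1 \<Longrightarrow> \<bar>Dr (s - 1) f y - Dr (s - 1) f x\<bar> \<le> C * (y - x)"
    using W_inf_derivatives[OF s f] by metis
  define A where "A x = (\<lambda>a. if a < s then Dr a f x else 0)" for x
  have taylor: "\<bar>Dr r f y - tay s (A x) r (y - x)\<bar> \<le> C * (y - x) ^ (s - r)"
    if r: "r < s" and xy: "0 < x" "x \<le> y" "y < 1" for r x y
  proof -
    \<comment> \<open>Downward in the order: each use of the mean value theorem integrates the
      remainder estimate once.\<close>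
    have "\<forall>y. x \<le> y \<longrightarrow> y < 1 \<longrightarrow> \<bar>Dr (s - Suc d) f y - tay s (A x) (s - Suc d) (y - x)\<bar> \<le> C * (y - x) ^ Suc d"
      if "d < s" for d
      using that
    proof (induction d)
      case 0
      have s1: "s - (s - Suc 0) = Suc 0" using s by simp
      have "tay s (A x) (s - Suc 0) z = Dr (s - 1) f x" for z
        unfolding tay_def s1 using s by (simp add: A_def)
      then show ?case using lip xy by simp
    next
      case (Suc d)
      let ?r = "s - Suc (Suc d)"
      have r: "Suc ?r = s - Suc d" "Suc ?r < s" "?r < s" using Suc.prems by auto
      have "\<bar>Dr ?r f y - tay s (A x) ?r (y - x)\<bar> \<le> C * (y - x) ^ Suc (Suc d)" if y: "x < y" "y < 1" for y
      proof -
        let ?g = "\<lambda>z. Dr ?r f z - tay s (A x) ?r (z - x)"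
        have "\<exists>z>x. z < y \<and> ?g y - ?g x = (y - x) * (Dr (Suc ?r) f z - tay s (A x) (Suc ?r) (z - x))"
          using xy y by (intro MVT2 DERIV_diff der[OF r(2)] tay_deriv[OF r(3)]) auto
        then obtain z where z: "x < z" "z < y" "?g y - ?g x = (y - x) * (Dr (Suc ?r) f z - tay s (A x) (Suc ?r) (z - x))"
          by blast
        have g0: "?g x = 0" using r by (simp add: A_def)
        have "\<bar>?g y\<bar> = (y - x) * \<bar>Dr (Suc ?r) f z - tay s (A x) (Suc ?r) (z - x)\<bar>"
          using z y unfolding g0 by (simp add: abs_mult)
        also have "\<dots> \<le> (y - x) * (C * (z - x) ^ Suc d)"
          using Suc z y unfolding r(1) by (intro mult_left_mono) auto
        also have "\<dots> \<le> (y - x) * (C * (y - x) ^ Suc d)"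
          using C z y by (intro mult_left_mono power_mono) auto
        finally show ?thesis by (simp add: mult_ac)
      qed
      moreover have "\<bar>Dr ?r f x - tay s (A x) ?r (x - x)\<bar> \<le> C * (x - x) ^ Suc (Suc d)"
        using r by (simp add: A_def)
      ultimately show ?case by (metis order_le_less)
    qed
    from this[of "s - Suc r"] show ?thesis using r xy by (simp add: Suc_diff_Suc)
  qed
  \<comment> \<open>Again from the top: a bounded derivative makes the next lower one Lipschitz and
    hence bounded on (0,1).\<close>
  have bnd: "\<exists>B\<ge>0. (\<forall>x\<in>{0<..<1}. \<bar>Dr (s - Suc d) f x\<bar> \<le> B) \<and> (\<forall>x\<in>{0<..<1}. \<forall>y\<in>{0<..<1}. \<bar>Dr (s - Suc d) f y - Dr (s - Suc d) f x\<bar> \<le> B * \<bar>y - x\<bar>)"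
    if "d < s" for d
    using that
  proof (induction d)
    case 0
    have l: "\<bar>Dr (s - Suc 0) f y - Dr (s - Suc 0) f x\<bar> \<le> C * \<bar>y - x\<bar>" if "x \<in> {0<..<1}" "y \<in> {0<..<1}" for x y
      using lip[of x y] lip[of y x] that by (cases "x \<le> y") (auto simp: abs_minus_commute)
    define B where "B = \<bar>Dr (s - Suc 0) f (1/2)\<bar> + C"
    have "\<bar>Dr (s - Suc 0) f x\<bar> \<le> B" if x: "x \<in> {0<..<1}" for x
    proof -
      have "C * \<bar>x - 1/2\<bar> \<le> C * 1" using C x by (intro mult_left_mono) auto
      moreover have "\<bar>Dr (s - Suc 0) f x - Dr (s - Suc 0) f (1/2)\<bar> \<le> C * \<bar>x - 1/2\<bar>" using x by (intro l) auto
      ultimately show ?thesis unfolding B_def by linarith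
    qed
    moreover have "\<bar>Dr (s - Suc 0) f y - Dr (s - Suc 0) f x\<bar> \<le> B * \<bar>y - x\<bar>" if "x \<in> {0<..<1}" "y \<in> {0<..<1}" for x y
      using l[OF that] mult_right_mono[of C B "\<bar>y - x\<bar>"] by (simp add: B_def)
    ultimately show ?case using C by (intro exI[of _ B]) (auto simp: B_def)
  next
    case (Suc d)
    then obtain B where B: "B \<ge> 0" "\<And>x. x\<in>{0<..<1} \<Longrightarrow> \<bar>Dr (s - Suc d) f x\<bar> \<le> B" using Suc_lessD by blast
    let ?r = "s - Suc (Suc d)"
    have r: "Suc ?r = s - Suc d" "Suc ?r < s" using Suc.prems by auto
    have l0: "\<bar>Dr ?r f y - Dr ?r f x\<bar> \<le> B * \<bar>y - x\<bar>" if xy: "0 < x" "x < y" "y < 1" for x y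
    proof -
      have "\<exists>z>x. z < y \<and> Dr ?r f y - Dr ?r f x = (y - x) * Dr (Suc ?r) f z"
        using xy by (intro MVT2 der[OF r(2)]) auto
      then obtain z where z: "x < z" "z < y" "Dr ?r f y - Dr ?r f x = (y - x) * Dr (s - Suc d) f z" unfolding r(1) by blast
      have "\<bar>Dr ?r f y - Dr ?r f x\<bar> = (y - x) * \<bar>Dr (s - Suc d) f z\<bar>" using z xy by (simp add: abs_mult)
      also have "\<dots> \<le> (y - x) * B" using xy z by (intro mult_left_mono B) auto
      finally show ?thesis using xy by (simp add: mult.commute)
    qed
    have l: "\<bar>Dr ?r f y - Dr ?r f x\<bar> \<le> B * \<bar>y - x\<bar>" if "x \<in> {0<..<1}" "y \<in> {0<..<1}" for x y
      using l0[of x y] l0[of y x] that by (cases x y rule: linorder_cases) (auto simp: abs_minus_commute)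
    define B' where "B' = \<bar>Dr ?r f (1/2)\<bar> + B"
    have "\<bar>Dr ?r f x\<bar> \<le> B'" if x: "x \<in> {0<..<1}" for x
    proof -
      have "B * \<bar>x - 1/2\<bar> \<le> B * 1" using B(1) x by (intro mult_left_mono) auto
      moreover have "\<bar>Dr ?r f x - Dr ?r f (1/2)\<bar> \<le> B * \<bar>x - 1/2\<bar>" using x by (intro l) auto
      ultimately show ?thesis unfolding B'_def by linarith
    qed
    moreover have "\<bar>Dr ?r f y - Dr ?r f x\<bar> \<le> B' * \<bar>y - x\<bar>" if "x \<in> {0<..<1}" "y \<in> {0<..<1}" for x y
      using l[OF that] mult_right_mono[of B B' "\<bar>y - x\<bar>"] by (simp add: B'_def)
    ultimately show ?case using B(1) by (intro exI[of _ B']) (auto simp: B'_def)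
  qed
  have "\<exists>B\<ge>0. (\<forall>x\<in>{0<..<1}. \<bar>Dr r f x\<bar> \<le> B) \<and> (\<forall>x\<in>{0<..<1}. \<forall>y\<in>{0<..<1}. \<bar>Dr r f y - Dr r f x\<bar> \<le> B * \<bar>y - x\<bar>)"
    if "r < s" for r
  proof -
    have e: "s - Suc (s - Suc r) = r" "s - Suc r < s" using that by auto
    show ?thesis using bnd[OF e(2)] unfolding e(1) .
  qed
  then have "\<forall>r. \<exists>B. r < s \<longrightarrow> B \<ge> 0 \<and> (\<forall>x\<in>{0<..<1}. \<bar>Dr r f x\<bar> \<le> B) \<and> (\<forall>x\<in>{0<..<1}. \<forall>y\<in>{0<..<1}. \<bar>Dr r f y - Dr r f x\<bar> \<le> B * \<bar>y - x\<bar>)"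
    by blast
  from choice[OF this] obtain B where B': "\<forall>r. r < s \<longrightarrow> B r \<ge> 0 \<and> (\<forall>x\<in>{0<..<1}. \<bar>Dr r f x\<bar> \<le> B r) \<and> (\<forall>x\<in>{0<..<1}. \<forall>y\<in>{0<..<1}. \<bar>Dr r f y - Dr r f x\<bar> \<le> B r * \<bar>y - x\<bar>)" ..
  have B: "\<And>r. r < s \<Longrightarrow> B r \<ge> 0" "\<And>r x. r < s \<Longrightarrow> x\<in>{0<..<1} \<Longrightarrow> \<bar>Dr r f x\<bar> \<le> B r"
     "\<And>r x y. r < s \<Longrightarrow> x\<in>{0<..<1} \<Longrightarrow> y\<in>{0<..<1} \<Longrightarrow> \<bar>Dr r f y - Dr r f x\<bar> \<le> B r * \<bar>y - x\<bar>"
    using B' by simp_all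
  have "\<exists>l. (Dr r f \<longlongrightarrow> l) (at 0 within {0<..<1})" if r: "r < s" for r
  proof -
    have "uniformly_continuous_on {0<..<1} (Dr r f)"
      unfolding uniformly_continuous_on_def
    proof (intro allI impI)
      fix e :: real assume e: "e > 0"
      have "dist (Dr r f x') (Dr r f x) < e" if "x\<in>{0<..<1}" "x'\<in>{0<..<1}" "dist x' x < e / (B r + 1)" for x x'
      proof -
        have "\<bar>Dr r f x' - Dr r f x\<bar> \<le> B r * \<bar>x' - x\<bar>" by (rule B(3)[OF r that(1,2)])
        also have "\<dots> \<le> (B r + 1) * \<bar>x' - x\<bar>" by (intro mult_right_mono) auto
        also have "\<dots> < e" using that(3) B(1)[OF r] by (simp add: dist_real_def pos_less_divide_eq mult.commute)
        finally show ?thesis by (simp add: dist_real_def)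
      qed
      then show "\<exists>d>0. \<forall>x\<in>{0<..<1}. \<forall>x'\<in>{0<..<1}. dist x' x < d \<longrightarrow> dist (Dr r f x') (Dr r f x) < e"
        using e B(1)[OF r] by (intro exI[of _ "e / (B r + 1)"]) auto
    qed
    then show ?thesis
      using uniformly_continuous_on_extension_at_closure[of "{0<..<1}" "Dr r f" 0] by auto
  qed
  then obtain l where l: "\<And>r. r < s \<Longrightarrow> (Dr r f \<longlongrightarrow> l r) (at 0 within {0<..<1})" by metis
  have nt: "at 0 within {0<..<1::real} \<noteq> bot" by (simp add: trivial_limit_within islimpt_greaterThanLessThan1)
  define E where "E r x = (if x = 0 then l r else Dr r f x)" for r x
  define C' where "C' = C + (\<Sum>r<s. B r)"
  have BC: "B r \<le> C'" if "r < s" for r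
    using member_le_sum[of r "{..<s}" B] B(1) that C unfolding C'_def by auto
  have CC: "C \<le> C'" "C' \<ge> 0" using sum_nonneg[of "{..<s}" B] B(1) C unfolding C'_def by auto
  show ?thesis
  proof (intro exI[of _ E] exI[of _ C'] conjI ballI allI impI)
    show "E 0 x = f x" if "x \<in> {0<..<1}" for x using that by (simp add: E_def Dr_def)
    show "\<bar>E r x\<bar> \<le> C'" if r: "r < s" and x: "x \<in> {0..<1}" for r x
    proof (cases "x = 0")
      case True
      have "\<bar>l r\<bar> \<le> B r"
        by (rule tendsto_upperbound[OF tendsto_rabs[OF l[OF r]] _ nt])
          (use B(2)[OF r] in \<open>auto simp: eventually_at_filter\<close>)
      then show ?thesis using True BC[OF r] by (simp add: E_def)
    next
      case False
      then show ?thesis using B(2)[OF r, of x] BC[OF r] x by (simp add: E_def)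
    qed
    show "\<bar>E r y - tay s (\<lambda>a. if a < s then E a x else 0) r (y - x)\<bar> \<le> C' * (y - x) ^ (s - r)"
      if r: "r < s" and xy: "0 \<le> x" "x \<le> y" "y < 1" for r x y
    proof -
      have "\<bar>E r y - tay s (\<lambda>a. if a < s then E a x else 0) r (y - x)\<bar> \<le> C * (y - x) ^ (s - r)"
      proof (cases "x = 0")
        case False
        then have "(\<lambda>a. if a < s then E a x else 0) = A x" by (auto simp: A_def E_def)
        then show ?thesis using taylor[OF r _ xy(2,3)] False xy by (simp add: E_def)
      next
        case x0: True
        show ?thesis
        proof (cases "y = 0")
          case True
          then show ?thesis using x0 r C by simp
        next
          case False
          then have y: "y > 0" using xy by simp
          \<comment> \<open>At 0 the expansion is obtained as the limit of the expansions at
            interior points.\<close>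
          let ?F = "at 0 within {0<..<1::real}"
          have At: "((\<lambda>x. A x a) \<longlongrightarrow> (if a < s then E a 0 else 0)) ?F" for a
            using l[of a] by (auto simp: A_def E_def)
          have "((\<lambda>x. \<bar>Dr r f y - tay s (A x) r (y - x)\<bar>) \<longlongrightarrow> \<bar>Dr r f y - tay s (\<lambda>a. if a < s then E a 0 else 0) r (y - 0)\<bar>) ?F"
            unfolding tay_def divide_inverse by (intro tendsto_intros At)
          moreover have "((\<lambda>x. C * (y - x) ^ (s - r)) \<longlongrightarrow> C * (y - 0) ^ (s - r)) ?F" by (intro tendsto_intros)
          moreover have "\<forall>\<^sub>F x in ?F. \<bar>Dr r f y - tay s (A x) r (y - x)\<bar> \<le> C * (y - x) ^ (s - r)"
          proof -
            have "\<forall>\<^sub>F x in ?F. x < y" using y by (intro order_tendstoD(2)[OF tendsto_ident_at])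
            moreover have "\<forall>\<^sub>F x in ?F. x \<in> {0<..<1}" by (auto simp: eventually_at_filter)
            ultimately show ?thesis by eventually_elim (use taylor[OF r] xy in auto)
          qed
          ultimately have "\<bar>Dr r f y - tay s (\<lambda>a. if a < s then E a 0 else 0) r (y - 0)\<bar> \<le> C * (y - 0) ^ (s - r)"
            by (intro tendsto_le[OF nt])
          then show ?thesis unfolding x0 using False by (simp add: E_def)
        qed
      qed
      also have "\<dots> \<le> C' * (y - x) ^ (s - r)" using CC xy by (intro mult_right_mono) auto
      finally show ?thesis .
    qed
  qed (use CC in auto)
qed

subsection \<open>Hermite approximation by splines\<close>

text \<open>Within a block the jumps of the top derivative are solved for so that all derivatives of
  order below s agree with those of \<open>E\<close> at the end of the block. In the distances to
  that end this is a Vandermonde system, and its right-hand side is bounded because the Taylor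
  remainder has the matching power of the mesh. Hence jumps and top derivative stay bounded
  independently of \<open>N\<close>, and every block starts with exact data.\<close>

lemma spline_Hermite_approximation:
  fixes E :: "nat \<Rightarrow> real \<Rightarrow> real"
  assumes s: "s \<ge> 1" and C: "C \<ge> 0"
    and Eb: "\<And>r x. r < s \<Longrightarrow> x \<in> {0..<1} \<Longrightarrow> \<bar>E r x\<bar> \<le> C"
    and Et: "\<And>r x y. r < s \<Longrightarrow> 0 \<le> x \<Longrightarrow> x \<le> y \<Longrightarrow> y < 1 \<Longrightarrow>
       \<bar>E r y - tay s (\<lambda>a. if a < s then E a x else 0) r (y - x)\<bar> \<le> C * (y - x) ^ (s - r)"
  shows "\<exists>C'\<ge>0. \<forall>N\<ge>1. \<exists>\<theta>. (\<forall>x\<in>{0..<1}. \<bar>dspl (s * N - 1) (Suc s) 0 \<theta> x - E 0 x\<bar> \<le> C' * (1 / real N) ^ s) \<and>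
       (\<forall>r\<le>s. \<forall>x\<in>{0..<1}. \<bar>dspl (s * N - 1) (Suc s) r \<theta> x\<bar> \<le> C')"
proof -
  obtain D where D: "D \<ge> 0" and Dv: "\<forall>e B. (\<forall>p\<in>{1..s}. \<bar>e p\<bar> \<le> B) \<longrightarrow>
     (\<exists>d :: nat \<Rightarrow> real. (\<forall>p\<in>{1..s}. (\<Sum>t=1..s. d t * real t ^ p) = e p) \<and> (\<forall>t\<in>{1..s}. \<bar>d t\<bar> \<le> D * B))"
    using vandermonde_solve[of s] by (elim exE conjE)
  \<comment> \<open>Bounds p! C s^p for all p up to s; the base s is the ratio of block length
    \<open>H\<close> to cell length \<open>h\<close>.\<close>
  define B where "B = fact s * C * real s ^ s"
  have B: "B \<ge> 0" using C by (simp add: B_def)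
  define C' where "C' = 3 * C + real s * (D * B)"
  have "\<exists>\<theta>. (\<forall>x\<in>{0..<1}. \<bar>dspl (s * N - 1) (Suc s) 0 \<theta> x - E 0 x\<bar> \<le> C' * (1 / real N) ^ s) \<and>
       (\<forall>r\<le>s. \<forall>x\<in>{0..<1}. \<bar>dspl (s * N - 1) (Suc s) r \<theta> x\<bar> \<le> C')" if N: "N \<ge> 1" for N
  proof -
    define k where "k = s * N - 1"
    have k1: "k + 1 = s * N" using s N by (simp add: k_def)
    define h where "h = 1 / (real s * real N)"
    define H where "H = 1 / real N"
    have n: "1 + real k = real s * real N" using k1 by (metis of_nat_Suc of_nat_mult Suc_eq_plus1)
    have h: "h > 0" "H > 0" "H \<le> 1"
      using s N by (auto simp: h_def H_def)
    have hk: "h = 1 / (1 + real k)" using n by (simp add: h_def)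
    have Hs: "H = real s * h" using s N by (simp add: h_def H_def)
    define X where "X b = real b * H" for b
    have X: "0 \<le> X b" "b < N \<Longrightarrow> X b < 1" "X (Suc b) = X b + H" for b
      unfolding X_def H_def using N by (auto simp: add_divide_distrib)
    define A where "A b = (\<lambda>a. if a < s then E a (X b) else 0)" for b
    \<comment> \<open>Right-hand side of the Vandermonde system: the amount by which the Taylor
      polynomial from the left end of block b misses the derivative of order s - p at the right end,
      in units of the mesh.\<close>
    define e where "e b p = fact p * (E (s - p) (X (Suc b)) - tay s (A b) (s - p) H) / h ^ p" for b p
    have eB: "\<bar>e b p\<bar> \<le> B" if b: "Suc b < N" and p: "p \<in> {1..s}" for b p
    proof -
      have sp: "s - (s - p) = p" using p by auto
      have "\<bar>E (s - p) (X (Suc b)) - tay s (A b) (s - p) (X (Suc b) - X b)\<bar> \<le> C * (X (Suc b) - X b) ^ (s - (s - p))"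
        unfolding A_def using p s X(1)[of b] X(2)[OF b] X(3)[of b] h(2) by (intro Et) auto
      then have 1: "\<bar>E (s - p) (X (Suc b)) - tay s (A b) (s - p) H\<bar> \<le> C * H ^ p" unfolding sp X(3) by simp
      have "\<bar>e b p\<bar> = fact p * \<bar>E (s - p) (X (Suc b)) - tay s (A b) (s - p) H\<bar> / h ^ p"
        using h by (simp add: e_def abs_mult)
      also have "\<dots> \<le> fact p * (C * H ^ p) / h ^ p"
        using 1 h by (intro divide_right_mono mult_left_mono) auto
      also have "\<dots> = fact p * C * real s ^ p" using h(1) unfolding Hs by (simp add: power_mult_distrib)
      also have "\<dots> \<le> B" unfolding B_def
        using p s C by (intro mult_mono fact_mono power_increasing) auto
      finally show ?thesis .
    qed
    have "\<exists>d. (Suc b < N \<longrightarrow> (\<forall>p\<in>{1..s}. (\<Sum>t=1..s. d t * real t ^ p) = e b p)) \<and> (\<forall>t\<in>{1..s}. \<bar>d t\<bar> \<le> D * B)" for b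
    proof (cases "Suc b < N")
      case True
      have "\<forall>p\<in>{1..s}. \<bar>e b p\<bar> \<le> B" using eB[OF True] by blast
      from Dv[THEN spec, THEN spec, THEN mp, OF this] show ?thesis by blast
    next
      case False
      \<comment> \<open>The last block ends at 1, where \<open>E\<close> is not controlled; nothing
        is interpolated there.\<close>
      then show ?thesis using D B by (intro exI[of _ "\<lambda>_. 0"]) auto
    qed
    then have "\<forall>b. \<exists>d. (Suc b < N \<longrightarrow> (\<forall>p\<in>{1..s}. (\<Sum>t=1..s. d t * real t ^ p) = e b p)) \<and> (\<forall>t\<in>{1..s}. \<bar>d t\<bar> \<le> D * B)" by (rule allI)
    from choice[OF this] obtain d where d: "\<forall>b. (Suc b < N \<longrightarrow> (\<forall>p\<in>{1..s}. (\<Sum>t=1..s. d b t * real t ^ p) = e b p)) \<and> (\<forall>t\<in>{1..s}. \<bar>d b t\<bar> \<le> D * B)" ..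
    have d1: "(\<Sum>t=1..s. d b t * real t ^ p) = e b p" if "Suc b < N" "p \<in> {1..s}" for b p
      using d[THEN spec, of b] that by blast
    have d2: "\<bar>d b t\<bar> \<le> D * B" if "t \<in> {1..s}" for b t
      using d[THEN spec, of b] that by blast
    \<comment> \<open>Value of the top derivative on cell l. The jumps are indexed by their distance
      s - i, in cells, to the end of the block, and the partial sums restart with each
      block.\<close>
    define g where "g l = (\<Sum>i\<le>l mod s. d (l div s) (s - i))" for l
    have one_le_Suc: "1 \<le> Suc s" by simp
    obtain \<theta> where \<theta>': "(\<forall>r<Suc s - 1. dcoefs k (Suc s) r \<theta> 1 = E r 0) \<and> (\<forall>i\<in>{1..k + 1}. dcoefs k (Suc s) (Suc s - 1) \<theta> i = g (i - 1))"
      using ex_coefs[of "Suc s" k "\<lambda>r. E r 0" "\<lambda>i. g (i - 1)", OF one_le_Suc] by (rule exE)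
    have \<theta>0: "dspl k (Suc s) r \<theta> 0 = E r 0" if "r < s" for r
      using \<theta>' that dspl_at_0[of r s k \<theta>] by simp
    have \<theta>s: "dspl k (Suc s) s \<theta> x = g l" if "l \<le> k" "real l * h \<le> x" "x < (1 + real l) * h" for l x
      using \<theta>' dspl_top[of l k x s \<theta>] that hk by simp
    define F where "F r = dspl k (Suc s) r \<theta>" for r
    \<comment> \<open>Explicit solution on block b: the Taylor polynomial at its left end plus one
      truncated power for each of its cells.\<close>
    define R where "R b r x = tay s (A b) r (x - X b) + (\<Sum>i<s. d b (s - i) * tpow (s - r) (x - (X b + real i * h)))" for b r x
    have chR: "dchain s u v (R b)" for u v b
      unfolding dchain_def
    proof (intro allI impI conjI)
      fix r assume r: "r < s"
      then have sr: "s - r = Suc (s - Suc r)" by simp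
      have "continuous_on {u..v} (\<lambda>x. tpow (s - r) (x - c))" for c
        by (rule continuous_on_compose2[OF tpow_continuous[of "s - r" UNIV]]) (use r in \<open>auto intro!: continuous_intros\<close>)
      then show "continuous_on {u..v} (R b r)"
        unfolding R_def[abs_def] by (intro continuous_on_add tay_continuous continuous_on_sum continuous_on_mult continuous_on_const)
      show "\<exists>K. finite K \<and> (\<forall>x\<in>{u<..<v} - K. (R b r has_real_derivative R b (Suc r) x) (at x))"
      proof (intro exI conjI ballI)
        show "finite ((\<lambda>i. X b + real i * h) ` {..<s})" by simp
        fix x assume x: "x \<in> {u<..<v} - (\<lambda>i. X b + real i * h) ` {..<s}"
        have "((\<lambda>x. tpow (s - r) (x - (X b + real i * h))) has_real_derivative tpow (s - Suc r) (x - (X b + real i * h))) (at x)" if "i < s" for i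
        proof -
          have "x - (X b + real i * h) \<noteq> 0" using x that by auto
          from DERIV_chain2[OF tpow_deriv[OF this] DERIV_diff[OF DERIV_ident DERIV_const]] show ?thesis
            unfolding sr by simp
        qed
        then show "(R b r has_real_derivative R b (Suc r) x) (at x)"
          unfolding R_def[abs_def] by (intro DERIV_add tay_deriv[OF r] DERIV_sum DERIV_cmult) auto
      qed
    qed
    have top: "F s z = R b s z" if b: "b < N" and z: "X b \<le> z" "z < X (Suc b)" for b z
    proof -
      define y where "y = (z - X b) / h"
      have y: "0 \<le> y" "y < real s" "z = X b + y * h" using z X(3)[of b] h(1) Hs by (auto simp: y_def pos_divide_less_eq)
      define i0 where "i0 = nat \<lfloor>y\<rfloor>"
      have i0: "real i0 \<le> y" "y < real i0 + 1" using y by (auto simp: i0_def)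
      have i0s: "i0 < s" using y(2) i0(1) by linarith
      have Xb: "X b = real (s * b) * h" by (simp add: X_def Hs mult_ac)
      let ?l = "s * b + i0"
      have "?l < s * Suc b" using i0s by simp
      also have "\<dots> \<le> s * N" using b by (intro mult_le_mono2) simp
      finally have lk: "?l \<le> k" using k1 by simp
      have "F s z = g ?l"
        unfolding F_def
      proof (rule \<theta>s[OF lk])
        have zz: "z = (real (s * b) + y) * h" unfolding y(3) Xb by (simp add: algebra_simps)
        show "real ?l * h \<le> z" unfolding zz using i0 h by (intro mult_right_mono) auto
        show "z < (1 + real ?l) * h" unfolding zz using i0 h by (intro mult_strict_right_mono) auto
      qed
      also have "g ?l = (\<Sum>i\<le>i0. d b (s - i))" using i0s by (simp add: g_def)
      also have "\<dots> = (\<Sum>i<s. if i \<le> i0 then d b (s - i) else 0)"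
        using i0s by (intro sum.mono_neutral_cong_left) auto
      also have "\<dots> = (\<Sum>i<s. d b (s - i) * tpow (s - s) (z - (X b + real i * h)))"
      proof (intro sum.cong refl)
        fix i assume "i \<in> {..<s}"
        have "z - (X b + real i * h) = (y - real i) * h" unfolding y(3) by (simp add: algebra_simps)
        moreover have "0 \<le> (y - real i) * h \<longleftrightarrow> i \<le> i0" using i0 h by (auto simp: zero_le_mult_iff)
        ultimately show "(if i \<le> i0 then d b (s - i) else 0) = d b (s - i) * tpow (s - s) (z - (X b + real i * h))"
          by (simp add: tpow_def)
      qed
      also have "\<dots> = R b s z" by (simp add: R_def A_def)
      finally show ?thesis .
    qed
    have R_at: "R b r (X b) = E r (X b)" if "r < s" for b r
    proof -
      have "(\<Sum>i<s. d b (s - i) * tpow (s - r) (X b - (X b + real i * h))) = 0"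
      proof (intro sum.neutral ballI)
        fix i
        have "i = 0 \<or> real i * h > 0" using h(1) by (cases i) auto
        then have "tpow (s - r) (X b - (X b + real i * h)) = 0"
          using that by (auto simp: tpow_def)
        then show "d b (s - i) * tpow (s - r) (X b - (X b + real i * h)) = 0" by simp
      qed
      then show ?thesis using that by (simp add: R_def A_def)
    qed
    have R_end: "R b r (X (Suc b)) = E r (X (Suc b))" if r: "r < s" and b: "Suc b < N" for b r
    proof -
      let ?p = "s - r"
      have p: "?p \<in> {1..s}" "s - ?p = r" using r by auto
      have "(\<Sum>i<s. d b (s - i) * tpow ?p (X (Suc b) - (X b + real i * h)))
          = (\<Sum>i<s. d b (s - i) * (real (s - i) ^ ?p * h ^ ?p / fact ?p))"
      proof (intro sum.cong refl)
        fix i assume "i \<in> {..<s}"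
        then have "X (Suc b) - (X b + real i * h) = real (s - i) * h" unfolding X(3) Hs by (simp add: of_nat_diff algebra_simps)
        then show "d b (s - i) * tpow ?p (X (Suc b) - (X b + real i * h)) = d b (s - i) * (real (s - i) ^ ?p * h ^ ?p / fact ?p)"
          using h by (simp add: tpow_def power_mult_distrib)
      qed
      also have "\<dots> = (\<Sum>i<s. d b (s - i) * real (s - i) ^ ?p) * (h ^ ?p / fact ?p)"
        unfolding sum_distrib_right by (intro sum.cong refl) (simp add: mult_ac)
      also have "(\<Sum>i<s. d b (s - i) * real (s - i) ^ ?p) = (\<Sum>t=1..s. d b t * real t ^ ?p)"
        by (rule sum.reindex_bij_witness[of _ "\<lambda>t. s - t" "\<lambda>i. s - i"]) auto
      also have "\<dots> = e b ?p" by (rule d1[OF b p(1)])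
      also have "e b ?p * (h ^ ?p / fact ?p) = E r (X (Suc b)) - tay s (A b) r H"
        using h unfolding e_def p(2) by simp
      finally show ?thesis unfolding R_def X(3) by simp
    qed
    \<comment> \<open>Equal data at the left end and equal top derivatives give \<open>F = R\<close>
      up to the right end of the block, where \<open>R\<close> meets \<open>E\<close> by the choice
      of the jumps; so exactness passes from block to block.\<close>
    have F0: "F r (X b) = E r (X b)" if "b < N" "r < s" for b r
      using that
    proof (induction b arbitrary: r)
      case 0
      then show ?case using \<theta>0 by (simp add: F_def X_def)
    next
      case (Suc b)
      have "F r (X (Suc b)) = R b r (X (Suc b))"
      proof (rule dchain_unique[OF _ chR, where K="{}"])
        show "dchain s (X b) (X (Suc b)) F" unfolding F_def[abs_def] by (rule dchain_dspl[OF X(1) X(2)[OF Suc.prems(1)]])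
        show "F s x = R b s x" if "x \<in> {X b<..<X (Suc b)} - {}" for x using that Suc.prems by (intro top) auto
        show "F r (X b) = R b r (X b)" if "r < s" for r using Suc that by (simp add: R_at)
      qed (use Suc.prems X h in auto)
      then show ?case using R_end Suc.prems by simp
    qed
    have FR: "F r x = R b r x" if b: "b < N" and x: "X b \<le> x" "x < X (Suc b)" "x < 1" and r: "r \<le> s" for b r x
    proof (cases "r = s")
      case True
      then show ?thesis using top[OF b x(1,2)] by simp
    next
      case False
      show ?thesis
      proof (rule dchain_unique[OF _ chR, where K="{}" and u="X b" and v=x])
        show "dchain s (X b) x F" unfolding F_def[abs_def] using X x by (intro dchain_dspl) auto
        show "F s z = R b s z" if "z \<in> {X b<..<x} - {}" for z using that x by (intro top[OF b]) auto
        show "F r (X b) = R b r (X b)" if "r < s" for r using F0[OF b that] that by (simp add: R_at)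
      qed (use False r x in auto)
    qed
    have blk: "\<exists>b<N. X b \<le> x \<and> x < X (Suc b)" if x: "x \<in> {0..<1}" for x
    proof -
      define b where "b = nat \<lfloor>x * real N\<rfloor>"
      have b: "real b \<le> x * real N" "x * real N < real b + 1" using x by (auto simp: b_def)
      have "x * real N < 1 * real N" using x N by (intro mult_strict_right_mono) auto
      then have "b < N" using b by linarith
      then show ?thesis using b N by (intro exI[of _ b]) (auto simp: X_def H_def field_simps)
    qed
    have tp: "\<bar>\<Sum>i<s. d b (s - i) * tpow p (x - (X b + real i * h))\<bar> \<le> real s * (D * B) * H ^ p"
      if x: "X b \<le> x" "x < X (Suc b)" for b p x
    proof -
      have "\<bar>\<Sum>i<s. d b (s - i) * tpow p (x - (X b + real i * h))\<bar> \<le> (\<Sum>i<s. (D * B) * H ^ p)"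
      proof (rule order_trans[OF sum_abs], rule sum_mono)
        fix i assume i: "i \<in> {..<s}"
        have "0 \<le> real i * h" using h(1) by simp
        then have "x - (X b + real i * h) \<le> H" using x X(3)[of b] by linarith
        then show "\<bar>d b (s - i) * tpow p (x - (X b + real i * h))\<bar> \<le> (D * B) * H ^ p"
          unfolding abs_mult using i D B h by (intro mult_mono d2 tpow_bound) auto
      qed
      then show ?thesis by (simp add: mult_ac)
    qed
    have P1: "\<bar>F 0 x - E 0 x\<bar> \<le> C' * (1 / real N) ^ s" if x: "x \<in> {0..<1}" for x
    proof -
      obtain b where b: "b < N" "X b \<le> x" "x < X (Suc b)" using blk[OF x] by blast
      have 1: "\<bar>E 0 x - tay s (A b) 0 (x - X b)\<bar> \<le> C * (x - X b) ^ (s - 0)"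
        unfolding A_def using s b x X by (intro Et) auto
      also have "\<dots> \<le> C * H ^ s" using b X(3)[of b] C by (intro mult_left_mono) (auto intro!: power_mono)
      finally have 1: "\<bar>E 0 x - tay s (A b) 0 (x - X b)\<bar> \<le> C * H ^ s" .
      have "F 0 x = R b 0 x" by (rule FR[OF b]) (use x in auto)
      then have "\<bar>F 0 x - E 0 x\<bar> \<le> C * H ^ s + real s * (D * B) * H ^ s"
        using 1 tp[OF b(2,3), of s] by (simp add: R_def)
      also have "\<dots> \<le> C' * H ^ s" using C h by (simp add: C'_def algebra_simps)
      finally show ?thesis by (simp add: H_def)
    qed
    have P2: "\<bar>F r x\<bar> \<le> C'" if r: "r \<le> s" and x: "x \<in> {0..<1}" for r x
    proof -
      obtain b where b: "b < N" "X b \<le> x" "x < X (Suc b)" using blk[OF x] by blast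
      have "\<bar>tay s (A b) r (x - X b)\<bar> \<le> (\<Sum>i\<le>s - r. C * (1 / fact i))"
        unfolding tay_def
      proof (rule order_trans[OF sum_abs], rule sum_mono)
        fix i
        have "\<bar>A b (r + i)\<bar> \<le> C" using Eb X b(1) C by (auto simp: A_def)
        moreover have "0 \<le> x - X b" "x - X b \<le> 1" using b X(3)[of b] h by auto
        then have "\<bar>(x - X b) ^ i / fact i\<bar> \<le> 1 / fact i"
          by (simp add: abs_divide divide_right_mono power_le_one)
        ultimately show "\<bar>A b (r + i) * ((x - X b) ^ i / fact i)\<bar> \<le> C * (1 / fact i)"
          unfolding abs_mult using C by (intro mult_mono) auto
      qed
      also have "\<dots> \<le> C * 3" unfolding sum_distrib_left[symmetric] using C sum_inverse_fact_le by (intro mult_left_mono) auto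
      finally have 1: "\<bar>tay s (A b) r (x - X b)\<bar> \<le> C * 3" .
      have "real s * (D * B) * H ^ (s - r) \<le> real s * (D * B) * 1"
        using D B h by (intro mult_left_mono power_le_one) auto
      then have "\<bar>R b r x\<bar> \<le> C'" using 1 tp[OF b(2,3), of "s - r"] by (simp add: R_def C'_def)
      moreover have "F r x = R b r x" by (rule FR[OF b]) (use x r in auto)
      ultimately show ?thesis by simp
    qed
    show ?thesis using P1 P2 unfolding k_def[symmetric] F_def by (intro exI[of _ \<theta>]) auto
  qed
  moreover have "C' \<ge> 0" using C D B by (simp add: C'_def)
  ultimately show ?thesis by (intro exI[of _ C'] conjI allI impI)
qed

subsection \<open>Lebesgue measure on coefficient vectors\<close>

definition shift_vec :: "nat \<Rightarrow> (nat \<Rightarrow> real) \<Rightarrow> (nat \<Rightarrow> real) \<Rightarrow> nat \<Rightarrow> real" where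
  "shift_vec m t \<theta> = (\<lambda>i\<in>{1..m}. \<theta> i - t i)"

lemma space_lebesgue_R: "space (lebesgue_R m) = PiE {1..m} (\<lambda>_. UNIV)"
  by (simp add: lebesgue_R_def space_PiM)

lemma shift_vec_in_space: "shift_vec m t \<theta> \<in> space (lebesgue_R m)"
  by (auto simp: space_lebesgue_R shift_vec_def)

lemma shift_vec_measurable [measurable]: "shift_vec m t \<in> measurable (lebesgue_R m) (lebesgue_R m)"
  unfolding shift_vec_def[abs_def] lebesgue_R_def by measurable

text \<open>Checked on boxes, where it reduces to translation invariance in each coordinate.\<close>

lemma distr_shift_vec: "distr (lebesgue_R m) (lebesgue_R m) (shift_vec m t) = lebesgue_R m"
proof -
  interpret product_sigma_finite "\<lambda>_::nat. lborel :: real measure" ..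
  have "distr (lebesgue_R m) (lebesgue_R m) (shift_vec m t) = (\<Pi>\<^sub>M i\<in>{1..m}. lborel)"
  proof (rule PiM_eqI)
    show "sets (distr (lebesgue_R m) (lebesgue_R m) (shift_vec m t)) = sets (\<Pi>\<^sub>M i\<in>{1..m}. lborel)"
      by (simp add: lebesgue_R_def)
    fix A :: "nat \<Rightarrow> real set" assume A: "\<And>i. i \<in> {1..m} \<Longrightarrow> A i \<in> sets lborel"
    have PA: "PiE {1..m} A \<in> sets (lebesgue_R m)"
      unfolding lebesgue_R_def by (rule sets_PiM_I_finite) (use A in auto)
    have pre: "(\<lambda>x. x - t i) -` A i \<in> sets lborel" if "i \<in> {1..m}" for i
      using measurable_sets[of "\<lambda>x. x - t i" borel borel "A i"] A[OF that] by simp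
    have "emeasure (distr (lebesgue_R m) (lebesgue_R m) (shift_vec m t)) (PiE {1..m} A)
        = emeasure (lebesgue_R m) (shift_vec m t -` PiE {1..m} A \<inter> space (lebesgue_R m))"
      by (rule emeasure_distr[OF shift_vec_measurable PA])
    also have "shift_vec m t -` PiE {1..m} A \<inter> space (lebesgue_R m) = PiE {1..m} (\<lambda>i. (\<lambda>x. x - t i) -` A i)"
      by (auto simp: shift_vec_def space_lebesgue_R PiE_iff)
    also have "emeasure (lebesgue_R m) \<dots> = (\<Prod>i\<in>{1..m}. emeasure lborel ((\<lambda>x. x - t i) -` A i))"
      unfolding lebesgue_R_def by (rule emeasure_PiM) (use pre in auto)
    also have "\<dots> = (\<Prod>i\<in>{1..m}. emeasure lborel (A i))"
    proof (intro prod.cong refl)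
      fix i assume i: "i \<in> {1..m}"
      have "emeasure lborel (A i) = emeasure (distr lborel borel ((+) (- t i))) (A i)"
        by (simp add: lborel_distr_plus)
      also have "\<dots> = emeasure lborel ((+) (- t i) -` A i \<inter> space lborel)"
        using A[OF i] by (intro emeasure_distr) auto
      also have "(+) (- t i) -` A i \<inter> space lborel = (\<lambda>x. x - t i) -` A i" by auto
      finally show "emeasure lborel ((\<lambda>x. x - t i) -` A i) = emeasure lborel (A i)" by simp
    qed
    finally show "emeasure (distr (lebesgue_R m) (lebesgue_R m) (shift_vec m t)) (PiE {1..m} A) = (\<Prod>i\<in>{1..m}. emeasure lborel (A i))" .
  qed simp
  then show ?thesis by (simp add: lebesgue_R_def)
qed

definition translate :: "nat \<Rightarrow> (nat \<Rightarrow> real) \<Rightarrow> (nat \<Rightarrow> real) set \<Rightarrow> (nat \<Rightarrow> real) set" where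
  "translate m t A = shift_vec m t -` A \<inter> space (lebesgue_R m)"

lemma translate_sets: "A \<in> sets (lebesgue_R m) \<Longrightarrow> translate m t A \<in> sets (lebesgue_R m)"
  unfolding translate_def by measurable

lemma emeasure_translate:
  "A \<in> sets (lebesgue_R m) \<Longrightarrow> emeasure (lebesgue_R m) (translate m t A) = emeasure (lebesgue_R m) A"
  using emeasure_distr[OF shift_vec_measurable, of A m t] by (simp add: distr_shift_vec translate_def)

lemma emeasure_space_lebesgue_R: "emeasure (lebesgue_R m) (space (lebesgue_R m)) > 0"
proof -
  interpret product_sigma_finite "\<lambda>_::nat. lborel :: real measure" ..
  have "emeasure (lebesgue_R m) (PiE {1..m} (\<lambda>_. {0..1})) = (\<Prod>i\<in>{1..m}. emeasure lborel {0..1::real})"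
    unfolding lebesgue_R_def by (rule emeasure_PiM) auto
  also have "\<dots> = 1" by simp
  finally have "1 = emeasure (lebesgue_R m) (PiE {1..m} (\<lambda>_. {0..1}))" ..
  also have "\<dots> \<le> emeasure (lebesgue_R m) (space (lebesgue_R m))" by (rule emeasure_space)
  finally show ?thesis using order_less_le_trans zero_less_one by blast
qed

lemma emeasure_bounded_lebesgue_R:
  assumes "A \<subseteq> PiE {1..m} (\<lambda>_. {-B..B})"
  shows "emeasure (lebesgue_R m) A < \<infinity>"
proof -
  interpret product_sigma_finite "\<lambda>_::nat. lborel :: real measure" ..
  have "emeasure (lebesgue_R m) A \<le> emeasure (lebesgue_R m) (PiE {1..m} (\<lambda>_. {-B..B}))"
    unfolding lebesgue_R_def by (rule emeasure_mono[OF assms]) (auto intro: sets_PiM_I_finite)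
  also have "\<dots> = (\<Prod>i\<in>{1..m}. emeasure lborel {-B..B})"
    unfolding lebesgue_R_def by (rule emeasure_PiM) auto
  also have "\<dots> < \<infinity>" by (simp add: power_less_top_ennreal emeasure_lborel_Icc_eq)
  finally show ?thesis .
qed

subsection \<open>Volume of the parameter set\<close>

text \<open>Derivatives at the grid points, scaled so that the natural size is of order one.\<close>
definition gval :: "nat \<Rightarrow> nat \<Rightarrow> nat \<Rightarrow> nat \<Rightarrow> (nat \<Rightarrow> real) \<Rightarrow> real" where
  "gval k s r l \<theta> = dspl k (Suc s) r \<theta> (real l / (1 + real k)) * (1 + real k) ^ (s - r)"

text \<open>Derivatives at all left ends of cells are constrained, in general more numbers than the
  dimension. Together they bound the spline and its derivatives on every whole cell with the right
  power of the mesh.\<close>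

definition unit_box :: "nat \<Rightarrow> nat \<Rightarrow> (nat \<Rightarrow> real) set" where
  "unit_box k s = {\<theta> \<in> space (lebesgue_R (k + Suc s)). \<forall>r\<in>{..s}. \<forall>l\<in>{..k}. \<bar>gval k s r l \<theta>\<bar> \<le> 1}"

lemma gval_measurable: "r \<le> s \<Longrightarrow> (\<lambda>\<theta>. gval k s r l \<theta>) \<in> borel_measurable (lebesgue_R (k + Suc s))"
  unfolding gval_def by (intro borel_measurable_times dspl_measurable_coef borel_measurable_const) simp

lemma unit_box_sets: "unit_box k s \<in> sets (lebesgue_R (k + Suc s))"
  unfolding unit_box_def
proof (intro sets.sets_Collect_countable_All' countable_finite)
  fix r l assume "r \<in> {..s}"
  then have [measurable]: "(\<lambda>\<theta>. gval k s r l \<theta>) \<in> borel_measurable (lebesgue_R (k + Suc s))"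
    by (intro gval_measurable) simp
  show "{\<theta> \<in> space (lebesgue_R (k + Suc s)). \<bar>gval k s r l \<theta>\<bar> \<le> 1} \<in> sets (lebesgue_R (k + Suc s))"
    by measurable
qed auto

lemma dspl_shift_vec:
  assumes "r < q"
  shows "dspl k q r (shift_vec (k + q) t \<theta>) x = dspl k q r \<theta> x - dspl k q r t x"
proof -
  have "dspl k q r (shift_vec (k + q) t \<theta>) x = dspl k q r (\<lambda>i. \<theta> i + (-1) * t i) x"
    by (rule dspl_cong[OF _ assms]) (simp add: shift_vec_def)
  then show ?thesis unfolding dspl_linear by simp
qed

lemma gval_shift_vec: "r \<le> s \<Longrightarrow> gval k s r l (shift_vec (k + Suc s) t \<theta>) = gval k s r l \<theta> - gval k s r l t"
  unfolding gval_def by (subst dspl_shift_vec) (auto simp: left_diff_distrib)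

lemma grid_cell:
  assumes "x \<in> {0..<1}"
  obtains l where "l \<le> k" "real l / (1 + real k) \<le> x" "x < (1 + real l) / (1 + real k)"
proof -
  define l where "l = nat \<lfloor>x * (1 + real k)\<rfloor>"
  have l: "real l \<le> x * (1 + real k)" "x * (1 + real k) < real l + 1" using assms by (auto simp: l_def)
  have "x * (1 + real k) < 1 * (1 + real k)" using assms by (intro mult_strict_right_mono) auto
  with l(1) have "real l < 1 * (1 + real k)" by (rule le_less_trans)
  then have "real l < 1 + real k" by simp
  then have "l \<le> k" by linarith
  then show ?thesis using that l by (auto simp: pos_divide_le_eq pos_less_divide_eq add.commute)
qed

lemma unit_box_dspl_bound:
  assumes \<theta>: "\<theta> \<in> unit_box k s" and r: "r \<le> s" and x: "x \<in> {0..<1}"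
  shows "\<bar>dspl k (Suc s) r \<theta> x\<bar> \<le> 3 * (1 / (1 + real k)) ^ (s - r)"
proof -
  obtain l where l: "l \<le> k" "real l / (1 + real k) \<le> x" "x < (1 + real l) / (1 + real k)"
    using grid_cell[OF x] by blast
  let ?n = "1 + real k" and ?xl = "real l / (1 + real k)"
  have g: "\<bar>dspl k (Suc s) a \<theta> ?xl\<bar> \<le> (1 / ?n) ^ (s - a)" if "a \<le> s" for a
  proof -
    have "\<bar>gval k s a l \<theta>\<bar> \<le> 1" using \<theta> that l(1) by (simp add: unit_box_def)
    then have "\<bar>dspl k (Suc s) a \<theta> ?xl\<bar> * ?n ^ (s - a) \<le> 1" by (simp add: gval_def abs_mult)
    then show ?thesis by (simp add: power_divide pos_le_divide_eq)
  qed
  have y: "0 \<le> x - ?xl" "x - ?xl \<le> 1 / ?n" using l by (auto simp: add_divide_distrib)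
  have "dspl k (Suc s) r \<theta> x = tay s (\<lambda>a. dspl k (Suc s) a \<theta> ?xl) r (x - ?xl)"
    by (rule dspl_taylor) (use l x r in auto)
  also have "\<bar>\<dots>\<bar> \<le> (\<Sum>i\<le>s - r. (1 / ?n) ^ (s - r) * (1 / fact i))"
    unfolding tay_def
  proof (rule order_trans[OF sum_abs], rule sum_mono)
    fix i assume i: "i \<in> {..s - r}"
    have "\<bar>dspl k (Suc s) (r + i) \<theta> ?xl * ((x - ?xl) ^ i / fact i)\<bar> \<le> (1 / ?n) ^ (s - (r + i)) * ((1 / ?n) ^ i / fact i)"
    proof -
      have "(x - ?xl) ^ i / fact i \<le> (1 / ?n) ^ i / fact i" "0 \<le> (x - ?xl) ^ i / fact i"
        using y by (auto intro!: divide_right_mono power_mono)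
      then have "\<bar>(x - ?xl) ^ i / fact i\<bar> \<le> (1 / ?n) ^ i / fact i" by linarith
      then show ?thesis unfolding abs_mult using g[of "r + i"] i r by (intro mult_mono) auto
    qed
    also have "\<dots> = (1 / ?n) ^ (s - (r + i) + i) * (1 / fact i)" unfolding power_add by simp
    also have "s - (r + i) + i = s - r" using i r by auto
    finally show "\<bar>dspl k (Suc s) (r + i) \<theta> ?xl * ((x - ?xl) ^ i / fact i)\<bar> \<le> (1 / ?n) ^ (s - r) * (1 / fact i)" .
  qed
  also have "\<dots> \<le> (1 / ?n) ^ (s - r) * 3"
    unfolding sum_distrib_left[symmetric] by (intro mult_left_mono sum_inverse_fact_le) simp
  finally show ?thesis by simp
qed

text \<open>Finiteness and positivity of this volume are enough, as its value cancels in the prior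
  mass.\<close>

lemma emeasure_unit_box_finite: "emeasure (lebesgue_R (k + Suc s)) (unit_box k s) < \<infinity>"
proof -
  have one_le_Suc: "1 \<le> Suc s" by simp
  obtain B where B: "B \<ge> 0 \<and> (\<forall>\<theta>. (\<forall>r<Suc s. \<bar>dcoefs k (Suc s) r \<theta> 1\<bar> \<le> 3) \<longrightarrow>
     (\<forall>i\<in>{1..k + 1}. \<bar>dcoefs k (Suc s) (Suc s - 1) \<theta> i\<bar> \<le> 3) \<longrightarrow> (\<forall>i\<in>{1..k + Suc s}. \<bar>\<theta> i\<bar> \<le> B))"
    using coefs_bounded[of "Suc s" 3 k, OF one_le_Suc zero_le_numeral] by (rule exE)
  have "unit_box k s \<subseteq> PiE {1..k + Suc s} (\<lambda>_. {-B..B})"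
  proof
    fix \<theta> assume \<theta>: "\<theta> \<in> unit_box k s"
    have b: "\<bar>dspl k (Suc s) r \<theta> x\<bar> \<le> 3" if "r \<le> s" "x \<in> {0..<1}" for r x
    proof -
      have "(1 / (1 + real k)) ^ (s - r) \<le> 1" by (intro power_le_one) auto
      then show ?thesis using unit_box_dspl_bound[OF \<theta> that] by linarith
    qed
    have 1: "\<forall>r<Suc s. \<bar>dcoefs k (Suc s) r \<theta> 1\<bar> \<le> 3"
      using b[of _ 0] dspl_at_0[of _ s k \<theta>] by (auto simp: less_Suc_eq_le)
    have 2: "\<forall>i\<in>{1..k + 1}. \<bar>dcoefs k (Suc s) (Suc s - 1) \<theta> i\<bar> \<le> 3"
    proof
      fix i assume i: "i \<in> {1..k + 1}"
      have "real (i - 1) < 1 + real k" using i by auto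
      then have "real (i - 1) / (1 + real k) \<in> {0..<1}" by simp
      note b3 = b[OF order_refl this]
      have "dspl k (Suc s) s \<theta> (real (i - 1) / (1 + real k)) = dcoefs k (Suc s) s \<theta> (Suc (i - 1))"
      proof (rule dspl_top)
        show "i - 1 \<le> k" using i by auto
        show "real (i - 1) / (1 + real k) < (1 + real (i - 1)) / (1 + real k)" by (rule divide_strict_right_mono) auto
      qed simp
      moreover have "Suc (i - 1) = i" using i by simp
      ultimately show "\<bar>dcoefs k (Suc s) (Suc s - 1) \<theta> i\<bar> \<le> 3" using b3 by simp
    qed
    have bd: "\<forall>i\<in>{1..k + Suc s}. \<bar>\<theta> i\<bar> \<le> B"
      by (rule B[THEN conjunct2, THEN spec, THEN mp, OF 1, THEN mp, OF 2])
    show "\<theta> \<in> PiE {1..k + Suc s} (\<lambda>_. {-B..B})"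
    proof (rule PiE_I)
      fix i assume "i \<in> {1..k + Suc s}"
      then have "\<bar>\<theta> i\<bar> \<le> B" using bd by blast
      then show "\<theta> i \<in> {-B..B}" by (simp add: abs_le_iff)
    next
      fix i assume i: "i \<notin> {1..k + Suc s}"
      have "\<theta> \<in> PiE {1..k + Suc s} (\<lambda>_. UNIV)" using \<theta> unfolding unit_box_def space_lebesgue_R by blast
      then show "\<theta> i = undefined" using i by (rule PiE_arb)
    qed
  qed
  then show ?thesis by (rule emeasure_bounded_lebesgue_R)
qed

text \<open>Equal integer parts mean that the scaled derivatives differ by less than one, so a point
  differs from any representative with the same integer parts by an element of the box. Both
  coverings below rest on this.\<close>

lemma translate_unit_boxI:
  assumes "\<theta> \<in> space (lebesgue_R (k + Suc s))"
    and "\<And>r l. r \<le> s \<Longrightarrow> l \<le> k \<Longrightarrow> \<lfloor>gval k s r l \<theta>\<rfloor> = \<lfloor>gval k s r l t\<rfloor>"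
  shows "\<theta> \<in> translate (k + Suc s) t (unit_box k s)"
proof -
  have "\<bar>gval k s r l (shift_vec (k + Suc s) t \<theta>)\<bar> \<le> 1" if "r \<le> s" "l \<le> k" for r l
    unfolding gval_shift_vec[OF that(1)] using assms(2)[OF that] by linarith
  then show ?thesis using assms(1) by (simp add: translate_def unit_box_def shift_vec_in_space)
qed

text \<open>Countably many translates of the unit box cover the whole space.\<close>
lemma emeasure_unit_box_pos: "emeasure (lebesgue_R (k + Suc s)) (unit_box k s) > 0"
proof (rule ccontr)
  assume "\<not> ?thesis"
  then have z: "emeasure (lebesgue_R (k + Suc s)) (unit_box k s) = 0" by simp
  let ?R = "lebesgue_R (k + Suc s)"
  define code where "code \<theta> = (\<lambda>p\<in>{..s} \<times> {..k}. \<lfloor>gval k s (fst p) (snd p) \<theta>\<rfloor>)" for \<theta>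
  define pick where "pick c = (SOME \<theta>. code \<theta> = c)" for c
  let ?W = "PiE ({..s} \<times> {..k}) (\<lambda>_. UNIV :: int set)"
  have "space ?R \<subseteq> (\<Union>c\<in>?W. translate (k + Suc s) (pick c) (unit_box k s))"
  proof
    fix \<theta> assume \<theta>: "\<theta> \<in> space ?R"
    have p: "code (pick (code \<theta>)) = code \<theta>" unfolding pick_def by (rule someI[where P="\<lambda>t. code t = code \<theta>"]) (rule refl)
    have "\<theta> \<in> translate (k + Suc s) (pick (code \<theta>)) (unit_box k s)"
    proof (rule translate_unit_boxI[OF \<theta>])
      fix r l assume "r \<le> s" "l \<le> k"
      then show "\<lfloor>gval k s r l \<theta>\<rfloor> = \<lfloor>gval k s r l (pick (code \<theta>))\<rfloor>"
        using fun_cong[OF p, of "(r, l)"] by (simp add: code_def)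
    qed
    moreover have "code \<theta> \<in> ?W" by (simp add: code_def)
    ultimately show "\<theta> \<in> (\<Union>c\<in>?W. translate (k + Suc s) (pick c) (unit_box k s))" by blast
  qed
  then have sub: "space ?R \<subseteq> (\<Union>c\<in>?W. translate (k + Suc s) (pick c) (unit_box k s))" .
  have null: "(\<Union>c\<in>?W. translate (k + Suc s) (pick c) (unit_box k s)) \<in> null_sets ?R"
  proof (rule null_sets_UN')
    show "countable ?W" by (intro countable_PiE) auto
    show "translate (k + Suc s) (pick c) (unit_box k s) \<in> null_sets ?R" for c
      using translate_sets[OF unit_box_sets] emeasure_translate[OF unit_box_sets] z by (simp add: null_sets_def)
  qed
  have "space ?R \<in> null_sets ?R" by (rule null_sets_subset[OF null sets.top sub])
  then show False using emeasure_space_lebesgue_R[of "k + Suc s"] by (auto simp: null_sets_def)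
qed

text \<open>After scaling, the expansion across a cell has the coefficients 1/i!, independent of the
  mesh. This keeps the number of choices per cell bounded.\<close>

lemma gval_step:
  assumes "r < s" "Suc l \<le> k"
  shows "gval k s r (Suc l) \<theta> = (\<Sum>i\<le>s - r. gval k s (r + i) l \<theta> / fact i)"
proof -
  let ?n = "1 + real k"
  have x: "real (Suc l) / ?n - real l / ?n = 1 / ?n" by (simp add: add_divide_distrib)
  have "dspl k (Suc s) r \<theta> (real (Suc l) / ?n) = tay s (\<lambda>a. dspl k (Suc s) a \<theta> (real l / ?n)) r (real (Suc l) / ?n - real l / ?n)"
    by (rule dspl_taylor) (use assms in \<open>auto simp: divide_right_mono\<close>)
  then have "gval k s r (Suc l) \<theta> = (\<Sum>i\<le>s - r. dspl k (Suc s) (r + i) \<theta> (real l / ?n) * ((1 / ?n) ^ i / fact i)) * ?n ^ (s - r)"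
    unfolding gval_def x tay_def by simp
  also have "\<dots> = (\<Sum>i\<le>s - r. gval k s (r + i) l \<theta> / fact i)"
    unfolding sum_distrib_right
  proof (intro sum.cong refl)
    fix i assume i: "i \<in> {..s - r}"
    then have "s - r = (s - (r + i)) + i" using assms by auto
    then have "?n ^ (s - r) = ?n ^ (s - (r + i)) * ?n ^ i" by (metis power_add)
    then show "dspl k (Suc s) (r + i) \<theta> (real l / ?n) * ((1 / ?n) ^ i / fact i) * ?n ^ (s - r) = gval k s (r + i) l \<theta> / fact i"
      by (simp add: gval_def power_divide)
  qed
  finally show ?thesis .
qed

text \<open>By the Taylor expansion across a cell, the integer parts of the scaled derivatives at one grid
  point determine those at the next one up to boundedly many choices. Hence only exponentially many
  (in the number of cells) translates of the unit box are needed, with no logarithmic factor.\<close>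
lemma emeasure_Theta_le:
  "emeasure (lebesgue_R (k + Suc s)) (Theta M (k, Suc s, L)) \<le>
     of_nat ((2 * (L + 4)) ^ (Suc s * Suc k) * (Suc k ^ s) ^ Suc s) * emeasure (lebesgue_R (k + Suc s)) (unit_box k s)"
proof -
  let ?R = "lebesgue_R (k + Suc s)" and ?T = "Theta M (k, Suc s, L)"
  define z where "z r l \<theta> = \<lfloor>gval k s r l \<theta>\<rfloor>" for r l \<theta>
  \<comment> \<open>Prediction of the next integer part from the integer parts at the grid point
    before.\<close>
  define pr where "pr r l \<theta> = \<lfloor>\<Sum>i\<le>s - r. real_of_int (z (r + i) l \<theta>) / fact i\<rfloor>" for r l \<theta>
  \<comment> \<open>For the top order, and at the first grid point, the integer part itself is
    recorded; elsewhere its deviation from the prediction.\<close>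
  define code where "code \<theta> = (\<lambda>p\<in>{..s} \<times> {..k}. if snd p = 0 \<or> fst p = s then z (fst p) (snd p) \<theta>
      else z (fst p) (snd p) \<theta> - pr (fst p) (snd p - 1) \<theta>)" for \<theta>
  \<comment> \<open>At 0 the scaled derivatives may be as large as L (k + 1)^s; this one grid point
    contributes a factor polynomial in k. Elsewhere L bounds the top derivative, and the deviations
    are at most 3.\<close>
  define c where "c l = (if l = 0 then (L + 4) * Suc k ^ s else L + 4)" for l :: nat
  define W where "W = PiE ({..s} \<times> {..k}) (\<lambda>p. {- int (c (snd p))..<int (c (snd p))})"
  have finW: "finite W" unfolding W_def by (intro finite_PiE) auto
  have cardW: "card W = (2 * (L + 4)) ^ (Suc s * Suc k) * (Suc k ^ s) ^ Suc s"
  proof -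
    have prod_if_0: "(\<Prod>l\<in>{..k}. A * (if l = 0 then B else 1)) = A ^ Suc k * B" for A B :: nat
      by (subst prod.distrib) simp
    have "card W = (\<Prod>p\<in>{..s} \<times> {..k}. 2 * c (snd p))" unfolding W_def by (subst card_PiE) (auto simp: nat_mult_distrib)
    also have "\<dots> = (\<Prod>r\<in>{..s}. \<Prod>l\<in>{..k}. 2 * c l)" by (subst prod.cartesian_product) (rule prod.cong, auto)
    also have "(\<Prod>l\<in>{..k}. 2 * c l) = (\<Prod>l\<in>{..k}. (2 * (L + 4)) * (if l = 0 then Suc k ^ s else 1))"
      by (intro prod.cong) (auto simp: c_def)
    also have "\<dots> = (2 * (L + 4)) ^ Suc k * Suc k ^ s" by (rule prod_if_0)
    also have "(\<Prod>r\<in>{..s}. (2 * (L + 4)) ^ Suc k * Suc k ^ s) = ((2 * (L + 4)) ^ Suc k * Suc k ^ s) ^ Suc s" by simp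
    also have "\<dots> = (2 * (L + 4)) ^ (Suc s * Suc k) * (Suc k ^ s) ^ Suc s"
      unfolding power_mult_distrib power_mult[symmetric] by (simp only: mult.commute)
    finally show ?thesis .
  qed
  \<comment> \<open>The code loses nothing: a prediction uses only integer parts already recovered
    at the previous grid point.\<close>
  have det: "z r l \<theta> = z r l \<theta>'" if "code \<theta> = code \<theta>'" "r \<le> s" "l \<le> k" for r l \<theta> \<theta>'
    using that(2,3)
  proof (induction l arbitrary: r)
    case 0
    then show ?case using fun_cong[OF that(1), of "(r, 0)"] by (simp add: code_def)
  next
    case (Suc l)
    show ?case
    proof (cases "r = s")
      case True
      then show ?thesis using fun_cong[OF that(1), of "(r, Suc l)"] Suc.prems by (simp add: code_def)
    next
      case False
      have "pr r l \<theta> = pr r l \<theta>'"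
        unfolding pr_def by (intro arg_cong[of _ _ floor] sum.cong refl arg_cong2[of _ _ _ _ "(/)"] arg_cong[of _ _ real_of_int] Suc.IH)
          (use Suc.prems in auto)
      then show ?thesis using fun_cong[OF that(1), of "(r, Suc l)"] Suc.prems False by (simp add: code_def)
    qed
  qed
  have codeW: "code \<theta> \<in> W" if \<theta>: "\<theta> \<in> ?T" for \<theta>
    unfolding W_def
  proof (rule PiE_I)
    fix p assume p: "p \<in> {..s} \<times> {..k}"
    obtain r l where rl: "p = (r, l)" "r \<le> s" "l \<le> k" using p by auto
    have "real l / (1 + real k) \<in> {0..<1}" using rl by (simp add: divide_less_eq)
    then have dL: "\<bar>dspl k (Suc s) r \<theta> (real l / (1 + real k))\<bar> \<le> real L"
      using \<theta> Theta_iff[of "Suc s" \<theta> M k L] rl by auto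
    have gL: "\<bar>gval k s r l \<theta>\<bar> \<le> real L * (1 + real k) ^ (s - r)"
      unfolding gval_def abs_mult using dL by (intro mult_mono) auto
    show "code \<theta> p \<in> {- int (c (snd p))..<int (c (snd p))}"
    proof (cases "l = 0 \<or> r = s")
      case True
      have "\<bar>gval k s r l \<theta>\<bar> < real (c l)"
      proof (cases "l = 0")
        case True
        have "(1 + real k) ^ (s - r) \<le> (1 + real k) ^ s" by (intro power_increasing) auto
        then have "real L * (1 + real k) ^ (s - r) \<le> real L * (1 + real k) ^ s" by (intro mult_left_mono) auto
        also have "\<dots> < real (L + 4) * (1 + real k) ^ s" by (intro mult_strict_right_mono) auto
        finally show ?thesis using gL True by (simp add: c_def)
      next
        case False
        then show ?thesis using gL True by (simp add: c_def)
      qed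
      then have "- real (c l) < gval k s r l \<theta>" "gval k s r l \<theta> < real (c l)" by linarith+
      then have "- int (c l) \<le> z r l \<theta> \<and> z r l \<theta> < int (c l)" unfolding z_def by linarith
      then show ?thesis using True rl by (auto simp: code_def)
    next
      case False
      then obtain l' where l': "l = Suc l'" by (cases l) auto
      have rs: "r < s" using False rl by simp
      let ?S = "\<Sum>i\<le>s - r. real_of_int (z (r + i) l' \<theta>) / fact i"
      have g: "gval k s r l \<theta> = (\<Sum>i\<le>s - r. gval k s (r + i) l' \<theta> / fact i)"
        using gval_step[OF rs, of l' k \<theta>] rl l' by simp
      have "?S \<le> gval k s r l \<theta>"
        unfolding g z_def by (intro sum_mono divide_right_mono) auto
      moreover have "gval k s r l \<theta> \<le> ?S + 3"
      proof -
        have "gval k s r l \<theta> \<le> (\<Sum>i\<le>s - r. (real_of_int (z (r + i) l' \<theta>) + 1) / fact i)"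
          unfolding g z_def by (intro sum_mono divide_right_mono) (auto intro: order_less_imp_le)
        also have "\<dots> = ?S + (\<Sum>i\<le>s - r. 1 / fact i)" by (simp add: add_divide_distrib sum.distrib)
        also have "\<dots> \<le> ?S + 3" using sum_inverse_fact_le[of "s - r"] by linarith
        finally show ?thesis .
      qed
      ultimately have "0 \<le> z r l \<theta> - pr r l' \<theta> \<and> z r l \<theta> - pr r l' \<theta> \<le> 3" unfolding pr_def z_def[of r l] by linarith
      moreover have "code \<theta> p = z r l \<theta> - pr r l' \<theta>" using False rl l' by (simp add: code_def)
      ultimately show ?thesis using rl l' by (simp add: c_def)
    qed
  qed (auto simp: code_def)
  define pick where "pick w = (SOME \<theta>. code \<theta> = w)" for w
  have "?T \<subseteq> (\<Union>w\<in>W. translate (k + Suc s) (pick w) (unit_box k s))"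
  proof
    fix \<theta> assume \<theta>: "\<theta> \<in> ?T"
    have p: "code (pick (code \<theta>)) = code \<theta>" unfolding pick_def by (rule someI[where P="\<lambda>t. code t = code \<theta>"]) (rule refl)
    have "\<theta> \<in> translate (k + Suc s) (pick (code \<theta>)) (unit_box k s)"
      using \<theta> det[OF p] Theta_iff[of "Suc s" \<theta> M k L] by (intro translate_unit_boxI) (auto simp: z_def)
    then show "\<theta> \<in> (\<Union>w\<in>W. translate (k + Suc s) (pick w) (unit_box k s))" using codeW[OF \<theta>] by blast
  qed
  then have "emeasure ?R ?T \<le> emeasure ?R (\<Union>w\<in>W. translate (k + Suc s) (pick w) (unit_box k s))"
    by (intro emeasure_mono sets.finite_UN finW translate_sets unit_box_sets)
  also have "\<dots> \<le> (\<Sum>w\<in>W. emeasure ?R (translate (k + Suc s) (pick w) (unit_box k s)))"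
    by (rule emeasure_subadditive_finite[OF finW]) (rule image_subsetI, rule translate_sets[OF unit_box_sets])
  also have "\<dots> = of_nat (card W) * emeasure ?R (unit_box k s)"
    unfolding emeasure_translate[OF unit_box_sets] by simp
  finally show ?thesis unfolding cardW .
qed

lemma ennreal_ratio_ge:
  fixes c :: nat and v T :: ennreal
  assumes "c > 0" "0 < v" "v < \<infinity>" "v \<le> T" "T \<le> of_nat c * v"
  shows "1 / of_nat c \<le> v / T"
proof -
  have c: "of_nat c = ennreal (real c)" by (simp add: ennreal_of_nat_eq_real_of_nat)
  obtain r where r: "v = ennreal r" "r > 0" using assms(2,3) by (cases v) auto
  have cv: "of_nat c * v = ennreal (real c * r)" unfolding c r(1) using r(2) by (simp add: ennreal_mult)
  obtain t where t: "T = ennreal t" "t \<ge> 0" using assms(5) unfolding cv by (cases T) (auto simp: top_unique)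
  have "ennreal t \<le> ennreal (real c * r)" using assms(5) unfolding cv t(1) .
  moreover have "ennreal r \<le> ennreal t" using assms(4) unfolding r(1) t(1) .
  ultimately have t': "r \<le> t" "t \<le> real c * r" using r(2) t(2) by (simp_all add: ennreal_le_iff)
  have "1 / real c = r / (real c * r)" using r(2) by simp
  also have "\<dots> \<le> r / t" using t' r(2) by (intro divide_left_mono) (auto intro: mult_pos_pos)
  finally have "ennreal (1 / real c) \<le> ennreal (r / t)" by (rule ennreal_leI)
  moreover have "1 / of_nat c = ennreal (1 / real c)" unfolding c using assms(1) by (subst divide_ennreal[symmetric]) auto
  moreover have "v / T = ennreal (r / t)" unfolding r(1) t(1) using r(2) t' by (subst divide_ennreal) auto
  ultimately show ?thesis by simp
qed

text \<open>The translate has the volume of the unit box, and \<open>Theta\<close> has at most a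
  known multiple of it, so the unknown volume drops out of the ratio.\<close>

lemma pi_prior_translate_ge:
  assumes sub: "translate (k + Suc s) t (unit_box k s) \<subseteq> Theta M (k, Suc s, L)"
    and L: "L \<ge> 1"
  shows "emeasure (pi_prior M (k, Suc s, L)) (translate (k + Suc s) t (unit_box k s)) \<ge>
     1 / of_nat ((2 * (L + 4)) ^ (Suc s * Suc k) * (Suc k ^ s) ^ Suc s)"
proof -
  let ?R = "lebesgue_R (k + Suc s)" and ?T = "Theta M (k, Suc s, L)"
  let ?c = "(2 * (L + 4)) ^ (Suc s * Suc k) * (Suc k ^ s) ^ Suc s"
  let ?U = "translate (k + Suc s) t (unit_box k s)"
  let ?v = "emeasure ?R (unit_box k s)"
  have U: "?U \<in> sets ?R" by (rule translate_sets[OF unit_box_sets])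
  have T: "?T \<in> sets ?R"
    using Theta_measurable[of "(k, Suc s, L)" M] L by (simp add: Jset_def del: Theta.simps)
  have c0: "?c > 0" by simp
  have v: "0 < ?v" "?v < \<infinity>" using emeasure_unit_box_pos emeasure_unit_box_finite by auto
  have Tle: "emeasure ?R ?T \<le> of_nat ?c * ?v" by (rule emeasure_Theta_le)
  have "emeasure ?R ?U = ?v" by (rule emeasure_translate[OF unit_box_sets])
  moreover have "emeasure (pi_prior M (k, Suc s, L)) ?U = emeasure ?R (?T \<inter> ?U) / emeasure ?R ?T"
    unfolding pi_prior_def mdim.simps by (rule emeasure_uniform_measure[OF T U])
  moreover have "?T \<inter> ?U = ?U" using sub by blast
  ultimately have e: "emeasure (pi_prior M (k, Suc s, L)) ?U = ?v / emeasure ?R ?T" by simp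
  have "?v \<le> emeasure ?R ?T" using emeasure_mono[OF sub T] emeasure_translate[OF unit_box_sets, of k s t] by simp
  then show ?thesis unfolding e by (rule ennreal_ratio_ge[OF c0 v _ Tle])
qed

subsection \<open>Prior mass near the regression function\<close>

lemma f_spline_at_1_bound:
  assumes "\<And>x. x \<in> {0..<1} \<Longrightarrow> \<bar>spl k q \<theta> x\<bar> \<le> M"
  shows "\<bar>f_spline (k, q, L) \<theta> 1\<bar> \<le> M"
proof -
  have "(N_spline (knot k q) q i \<longlongrightarrow> B_spline k q i 1) (at_left 1)" for i
  proof -
    obtain l where l: "(N_spline (knot k q) q i \<longlongrightarrow> l) (at_left 1)" using N_spline_left_lim by blast
    then have "Lim (at_left 1) (N_spline (knot k q) q i) = l" by (intro tendsto_Lim) auto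
    then show ?thesis using l by (simp add: B_spline_def)
  qed
  then have "(spl k q \<theta> \<longlongrightarrow> f_spline (k, q, L) \<theta> 1) (at_left 1)"
    unfolding spl_def[abs_def] f_spline.simps by (intro tendsto_sum tendsto_mult tendsto_const)
  then have "((\<lambda>x. \<bar>spl k q \<theta> x\<bar>) \<longlongrightarrow> \<bar>f_spline (k, q, L) \<theta> 1\<bar>) (at_left 1)" by (rule tendsto_rabs)
  moreover have "\<forall>\<^sub>F x in at_left 1. \<bar>spl k q \<theta> x\<bar> \<le> M"
    using eventually_at_left_real[of 0 "1::real"] by (rule eventually_mono) (use assms in auto)
  ultimately show ?thesis by (intro tendsto_upperbound) auto
qed

text \<open>\<open>L\<close> has to dominate the derivatives of the approximating splines plus those
  of the box, uniformly in N. The strict inequality for the sup norm leaves a margin into which the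
  approximation error fits once N is at least \<open>N0\<close>, so the whole translated box
  respects the bound M.\<close>

lemma prior_mass_near:
  assumes s: "s \<ge> 1" and f: "f \<in> W_inf s" and fM: "sup_norm f < ereal M"
  shows "\<exists>L C0 N0. L \<ge> 1 \<and> C0 \<ge> 0 \<and>
    (\<forall>N\<ge>N0. N \<ge> 1 \<longrightarrow> (\<exists>U\<in>sets (lebesgue_R (mdim (s * N - 1, Suc s, L))).
       U \<subseteq> Theta M (s * N - 1, Suc s, L) \<and>
       emeasure (pi_prior M (s * N - 1, Suc s, L)) U \<ge> ennreal (exp (- C0 * real N)) \<and>
       (\<forall>\<theta>\<in>U. \<forall>x\<in>{0<..<1}. \<bar>f_spline (s * N - 1, Suc s, L) \<theta> x - f x\<bar> \<le> C0 * (1 / real N) ^ s)))"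
proof -
  obtain E C where EC: "C \<ge> 0 \<and> (\<forall>x\<in>{0<..<1}. E 0 x = f x) \<and>
    (\<forall>r<s. \<forall>x\<in>{0..<1}. \<bar>E r x\<bar> \<le> C) \<and>
    (\<forall>r x y. r < s \<longrightarrow> 0 \<le> x \<longrightarrow> x \<le> y \<longrightarrow> y < 1 \<longrightarrow>
       \<bar>E r y - tay s (\<lambda>a. if a < s then E a x else 0) r (y - x)\<bar> \<le> C * (y - x) ^ (s - r))"
    using W_inf_Taylor[OF s f] by (elim exE)
  have E0: "E 0 x = f x" if "x \<in> {0<..<1}" for x
    using EC that by simp
  have Eb: "\<bar>E r x\<bar> \<le> C" if "r < s" "x \<in> {0..<1}" for r x using EC that by simp
  have Et: "\<bar>E r y - tay s (\<lambda>a. if a < s then E a x else 0) r (y - x)\<bar> \<le> C * (y - x) ^ (s - r)"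
    if "r < s" "0 \<le> x" "x \<le> y" "y < 1" for r x y
    using EC[THEN conjunct2, THEN conjunct2, THEN conjunct2, THEN spec, of r, THEN spec, of x, THEN spec, of y] that by blast
  have ex: "\<exists>C'\<ge>0. \<forall>N\<ge>1. \<exists>\<theta>. (\<forall>x\<in>{0..<1}. \<bar>dspl (s * N - 1) (Suc s) 0 \<theta> x - E 0 x\<bar> \<le> C' * (1 / real N) ^ s) \<and>
       (\<forall>r\<le>s. \<forall>x\<in>{0..<1}. \<bar>dspl (s * N - 1) (Suc s) r \<theta> x\<bar> \<le> C')"
  proof (rule spline_Hermite_approximation[OF s EC[THEN conjunct1]])
    fix r x assume "r < s" "x \<in> {0..<1::real}"
    then show "\<bar>E r x\<bar> \<le> C" by (rule Eb)
  next
    fix r x y assume "r < s" "0 \<le> x" "x \<le> y" "y < (1::real)"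
    then show "\<bar>E r y - tay s (\<lambda>a. if a < s then E a x else 0) r (y - x)\<bar> \<le> C * (y - x) ^ (s - r)" by (rule Et)
  qed
  obtain C' where C'a: "C' \<ge> 0 \<and> (\<forall>N\<ge>1. \<exists>\<theta>. (\<forall>x\<in>{0..<1}. \<bar>dspl (s * N - 1) (Suc s) 0 \<theta> x - E 0 x\<bar> \<le> C' * (1 / real N) ^ s) \<and>
       (\<forall>r\<le>s. \<forall>x\<in>{0..<1}. \<bar>dspl (s * N - 1) (Suc s) r \<theta> x\<bar> \<le> C'))"
    using ex by (elim exE)
  have C': "C' \<ge> 0" using C'a by (rule conjunct1)
  have appr: "\<exists>\<theta>. (\<forall>x\<in>{0..<1}. \<bar>dspl (s * N - 1) (Suc s) 0 \<theta> x - E 0 x\<bar> \<le> C' * (1 / real N) ^ s) \<and>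
       (\<forall>r\<le>s. \<forall>x\<in>{0..<1}. \<bar>dspl (s * N - 1) (Suc s) r \<theta> x\<bar> \<le> C')" if "N \<ge> 1" for N
    using C'a[THEN conjunct2, THEN spec, of N, THEN mp, OF that] .
  obtain M' where M': "M' < M" "\<And>x. x \<in> {0..1} \<Longrightarrow> \<bar>f x\<bar> \<le> M'"
  proof -
    obtain c where c: "sup_norm f < ereal c" "ereal c < ereal M" using ereal_dense2[OF fM] by (metis ereal_less_eq ereal_cases fM less_ereal.simps)
    have "sup_norm f \<le> ereal c" using c(1) by simp
    then have "\<forall>x\<in>{0..1}. \<bar>f x\<bar> \<le> c" by (simp add: sup_norm_le_iff)
    then show ?thesis using that[of c] c(2) by auto
  qed
  define L where "L = nat \<lceil>C' + 3\<rceil>"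
  have L: "real L \<ge> C' + 3" "L \<ge> 1" using C' by (auto simp: L_def le_nat_iff)
  define N0 where "N0 = nat \<lceil>(C' + 3) / (M - M')\<rceil>"
  \<comment> \<open>The summands pay, in order, for the radius of approximation, for the exponential
    number of translates, and for the polynomial factor through ln (k + 1) \<le> s N.\<close>
  define C0 where "C0 = (C' + 3) + ln (2 * (real L + 4)) * real (Suc s) * real s + real (s * Suc s) * real s"
  have lnL: "ln (2 * (real L + 4)) \<ge> 0" by (intro ln_ge_zero) auto
  have C0: "C0 \<ge> C' + 3" using lnL by (simp add: C0_def)
  show ?thesis
  proof (rule exI[of _ L], rule exI[of _ C0], rule exI[of _ N0], intro conjI allI impI L(2))
    show "C0 \<ge> 0" using C0 C' by simp
    fix N assume N0: "N \<ge> N0" and N: "N \<ge> 1"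
    define k where "k = s * N - 1"
    have k1: "Suc k = s * N" using s N by (simp add: k_def)
    have rk: "1 + real k = real s * real N" using k1 by (metis of_nat_Suc of_nat_mult)
    obtain t where t: "\<forall>x\<in>{0..<1}. \<bar>dspl k (Suc s) 0 t x - E 0 x\<bar> \<le> C' * (1 / real N) ^ s"
       "\<forall>r\<le>s. \<forall>x\<in>{0..<1}. \<bar>dspl k (Suc s) r t x\<bar> \<le> C'"
      using appr[OF N] unfolding k_def[symmetric] by (elim exE conjE)
    let ?j = "(k, Suc s, L)" and ?U = "translate (k + Suc s) t (unit_box k s)"
    have near: "\<bar>dspl k (Suc s) 0 \<theta> x - E 0 x\<bar> \<le> (C' + 3) * (1 / real N) ^ s"
      and der: "\<And>r. r \<le> s \<Longrightarrow> \<bar>dspl k (Suc s) r \<theta> x\<bar> \<le> C' + 3"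
      if \<theta>: "\<theta> \<in> ?U" and x: "x \<in> {0..<1}" for \<theta> x
    proof -
      have v: "shift_vec (k + Suc s) t \<theta> \<in> unit_box k s" using \<theta> by (simp add: translate_def)
      have d: "dspl k (Suc s) r \<theta> x = dspl k (Suc s) r (shift_vec (k + Suc s) t \<theta>) x + dspl k (Suc s) r t x" if "r \<le> s" for r
        using that by (subst dspl_shift_vec) auto
      have b: "\<bar>dspl k (Suc s) r (shift_vec (k + Suc s) t \<theta>) x\<bar> \<le> 3 * (1 / (1 + real k)) ^ (s - r)" if "r \<le> s" for r
        by (rule unit_box_dspl_bound[OF v that x])
      have "1 * real N \<le> real s * real N" using s by (intro mult_right_mono) auto
      then have "1 / (1 + real k) \<le> 1 / real N" unfolding rk using N by (intro divide_left_mono) auto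
      then have "(1 / (1 + real k)) ^ s \<le> (1 / real N) ^ s" by (intro power_mono) auto
      then have b0: "\<bar>dspl k (Suc s) 0 (shift_vec (k + Suc s) t \<theta>) x\<bar> \<le> 3 * (1 / real N) ^ s"
        using b[of 0] by simp
      have "\<bar>dspl k (Suc s) 0 t x - E 0 x\<bar> \<le> C' * (1 / real N) ^ s" using t(1) x by blast
      then show "\<bar>dspl k (Suc s) 0 \<theta> x - E 0 x\<bar> \<le> (C' + 3) * (1 / real N) ^ s"
        using b0 d[of 0] unfolding distrib_right by linarith
      fix r assume r: "r \<le> s"
      have "(1 / (1 + real k)) ^ (s - r) \<le> 1" by (intro power_le_one) auto
      moreover have "\<bar>dspl k (Suc s) r t x\<bar> \<le> C'" using t(2) x r by blast
      ultimately show "\<bar>dspl k (Suc s) r \<theta> x\<bar> \<le> C' + 3" using b[OF r] d[OF r] by linarith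
    qed
    have small: "(C' + 3) * (1 / real N) ^ s \<le> M - M'"
    proof -
      have "(1 / real N) ^ s \<le> (1 / real N) ^ 1" using N s by (intro power_decreasing) auto
      then have "(C' + 3) * (1 / real N) ^ s \<le> (C' + 3) * (1 / real N) ^ 1" using C' by (intro mult_left_mono) auto
      also have "\<dots> = (C' + 3) / real N" by simp
      finally have "(C' + 3) * (1 / real N) ^ s \<le> (C' + 3) / real N" .
      also have "\<dots> \<le> M - M'"
      proof -
        have "(C' + 3) / (M - M') \<le> real N" using N0 unfolding N0_def by linarith
        then show ?thesis using M'(1) N by (simp add: pos_divide_le_eq mult.commute)
      qed
      finally show ?thesis .
    qed
    have fs: "f_spline ?j \<theta> x = dspl k (Suc s) 0 \<theta> x" if "x \<in> {0..<1}" for \<theta> x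
      using that by (subst f_spline_eq_spl) (auto simp: dspl_def)
    have bM: "\<bar>dspl k (Suc s) 0 \<theta> x\<bar> \<le> M" if \<theta>: "\<theta> \<in> ?U" and x: "x \<in> {0..<1}" for \<theta> x
    proof (cases "x = 0")
      case False
      then have "E 0 x = f x" using E0[of x] x by auto
      moreover have "\<bar>f x\<bar> \<le> M'" using M'(2) x by auto
      ultimately show ?thesis using near[OF \<theta> x] small by linarith
    next
      case True
      \<comment> \<open>\<open>E 0\<close> is known to agree with f in the open interval only, so
        the bound at 0 is reached by right continuity.\<close>
      have "\<bar>spl k (Suc s) \<theta> x\<bar> \<le> M"
      proof (rule right_cont_bound[of "spl k (Suc s) \<theta>" "{0<..<1}" M x])
        show "\<exists>x\<in>{0<..<1}. a < x \<and> x < b" if "0 \<le> a" "a < b" "b \<le> 1" for a b :: real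
          using dense[OF that(2)] that by (metis greaterThanLessThan_iff le_less_trans less_le_trans)
        fix z :: real assume z: "z \<in> {0<..<1}"
        then have "E 0 z = f z" "\<bar>f z\<bar> \<le> M'" using E0[of z] M'(2) by auto
        then show "\<bar>spl k (Suc s) \<theta> z\<bar> \<le> M" using near[OF \<theta>, of z] z small by (simp add: dspl_def)
      qed (use x spl_right_cont in auto)
      then show ?thesis by (simp add: dspl_def)
    qed
    have sub: "?U \<subseteq> Theta M ?j"
    proof
      fix \<theta> assume \<theta>: "\<theta> \<in> ?U"
      have "\<bar>f_spline ?j \<theta> x\<bar> \<le> M" if "x \<in> {0..1}" for x
      proof (cases "x = 1")
        case True
        have "\<bar>f_spline ?j \<theta> 1\<bar> \<le> M"
          by (rule f_spline_at_1_bound) (use bM[OF \<theta>] in \<open>simp add: dspl_def\<close>)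
        then show ?thesis unfolding True .
      next
        case False
        then have "x \<in> {0..<1}" using that by auto
        then show ?thesis unfolding fs[OF \<open>x \<in> {0..<1}\<close>] by (rule bM[OF \<theta>])
      qed
      moreover have "\<bar>dspl k (Suc s) r \<theta> x\<bar> \<le> real L" if "r < Suc s" "x \<in> {0..<1}" for r x
        using der[OF \<theta> that(2), of r] that(1) L(1) by simp
      moreover have "\<theta> \<in> space (lebesgue_R (k + Suc s))" using \<theta> by (simp add: translate_def)
      ultimately show "\<theta> \<in> Theta M ?j"
        by (subst Theta_iff) (auto simp del: f_spline.simps)
    qed
    have mass: "emeasure (pi_prior M ?j) ?U \<ge> ennreal (exp (- C0 * real N))"
    proof -
      let ?c = "(2 * (L + 4)) ^ (Suc s * Suc k) * (Suc k ^ s) ^ Suc s"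
      have "real ?c = exp (ln (2 * (real L + 4)) * real (Suc s * Suc k)) * exp (ln (real (Suc k)) * real (s * Suc s))"
      proof -
        have "exp (ln (2 * (real L + 4)) * real (Suc s * Suc k)) = (2 * (real L + 4)) ^ (Suc s * Suc k)"
          unfolding exp_of_nat2_mult by (subst exp_ln) auto
        moreover have "exp (ln (real (Suc k)) * real (s * Suc s)) = real (Suc k) ^ (s * Suc s)"
          unfolding exp_of_nat2_mult by (subst exp_ln) auto
        moreover have "real ?c = (2 * (real L + 4)) ^ (Suc s * Suc k) * real (Suc k) ^ (s * Suc s)"
          by (simp only: power_mult[of "real (Suc k)" s "Suc s"] of_nat_mult of_nat_power of_nat_add of_nat_numeral)
        ultimately show ?thesis by (simp only:)
      qed
      also have "\<dots> = exp (ln (2 * (real L + 4)) * real (Suc s * Suc k) + ln (real (Suc k)) * real (s * Suc s))"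
        by (simp add: exp_add)
      also have "\<dots> \<le> exp (C0 * real N)"
      proof -
        have "ln (real (Suc k)) \<le> real s * real N" using ln_le_minus_one[of "real (Suc k)"] rk by simp
        then have "ln (real (Suc k)) * real (s * Suc s) \<le> real s * real N * real (s * Suc s)"
          by (intro mult_right_mono) auto
        moreover have "real (Suc s * Suc k) = real (Suc s) * (real s * real N)" by (simp only: k1 of_nat_mult)
        moreover have "0 \<le> (C' + 3) * real N" using C' by simp
        ultimately show ?thesis by (simp add: C0_def algebra_simps)
      qed
      finally have c: "real ?c \<le> exp (C0 * real N)" .
      have "ennreal (exp (- C0 * real N)) = ennreal (1 / exp (C0 * real N))" by (simp add: exp_minus divide_inverse)
      also have "\<dots> \<le> ennreal (1 / real ?c)"
        by (intro ennreal_leI divide_left_mono c) auto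
      also have "\<dots> = 1 / of_nat ?c"
        by (subst divide_ennreal[symmetric]) (auto simp: ennreal_of_nat_eq_real_of_nat)
      also have "\<dots> \<le> emeasure (pi_prior M ?j) ?U" by (rule pi_prior_translate_ge[OF sub L(2)])
      finally show ?thesis .
    qed
    show "\<exists>U\<in>sets (lebesgue_R (mdim (s * N - 1, Suc s, L))).
       U \<subseteq> Theta M (s * N - 1, Suc s, L) \<and>
       emeasure (pi_prior M (s * N - 1, Suc s, L)) U \<ge> ennreal (exp (- C0 * real N)) \<and>
       (\<forall>\<theta>\<in>U. \<forall>x\<in>{0<..<1}. \<bar>f_spline (s * N - 1, Suc s, L) \<theta> x - f x\<bar> \<le> C0 * (1 / real N) ^ s)"
      unfolding k_def[symmetric]
    proof (intro bexI[of _ ?U] conjI ballI)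
      show "?U \<in> sets (lebesgue_R (mdim ?j))" unfolding mdim.simps by (rule translate_sets[OF unit_box_sets])
      fix \<theta> x assume \<theta>: "\<theta> \<in> ?U" and x: "x \<in> {0<..<1::real}"
      have x': "x \<in> {0..<1}" using x by auto
      have "\<bar>f_spline ?j \<theta> x - f x\<bar> \<le> (C' + 3) * (1 / real N) ^ s"
        unfolding fs[OF x'] using near[OF \<theta> x'] E0[OF x] by simp
      also have "\<dots> \<le> C0 * (1 / real N) ^ s" using C0 by (intro mult_right_mono) auto
      finally show "\<bar>f_spline ?j \<theta> x - f x\<bar> \<le> C0 * (1 / real N) ^ s" .
    qed (use sub mass in auto)
  qed
qed

subsection \<open>Likelihood ratios\<close>

lemma space_mu_X [simp]: "space mu_X = {0..1}"
  by (simp add: mu_X_def space_restrict_space)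

lemma sets_mu_X: "sets mu_X = sets (restrict_space borel {0..1})"
  unfolding mu_X_def by (intro sets_restrict_space_cong) simp

lemma measurable_mu_X_borel: "f \<in> borel_measurable borel \<Longrightarrow> f \<in> borel_measurable mu_X"
  unfolding mu_X_def by (rule measurable_restrict_space1) simp

lemma prob_space_mu_X: "prob_space mu_X"
  unfolding mu_X_def by (rule prob_spaceI) (simp add: emeasure_restrict_space space_restrict_space)

lemma AE_mu_X_open: "AE x in mu_X. x \<in> {0<..<1}"
proof -
  have "AE x in lborel. x \<notin> {0, 1::real}" by (rule AE_not_in) (simp add: finite_imp_null_set_lborel)
  then have "AE x in lborel. x \<in> {0..1} \<longrightarrow> x \<in> {0<..<1::real}"
    by eventually_elim auto
  then show ?thesis unfolding mu_X_def by (subst AE_restrict_space_iff) auto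
qed

text \<open>The moment generating function of the normal law, by completing the square; the four
  Gaussian integrals below are instances.\<close>

lemma nn_integral_exp_normal:
  assumes "\<sigma> > 0"
  shows "(\<integral>\<^sup>+y. ennreal (exp (a * y + b)) * ennreal (normal_density \<mu> \<sigma> y) \<partial>lborel)
    = ennreal (exp (a * \<mu> + b + a\<^sup>2 * \<sigma>\<^sup>2 / 2))"
proof -
  let ?c = "exp (a * \<mu> + b + a\<^sup>2 * \<sigma>\<^sup>2 / 2)"
  have eq: "exp (a * y + b) * normal_density \<mu> \<sigma> y = ?c * normal_density (\<mu> + a * \<sigma>\<^sup>2) \<sigma> y" for y
  proof -
    have "(a * y + b) + - (y - \<mu>)\<^sup>2 / (2 * \<sigma>\<^sup>2) = (a * \<mu> + b + a\<^sup>2 * \<sigma>\<^sup>2 / 2) + - (y - (\<mu> + a * \<sigma>\<^sup>2))\<^sup>2 / (2 * \<sigma>\<^sup>2)"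
      using assms by (simp add: divide_simps) (simp add: power2_eq_square algebra_simps)
    then have "exp (a * y + b) * exp (- (y - \<mu>)\<^sup>2 / (2 * \<sigma>\<^sup>2)) = ?c * exp (- (y - (\<mu> + a * \<sigma>\<^sup>2))\<^sup>2 / (2 * \<sigma>\<^sup>2))"
      unfolding exp_add[symmetric] by simp
    then show ?thesis unfolding normal_density_def by simp
  qed
  interpret N: prob_space "density lborel (normal_density (\<mu> + a * \<sigma>\<^sup>2) \<sigma>)"
    by (rule prob_space_normal_density[OF assms])
  have "(\<integral>\<^sup>+y. ennreal (normal_density (\<mu> + a * \<sigma>\<^sup>2) \<sigma> y) \<partial>lborel) = 1"
    using N.emeasure_space_1 by (simp add: emeasure_density)
  then show ?thesis
    by (simp add: ennreal_mult[symmetric] eq) (simp add: ennreal_mult nn_integral_cmult)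
qed

text \<open>The likelihood ratio of the normal densities with means \<open>c\<close> and \<open>a\<close>.\<close>
definition lratio :: "real \<Rightarrow> real \<Rightarrow> real \<Rightarrow> real \<Rightarrow> real" where
  "lratio \<sigma> a c y = exp ((c - a) * (2 * y - c - a) / (2 * \<sigma>\<^sup>2))"

text \<open>The square root of the likelihood ratio, which serves as test statistic.\<close>
definition hratio :: "real \<Rightarrow> real \<Rightarrow> real \<Rightarrow> real \<Rightarrow> real" where
  "hratio \<sigma> a b y = exp ((b - a) * (2 * y - b - a) / (4 * \<sigma>\<^sup>2))"

lemma lratio_pos: "lratio \<sigma> a c y > 0" and hratio_pos: "hratio \<sigma> a c y > 0"
  by (simp_all add: lratio_def hratio_def)

lemma normal_density_lratio:
  assumes "\<sigma> > 0"
  shows "normal_density c \<sigma> y = lratio \<sigma> a c y * normal_density a \<sigma> y"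
proof -
  have "- (y - c)\<^sup>2 / (2 * \<sigma>\<^sup>2) = (c - a) * (2 * y - c - a) / (2 * \<sigma>\<^sup>2) + - (y - a)\<^sup>2 / (2 * \<sigma>\<^sup>2)"
    using assms by (simp add: divide_simps) (simp add: power2_eq_square algebra_simps)
  then have "exp (- (y - c)\<^sup>2 / (2 * \<sigma>\<^sup>2)) = exp ((c - a) * (2 * y - c - a) / (2 * \<sigma>\<^sup>2)) * exp (- (y - a)\<^sup>2 / (2 * \<sigma>\<^sup>2))"
    by (simp only: exp_add)
  then show ?thesis unfolding normal_density_def lratio_def by (simp only: mult.left_commute)
qed

text \<open>The exponents that this formula produces for \<open>lratio\<close>, its inverse,
  \<open>hratio\<close> and \<open>lratio / hratio\<close>, in this order; v stands for the
  variance.\<close>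

lemma gauss_exponent:
  fixes a b c v :: real
  assumes v: "v \<noteq> 0"
  shows "(c - a) / v * a + - ((c - a) * (c + a) / (2 * v)) + ((c - a) / v)\<^sup>2 * v / 2 = 0"
    and "- ((c - a) / v) * a + (c - a) * (c + a) / (2 * v) + (- ((c - a) / v))\<^sup>2 * v / 2 = (c - a)\<^sup>2 / v"
    and "(b - a) / (2 * v) * a + - ((b - a) * (b + a) / (4 * v)) + ((b - a) / (2 * v))\<^sup>2 * v / 2 = - (b - a)\<^sup>2 / (8 * v)"
    and "((c - a) / v - (b - a) / (2 * v)) * a + ((b - a) * (b + a) / (4 * v) - (c - a) * (c + a) / (2 * v))
        + ((c - a) / v - (b - a) / (2 * v))\<^sup>2 * v / 2 = (- (b - a)\<^sup>2 - 4 * (c - b) * (b - a)) / (8 * v)"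
proof -
  have sq: "(x / v)\<^sup>2 * v = x\<^sup>2 / v" for x using v by (simp add: power2_eq_square)
  have h: "(b - a) / (2 * v) = ((b - a) / 2) / v" by simp
  have d: "(c - a) / v - (b - a) / (2 * v) = ((c - a) - (b - a) / 2) / v" by (simp add: diff_divide_distrib)
  have m: "- ((c - a) / v) = (- (c - a)) / v" by (rule minus_divide_left)
  show "(c - a) / v * a + - ((c - a) * (c + a) / (2 * v)) + ((c - a) / v)\<^sup>2 * v / 2 = 0"
    unfolding sq using v by (simp add: divide_simps) (simp add: power2_eq_square algebra_simps)
  show "- ((c - a) / v) * a + (c - a) * (c + a) / (2 * v) + (- ((c - a) / v))\<^sup>2 * v / 2 = (c - a)\<^sup>2 / v"
    unfolding m sq using v by (simp add: divide_simps) (simp add: power2_eq_square algebra_simps)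
  show "(b - a) / (2 * v) * a + - ((b - a) * (b + a) / (4 * v)) + ((b - a) / (2 * v))\<^sup>2 * v / 2 = - (b - a)\<^sup>2 / (8 * v)"
    unfolding h sq using v by (simp add: divide_simps) (simp add: power2_eq_square algebra_simps)
  show "((c - a) / v - (b - a) / (2 * v)) * a + ((b - a) * (b + a) / (4 * v) - (c - a) * (c + a) / (2 * v))
        + ((c - a) / v - (b - a) / (2 * v))\<^sup>2 * v / 2 = (- (b - a)\<^sup>2 - 4 * (c - b) * (b - a)) / (8 * v)"
    unfolding d sq using v by (simp add: divide_simps) (simp add: power2_eq_square algebra_simps)
qed

lemma nn_integral_lratio:
  assumes "\<sigma> > 0"
  shows "(\<integral>\<^sup>+y. ennreal (lratio \<sigma> a c y) * ennreal (normal_density a \<sigma> y) \<partial>lborel) = 1"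
proof -
  have "lratio \<sigma> a c y = exp ((c - a) / \<sigma>\<^sup>2 * y + - ((c - a) * (c + a) / (2 * \<sigma>\<^sup>2)))" for y
    unfolding lratio_def using assms by (simp add: divide_simps) (simp add: algebra_simps)
  then have "(\<integral>\<^sup>+y. ennreal (lratio \<sigma> a c y) * ennreal (normal_density a \<sigma> y) \<partial>lborel)
     = ennreal (exp ((c - a) / \<sigma>\<^sup>2 * a + - ((c - a) * (c + a) / (2 * \<sigma>\<^sup>2)) + ((c - a) / \<sigma>\<^sup>2)\<^sup>2 * \<sigma>\<^sup>2 / 2))"
    by (simp only: nn_integral_exp_normal[OF assms])
  also have "(c - a) / \<sigma>\<^sup>2 * a + - ((c - a) * (c + a) / (2 * \<sigma>\<^sup>2)) + ((c - a) / \<sigma>\<^sup>2)\<^sup>2 * \<sigma>\<^sup>2 / 2 = 0"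
    by (rule gauss_exponent(1)) (use assms in simp)
  finally show ?thesis by simp
qed

lemma nn_integral_inverse_lratio:
  assumes "\<sigma> > 0"
  shows "(\<integral>\<^sup>+y. ennreal (1 / lratio \<sigma> a c y) * ennreal (normal_density a \<sigma> y) \<partial>lborel) = ennreal (exp ((c - a)\<^sup>2 / \<sigma>\<^sup>2))"
proof -
  have "1 / lratio \<sigma> a c y = exp (- ((c - a) / \<sigma>\<^sup>2) * y + (c - a) * (c + a) / (2 * \<sigma>\<^sup>2))" for y
  proof -
    have "1 / lratio \<sigma> a c y = exp (- ((c - a) * (2 * y - c - a) / (2 * \<sigma>\<^sup>2)))"
      unfolding lratio_def by (simp only: exp_minus inverse_eq_divide)
    also have "- ((c - a) * (2 * y - c - a) / (2 * \<sigma>\<^sup>2)) = - ((c - a) / \<sigma>\<^sup>2) * y + (c - a) * (c + a) / (2 * \<sigma>\<^sup>2)"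
      using assms by (simp add: divide_simps) (simp add: algebra_simps)
    finally show ?thesis .
  qed
  then have "(\<integral>\<^sup>+y. ennreal (1 / lratio \<sigma> a c y) * ennreal (normal_density a \<sigma> y) \<partial>lborel)
     = ennreal (exp (- ((c - a) / \<sigma>\<^sup>2) * a + (c - a) * (c + a) / (2 * \<sigma>\<^sup>2) + (- ((c - a) / \<sigma>\<^sup>2))\<^sup>2 * \<sigma>\<^sup>2 / 2))"
    by (simp only: nn_integral_exp_normal[OF assms])
  also have "- ((c - a) / \<sigma>\<^sup>2) * a + (c - a) * (c + a) / (2 * \<sigma>\<^sup>2) + (- ((c - a) / \<sigma>\<^sup>2))\<^sup>2 * \<sigma>\<^sup>2 / 2 = (c - a)\<^sup>2 / \<sigma>\<^sup>2"
    by (rule gauss_exponent(2)) (use assms in simp)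
  finally show ?thesis .
qed

text \<open>This is the Hellinger affinity of two normal laws with the same variance.\<close>

lemma nn_integral_hratio:
  assumes "\<sigma> > 0"
  shows "(\<integral>\<^sup>+y. ennreal (hratio \<sigma> a b y) * ennreal (normal_density a \<sigma> y) \<partial>lborel) = ennreal (exp (- (b - a)\<^sup>2 / (8 * \<sigma>\<^sup>2)))"
proof -
  have "hratio \<sigma> a b y = exp ((b - a) / (2 * \<sigma>\<^sup>2) * y + - ((b - a) * (b + a) / (4 * \<sigma>\<^sup>2)))" for y
    unfolding hratio_def using assms by (simp add: divide_simps) (simp add: algebra_simps)
  then have "(\<integral>\<^sup>+y. ennreal (hratio \<sigma> a b y) * ennreal (normal_density a \<sigma> y) \<partial>lborel)
     = ennreal (exp ((b - a) / (2 * \<sigma>\<^sup>2) * a + - ((b - a) * (b + a) / (4 * \<sigma>\<^sup>2)) + ((b - a) / (2 * \<sigma>\<^sup>2))\<^sup>2 * \<sigma>\<^sup>2 / 2))"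
    by (simp only: nn_integral_exp_normal[OF assms])
  also have "(b - a) / (2 * \<sigma>\<^sup>2) * a + - ((b - a) * (b + a) / (4 * \<sigma>\<^sup>2)) + ((b - a) / (2 * \<sigma>\<^sup>2))\<^sup>2 * \<sigma>\<^sup>2 / 2 = - (b - a)\<^sup>2 / (8 * \<sigma>\<^sup>2)"
    by (rule gauss_exponent(3)) (use assms in simp)
  finally show ?thesis .
qed

text \<open>For c = b this is the affinity again. The cross term is the price for testing a whole
  cell with the statistic of a single member b.\<close>

lemma nn_integral_lratio_hratio:
  assumes "\<sigma> > 0"
  shows "(\<integral>\<^sup>+y. ennreal (lratio \<sigma> a c y / hratio \<sigma> a b y) * ennreal (normal_density a \<sigma> y) \<partial>lborel)
     = ennreal (exp ((- (b - a)\<^sup>2 - 4 * (c - b) * (b - a)) / (8 * \<sigma>\<^sup>2)))"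
proof -
  have "lratio \<sigma> a c y / hratio \<sigma> a b y
      = exp (((c - a) / \<sigma>\<^sup>2 - (b - a) / (2 * \<sigma>\<^sup>2)) * y + ((b - a) * (b + a) / (4 * \<sigma>\<^sup>2) - (c - a) * (c + a) / (2 * \<sigma>\<^sup>2)))" for y
    unfolding lratio_def hratio_def exp_diff[symmetric] using assms by (simp add: divide_simps) (simp add: algebra_simps)
  then have "(\<integral>\<^sup>+y. ennreal (lratio \<sigma> a c y / hratio \<sigma> a b y) * ennreal (normal_density a \<sigma> y) \<partial>lborel)
     = ennreal (exp (((c - a) / \<sigma>\<^sup>2 - (b - a) / (2 * \<sigma>\<^sup>2)) * a + ((b - a) * (b + a) / (4 * \<sigma>\<^sup>2) - (c - a) * (c + a) / (2 * \<sigma>\<^sup>2))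
        + ((c - a) / \<sigma>\<^sup>2 - (b - a) / (2 * \<sigma>\<^sup>2))\<^sup>2 * \<sigma>\<^sup>2 / 2))"
    by (simp only: nn_integral_exp_normal[OF assms])
  also have "((c - a) / \<sigma>\<^sup>2 - (b - a) / (2 * \<sigma>\<^sup>2)) * a + ((b - a) * (b + a) / (4 * \<sigma>\<^sup>2) - (c - a) * (c + a) / (2 * \<sigma>\<^sup>2))
        + ((c - a) / \<sigma>\<^sup>2 - (b - a) / (2 * \<sigma>\<^sup>2))\<^sup>2 * \<sigma>\<^sup>2 / 2 = (- (b - a)\<^sup>2 - 4 * (c - b) * (b - a)) / (8 * \<sigma>\<^sup>2)"
    by (rule gauss_exponent(4)) (use assms in simp)
  finally show ?thesis .
qed

text \<open>A bound linear in D^2 and e^2 turns into squared L2 norms when integrated over x. The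
  mixed term is absorbed by (D + 4e)^2 \<ge> 0, and the bound 2M makes both exponentials comparable
  with their linearizations.\<close>

lemma exp_quadratic_bound:
  fixes D e \<sigma> M :: real
  assumes "\<sigma> > 0" "\<bar>D\<bar> \<le> 2 * M" "\<bar>e\<bar> \<le> 2 * M"
  shows "exp ((- D\<^sup>2 - 4 * e * D) / (8 * \<sigma>\<^sup>2)) \<le>
     1 + exp (4 * M\<^sup>2 / \<sigma>\<^sup>2) / \<sigma>\<^sup>2 * e\<^sup>2 - exp (- M\<^sup>2 / (4 * \<sigma>\<^sup>2)) / (16 * \<sigma>\<^sup>2) * D\<^sup>2"
proof -
  define \<alpha> where "\<alpha> = e\<^sup>2 / \<sigma>\<^sup>2"
  define \<beta> where "\<beta> = D\<^sup>2 / (16 * \<sigma>\<^sup>2)"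
  have ab: "\<alpha> \<ge> 0" "\<beta> \<ge> 0" by (simp_all add: \<alpha>_def \<beta>_def)
  have D2: "D\<^sup>2 \<le> (2 * M)\<^sup>2" "e\<^sup>2 \<le> (2 * M)\<^sup>2" using assms(2,3) power_mono[of "\<bar>D\<bar>" "2*M" 2] power_mono[of "\<bar>e\<bar>" "2*M" 2] by auto
  have \<alpha>M: "\<alpha> \<le> 4 * M\<^sup>2 / \<sigma>\<^sup>2" unfolding \<alpha>_def using D2 assms(1) by (intro divide_right_mono) (auto simp: power_mult_distrib)
  have \<beta>M: "\<beta> \<le> M\<^sup>2 / (4 * \<sigma>\<^sup>2)" unfolding \<beta>_def using D2 assms(1) by (auto simp: power_mult_distrib divide_simps)
  have "(D + 4 * e)\<^sup>2 = D\<^sup>2 + 8 * (e * D) + 16 * e\<^sup>2" by (simp add: power2_eq_square algebra_simps)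
  moreover have "0 \<le> (D + 4 * e)\<^sup>2" by simp
  moreover have "4 * e * D = 4 * (e * D)" by simp
  ultimately have "- D\<^sup>2 - 4 * e * D \<le> 8 * e\<^sup>2 - D\<^sup>2 / 2" by linarith
  then have "(- D\<^sup>2 - 4 * e * D) / (8 * \<sigma>\<^sup>2) \<le> (8 * e\<^sup>2 - D\<^sup>2 / 2) / (8 * \<sigma>\<^sup>2)"
    using assms(1) by (intro divide_right_mono) auto
  also have "\<dots> = \<alpha> - \<beta>" using assms(1) by (simp add: \<alpha>_def \<beta>_def divide_simps)
  finally have "exp ((- D\<^sup>2 - 4 * e * D) / (8 * \<sigma>\<^sup>2)) \<le> exp \<alpha> * exp (- \<beta>)" by (simp add: exp_add[symmetric])
  also have "\<dots> \<le> (1 + exp (4 * M\<^sup>2 / \<sigma>\<^sup>2) * \<alpha>) * (1 - exp (- M\<^sup>2 / (4 * \<sigma>\<^sup>2)) * \<beta>)"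
  proof (rule mult_mono)
    have "exp \<alpha> * (1 - \<alpha>) \<le> exp \<alpha> * exp (- \<alpha>)" using exp_ge_add_one_self[of "- \<alpha>"] by (intro mult_left_mono) auto
    then have "exp \<alpha> \<le> 1 + exp \<alpha> * \<alpha>" by (simp add: exp_minus algebra_simps)
    also have "exp \<alpha> * \<alpha> \<le> exp (4 * M\<^sup>2 / \<sigma>\<^sup>2) * \<alpha>" using \<alpha>M ab by (intro mult_right_mono) auto
    finally show "exp \<alpha> \<le> 1 + exp (4 * M\<^sup>2 / \<sigma>\<^sup>2) * \<alpha>" by simp
    have "exp (- \<beta>) * (1 + \<beta>) \<le> exp (- \<beta>) * exp \<beta>" using exp_ge_add_one_self[of \<beta>] by (intro mult_left_mono) auto
    then have "exp (- \<beta>) \<le> 1 - exp (- \<beta>) * \<beta>" by (simp add: exp_minus algebra_simps)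
    moreover have "exp (- M\<^sup>2 / (4 * \<sigma>\<^sup>2)) * \<beta> \<le> exp (- \<beta>) * \<beta>" using \<beta>M ab by (intro mult_right_mono) auto
    ultimately show "exp (- \<beta>) \<le> 1 - exp (- M\<^sup>2 / (4 * \<sigma>\<^sup>2)) * \<beta>" by linarith
  qed (use ab in auto)
  also have "\<dots> \<le> 1 + exp (4 * M\<^sup>2 / \<sigma>\<^sup>2) * \<alpha> - exp (- M\<^sup>2 / (4 * \<sigma>\<^sup>2)) * \<beta>"
  proof -
    have "0 \<le> exp (4 * M\<^sup>2 / \<sigma>\<^sup>2) * \<alpha> * (exp (- M\<^sup>2 / (4 * \<sigma>\<^sup>2)) * \<beta>)" using ab by simp
    then show ?thesis by (simp add: algebra_simps)
  qed
  finally show ?thesis by (simp add: \<alpha>_def \<beta>_def)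
qed

section \<open>The prior as a measure of mass at most one\<close>

lemma sets_pi_prior [measurable_cong]: "sets (pi_prior M j) = sets (lebesgue_R (mdim j))"
  by (simp add: pi_prior_def)

text \<open>Holds whatever the volume of \<open>Theta M j\<close>: for extended nonnegative reals
  both 0/0 and infinity/infinity are 0.\<close>

lemma emeasure_pi_prior_le:
  assumes "j \<in> Jset"
  shows "emeasure (pi_prior M j) A \<le> 1"
proof -
  let ?R = "lebesgue_R (mdim j)"
  have T: "Theta M j \<in> sets ?R" by (rule Theta_measurable[OF assms])
  have "emeasure (pi_prior M j) A \<le> emeasure (pi_prior M j) (space (pi_prior M j))" by (rule emeasure_space)
  also have "space (pi_prior M j) = space ?R" by (rule sets_eq_imp_space_eq[OF sets_pi_prior])
  also have "emeasure (pi_prior M j) (space ?R) = emeasure ?R (Theta M j \<inter> space ?R) / emeasure ?R (Theta M j)"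
    unfolding pi_prior_def by (rule emeasure_uniform_measure[OF T sets.top])
  also have "Theta M j \<inter> space ?R = Theta M j" using sets.sets_into_space[OF T] by blast
  also have "emeasure ?R (Theta M j) / emeasure ?R (Theta M j) \<le> 1"
  proof (cases "emeasure ?R (Theta M j)")
    case (real r)
    then show ?thesis by (cases "r = 0") (auto simp: divide_ennreal)
  qed simp
  finally show ?thesis .
qed

lemma finite_measure_pi_prior: "j \<in> Jset \<Longrightarrow> finite_measure (pi_prior M j)"
  using emeasure_pi_prior_le[of j M "space (pi_prior M j)"] by (intro finite_measureI) (auto simp: top_unique)

lemma countable_Jset: "countable Jset"
  by (rule countable_subset[OF subset_UNIV]) simp

lemma infsum_eq_nn_integral_count_space:
  fixes u :: "'a \<Rightarrow> real"
  assumes "u summable_on A" "\<And>x. x \<in> A \<Longrightarrow> u x \<ge> 0"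
  shows "ennreal (infsum u A) = (\<integral>\<^sup>+x. ennreal (u x) \<partial>count_space A)"
proof -
  have "(\<lambda>x. norm (u x)) summable_on A"
    using assms by (subst summable_on_cong[where g=u]) auto
  note abs = abs_summable_equivalent[THEN iffD1, OF this]
  show ?thesis
    using nn_integral_conv_infsetsum[OF abs assms(2)] infsetsum_infsum[OF abs] by simp
qed

lemma lratio_measurable:
  assumes [measurable]: "f \<in> borel_measurable N" "g \<in> borel_measurable N" "h \<in> borel_measurable N"
  shows "(\<lambda>x. lratio \<sigma> (f x) (g x) (h x)) \<in> borel_measurable N"
    and "(\<lambda>x. hratio \<sigma> (f x) (g x) (h x)) \<in> borel_measurable N"
  unfolding lratio_def hratio_def by measurable

text \<open>Independence and the common law of the observations are condensed into the product
  formula \<open>prod_P\<close>, from which all expectations below are computed.\<close>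

locale regression_law =
  fixes P :: "nat \<Rightarrow> (nat \<Rightarrow> real \<times> real) measure" and fo :: "real \<Rightarrow> real" and \<sigma> M :: real
  assumes \<sigma>: "\<sigma> > 0" and M: "M > 0"
    and fo_meas [measurable]: "fo \<in> borel_measurable mu_X"
    and fo_bound: "\<And>x. x \<in> {0..1} \<Longrightarrow> \<bar>fo x\<bar> \<le> M"
    and prob_P: "\<And>n. prob_space (P n)"
    and sets_P [measurable_cong]: "\<And>n. sets (P n) = sets (data_space n)"
    and prod_P: "\<And>n g. g \<in> borel_measurable (mu_X \<Otimes>\<^sub>M borel) \<Longrightarrow>
      (\<integral>\<^sup>+z. (\<Prod>i\<in>{1..n}. g (z i)) \<partial>P n) =
      (\<integral>\<^sup>+x. \<integral>\<^sup>+y. g (x, y) * ennreal (normal_density (fo x) \<sigma> y) \<partial>lborel \<partial>mu_X) ^ n"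
begin

definition LR :: "nat \<Rightarrow> (real \<Rightarrow> real) \<Rightarrow> (nat \<Rightarrow> real \<times> real) \<Rightarrow> real" where
  "LR n f z = (\<Prod>i\<in>{1..n}. lratio \<sigma> (fo (fst (z i))) (f (fst (z i))) (snd (z i)))"

definition TR :: "nat \<Rightarrow> (real \<Rightarrow> real) \<Rightarrow> (nat \<Rightarrow> real \<times> real) \<Rightarrow> real" where
  "TR n f z = (\<Prod>i\<in>{1..n}. hratio \<sigma> (fo (fst (z i))) (f (fst (z i))) (snd (z i)))"

lemma LR_pos: "LR n f z > 0" and TR_pos: "TR n f z > 0"
  by (auto simp: LR_def TR_def intro!: prod_pos lratio_pos hratio_pos)

lemma space_P: "space (P n) = space (data_space n)"
  by (rule sets_eq_imp_space_eq[OF sets_P])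

lemma fst_data: "i \<in> {1..n} \<Longrightarrow> (\<lambda>z. fst (z i)) \<in> measurable (data_space n) mu_X"
proof -
  assume "i \<in> {1..n}"
  then have "(\<lambda>z. z i) \<in> measurable (data_space n) (mu_X \<Otimes>\<^sub>M borel)"
    unfolding data_space_def by (rule measurable_component_singleton)
  from measurable_compose[OF this measurable_fst] show ?thesis .
qed

lemma snd_data: "i \<in> {1..n} \<Longrightarrow> (\<lambda>z. snd (z i)) \<in> borel_measurable (data_space n)"
proof -
  assume "i \<in> {1..n}"
  then have "(\<lambda>z. z i) \<in> measurable (data_space n) (mu_X \<Otimes>\<^sub>M borel)"
    unfolding data_space_def by (rule measurable_component_singleton)
  from measurable_compose[OF this measurable_snd] show ?thesis .
qed

lemma fst_data_borel: "i \<in> {1..n} \<Longrightarrow> (\<lambda>z. fst (z i)) \<in> borel_measurable (data_space n)"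
proof -
  assume i: "i \<in> {1..n}"
  have "(\<lambda>x. x) \<in> borel_measurable mu_X" by (rule measurable_mu_X_borel) simp
  from measurable_compose[OF fst_data[OF i] this] show ?thesis .
qed

lemma fo_data: "i \<in> {1..n} \<Longrightarrow> (\<lambda>z. fo (fst (z i))) \<in> borel_measurable (data_space n)"
  by (rule measurable_compose[OF fst_data fo_meas])

lemma LR_measurable:
  assumes f: "f \<in> borel_measurable borel"
  shows "LR n f \<in> borel_measurable (data_space n)" "TR n f \<in> borel_measurable (data_space n)"
proof -
  have 1: "(\<lambda>z. f (fst (z i))) \<in> borel_measurable (data_space n)" if "i \<in> {1..n}" for i
    by (rule measurable_compose[OF fst_data_borel[OF that] f])
  show "LR n f \<in> borel_measurable (data_space n)"
    unfolding LR_def[abs_def] by (intro borel_measurable_prod lratio_measurable(1) 1 fo_data snd_data)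
  show "TR n f \<in> borel_measurable (data_space n)"
    unfolding TR_def[abs_def] by (intro borel_measurable_prod lratio_measurable(2) 1 fo_data snd_data)
qed

lemma LR_pair_measurable:
  "(\<lambda>(z, \<theta>). LR n (f_spline j \<theta>) z) \<in> borel_measurable (data_space n \<Otimes>\<^sub>M lebesgue_R (mdim j))"
proof -
  let ?N = "data_space n \<Otimes>\<^sub>M lebesgue_R (mdim j)"
  have 1: "(\<lambda>p. f_spline j (snd p) (fst (fst p i))) \<in> borel_measurable ?N" if "i \<in> {1..n}" for i
  proof -
    have a: "(\<lambda>p. fst (fst p i)) \<in> borel_measurable ?N"
      by (rule measurable_compose[OF measurable_fst fst_data_borel[OF that]])
    have "(\<lambda>p. (snd p, fst (fst p i))) \<in> measurable ?N (lebesgue_R (mdim j) \<Otimes>\<^sub>M borel)"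
      by (rule measurable_Pair[OF measurable_snd a])
    from measurable_compose[OF this f_spline_measurable_pair] show ?thesis by simp
  qed
  have 2: "(\<lambda>p. fo (fst (fst p i))) \<in> borel_measurable ?N" if "i \<in> {1..n}" for i
    by (rule measurable_compose[OF measurable_fst fo_data[OF that]])
  have 3: "(\<lambda>p. snd (fst p i)) \<in> borel_measurable ?N" if "i \<in> {1..n}" for i
    by (rule measurable_compose[OF measurable_fst snd_data[OF that]])
  show ?thesis unfolding LR_def split_beta
    by (intro borel_measurable_prod lratio_measurable(1) 1 2 3)
qed

lemma nn_integral_prod_P:
  assumes h: "\<And>x y. h x y \<ge> 0" and hm: "(\<lambda>(x, y). h x y) \<in> borel_measurable (mu_X \<Otimes>\<^sub>M borel)"
    and eq: "\<And>x. (\<integral>\<^sup>+y. ennreal (h x y) * ennreal (normal_density (fo x) \<sigma> y) \<partial>lborel) = v x"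
  shows "(\<integral>\<^sup>+z. ennreal (\<Prod>i\<in>{1..n}. h (fst (z i)) (snd (z i))) \<partial>P n) = (\<integral>\<^sup>+x. v x \<partial>mu_X) ^ n"
proof -
  have "(\<integral>\<^sup>+z. ennreal (\<Prod>i\<in>{1..n}. h (fst (z i)) (snd (z i))) \<partial>P n)
     = (\<integral>\<^sup>+z. (\<Prod>i\<in>{1..n}. (\<lambda>p. ennreal (h (fst p) (snd p))) (z i)) \<partial>P n)"
    using h by (intro nn_integral_cong) (simp add: prod_ennreal)
  also have "\<dots> = (\<integral>\<^sup>+x. \<integral>\<^sup>+y. ennreal (h (fst (x, y)) (snd (x, y))) * ennreal (normal_density (fo x) \<sigma> y) \<partial>lborel \<partial>mu_X) ^ n"
    using hm by (intro prod_P) (auto simp: split_beta)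
  finally show ?thesis by (simp add: eq)
qed

lemma pair_measurable_mu:
  assumes [measurable]: "f \<in> borel_measurable borel" "g \<in> borel_measurable borel"
  shows "(\<lambda>(x, y). lratio \<sigma> (fo x) (f x) y) \<in> borel_measurable (mu_X \<Otimes>\<^sub>M borel)"
    "(\<lambda>(x, y). hratio \<sigma> (fo x) (f x) y) \<in> borel_measurable (mu_X \<Otimes>\<^sub>M borel)"
proof -
  have [measurable]: "f \<in> borel_measurable mu_X" by (rule measurable_mu_X_borel) fact
  show "(\<lambda>(x, y). lratio \<sigma> (fo x) (f x) y) \<in> borel_measurable (mu_X \<Otimes>\<^sub>M borel)"
    "(\<lambda>(x, y). hratio \<sigma> (fo x) (f x) y) \<in> borel_measurable (mu_X \<Otimes>\<^sub>M borel)"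
    unfolding lratio_def hratio_def by measurable
qed

lemma expectation_LR:
  assumes f: "f \<in> borel_measurable borel"
  shows "(\<integral>\<^sup>+z. ennreal (LR n f z) \<partial>P n) = 1"
proof -
  interpret X: prob_space mu_X by (rule prob_space_mu_X)
  have "(\<integral>\<^sup>+z. ennreal (LR n f z) \<partial>P n) = (\<integral>\<^sup>+x. 1 \<partial>mu_X) ^ n"
    unfolding LR_def
    by (rule nn_integral_prod_P[of "\<lambda>x y. lratio \<sigma> (fo x) (f x) y"])
      (use pair_measurable_mu[OF f f] nn_integral_lratio[OF \<sigma>] lratio_pos in \<open>auto intro: less_imp_le\<close>)
  then show ?thesis using X.emeasure_space_1 by simp
qed

lemma expectation_TR:
  assumes f: "f \<in> borel_measurable borel"
  shows "(\<integral>\<^sup>+z. ennreal (TR n f z) \<partial>P n) = (\<integral>\<^sup>+x. ennreal (exp (- (f x - fo x)\<^sup>2 / (8 * \<sigma>\<^sup>2))) \<partial>mu_X) ^ n"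
  unfolding TR_def
  by (rule nn_integral_prod_P[of "\<lambda>x y. hratio \<sigma> (fo x) (f x) y"])
    (use pair_measurable_mu[OF f f] nn_integral_hratio[OF \<sigma>] hratio_pos in \<open>auto intro: less_imp_le\<close>)

lemma expectation_inverse_LR:
  assumes f: "f \<in> borel_measurable borel"
  shows "(\<integral>\<^sup>+z. ennreal (1 / LR n f z) \<partial>P n) = (\<integral>\<^sup>+x. ennreal (exp ((f x - fo x)\<^sup>2 / \<sigma>\<^sup>2)) \<partial>mu_X) ^ n"
proof -
  have e: "1 / LR n f z = (\<Prod>i\<in>{1..n}. 1 / lratio \<sigma> (fo (fst (z i))) (f (fst (z i))) (snd (z i)))" for z
    by (simp add: LR_def prod_dividef)
  have [measurable]: "(\<lambda>(x, y). lratio \<sigma> (fo x) (f x) y) \<in> borel_measurable (mu_X \<Otimes>\<^sub>M borel)"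
    by (rule pair_measurable_mu[OF f f])
  have "(\<lambda>p. 1 / (case p of (x, y) \<Rightarrow> lratio \<sigma> (fo x) (f x) y)) \<in> borel_measurable (mu_X \<Otimes>\<^sub>M borel)" by measurable
  then have "(\<lambda>(x, y). 1 / lratio \<sigma> (fo x) (f x) y) \<in> borel_measurable (mu_X \<Otimes>\<^sub>M borel)" by (simp add: split_beta)
  then show ?thesis unfolding e
    by (intro nn_integral_prod_P[of "\<lambda>x y. 1 / lratio \<sigma> (fo x) (f x) y"])
      (use nn_integral_inverse_lratio[OF \<sigma>] lratio_pos in \<open>auto intro: less_imp_le\<close>)
qed

lemma expectation_LR_TR:
  assumes f: "f \<in> borel_measurable borel" and g: "g \<in> borel_measurable borel"
  shows "(\<integral>\<^sup>+z. ennreal (LR n g z / TR n f z) \<partial>P n) =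
     (\<integral>\<^sup>+x. ennreal (exp ((- (f x - fo x)\<^sup>2 - 4 * (g x - f x) * (f x - fo x)) / (8 * \<sigma>\<^sup>2))) \<partial>mu_X) ^ n"
proof -
  have e: "LR n g z / TR n f z = (\<Prod>i\<in>{1..n}. lratio \<sigma> (fo (fst (z i))) (g (fst (z i))) (snd (z i)) / hratio \<sigma> (fo (fst (z i))) (f (fst (z i))) (snd (z i)))" for z
    by (simp add: LR_def TR_def prod_dividef)
  have [measurable]: "(\<lambda>(x, y). lratio \<sigma> (fo x) (g x) y) \<in> borel_measurable (mu_X \<Otimes>\<^sub>M borel)"
    "(\<lambda>(x, y). hratio \<sigma> (fo x) (f x) y) \<in> borel_measurable (mu_X \<Otimes>\<^sub>M borel)"
    using pair_measurable_mu[OF g f] pair_measurable_mu[OF f g] by auto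
  have "(\<lambda>p. (case p of (x, y) \<Rightarrow> lratio \<sigma> (fo x) (g x) y) / (case p of (x, y) \<Rightarrow> hratio \<sigma> (fo x) (f x) y)) \<in> borel_measurable (mu_X \<Otimes>\<^sub>M borel)" by measurable
  then have "(\<lambda>(x, y). lratio \<sigma> (fo x) (g x) y / hratio \<sigma> (fo x) (f x) y) \<in> borel_measurable (mu_X \<Otimes>\<^sub>M borel)" by (simp add: split_beta)
  then show ?thesis unfolding e
    by (intro nn_integral_prod_P[of "\<lambda>x y. lratio \<sigma> (fo x) (g x) y / hratio \<sigma> (fo x) (f x) y"])
      (use nn_integral_lratio_hratio[OF \<sigma>] lratio_pos hratio_pos in \<open>auto intro: less_imp_le divide_nonneg_pos\<close>)
qed

subsection \<open>Error bounds for the tests\<close>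

text \<open>\<open>K1\<close> and \<open>K2\<close> are the coefficients of e^2 and D^2 in
  \<open>exp_quadratic_bound\<close>.\<close>

definition K1 :: real where "K1 = exp (4 * M\<^sup>2 / \<sigma>\<^sup>2) / \<sigma>\<^sup>2"
definition K2 :: real where "K2 = exp (- M\<^sup>2 / (4 * \<sigma>\<^sup>2)) / (16 * \<sigma>\<^sup>2)"

lemma K_pos: "K1 > 0" "K2 > 0"
  using \<sigma> by (simp_all add: K1_def K2_def)

lemma integrable_bounded_mu_X:
  assumes "h \<in> borel_measurable mu_X" "\<And>x. x \<in> {0..1} \<Longrightarrow> \<bar>h x\<bar> \<le> (B :: real)"
  shows "integrable mu_X h"
proof -
  interpret X: prob_space mu_X by (rule prob_space_mu_X)
  show ?thesis by (rule X.integrable_const_bound[of _ B]) (use assms in auto)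
qed

lemma L2_norm_sq: "(L2_norm h)\<^sup>2 = (\<integral>x. (h x)\<^sup>2 \<partial>mu_X)"
proof -
  have "0 \<le> (\<integral>x. (h x)\<^sup>2 \<partial>mu_X)" by (intro integral_nonneg_AE AE_I2) simp
  then show ?thesis unfolding L2_norm_def by simp
qed

text \<open>The pointwise quadratic bound is integrated. Closeness lets half of the negative term
  absorb the positive one, and 1 + u \<le> exp u restores an exponential, whose n-th power is
  explicit.\<close>

lemma nn_integral_test_bound:
  assumes f: "f \<in> borel_measurable borel" and g: "g \<in> borel_measurable borel"
    and fb: "\<And>x. x \<in> {0..1} \<Longrightarrow> \<bar>f x\<bar> \<le> M" and gb: "\<And>x. x \<in> {0..1} \<Longrightarrow> \<bar>g x\<bar> \<le> M"
    and close: "K1 * (L2_norm (\<lambda>x. g x - f x))\<^sup>2 \<le> K2 / 2 * (L2_norm (\<lambda>x. f x - fo x))\<^sup>2"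
  shows "(\<integral>\<^sup>+x. ennreal (exp ((- (f x - fo x)\<^sup>2 - 4 * (g x - f x) * (f x - fo x)) / (8 * \<sigma>\<^sup>2))) \<partial>mu_X)
     \<le> ennreal (exp (- (K2 / 2) * (L2_norm (\<lambda>x. f x - fo x))\<^sup>2))"
proof -
  interpret X: prob_space mu_X by (rule prob_space_mu_X)
  have [measurable]: "f \<in> borel_measurable mu_X" "g \<in> borel_measurable mu_X"
    using f g by (auto intro: measurable_mu_X_borel)
  let ?h = "\<lambda>x. 1 + K1 * (g x - f x)\<^sup>2 - K2 * (f x - fo x)\<^sup>2"
  have b: "\<bar>f x - fo x\<bar> \<le> 2 * M" "\<bar>g x - f x\<bar> \<le> 2 * M" if "x \<in> {0..1}" for x
    using fb[OF that] gb[OF that] fo_bound[OF that] by auto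
  have sq: "\<bar>t\<^sup>2\<bar> \<le> (2 * M)\<^sup>2" if "\<bar>t\<bar> \<le> 2 * M" for t :: real
    using power_mono[OF that, of 2] by simp
  have i1: "integrable mu_X (\<lambda>x. (g x - f x)\<^sup>2)" "integrable mu_X (\<lambda>x. (f x - fo x)\<^sup>2)"
    by (rule integrable_bounded_mu_X[of _ "(2 * M)\<^sup>2"], measurable, use b sq in blast)+
  have pw: "exp ((- (f x - fo x)\<^sup>2 - 4 * (g x - f x) * (f x - fo x)) / (8 * \<sigma>\<^sup>2)) \<le> ?h x" if "x \<in> {0..1}" for x
    using exp_quadratic_bound[OF \<sigma> b[OF that]] by (simp add: K1_def K2_def)
  have "(\<integral>\<^sup>+x. ennreal (exp ((- (f x - fo x)\<^sup>2 - 4 * (g x - f x) * (f x - fo x)) / (8 * \<sigma>\<^sup>2))) \<partial>mu_X) \<le> (\<integral>\<^sup>+x. ennreal (?h x) \<partial>mu_X)"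
    by (intro nn_integral_mono ennreal_leI pw) simp
  also have "\<dots> = ennreal (\<integral>x. ?h x \<partial>mu_X)"
  proof (rule nn_integral_eq_integral)
    show "integrable mu_X ?h" using i1 by auto
    show "AE x in mu_X. 0 \<le> ?h x"
    proof (rule AE_I2)
      fix x assume "x \<in> space mu_X"
      then have "x \<in> {0..1}" by simp
      from pw[OF this] show "0 \<le> ?h x" by (rule order_trans[OF exp_ge_zero])
    qed
  qed
  also have "(\<integral>x. ?h x \<partial>mu_X) = 1 + K1 * (L2_norm (\<lambda>x. g x - f x))\<^sup>2 - K2 * (L2_norm (\<lambda>x. f x - fo x))\<^sup>2"
    unfolding L2_norm_sq using i1 by (simp add: X.prob_space[simplified])
  also have "\<dots> \<le> 1 + - (K2 / 2) * (L2_norm (\<lambda>x. f x - fo x))\<^sup>2" using close by simp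
  also have "\<dots> \<le> exp (- (K2 / 2) * (L2_norm (\<lambda>x. f x - fo x))\<^sup>2)" by (rule exp_ge_add_one_self)
  finally show ?thesis by (simp add: ennreal_leI)
qed

text \<open>The error of the first kind is the special case g = f, because
  \<open>LR n f / TR n f\<close> and \<open>TR n f\<close> have the same expectation under the true
  law.\<close>

lemma test_errors:
  assumes f: "f \<in> borel_measurable borel" and g: "g \<in> borel_measurable borel"
    and fb: "\<And>x. x \<in> {0..1} \<Longrightarrow> \<bar>f x\<bar> \<le> M" and gb: "\<And>x. x \<in> {0..1} \<Longrightarrow> \<bar>g x\<bar> \<le> M"
    and close: "K1 * (L2_norm (\<lambda>x. g x - f x))\<^sup>2 \<le> K2 / 2 * (L2_norm (\<lambda>x. f x - fo x))\<^sup>2"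
  shows "(\<integral>\<^sup>+z. ennreal (LR n g z / TR n f z) \<partial>P n) \<le> ennreal (exp (- (K2 / 2) * real n * (L2_norm (\<lambda>x. f x - fo x))\<^sup>2))"
    and "(\<integral>\<^sup>+z. ennreal (TR n f z) \<partial>P n) \<le> ennreal (exp (- (K2 / 2) * real n * (L2_norm (\<lambda>x. f x - fo x))\<^sup>2))"
proof -
  let ?r = "exp (- (K2 / 2) * (L2_norm (\<lambda>x. f x - fo x))\<^sup>2)"
  have pw: "ennreal ?r ^ n = ennreal (exp (- (K2 / 2) * real n * (L2_norm (\<lambda>x. f x - fo x))\<^sup>2))"
    by (simp add: ennreal_power exp_of_nat_mult[symmetric] mult_ac)
  show "(\<integral>\<^sup>+z. ennreal (LR n g z / TR n f z) \<partial>P n) \<le> ennreal (exp (- (K2 / 2) * real n * (L2_norm (\<lambda>x. f x - fo x))\<^sup>2))"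
    unfolding expectation_LR_TR[OF f g] pw[symmetric] by (intro power_mono nn_integral_test_bound[OF f g fb gb close]) auto
  have "K1 * (L2_norm (\<lambda>x. f x - f x))\<^sup>2 \<le> K2 / 2 * (L2_norm (\<lambda>x. f x - fo x))\<^sup>2"
    using K_pos by (simp add: L2_norm_def)
  from nn_integral_test_bound[OF f f fb fb this]
  have "(\<integral>\<^sup>+x. ennreal (exp (- (f x - fo x)\<^sup>2 / (8 * \<sigma>\<^sup>2))) \<partial>mu_X) \<le> ennreal ?r" by simp
  then show "(\<integral>\<^sup>+z. ennreal (TR n f z) \<partial>P n) \<le> ennreal (exp (- (K2 / 2) * real n * (L2_norm (\<lambda>x. f x - fo x))\<^sup>2))"
    unfolding expectation_TR[OF f] pw[symmetric] by (intro power_mono) auto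
qed

subsection \<open>Evidence\<close>

text \<open>Likelihood ratios against the true density replace likelihoods, which leaves the
  posterior unchanged and gives expectations of at most one. Extended nonnegative values allow
  interchange of integrals without integrability conditions.\<close>

definition evid :: "nat \<Rightarrow> idx \<Rightarrow> (nat \<Rightarrow> real) set \<Rightarrow> (nat \<Rightarrow> real \<times> real) \<Rightarrow> ennreal" where
  "evid n j S z = (\<integral>\<^sup>+\<theta>. ennreal (LR n (f_spline j \<theta>) z) * indicator S \<theta> \<partial>pi_prior M j)"

lemma LR_pair_measurable_P:
  "(\<lambda>(z, \<theta>). ennreal (LR n (f_spline j \<theta>) z)) \<in> borel_measurable (P n \<Otimes>\<^sub>M pi_prior M j)"
proof -
  have eq: "sets (P n \<Otimes>\<^sub>M pi_prior M j) = sets (data_space n \<Otimes>\<^sub>M lebesgue_R (mdim j))"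
    by (rule sets_pair_measure_cong[OF sets_P sets_pi_prior])
  have "(\<lambda>(z, \<theta>). LR n (f_spline j \<theta>) z) \<in> borel_measurable (P n \<Otimes>\<^sub>M pi_prior M j)"
    using LR_pair_measurable[of n j] unfolding measurable_cong_sets[OF eq refl] .
  then have "(\<lambda>p. ennreal (case p of (z, \<theta>) \<Rightarrow> LR n (f_spline j \<theta>) z)) \<in> borel_measurable (P n \<Otimes>\<^sub>M pi_prior M j)"
    by measurable
  then show ?thesis by (simp add: split_beta)
qed

lemma evid_integrand_measurable:
  assumes S: "S \<in> sets (lebesgue_R (mdim j))"
  shows "(\<lambda>(z, \<theta>). ennreal (LR n (f_spline j \<theta>) z) * indicator S \<theta>) \<in> borel_measurable (P n \<Otimes>\<^sub>M pi_prior M j)"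
proof -
  have "indicator S \<in> borel_measurable (pi_prior M j)" using S by (simp add: sets_pi_prior)
  then have "(\<lambda>p. indicator S (snd p) :: ennreal) \<in> borel_measurable (P n \<Otimes>\<^sub>M pi_prior M j)"
    by (rule measurable_compose[OF measurable_snd])
  from borel_measurable_times_ennreal[OF LR_pair_measurable_P[of n j] this] show ?thesis by (simp add: split_beta)
qed

lemma evid_measurable:
  assumes j: "j \<in> Jset" and S: "S \<in> sets (lebesgue_R (mdim j))"
  shows "evid n j S \<in> borel_measurable (P n)"
proof -
  interpret \<pi>: finite_measure "pi_prior M j" by (rule finite_measure_pi_prior[OF j])
  show ?thesis unfolding evid_def[abs_def]
    using \<pi>.borel_measurable_nn_integral[OF evid_integrand_measurable[OF S, of n]] by simp
qed

text \<open>The integrals are interchanged and the prior has mass at most one. Applied with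
  \<open>w = 1\<close> and with the inverse of a test statistic.\<close>

lemma expectation_evid:
  assumes j: "j \<in> Jset" and S: "S \<in> sets (lebesgue_R (mdim j))"
    and w: "w \<in> borel_measurable (P n)"
    and le: "\<And>\<theta>. \<theta> \<in> S \<Longrightarrow> (\<integral>\<^sup>+z. ennreal (LR n (f_spline j \<theta>) z) * w z \<partial>P n) \<le> c"
  shows "(\<integral>\<^sup>+z. evid n j S z * w z \<partial>P n) \<le> c"
proof -
  interpret \<pi>: finite_measure "pi_prior M j" by (rule finite_measure_pi_prior[OF j])
  interpret Pn: prob_space "P n" by (rule prob_P)
  interpret pair_sigma_finite "P n" "pi_prior M j" ..
  let ?h = "\<lambda>z \<theta>. ennreal (LR n (f_spline j \<theta>) z) * indicator S \<theta> * w z"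
  have m: "(\<lambda>(z, \<theta>). ?h z \<theta>) \<in> borel_measurable (P n \<Otimes>\<^sub>M pi_prior M j)"
    using borel_measurable_times_ennreal[OF evid_integrand_measurable[OF S, of n] measurable_compose[OF measurable_fst w]]
    by (simp add: split_beta)
  have m1: "(\<lambda>\<theta>. ennreal (LR n (f_spline j \<theta>) z) * indicator S \<theta>) \<in> borel_measurable (pi_prior M j)" if "z \<in> space (P n)" for z
    using measurable_compose[OF measurable_Pair1'[OF that] evid_integrand_measurable[OF S, of n]] by simp
  have "(\<integral>\<^sup>+z. evid n j S z * w z \<partial>P n) = (\<integral>\<^sup>+z. \<integral>\<^sup>+\<theta>. ?h z \<theta> \<partial>pi_prior M j \<partial>P n)"
    unfolding evid_def by (intro nn_integral_cong nn_integral_multc[symmetric] m1)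
  also have "\<dots> = (\<integral>\<^sup>+\<theta>. \<integral>\<^sup>+z. ?h z \<theta> \<partial>P n \<partial>pi_prior M j)"
    using Fubini[OF m] by simp
  also have "\<dots> \<le> (\<integral>\<^sup>+\<theta>. c \<partial>pi_prior M j)"
  proof (rule nn_integral_mono)
    fix \<theta>
    show "(\<integral>\<^sup>+z. ?h z \<theta> \<partial>P n) \<le> c"
      using le[of \<theta>] by (cases "\<theta> \<in> S") auto
  qed
  also have "\<dots> = c * emeasure (pi_prior M j) (space (pi_prior M j))" by simp
  also have "\<dots> \<le> c * 1" by (intro mult_left_mono emeasure_pi_prior_le[OF j]) simp
  finally show ?thesis by simp
qed

end

text \<open>For c \<ge> 1 the first term suffices, otherwise the second. This takes the place of a
  test that accepts or rejects: both kinds of error enter additively.\<close>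

lemma ennreal_le_mult_add:
  fixes x y :: ennreal
  assumes "x \<le> y" "c > 0"
  shows "x \<le> y * ennreal c + x * ennreal (1 / c)"
proof (cases "c \<ge> 1")
  case True
  have "x \<le> y * 1" using assms by simp
  also have "\<dots> \<le> y * ennreal c" using True by (intro mult_left_mono) (auto simp: ennreal_le_iff2 simp flip: ennreal_1)
  finally show ?thesis by (rule add_increasing2[OF zero_le])
next
  case False
  then have "1 \<le> 1 / c" using assms(2) by simp
  then have "ennreal 1 \<le> ennreal (1 / c)" by (rule ennreal_leI)
  then have "x * 1 \<le> x * ennreal (1 / c)" by (intro mult_left_mono) auto
  then show ?thesis by (intro add_increasing) auto
qed

lemma nn_integral_count_space_split:
  assumes "finite F" "F \<subseteq> A"
  shows "(\<integral>\<^sup>+x. f x \<partial>count_space A) = (\<Sum>x\<in>F. f x) + (\<integral>\<^sup>+x. f x \<partial>count_space (A - F))"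
proof -
  have cs: "(\<integral>\<^sup>+x. f x * indicator B x \<partial>count_space A) = (\<integral>\<^sup>+x. f x \<partial>count_space B)" if "B \<subseteq> A" for B
    using nn_integral_restrict_space[of B "count_space A" f] that by (simp add: restrict_count_space Int_absorb2)
  have "(\<integral>\<^sup>+x. f x \<partial>count_space A) = (\<integral>\<^sup>+x. f x * indicator F x + f x * indicator (A - F) x \<partial>count_space A)"
    using assms by (intro nn_integral_cong) (auto simp: indicator_def)
  also have "\<dots> = (\<integral>\<^sup>+x. f x * indicator F x \<partial>count_space A) + (\<integral>\<^sup>+x. f x * indicator (A - F) x \<partial>count_space A)"
    by (rule nn_integral_add) auto
  also have "(\<integral>\<^sup>+x. f x * indicator F x \<partial>count_space A) = (\<integral>\<^sup>+x. f x \<partial>count_space F)"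
    by (rule cs[OF assms(2)])
  also have "(\<integral>\<^sup>+x. f x * indicator (A - F) x \<partial>count_space A) = (\<integral>\<^sup>+x. f x \<partial>count_space (A - F))"
    by (rule cs) auto
  also have "(\<integral>\<^sup>+x. f x \<partial>count_space F) = (\<Sum>x\<in>F. f x)" by (rule nn_integral_count_space_finite[OF assms(1)])
  finally show ?thesis .
qed

lemma normal_density_le:
  assumes "\<sigma> > 0"
  shows "normal_density \<mu> \<sigma> y \<le> 1 / sqrt (2 * pi * \<sigma>\<^sup>2)"
proof -
  have "exp (- (y - \<mu>)\<^sup>2 / (2 * \<sigma>\<^sup>2)) \<le> 1" by simp
  then show ?thesis unfolding normal_density_def using assms by (simp add: mult_left_le divide_right_mono)
qed

context regression_law
begin

section \<open>The posterior as a quotient of likelihood ratio integrals\<close>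

lemma weight_nonneg: "weight M \<sigma> j \<ge> 0"
  by (auto simp: weight_def alpha_cst_def weight0_def intro!: mult_nonneg_nonneg divide_nonneg_nonneg infsum_nonneg)

lemma weight_summable: "weight M \<sigma> summable_on Jset"
  using weight_has_sum_1[OF M \<sigma>] by (rule has_sum_imp_summable)

lemma weight_sum: "(\<integral>\<^sup>+j. ennreal (weight M \<sigma> j) \<partial>count_space Jset) = 1"
  using infsum_eq_nn_integral_count_space[OF weight_summable] weight_nonneg infsumI[OF weight_has_sum_1[OF M \<sigma>]] by simp

definition far :: "real \<Rightarrow> idx \<Rightarrow> (nat \<Rightarrow> real) set" where
  "far r j = {\<theta> \<in> Theta M j. L2_norm (\<lambda>x. f_spline j \<theta> x - fo x) > r}"

lemma L2_norm_coef_measurable: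
  "(\<lambda>\<theta>. L2_norm (\<lambda>x. f_spline j \<theta> x - fo x)) \<in> borel_measurable (lebesgue_R (mdim j))"
proof -
  interpret X: prob_space mu_X by (rule prob_space_mu_X)
  let ?N = "lebesgue_R (mdim j) \<Otimes>\<^sub>M mu_X"
  have "(\<lambda>x. x) \<in> borel_measurable mu_X" by (rule measurable_mu_X_borel) simp
  from measurable_compose[OF measurable_snd this] have "(\<lambda>p. snd p) \<in> borel_measurable ?N" .
  then have "(\<lambda>p. (fst p, snd p)) \<in> measurable ?N (lebesgue_R (mdim j) \<Otimes>\<^sub>M borel)"
    by (rule measurable_Pair[OF measurable_fst])
  from measurable_compose[OF this f_spline_measurable_pair]
  have 1: "(\<lambda>p. f_spline j (fst p) (snd p)) \<in> borel_measurable ?N" by simp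
  have 2: "(\<lambda>p. fo (snd p)) \<in> borel_measurable ?N" by (rule measurable_compose[OF measurable_snd fo_meas])
  have "(\<lambda>(\<theta>, x). (f_spline j \<theta> x - fo x)\<^sup>2) \<in> borel_measurable ?N"
    using borel_measurable_power[OF borel_measurable_diff[OF 1 2], of 2] by (simp add: split_beta)
  from X.borel_measurable_lebesgue_integral[OF this] show ?thesis
    unfolding L2_norm_def by (rule measurable_compose[OF _ borel_measurable_sqrt])
qed

lemma far_sets: "j \<in> Jset \<Longrightarrow> far r j \<in> sets (lebesgue_R (mdim j))"
proof -
  assume j: "j \<in> Jset"
  have [measurable]: "(\<lambda>\<theta>. L2_norm (\<lambda>x. f_spline j \<theta> x - fo x)) \<in> borel_measurable (lebesgue_R (mdim j))"
    by (rule L2_norm_coef_measurable)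
  have "{\<theta> \<in> space (lebesgue_R (mdim j)). L2_norm (\<lambda>x. f_spline j \<theta> x - fo x) > r} \<in> sets (lebesgue_R (mdim j))"
    by measurable
  then have "Theta M j \<inter> {\<theta> \<in> space (lebesgue_R (mdim j)). L2_norm (\<lambda>x. f_spline j \<theta> x - fo x) > r} \<in> sets (lebesgue_R (mdim j))"
    by (rule sets.Int[OF Theta_measurable[OF j]])
  also have "Theta M j \<inter> {\<theta> \<in> space (lebesgue_R (mdim j)). L2_norm (\<lambda>x. f_spline j \<theta> x - fo x) > r} = far r j"
    using sets.sets_into_space[OF Theta_measurable[OF j]] by (auto simp: far_def)
  finally show ?thesis .
qed

definition post_num :: "nat \<Rightarrow> (idx \<Rightarrow> (nat \<Rightarrow> real) set) \<Rightarrow> (nat \<Rightarrow> real \<times> real) \<Rightarrow> ennreal" where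
  "post_num n S z = (\<integral>\<^sup>+j. ennreal (weight M \<sigma> j) * evid n j (S j) z \<partial>count_space Jset)"

lemma nn_integral_evid_measurable:
  assumes "\<And>j. j \<in> J \<Longrightarrow> S j \<in> sets (lebesgue_R (mdim j))" "J \<subseteq> Jset"
  shows "(\<lambda>z. \<integral>\<^sup>+j. ennreal (weight M \<sigma> j) * evid n j (S j) z \<partial>count_space J) \<in> borel_measurable (P n)"
proof -
  have cJ: "countable J" by (rule countable_subset[OF assms(2) countable_Jset])
  interpret C: sigma_finite_measure "count_space J" by (rule sigma_finite_measure_count_space_countable[OF cJ])
  have "(\<lambda>p. ennreal (weight M \<sigma> (fst p)) * evid n (fst p) (S (fst p)) (snd p)) \<in> borel_measurable (count_space J \<Otimes>\<^sub>M P n)"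
  proof (rule measurable_pair_measure_countable1[OF cJ])
    fix j assume "j \<in> J"
    then have "evid n j (S j) \<in> borel_measurable (P n)" using assms by (intro evid_measurable) auto
    then show "(\<lambda>z. ennreal (weight M \<sigma> (fst (j, z))) * evid n (fst (j, z)) (S (fst (j, z))) (snd (j, z))) \<in> borel_measurable (P n)"
      by simp
  qed
  from measurable_pair_swap[OF this]
  have "(\<lambda>(z, j). ennreal (weight M \<sigma> j) * evid n j (S j) z) \<in> borel_measurable (P n \<Otimes>\<^sub>M count_space J)"
    by (simp add: split_beta)
  then show ?thesis by (rule C.borel_measurable_nn_integral)
qed

lemma post_num_measurable:
  "(\<And>j. j \<in> Jset \<Longrightarrow> S j \<in> sets (lebesgue_R (mdim j))) \<Longrightarrow> post_num n S \<in> borel_measurable (P n)"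
  unfolding post_num_def[abs_def] by (rule nn_integral_evid_measurable) auto

definition Lo :: "nat \<Rightarrow> (nat \<Rightarrow> real \<times> real) \<Rightarrow> real" where
  "Lo n z = (\<Prod>i=1..n. p_dens \<sigma> fo (z i))"

definition dbound :: real where "dbound = 1 / sqrt (2 * pi * \<sigma>\<^sup>2)"

lemma Lo_pos: "Lo n z > 0"
  unfolding Lo_def p_dens_def using \<sigma> by (auto intro!: prod_pos normal_density_pos simp: split_beta)

lemma likelihood_eq: "(\<Prod>i=1..n. p_dens \<sigma> f (z i)) = LR n f z * Lo n z"
  unfolding LR_def Lo_def prod.distrib[symmetric] p_dens_def split_beta
  by (intro prod.cong refl normal_density_lratio \<sigma>)

text \<open>The bound may depend on the data: its purpose is finiteness, which permits passing
  between Bochner integrals and infinite sums on one side and nonnegative integrals on the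
  other.\<close>

lemma LR_le: "LR n f z \<le> dbound ^ n / Lo n z"
proof -
  have "LR n f z * Lo n z \<le> (\<Prod>i=1..n. dbound)"
    unfolding likelihood_eq[symmetric] p_dens_def split_beta dbound_def
    by (intro prod_mono conjI normal_density_le \<sigma>) simp
  then show ?thesis using Lo_pos by (simp add: pos_le_divide_eq)
qed

lemma evid_le:
  assumes "j \<in> Jset"
  shows "evid n j S z \<le> ennreal (dbound ^ n / Lo n z)"
proof -
  have "evid n j S z \<le> (\<integral>\<^sup>+\<theta>. ennreal (dbound ^ n / Lo n z) \<partial>pi_prior M j)"
    unfolding evid_def
  proof (rule nn_integral_mono)
    fix \<theta>
    have "ennreal (LR n (f_spline j \<theta>) z) * indicator S \<theta> \<le> ennreal (dbound ^ n / Lo n z) * 1"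
      by (intro mult_mono ennreal_leI LR_le) (auto simp: indicator_def)
    then show "ennreal (LR n (f_spline j \<theta>) z) * indicator S \<theta> \<le> ennreal (dbound ^ n / Lo n z)" by simp
  qed
  also have "\<dots> = ennreal (dbound ^ n / Lo n z) * emeasure (pi_prior M j) (space (pi_prior M j))" by simp
  also have "\<dots> \<le> ennreal (dbound ^ n / Lo n z) * 1" by (intro mult_left_mono emeasure_pi_prior_le assms) simp
  finally show ?thesis by simp
qed

lemma LR_coef_measurable:
  assumes "z \<in> space (data_space n)"
  shows "(\<lambda>\<theta>. LR n (f_spline j \<theta>) z) \<in> borel_measurable (pi_prior M j)"
  using measurable_compose[OF measurable_Pair1'[OF assms] LR_pair_measurable[of n j]]
  by (simp add: measurable_cong_sets[OF sets_pi_prior refl])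

lemma likelihood_integral:
  assumes j: "j \<in> Jset" and S: "S \<in> sets (lebesgue_R (mdim j))" and z: "z \<in> space (data_space n)"
  shows "(LINT \<theta>:S|pi_prior M j. (\<Prod>i=1..n. p_dens \<sigma> (f_spline j \<theta>) (z i))) = enn2real (evid n j S z) * Lo n z"
proof -
  have [measurable]: "(\<lambda>\<theta>. LR n (f_spline j \<theta>) z) \<in> borel_measurable (pi_prior M j)" by (rule LR_coef_measurable[OF z])
  have [measurable]: "S \<in> sets (pi_prior M j)" using S by (simp add: sets_pi_prior)
  have "(LINT \<theta>:S|pi_prior M j. (\<Prod>i=1..n. p_dens \<sigma> (f_spline j \<theta>) (z i))) = (\<integral>\<theta>. indicator S \<theta> * (LR n (f_spline j \<theta>) z * Lo n z) \<partial>pi_prior M j)"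
    unfolding set_lebesgue_integral_def likelihood_eq by simp
  also have "\<dots> = enn2real (\<integral>\<^sup>+\<theta>. ennreal (indicator S \<theta> * (LR n (f_spline j \<theta>) z * Lo n z)) \<partial>pi_prior M j)"
    by (rule integral_eq_nn_integral, measurable) (intro AE_I2 mult_nonneg_nonneg less_imp_le[OF LR_pos] less_imp_le[OF Lo_pos], simp)
  also have "(\<integral>\<^sup>+\<theta>. ennreal (indicator S \<theta> * (LR n (f_spline j \<theta>) z * Lo n z)) \<partial>pi_prior M j)
      = (\<integral>\<^sup>+\<theta>. ennreal (LR n (f_spline j \<theta>) z) * indicator S \<theta> * ennreal (Lo n z) \<partial>pi_prior M j)"
    using LR_pos[of n _ z] Lo_pos[of n z] by (intro nn_integral_cong) (auto simp: indicator_def ennreal_mult less_imp_le)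
  also have "\<dots> = evid n j S z * ennreal (Lo n z)"
    unfolding evid_def by (rule nn_integral_multc) measurable
  also have "enn2real \<dots> = enn2real (evid n j S z) * Lo n z"
    using Lo_pos[of n z] by (simp add: enn2real_mult)
  finally show ?thesis .
qed

lemma post_num_le: "post_num n S z \<le> ennreal (dbound ^ n / Lo n z)"
proof -
  have "post_num n S z \<le> (\<integral>\<^sup>+j. ennreal (weight M \<sigma> j) * ennreal (dbound ^ n / Lo n z) \<partial>count_space Jset)"
    unfolding post_num_def by (intro nn_integral_mono mult_left_mono evid_le) auto
  also have "\<dots> = ennreal (dbound ^ n / Lo n z)" by (simp add: nn_integral_multc weight_sum)
  finally show ?thesis .
qed

lemma infsum_evid:
  assumes S: "\<And>j. j \<in> Jset \<Longrightarrow> S j \<in> sets (lebesgue_R (mdim j))" and z: "z \<in> space (data_space n)"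
  shows "(\<Sum>\<^sub>\<infinity>j\<in>Jset. weight M \<sigma> j * (LINT \<theta>:S j|pi_prior M j. (\<Prod>i=1..n. p_dens \<sigma> (f_spline j \<theta>) (z i))))
     = enn2real (post_num n S z) * Lo n z"
proof -
  let ?B = "dbound ^ n / Lo n z"
  define u where "u j = weight M \<sigma> j * enn2real (evid n j (S j) z)" for j
  have fin: "evid n j (S j) z < top" if "j \<in> Jset" for j
    using evid_le[OF that, of n "S j" z] by (rule le_less_trans) simp
  have B: "?B \<ge> 0" using Lo_pos[of n z] by (simp add: dbound_def)
  have u0: "u j \<ge> 0" for j by (simp add: u_def weight_nonneg)
  have su: "u summable_on Jset"
  proof (rule summable_on_comparison_test)
    show "(\<lambda>j. weight M \<sigma> j * ?B) summable_on Jset" by (intro summable_on_cmult_left weight_summable)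
    fix j assume j: "j \<in> Jset"
    have "enn2real (evid n j (S j) z) \<le> ?B" by (rule enn2real_leI[OF B evid_le[OF j]])
    then show "u j \<le> weight M \<sigma> j * ?B" unfolding u_def by (intro mult_left_mono weight_nonneg)
  qed (rule u0)
  have "ennreal (infsum u Jset) = (\<integral>\<^sup>+j. ennreal (u j) \<partial>count_space Jset)"
    by (rule infsum_eq_nn_integral_count_space[OF su u0])
  also have "\<dots> = post_num n S z"
    unfolding post_num_def u_def using fin weight_nonneg
    by (intro nn_integral_cong) (auto simp: ennreal_mult)
  finally have "infsum u Jset = enn2real (post_num n S z)"
    by (metis enn2real_ennreal infsum_nonneg u0)
  then have "enn2real (post_num n S z) * Lo n z = (\<Sum>\<^sub>\<infinity>j\<in>Jset. u j * Lo n z)"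
    by (simp add: infsum_cmult_left')
  also have "\<dots> = (\<Sum>\<^sub>\<infinity>j\<in>Jset. weight M \<sigma> j * (LINT \<theta>:S j|pi_prior M j. (\<Prod>i=1..n. p_dens \<sigma> (f_spline j \<theta>) (z i))))"
    by (intro infsum_cong) (simp only: u_def likelihood_integral[OF _ S z] mult.assoc)
  finally show ?thesis ..
qed

text \<open>The true likelihood \<open>Lo\<close> is a common positive factor of numerator and
  denominator.\<close>

lemma posterior_far_eq:
  assumes z: "z \<in> space (data_space n)"
  shows "posterior_far M \<sigma> fo n r z = enn2real (post_num n (far r) z) / enn2real (post_num n (Theta M) z)"
proof -
  have "posterior_far M \<sigma> fo n r z = (enn2real (post_num n (far r) z) * Lo n z) / (enn2real (post_num n (Theta M) z) * Lo n z)"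
    unfolding posterior_far_def far_def[symmetric]
    by (intro arg_cong2[where f="(/)"] infsum_evid z far_sets Theta_measurable)
  then show ?thesis using Lo_pos[of n z] by simp
qed

lemma posterior_far_measurable: "posterior_far M \<sigma> fo n r \<in> borel_measurable (P n)"
proof -
  have [measurable]: "post_num n (far r) \<in> borel_measurable (P n)" "post_num n (Theta M) \<in> borel_measurable (P n)"
    by (intro post_num_measurable far_sets Theta_measurable; assumption)+
  have "(\<lambda>z. enn2real (post_num n (far r) z) / enn2real (post_num n (Theta M) z)) \<in> borel_measurable (P n)" by measurable
  then show ?thesis by (rule measurable_cong[THEN iffD2, rotated]) (simp add: posterior_far_eq space_P)
qed

end

subsection \<open>Posterior tails\<close>

lemma Markov_inequality_space:
  fixes u :: "'a \<Rightarrow> ennreal"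
  assumes u: "u \<in> borel_measurable N"
  shows "emeasure N {x \<in> space N. 1 \<le> c * u x} \<le> c * (\<integral>\<^sup>+x. u x \<partial>N)"
proof -
  have 1: "(\<lambda>x. u x * indicator (space N) x) \<in> borel_measurable N"
    by (rule borel_measurable_times_ennreal[OF u]) simp
  have "(\<integral>\<^sup>+x. u x * indicator (space N) x \<partial>N) = (\<integral>\<^sup>+x. u x \<partial>N)"
    by (intro nn_integral_cong) simp
  then show ?thesis using nn_integral_Markov_inequality[OF 1 sets.top, of c] by simp
qed

context regression_law
begin

lemma evid_mono: "S \<subseteq> S' \<Longrightarrow> evid n j S z \<le> evid n j S' z"
  unfolding evid_def by (intro nn_integral_mono mult_left_mono) (auto simp: indicator_def)

lemma weight_evid_le_post_num: "j \<in> Jset \<Longrightarrow> ennreal (weight M \<sigma> j) * evid n j (S j) z \<le> post_num n S z"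
  unfolding post_num_def
  using nn_integral_ge_point[of j Jset "\<lambda>j. ennreal (weight M \<sigma> j) * evid n j (S j) z"] .

lemma evid_cover:
  assumes z: "z \<in> space (data_space n)" and I: "finite I" and sub: "S \<subseteq> (\<Union>c\<in>I. A c)"
    and A: "\<And>c. c \<in> I \<Longrightarrow> A c \<in> sets (lebesgue_R (mdim j))"
  shows "evid n j S z \<le> (\<Sum>c\<in>I. evid n j (A c) z)"
proof -
  have [measurable]: "(\<lambda>\<theta>. LR n (f_spline j \<theta>) z) \<in> borel_measurable (pi_prior M j)" by (rule LR_coef_measurable[OF z])
  have A': "A c \<in> sets (pi_prior M j)" if "c \<in> I" for c using A[OF that] by (simp add: sets_pi_prior)
  have "evid n j S z \<le> (\<integral>\<^sup>+\<theta>. (\<Sum>c\<in>I. ennreal (LR n (f_spline j \<theta>) z) * indicator (A c) \<theta>) \<partial>pi_prior M j)"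
    unfolding evid_def
  proof (rule nn_integral_mono)
    fix \<theta>
    show "ennreal (LR n (f_spline j \<theta>) z) * indicator S \<theta> \<le> (\<Sum>c\<in>I. ennreal (LR n (f_spline j \<theta>) z) * indicator (A c) \<theta>)"
    proof (cases "\<theta> \<in> S")
      case True
      then obtain c where c: "c \<in> I" "\<theta> \<in> A c" using sub by blast
      have "ennreal (LR n (f_spline j \<theta>) z) * indicator (A c) \<theta> \<le> (\<Sum>c\<in>I. ennreal (LR n (f_spline j \<theta>) z) * indicator (A c) \<theta>)"
        by (rule member_le_sum[OF c(1) _ I]) simp
      then show ?thesis using c True by simp
    qed simp
  qed
  also have "\<dots> = (\<Sum>c\<in>I. \<integral>\<^sup>+\<theta>. ennreal (LR n (f_spline j \<theta>) z) * indicator (A c) \<theta> \<partial>pi_prior M j)"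
  proof (rule nn_integral_sum)
    fix c assume "c \<in> I"
    then have [measurable]: "A c \<in> sets (pi_prior M j)" by (rule A')
    show "(\<lambda>\<theta>. ennreal (LR n (f_spline j \<theta>) z) * indicator (A c) \<theta>) \<in> borel_measurable (pi_prior M j)" by measurable
  qed
  finally show ?thesis by (simp add: evid_def)
qed

text \<open>The threshold d splits off the event of small evidence. On the rest the denominator
  cancels from every term, and the expectation of the remaining majorant \<open>G\<close> splits
  over models and cells, so Markov's inequality applies. Balancing with \<open>sqrt w * T\<close>
  gives both errors of a test the same factor \<open>sqrt w\<close>.\<close>

lemma posterior_tail_bound:
  fixes I :: "idx \<Rightarrow> 'c set" and A :: "idx \<Rightarrow> 'c \<Rightarrow> (nat \<Rightarrow> real) set" and F :: "idx \<Rightarrow> 'c \<Rightarrow> real \<Rightarrow> real"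
    and \<rho> :: "idx \<Rightarrow> 'c \<Rightarrow> real"
  assumes d: "d > 0" and \<delta>: "\<delta> > 0" and Js: "finite Js" "Js \<subseteq> Jset"
    and I: "\<And>j. j \<in> Js \<Longrightarrow> finite (I j)"
    and A: "\<And>j c. j \<in> Js \<Longrightarrow> c \<in> I j \<Longrightarrow> A j c \<in> sets (lebesgue_R (mdim j)) \<and> A j c \<subseteq> Theta M j"
    and cover: "\<And>j. j \<in> Js \<Longrightarrow> far r j \<subseteq> (\<Union>c\<in>I j. A j c)"
    and F: "\<And>j c. j \<in> Js \<Longrightarrow> c \<in> I j \<Longrightarrow> F j c \<in> borel_measurable borel"
    and \<rho>1: "\<And>j c. j \<in> Js \<Longrightarrow> c \<in> I j \<Longrightarrow> (\<integral>\<^sup>+z. ennreal (TR n (F j c) z) \<partial>P n) \<le> ennreal (\<rho> j c)"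
    and \<rho>2: "\<And>j c \<theta>. j \<in> Js \<Longrightarrow> c \<in> I j \<Longrightarrow> \<theta> \<in> A j c \<Longrightarrow>
       (\<integral>\<^sup>+z. ennreal (LR n (f_spline j \<theta>) z / TR n (F j c) z) \<partial>P n) \<le> ennreal (\<rho> j c)"
    and \<rho>0: "\<And>j c. \<rho> j c \<ge> 0" and wpos: "\<And>j. j \<in> Js \<Longrightarrow> weight M \<sigma> j > 0"
  shows "emeasure (P n) {z \<in> space (P n). posterior_far M \<sigma> fo n r z > \<delta>} \<le>
     emeasure (P n) {z \<in> space (P n). post_num n (Theta M) z < ennreal d} +
     ennreal (1 / \<delta>) * ((\<integral>\<^sup>+j. ennreal (weight M \<sigma> j) \<partial>count_space (Jset - Js)) * ennreal (1 / d) +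
       (\<Sum>j\<in>Js. \<Sum>c\<in>I j. ennreal (sqrt (weight M \<sigma> j) * (1 + 1 / d) * \<rho> j c)))"
proof -
  let ?w = "\<lambda>j. weight M \<sigma> j"
  define big where "big z = (\<integral>\<^sup>+j. ennreal (?w j) * evid n j (far r j) z \<partial>count_space (Jset - Js))" for z
  define G where "G z = big z * ennreal (1 / d) + (\<Sum>j\<in>Js. \<Sum>c\<in>I j. ennreal (sqrt (?w j)) *
     (ennreal (TR n (F j c) z) + evid n j (A j c) z * ennreal (1 / TR n (F j c) z) * ennreal (1 / d)))" for z
  have pw: "ennreal \<delta> \<le> G z" if z: "z \<in> space (P n)" and post: "posterior_far M \<sigma> fo n r z > \<delta>"
    and D: "post_num n (Theta M) z \<ge> ennreal d" for z
  proof -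
    have z': "z \<in> space (data_space n)" using z by (simp add: space_P)
    let ?N = "post_num n (far r) z" and ?D = "post_num n (Theta M) z"
    have Dfin: "?D < top" using post_num_le[of n "Theta M" z] by (rule le_less_trans) simp
    have Nfin: "?N < top" using post_num_le[of n "far r" z] by (rule le_less_trans) simp
    have Dpos: "0 < ?D" using D d by (intro less_le_trans[OF _ D]) simp
    \<comment> \<open>Lets a factor \<open>?D\<close> be inserted into every term that lacks one, so
      that it can be cancelled at the end.\<close>
    have D1: "1 \<le> ?D * ennreal (1 / d)"
    proof -
      have "ennreal d * ennreal (1 / d) \<le> ?D * ennreal (1 / d)" using D by (rule mult_right_mono) simp
      moreover have "ennreal d * ennreal (1 / d) = 1" using d by (simp add: ennreal_mult[symmetric])
      ultimately show ?thesis by simp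
    qed
    have "\<delta> * enn2real ?D < enn2real ?N"
    proof -
      have "enn2real ?D > 0" using Dpos Dfin by (simp add: enn2real_positive_iff)
      then show ?thesis using post unfolding posterior_far_eq[OF z'] by (simp add: pos_less_divide_eq)
    qed
    then have "ennreal (\<delta> * enn2real ?D) \<le> ennreal (enn2real ?N)" by (intro ennreal_leI) simp
    then have "?D * ennreal \<delta> \<le> ?N" using Dfin Nfin \<delta> by (simp add: ennreal_mult mult.commute)
    also have "?N = (\<Sum>j\<in>Js. ennreal (?w j) * evid n j (far r j) z) + big z"
      unfolding post_num_def big_def by (rule nn_integral_count_space_split[OF Js])
    also have "\<dots> \<le> (\<Sum>j\<in>Js. \<Sum>c\<in>I j. ?D * (ennreal (sqrt (?w j)) *
        (ennreal (TR n (F j c) z) + evid n j (A j c) z * ennreal (1 / TR n (F j c) z) * ennreal (1 / d)))) + ?D * (big z * ennreal (1 / d))"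
    proof (intro add_mono sum_mono)
      have "1 * big z \<le> (?D * ennreal (1 / d)) * big z" using D1 by (rule mult_right_mono) simp
      then show "big z \<le> ?D * (big z * ennreal (1 / d))" by (simp add: mult_ac)
      fix j assume j: "j \<in> Js"
      have "ennreal (?w j) * evid n j (far r j) z \<le> ennreal (?w j) * (\<Sum>c\<in>I j. evid n j (A j c) z)"
        using A[OF j] by (intro mult_left_mono evid_cover[OF z' I[OF j] cover[OF j]]) auto
      also have "\<dots> = (\<Sum>c\<in>I j. ennreal (?w j) * evid n j (A j c) z)" by (rule sum_distrib_left)
      also have "\<dots> \<le> (\<Sum>c\<in>I j. ?D * (ennreal (sqrt (?w j)) *
        (ennreal (TR n (F j c) z) + evid n j (A j c) z * ennreal (1 / TR n (F j c) z) * ennreal (1 / d))))"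
      proof (rule sum_mono)
        fix c assume c: "c \<in> I j"
        let ?T = "TR n (F j c) z" and ?e = "evid n j (A j c) z"
        have T: "?T > 0" by (rule TR_pos)
        have w: "?w j > 0" by (rule wpos[OF j])
        have "ennreal (?w j) * ?e \<le> ennreal (?w j) * evid n j (Theta M j) z"
          using A[OF j c] by (intro mult_left_mono evid_mono) auto
        also have "\<dots> \<le> ?D" using j Js by (intro weight_evid_le_post_num) auto
        finally have "ennreal (?w j) * ?e \<le> ?D * ennreal (sqrt (?w j) * ?T) + (ennreal (?w j) * ?e) * ennreal (1 / (sqrt (?w j) * ?T))"
          using T w by (intro ennreal_le_mult_add) auto
        also have "(ennreal (?w j) * ?e) * ennreal (1 / (sqrt (?w j) * ?T)) = ennreal (sqrt (?w j)) * (?e * ennreal (1 / ?T))"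
        proof -
          have "?w j * (1 / (sqrt (?w j) * ?T)) = sqrt (?w j) * (1 / ?T)"
            using w T real_sqrt_mult_self[of "?w j"] by (simp add: field_simps)
          then have "ennreal (?w j) * ennreal (1 / (sqrt (?w j) * ?T)) = ennreal (sqrt (?w j)) * ennreal (1 / ?T)"
            using w T by (simp add: ennreal_mult[symmetric])
          then show ?thesis by (metis mult.assoc mult.commute)
        qed
        also have "\<dots> \<le> ?D * ennreal (1 / d) * (ennreal (sqrt (?w j)) * (?e * ennreal (1 / ?T)))"
          using mult_right_mono[OF D1, of "ennreal (sqrt (?w j)) * (?e * ennreal (1 / ?T))"] by simp
        also have "?D * ennreal (sqrt (?w j) * ?T) = ?D * (ennreal (sqrt (?w j)) * ennreal ?T)"
          using w T by (simp add: ennreal_mult)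
        finally show "ennreal (?w j) * ?e \<le> ?D * (ennreal (sqrt (?w j)) * (ennreal ?T + ?e * ennreal (1 / ?T) * ennreal (1 / d)))"
          by (simp add: distrib_left mult_ac)
      qed
      finally show "ennreal (?w j) * evid n j (far r j) z \<le> (\<Sum>c\<in>I j. ?D * (ennreal (sqrt (?w j)) *
        (ennreal (TR n (F j c) z) + evid n j (A j c) z * ennreal (1 / TR n (F j c) z) * ennreal (1 / d))))" .
    qed
    also have "\<dots> = ?D * G z" unfolding G_def distrib_left sum_distrib_left by (rule add.commute)
    finally show "ennreal \<delta> \<le> G z" using Dpos Dfin by (subst (asm) ennreal_mult_le_mult_iff) auto
  qed
  have evm: "evid n j (A j c) \<in> borel_measurable (P n)" if "j \<in> Js" "c \<in> I j" for j c
    using A[OF that] Js that by (intro evid_measurable) auto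
  have TRm: "TR n (F j c) \<in> borel_measurable (P n)" if "j \<in> Js" "c \<in> I j" for j c
    using LR_measurable(2)[OF F[OF that], of n] by (simp add: measurable_cong_sets[OF sets_P refl])
  have m1: "(\<lambda>z. ennreal (TR n (F j c) z)) \<in> borel_measurable (P n)" if "j \<in> Js" "c \<in> I j" for j c
    using TRm[OF that] by measurable
  have m1': "(\<lambda>z. ennreal (1 / TR n (F j c) z)) \<in> borel_measurable (P n)" if "j \<in> Js" "c \<in> I j" for j c
    using TRm[OF that] by measurable
  have m2: "(\<lambda>z. evid n j (A j c) z * ennreal (1 / TR n (F j c) z)) \<in> borel_measurable (P n)" if "j \<in> Js" "c \<in> I j" for j c
    using evm[OF that] m1'[OF that] by measurable
  have m3: "(\<lambda>z. ennreal (sqrt (?w j)) * (ennreal (TR n (F j c) z) + evid n j (A j c) z * ennreal (1 / TR n (F j c) z) * ennreal (1 / d))) \<in> borel_measurable (P n)"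
    if "j \<in> Js" "c \<in> I j" for j c
    using m1[OF that] m2[OF that] by measurable
  have mbig: "big \<in> borel_measurable (P n)"
    unfolding big_def[abs_def] by (rule nn_integral_evid_measurable) (auto intro: far_sets)
  have mS: "(\<lambda>z. \<Sum>j\<in>Js. \<Sum>c\<in>I j. ennreal (sqrt (?w j)) *
     (ennreal (TR n (F j c) z) + evid n j (A j c) z * ennreal (1 / TR n (F j c) z) * ennreal (1 / d))) \<in> borel_measurable (P n)"
    by (intro borel_measurable_sum m3)
  have mB: "(\<lambda>z. big z * ennreal (1 / d)) \<in> borel_measurable (P n)"
    by (rule borel_measurable_times_ennreal[OF mbig borel_measurable_const])
  have mG: "G \<in> borel_measurable (P n)"
    unfolding G_def[abs_def] by (rule borel_measurable_add[OF mB mS])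
  have Ebig: "(\<integral>\<^sup>+z. big z \<partial>P n) \<le> (\<integral>\<^sup>+j. ennreal (?w j) \<partial>count_space (Jset - Js))"
  proof -
    have em: "evid n j (far r j) \<in> borel_measurable (P n)" if "j \<in> Jset - Js" for j
      using that by (intro evid_measurable far_sets) auto
    have "(\<integral>\<^sup>+z. big z \<partial>P n) = (\<integral>\<^sup>+j. \<integral>\<^sup>+z. ennreal (?w j) * evid n j (far r j) z \<partial>P n \<partial>count_space (Jset - Js))"
      unfolding big_def
    proof (rule nn_integral_count_space_nn_integral)
      show "countable (Jset - Js)" using countable_Jset by (rule countable_Diff)
      show "(\<lambda>z. ennreal (?w j) * evid n j (far r j) z) \<in> borel_measurable (P n)" if "j \<in> Jset - Js" for j
        using em[OF that] by measurable
    qed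
    also have "\<dots> \<le> (\<integral>\<^sup>+j. ennreal (?w j) \<partial>count_space (Jset - Js))"
    proof (rule nn_integral_mono)
      fix j assume j: "j \<in> space (count_space (Jset - Js))"
      then have j': "j \<in> Jset" "j \<in> Jset - Js" by auto
      have "(\<integral>\<^sup>+z. evid n j (far r j) z * 1 \<partial>P n) \<le> 1"
        by (rule expectation_evid[OF j'(1) far_sets[OF j'(1)]]) (auto simp: expectation_LR)
      then have "ennreal (?w j) * (\<integral>\<^sup>+z. evid n j (far r j) z \<partial>P n) \<le> ennreal (?w j) * 1"
        by (intro mult_left_mono) auto
      then show "(\<integral>\<^sup>+z. ennreal (?w j) * evid n j (far r j) z \<partial>P n) \<le> ennreal (?w j)"
        by (simp add: nn_integral_cmult[OF em[OF j'(2)]])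
    qed
    finally show ?thesis .
  qed
  have Ecell: "(\<integral>\<^sup>+z. ennreal (sqrt (?w j)) * (ennreal (TR n (F j c) z) + evid n j (A j c) z * ennreal (1 / TR n (F j c) z) * ennreal (1 / d)) \<partial>P n)
     \<le> ennreal (sqrt (?w j) * (1 + 1 / d) * \<rho> j c)" if jc: "j \<in> Js" "c \<in> I j" for j c
  proof -
    have jJ: "j \<in> Jset" using jc Js by auto
    have E2: "(\<integral>\<^sup>+z. evid n j (A j c) z * ennreal (1 / TR n (F j c) z) \<partial>P n) \<le> ennreal (\<rho> j c)"
    proof (rule expectation_evid[OF jJ])
      show "A j c \<in> sets (lebesgue_R (mdim j))" using A[OF jc] by blast
      show "(\<lambda>z. ennreal (1 / TR n (F j c) z)) \<in> borel_measurable (P n)" by (rule m1'[OF jc])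
      fix \<theta> assume "\<theta> \<in> A j c"
      from \<rho>2[OF jc this] show "(\<integral>\<^sup>+z. ennreal (LR n (f_spline j \<theta>) z) * ennreal (1 / TR n (F j c) z) \<partial>P n) \<le> ennreal (\<rho> j c)"
        using LR_pos TR_pos by (simp add: ennreal_mult[symmetric] less_imp_le)
    qed
    have "(\<integral>\<^sup>+z. ennreal (sqrt (?w j)) * (ennreal (TR n (F j c) z) + evid n j (A j c) z * ennreal (1 / TR n (F j c) z) * ennreal (1 / d)) \<partial>P n)
      = ennreal (sqrt (?w j)) * ((\<integral>\<^sup>+z. ennreal (TR n (F j c) z) \<partial>P n) + (\<integral>\<^sup>+z. evid n j (A j c) z * ennreal (1 / TR n (F j c) z) \<partial>P n) * ennreal (1 / d))"
      using m1[OF jc] m2[OF jc] by (simp add: nn_integral_cmult nn_integral_add nn_integral_multc)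
    also have "\<dots> \<le> ennreal (sqrt (?w j)) * (ennreal (\<rho> j c) + ennreal (\<rho> j c) * ennreal (1 / d))"
      by (intro mult_left_mono add_mono mult_right_mono \<rho>1[OF jc] E2) auto
    also have "\<dots> = ennreal (sqrt (?w j) * (1 + 1 / d) * \<rho> j c)"
    proof -
      have "ennreal (\<rho> j c) + ennreal (\<rho> j c) * ennreal (1 / d) = ennreal ((1 + 1 / d) * \<rho> j c)"
        using \<rho>0[of j c] d by (simp add: ennreal_mult[symmetric] ennreal_plus[symmetric] field_simps del: ennreal_plus)
      then show ?thesis using \<rho>0[of j c] d weight_nonneg[of j] by (simp add: ennreal_mult[symmetric] mult.assoc)
    qed
    finally show ?thesis .
  qed
  have EG: "(\<integral>\<^sup>+z. G z \<partial>P n) \<le> (\<integral>\<^sup>+j. ennreal (?w j) \<partial>count_space (Jset - Js)) * ennreal (1 / d) +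
       (\<Sum>j\<in>Js. \<Sum>c\<in>I j. ennreal (sqrt (?w j) * (1 + 1 / d) * \<rho> j c))"
  proof -
    have "(\<integral>\<^sup>+z. G z \<partial>P n) = (\<integral>\<^sup>+z. big z * ennreal (1 / d) \<partial>P n) + (\<integral>\<^sup>+z. (\<Sum>j\<in>Js. \<Sum>c\<in>I j. ennreal (sqrt (?w j)) *
     (ennreal (TR n (F j c) z) + evid n j (A j c) z * ennreal (1 / TR n (F j c) z) * ennreal (1 / d))) \<partial>P n)"
      unfolding G_def by (rule nn_integral_add[OF mB mS])
    also have "(\<integral>\<^sup>+z. (\<Sum>j\<in>Js. \<Sum>c\<in>I j. ennreal (sqrt (?w j)) *
     (ennreal (TR n (F j c) z) + evid n j (A j c) z * ennreal (1 / TR n (F j c) z) * ennreal (1 / d))) \<partial>P n)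
      = (\<Sum>j\<in>Js. \<Sum>c\<in>I j. \<integral>\<^sup>+z. ennreal (sqrt (?w j)) *
     (ennreal (TR n (F j c) z) + evid n j (A j c) z * ennreal (1 / TR n (F j c) z) * ennreal (1 / d)) \<partial>P n)"
      by (subst nn_integral_sum, intro borel_measurable_sum m3) (auto intro!: sum.cong nn_integral_sum m3)
    also have "(\<integral>\<^sup>+z. big z * ennreal (1 / d) \<partial>P n) = (\<integral>\<^sup>+z. big z \<partial>P n) * ennreal (1 / d)" by (rule nn_integral_multc[OF mbig])
    finally show ?thesis using Ebig Ecell by (auto intro!: add_mono sum_mono mult_right_mono)
  qed
  have "{z \<in> space (P n). posterior_far M \<sigma> fo n r z > \<delta>} \<subseteq>
     {z \<in> space (P n). post_num n (Theta M) z < ennreal d} \<union> {z \<in> space (P n). 1 \<le> ennreal (1 / \<delta>) * G z}"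
  proof
    fix z assume z: "z \<in> {z \<in> space (P n). posterior_far M \<sigma> fo n r z > \<delta>}"
    show "z \<in> {z \<in> space (P n). post_num n (Theta M) z < ennreal d} \<union> {z \<in> space (P n). 1 \<le> ennreal (1 / \<delta>) * G z}"
    proof (cases "post_num n (Theta M) z < ennreal d")
      case False
      then have "ennreal \<delta> \<le> G z" using z by (intro pw) auto
      then have "ennreal (1 / \<delta>) * ennreal \<delta> \<le> ennreal (1 / \<delta>) * G z" by (rule mult_left_mono) simp
      then have "1 \<le> ennreal (1 / \<delta>) * G z" using \<delta> by (simp add: ennreal_mult[symmetric])
      then show ?thesis using z by blast
    qed (use z in auto)
  qed
  note sub = this
  have mD: "post_num n (Theta M) \<in> borel_measurable (P n)" by (intro post_num_measurable Theta_measurable)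
  have s1: "{z \<in> space (P n). post_num n (Theta M) z < ennreal d} \<in> sets (P n)" using mD by measurable
  have s2: "{z \<in> space (P n). 1 \<le> ennreal (1 / \<delta>) * G z} \<in> sets (P n)" using mG by measurable
  have "emeasure (P n) {z \<in> space (P n). posterior_far M \<sigma> fo n r z > \<delta>} \<le>
     emeasure (P n) {z \<in> space (P n). post_num n (Theta M) z < ennreal d} + emeasure (P n) {z \<in> space (P n). 1 \<le> ennreal (1 / \<delta>) * G z}"
    by (rule order_trans[OF emeasure_mono[OF sub sets.Un[OF s1 s2]] emeasure_subadditive[OF s1 s2]])
  also have "emeasure (P n) {z \<in> space (P n). 1 \<le> ennreal (1 / \<delta>) * G z} \<le> ennreal (1 / \<delta>) * (\<integral>\<^sup>+z. G z \<partial>P n)"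
    by (rule Markov_inequality_space[OF mG])
  also have "ennreal (1 / \<delta>) * (\<integral>\<^sup>+z. G z \<partial>P n) \<le> ennreal (1 / \<delta>) * ((\<integral>\<^sup>+j. ennreal (?w j) \<partial>count_space (Jset - Js)) * ennreal (1 / d) +
       (\<Sum>j\<in>Js. \<Sum>c\<in>I j. ennreal (sqrt (?w j) * (1 + 1 / d) * \<rho> j c)))"
    by (intro mult_left_mono EG) simp
  finally show ?thesis by (simp add: add_left_mono)
qed

text \<open>The inverse likelihood ratio has an explicit Gaussian expectation, which the uniform
  distance \<Delta> controls; hence a first moment is enough. Small evidence forces the average
  \<open>V\<close> of the inverse ratio over U to be at least mass / \<tau>.\<close>

lemma evidence_lower_bound:
  assumes j: "j \<in> Jset" and U: "U \<in> sets (lebesgue_R (mdim j))" "U \<subseteq> Theta M j"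
    and u: "u > 0" "emeasure (pi_prior M j) U \<ge> ennreal u" and \<tau>: "\<tau> > 0" and \<Delta>: "\<Delta> \<ge> 0"
    and near: "\<And>\<theta> x. \<theta> \<in> U \<Longrightarrow> x \<in> {0<..<1} \<Longrightarrow> \<bar>f_spline j \<theta> x - fo x\<bar> \<le> \<Delta>"
  shows "emeasure (P n) {z \<in> space (P n). post_num n (Theta M) z < ennreal (weight M \<sigma> j * u * \<tau>)}
     \<le> ennreal (\<tau> * exp (real n * \<Delta>\<^sup>2 / \<sigma>\<^sup>2))"
proof -
  interpret \<pi>: finite_measure "pi_prior M j" by (rule finite_measure_pi_prior[OF j])
  interpret Pn: prob_space "P n" by (rule prob_P)
  interpret pair_sigma_finite "P n" "pi_prior M j" ..
  interpret X: prob_space mu_X by (rule prob_space_mu_X)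
  have US: "U \<in> sets (pi_prior M j)" using U(1) by (simp add: sets_pi_prior)
  define p where "p = measure (pi_prior M j) U"
  have p: "emeasure (pi_prior M j) U = ennreal p" by (simp add: p_def \<pi>.emeasure_eq_measure)
  have pu: "p \<ge> u" using u(2) unfolding p using u(1) by (simp add: ennreal_le_iff2)
  define V where "V z = (\<integral>\<^sup>+\<theta>. ennreal (1 / LR n (f_spline j \<theta>) z) * indicator U \<theta> \<partial>pi_prior M j)" for z
  have eq: "sets (P n \<Otimes>\<^sub>M pi_prior M j) = sets (data_space n \<Otimes>\<^sub>M lebesgue_R (mdim j))"
    by (rule sets_pair_measure_cong[OF sets_P sets_pi_prior])
  have "(\<lambda>p. ennreal (1 / (case p of (z, \<theta>) \<Rightarrow> LR n (f_spline j \<theta>) z))) \<in> borel_measurable (data_space n \<Otimes>\<^sub>M lebesgue_R (mdim j))"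
    using LR_pair_measurable[of n j] by measurable
  then have mi: "(\<lambda>p. ennreal (1 / LR n (f_spline j (snd p)) (fst p))) \<in> borel_measurable (P n \<Otimes>\<^sub>M pi_prior M j)"
    unfolding measurable_cong_sets[OF eq refl] split_beta .
  have "indicator U \<in> borel_measurable (pi_prior M j)" using US by simp
  then have "(\<lambda>p. indicator U (snd p) :: ennreal) \<in> borel_measurable (P n \<Otimes>\<^sub>M pi_prior M j)"
    by (rule measurable_compose[OF measurable_snd])
  from borel_measurable_times_ennreal[OF mi this]
  have mV: "(\<lambda>(z, \<theta>). ennreal (1 / LR n (f_spline j \<theta>) z) * indicator U \<theta>) \<in> borel_measurable (P n \<Otimes>\<^sub>M pi_prior M j)"
    by (simp add: split_beta)
  have VM: "V \<in> borel_measurable (P n)"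
    unfolding V_def[abs_def] using \<pi>.borel_measurable_nn_integral[OF mV] by simp
  have EV: "(\<integral>\<^sup>+z. V z \<partial>P n) \<le> ennreal (exp (real n * \<Delta>\<^sup>2 / \<sigma>\<^sup>2)) * ennreal p"
  proof -
    have "(\<integral>\<^sup>+z. V z \<partial>P n) = (\<integral>\<^sup>+\<theta>. \<integral>\<^sup>+z. ennreal (1 / LR n (f_spline j \<theta>) z) * indicator U \<theta> \<partial>P n \<partial>pi_prior M j)"
      unfolding V_def using Fubini[OF mV] by simp
    also have "\<dots> \<le> (\<integral>\<^sup>+\<theta>. ennreal (exp (real n * \<Delta>\<^sup>2 / \<sigma>\<^sup>2)) * indicator U \<theta> \<partial>pi_prior M j)"
    proof (rule nn_integral_mono)
      fix \<theta>
      show "(\<integral>\<^sup>+z. ennreal (1 / LR n (f_spline j \<theta>) z) * indicator U \<theta> \<partial>P n) \<le> ennreal (exp (real n * \<Delta>\<^sup>2 / \<sigma>\<^sup>2)) * indicator U \<theta>"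
      proof (cases "\<theta> \<in> U")
        case True
        have "(\<integral>\<^sup>+x. ennreal (exp ((f_spline j \<theta> x - fo x)\<^sup>2 / \<sigma>\<^sup>2)) \<partial>mu_X) \<le> (\<integral>\<^sup>+x. ennreal (exp (\<Delta>\<^sup>2 / \<sigma>\<^sup>2)) \<partial>mu_X)"
        proof (rule nn_integral_mono_AE)
          show "AE x in mu_X. ennreal (exp ((f_spline j \<theta> x - fo x)\<^sup>2 / \<sigma>\<^sup>2)) \<le> ennreal (exp (\<Delta>\<^sup>2 / \<sigma>\<^sup>2))"
            using AE_mu_X_open
          proof eventually_elim
            case (elim x)
            have "(f_spline j \<theta> x - fo x)\<^sup>2 \<le> \<Delta>\<^sup>2" using power_mono[OF near[OF True elim], of 2] by simp
            then show ?case by (intro ennreal_leI) (simp add: divide_right_mono)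
          qed
        qed
        also have "\<dots> = ennreal (exp (\<Delta>\<^sup>2 / \<sigma>\<^sup>2))" using X.emeasure_space_1 by simp
        finally have "(\<integral>\<^sup>+x. ennreal (exp ((f_spline j \<theta> x - fo x)\<^sup>2 / \<sigma>\<^sup>2)) \<partial>mu_X) ^ n \<le> ennreal (exp (\<Delta>\<^sup>2 / \<sigma>\<^sup>2)) ^ n"
          by (intro power_mono) auto
        also have "\<dots> = ennreal (exp (real n * \<Delta>\<^sup>2 / \<sigma>\<^sup>2))" by (simp add: ennreal_power exp_of_nat_mult[symmetric])
        finally show ?thesis using True by (simp add: expectation_inverse_LR[OF f_spline_measurable])
      qed simp
    qed
    also have "\<dots> = ennreal (exp (real n * \<Delta>\<^sup>2 / \<sigma>\<^sup>2)) * ennreal p"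
      using US p by (simp add: nn_integral_cmult)
    finally show ?thesis .
  qed
  have pw: "1 \<le> ennreal (\<tau> / p) * V z" if z: "z \<in> space (P n)" and less: "post_num n (Theta M) z < ennreal (weight M \<sigma> j * u * \<tau>)" for z
  proof (rule ccontr)
    assume not: "\<not> ?thesis"
    have p0: "p > 0" using pu u by simp
    have z': "z \<in> space (data_space n)" using z by (simp add: space_P)
    have [measurable]: "(\<lambda>\<theta>. LR n (f_spline j \<theta>) z) \<in> borel_measurable (pi_prior M j)" by (rule LR_coef_measurable[OF z'])
    note [measurable] = US
    have "ennreal (weight M \<sigma> j) * evid n j U z \<le> ennreal (weight M \<sigma> j) * evid n j (Theta M j) z"
      by (intro mult_left_mono evid_mono U) simp
    also have "\<dots> \<le> post_num n (Theta M) z" by (rule weight_evid_le_post_num[OF j])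
    also have "\<dots> < ennreal (weight M \<sigma> j) * ennreal (u * \<tau>)" using less u \<tau> weight_nonneg[of j] by (simp add: ennreal_mult[symmetric] mult.assoc)
    finally have "evid n j U z < ennreal (u * \<tau>)"
      by (meson linorder_not_less mult_left_mono zero_le)
    also have "\<dots> \<le> ennreal (p * \<tau>)" using pu \<tau> by (intro ennreal_leI mult_right_mono) auto
    finally obtain e where e: "evid n j U z = ennreal e" "e \<ge> 0" "e < p * \<tau>"
      by (cases "evid n j U z") (auto simp: ennreal_less_iff)
    have "V z < top"
    proof (rule ccontr)
      assume "\<not> V z < top"
      then have "V z = top" by (metis top.not_eq_extremum)
      then show False using not p0 \<tau> by (simp add: ennreal_mult_top)
    qed
    then obtain v where v: "V z = ennreal v" "v \<ge> 0" by (cases "V z") auto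
    have "\<tau> / p * v < 1" using not p0 \<tau> v by (simp add: ennreal_mult[symmetric] not_le ennreal_less_iff flip: ennreal_1)
    then have vp: "v < p / \<tau>" using p0 \<tau> by (simp add: field_simps)
    have "(\<integral>\<^sup>+\<theta>. ennreal (2 / \<tau>) * indicator U \<theta> \<partial>pi_prior M j)
       \<le> (\<integral>\<^sup>+\<theta>. ennreal (1 / LR n (f_spline j \<theta>) z) * indicator U \<theta> + ennreal (1 / \<tau>\<^sup>2) * (ennreal (LR n (f_spline j \<theta>) z) * indicator U \<theta>) \<partial>pi_prior M j)"
    \<comment> \<open>Integrated over U, (l - \<tau>)^2 \<ge> 0 bounds 2 p / \<tau> by a sum of two
      averages, each of which would be strictly below p / \<tau>.\<close>
    proof (rule nn_integral_mono)
      fix \<theta>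
      let ?l = "LR n (f_spline j \<theta>) z"
      have l: "?l > 0" by (rule LR_pos)
      have "0 \<le> (?l - \<tau>)\<^sup>2 / (?l * \<tau>\<^sup>2)" using l by simp
      also have "(?l - \<tau>)\<^sup>2 / (?l * \<tau>\<^sup>2) = 1 / ?l + 1 / \<tau>\<^sup>2 * ?l - 2 / \<tau>"
        using l \<tau> by (simp add: field_simps power2_eq_square)
      finally have "ennreal (2 / \<tau>) \<le> ennreal (1 / ?l + 1 / \<tau>\<^sup>2 * ?l)" by (intro ennreal_leI) simp
      also have "\<dots> = ennreal (1 / ?l) + ennreal (1 / \<tau>\<^sup>2) * ennreal ?l" using l by (simp add: ennreal_mult[symmetric] ennreal_plus[symmetric] del: ennreal_plus)
      finally show "ennreal (2 / \<tau>) * indicator U \<theta> \<le> ennreal (1 / ?l) * indicator U \<theta> + ennreal (1 / \<tau>\<^sup>2) * (ennreal ?l * indicator U \<theta>)"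
        by (cases "\<theta> \<in> U") auto
    qed
    also have "\<dots> = V z + ennreal (1 / \<tau>\<^sup>2) * evid n j U z"
      unfolding V_def evid_def by (subst nn_integral_add) (auto simp: nn_integral_cmult)
    also have "\<dots> = ennreal (v + 1 / \<tau>\<^sup>2 * e)" using v e by (simp add: ennreal_mult[symmetric] ennreal_plus[symmetric] del: ennreal_plus)
    also have "(\<integral>\<^sup>+\<theta>. ennreal (2 / \<tau>) * indicator U \<theta> \<partial>pi_prior M j) = ennreal (2 / \<tau> * p)"
      using p \<tau> p0 by (simp add: nn_integral_cmult ennreal_mult[symmetric])
    finally have "2 / \<tau> * p \<le> v + 1 / \<tau>\<^sup>2 * e" using v e \<tau> by (subst (asm) ennreal_le_iff) auto
    moreover have "1 / \<tau>\<^sup>2 * e < 1 / \<tau>\<^sup>2 * (p * \<tau>)" using e \<tau> by (intro mult_strict_left_mono) auto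
    moreover have "1 / \<tau>\<^sup>2 * (p * \<tau>) = p / \<tau>" using \<tau> by (simp add: power2_eq_square)
    moreover have "2 / \<tau> * p = p / \<tau> + p / \<tau>" by simp
    ultimately show False using vp by linarith
  qed
  have p0: "p > 0" using pu u by simp
  have "emeasure (P n) {z \<in> space (P n). post_num n (Theta M) z < ennreal (weight M \<sigma> j * u * \<tau>)} \<le> emeasure (P n) {z \<in> space (P n). 1 \<le> ennreal (\<tau> / p) * V z}"
    using VM pw by (intro emeasure_mono) auto
  also have "\<dots> \<le> ennreal (\<tau> / p) * (\<integral>\<^sup>+z. V z \<partial>P n)"
    by (rule Markov_inequality_space[OF VM])
  also have "\<dots> \<le> ennreal (\<tau> / p) * (ennreal (exp (real n * \<Delta>\<^sup>2 / \<sigma>\<^sup>2)) * ennreal p)"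
    by (intro mult_left_mono EV) simp
  also have "\<dots> = ennreal (\<tau> / p * (exp (real n * \<Delta>\<^sup>2 / \<sigma>\<^sup>2) * p))"
    using \<tau> p0 by (simp add: ennreal_mult[symmetric])
  also have "\<tau> / p * (exp (real n * \<Delta>\<^sup>2 / \<sigma>\<^sup>2) * p) = \<tau> * exp (real n * \<Delta>\<^sup>2 / \<sigma>\<^sup>2)" using p0 by simp
  finally show ?thesis .
qed

end

subsection \<open>Orthogonalization in \<open>L\<^sub>2\<close>\<close>

definition bdd_meas :: "(real \<Rightarrow> real) \<Rightarrow> bool" where
  "bdd_meas f \<longleftrightarrow> f \<in> borel_measurable mu_X \<and> (\<exists>B. \<forall>x\<in>{0..1}. \<bar>f x\<bar> \<le> B)"

lemma bdd_measI: "f \<in> borel_measurable mu_X \<Longrightarrow> (\<And>x. x \<in> {0..1} \<Longrightarrow> \<bar>f x\<bar> \<le> B) \<Longrightarrow> bdd_meas f"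
  unfolding bdd_meas_def by blast

lemma bdd_meas_const: "bdd_meas (\<lambda>x. c)"
  by (rule bdd_measI[of _ "\<bar>c\<bar>"]) auto

lemma bdd_meas_mult: "bdd_meas f \<Longrightarrow> bdd_meas g \<Longrightarrow> bdd_meas (\<lambda>x. f x * g x)"
proof -
  assume f: "bdd_meas f" and g: "bdd_meas g"
  obtain B where B: "\<And>x. x\<in>{0..1} \<Longrightarrow> \<bar>f x\<bar> \<le> B" using f unfolding bdd_meas_def by blast
  obtain C where C: "\<And>x. x\<in>{0..1} \<Longrightarrow> \<bar>g x\<bar> \<le> C" using g unfolding bdd_meas_def by blast
  have "\<bar>f x * g x\<bar> \<le> \<bar>B\<bar> * \<bar>C\<bar>" if "x \<in> {0..1}" for x
    unfolding abs_mult using B[OF that] C[OF that] by (intro mult_mono) auto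
  then show ?thesis using f g by (intro bdd_measI) (auto simp: bdd_meas_def)
qed

lemma bdd_meas_add: "bdd_meas f \<Longrightarrow> bdd_meas g \<Longrightarrow> bdd_meas (\<lambda>x. f x + g x)"
proof -
  assume f: "bdd_meas f" and g: "bdd_meas g"
  obtain B where B: "\<And>x. x\<in>{0..1} \<Longrightarrow> \<bar>f x\<bar> \<le> B" using f unfolding bdd_meas_def by blast
  obtain C where C: "\<And>x. x\<in>{0..1} \<Longrightarrow> \<bar>g x\<bar> \<le> C" using g unfolding bdd_meas_def by blast
  have "\<bar>f x + g x\<bar> \<le> B + C" if "x \<in> {0..1}" for x
    using B[OF that] C[OF that] by linarith
  then show ?thesis using f g by (intro bdd_measI) (auto simp: bdd_meas_def)
qed

lemma bdd_meas_cmult: "bdd_meas f \<Longrightarrow> bdd_meas (\<lambda>x. c * f x)"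
  by (intro bdd_meas_mult bdd_meas_const)

lemma bdd_meas_diff: "bdd_meas f \<Longrightarrow> bdd_meas g \<Longrightarrow> bdd_meas (\<lambda>x. f x - g x)"
  using bdd_meas_add[of f "\<lambda>x. (-1) * g x"] bdd_meas_cmult[of g "-1"] by simp

lemma bdd_meas_sum: "(\<And>i. i \<in> I \<Longrightarrow> bdd_meas (f i)) \<Longrightarrow> bdd_meas (\<lambda>x. \<Sum>i\<in>I. f i x)"
proof (induction I rule: infinite_finite_induct)
  case (insert i I)
  then have "bdd_meas (\<lambda>x. f i x + (\<Sum>i\<in>I. f i x))" by (intro bdd_meas_add) auto
  then show ?case using insert by simp
qed (simp_all add: bdd_meas_const)

lemma bdd_meas_integrable: "bdd_meas f \<Longrightarrow> integrable mu_X f"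
proof -
  assume f: "bdd_meas f"
  interpret X: prob_space mu_X by (rule prob_space_mu_X)
  obtain B where B: "\<And>x. x\<in>{0..1} \<Longrightarrow> \<bar>f x\<bar> \<le> B" using f unfolding bdd_meas_def by blast
  show ?thesis by (rule X.integrable_const_bound[of _ B]) (use B f in \<open>auto simp: bdd_meas_def\<close>)
qed

definition L2_inner :: "(real \<Rightarrow> real) \<Rightarrow> (real \<Rightarrow> real) \<Rightarrow> real" where
  "L2_inner f g = (\<integral>x. f x * g x \<partial>mu_X)"

lemma L2_inner_commute: "L2_inner f g = L2_inner g f"
  by (simp add: L2_inner_def mult.commute)

lemma L2_inner_cmult: "L2_inner (\<lambda>x. c * f x) h = c * L2_inner f h"
  unfolding L2_inner_def by (simp add: mult.assoc)

lemma L2_inner_diff: "bdd_meas f \<Longrightarrow> bdd_meas g \<Longrightarrow> bdd_meas h \<Longrightarrow> L2_inner (\<lambda>x. f x - g x) h = L2_inner f h - L2_inner g h"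
  unfolding L2_inner_def left_diff_distrib by (intro Bochner_Integration.integral_diff bdd_meas_integrable bdd_meas_mult)

lemma L2_inner_sum: "(\<And>i. i \<in> I \<Longrightarrow> bdd_meas (f i)) \<Longrightarrow> bdd_meas h \<Longrightarrow> L2_inner (\<lambda>x. \<Sum>i\<in>I. f i x) h = (\<Sum>i\<in>I. L2_inner (f i) h)"
  unfolding L2_inner_def sum_distrib_right by (intro Bochner_Integration.integral_sum bdd_meas_integrable bdd_meas_mult)

lemma L2_inner_cong_AE:
  assumes "bdd_meas f" "bdd_meas g" "bdd_meas h" "AE x in mu_X. f x = g x"
  shows "L2_inner f h = L2_inner g h"
  unfolding L2_inner_def
  by (rule integral_cong_AE) (use assms in \<open>auto simp: bdd_meas_def\<close>)

lemma L2_inner_self_nonneg: "L2_inner f f \<ge> 0"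
  unfolding L2_inner_def by (intro integral_nonneg_AE AE_I2) simp

lemma L2_inner_self_eq_0:
  assumes "bdd_meas f" "L2_inner f f = 0"
  shows "AE x in mu_X. f x = 0"
proof -
  have "AE x in mu_X. f x * f x = 0"
    using integral_nonneg_eq_0_iff_AE[of mu_X "\<lambda>x. f x * f x"] bdd_meas_integrable[OF bdd_meas_mult[OF assms(1,1)]] assms(2)
    by (simp add: L2_inner_def)
  then show ?thesis by simp
qed

lemma L2_norm_ip: "(L2_norm f)\<^sup>2 = L2_inner f f"
proof -
  have "0 \<le> (\<integral>x. (f x)\<^sup>2 \<partial>mu_X)" by (intro integral_nonneg_AE AE_I2) simp
  then show ?thesis by (simp add: L2_norm_def L2_inner_def power2_eq_square)
qed

text \<open>Degenerate vectors are replaced by the zero function, so no linear independence is needed.\<close>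
definition ortho :: "nat \<Rightarrow> (nat \<Rightarrow> real \<Rightarrow> real) \<Rightarrow> bool" where
  "ortho m g \<longleftrightarrow> (\<forall>i\<in>{1..m}. bdd_meas (g i) \<and> (g i = (\<lambda>_. 0) \<or> L2_inner (g i) (g i) = 1)) \<and>
     (\<forall>i\<in>{1..m}. \<forall>k\<in>{1..m}. i \<noteq> k \<longrightarrow> L2_inner (g i) (g k) = 0)"

lemma orthoD:
  assumes "ortho m g" "i \<in> {1..m}"
  shows "bdd_meas (g i)" "g i = (\<lambda>_. 0) \<or> L2_inner (g i) (g i) = 1" "\<And>k. k \<in> {1..m} \<Longrightarrow> i \<noteq> k \<Longrightarrow> L2_inner (g i) (g k) = 0"
  using assms unfolding ortho_def by blast+

lemma L2_inner_zero: "L2_inner (\<lambda>_. 0) h = 0" "L2_inner h (\<lambda>_. 0) = 0"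
  by (simp_all add: L2_inner_def)

lemma L2_inner_projection:
  assumes g: "ortho m g" and h: "bdd_meas h" and k: "k \<in> {1..m}"
  shows "L2_inner (\<lambda>x. \<Sum>i=1..m. L2_inner h (g i) * g i x) (g k) = L2_inner h (g k)"
proof -
  have "L2_inner (\<lambda>x. \<Sum>i=1..m. L2_inner h (g i) * g i x) (g k) = (\<Sum>i=1..m. L2_inner (\<lambda>x. L2_inner h (g i) * g i x) (g k))"
    by (intro L2_inner_sum bdd_meas_cmult orthoD(1)[OF g] k)
  also have "\<dots> = (\<Sum>i=1..m. L2_inner h (g i) * L2_inner (g i) (g k))" by (simp only: L2_inner_cmult)
  also have "\<dots> = (\<Sum>i=1..m. if i = k then L2_inner h (g k) else 0)"
  proof (intro sum.cong refl)
    fix i assume i: "i \<in> {1..m}"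
    show "L2_inner h (g i) * L2_inner (g i) (g k) = (if i = k then L2_inner h (g k) else 0)"
    proof (cases "i = k")
      case True
      then show ?thesis using orthoD(2)[OF g k] by (auto simp: L2_inner_zero)
    next
      case False
      then show ?thesis using orthoD(3)[OF g i k] by simp
    qed
  qed
  also have "\<dots> = L2_inner h (g k)" using k by simp
  finally show ?thesis .
qed

lemma L2_inner_residual:
  assumes g: "ortho m g" and h: "bdd_meas h" and k: "k \<in> {1..m}"
  shows "L2_inner (\<lambda>x. h x - (\<Sum>i=1..m. L2_inner h (g i) * g i x)) (g k) = 0"
proof -
  have "bdd_meas (\<lambda>x. \<Sum>i=1..m. L2_inner h (g i) * g i x)" by (intro bdd_meas_sum bdd_meas_cmult orthoD(1)[OF g])
  from L2_inner_diff[OF h this orthoD(1)[OF g k]] L2_inner_projection[OF g h k] show ?thesis by simp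
qed

lemma bessel:
  assumes g: "ortho m g" and h: "bdd_meas h"
  shows "(\<Sum>i=1..m. (L2_inner h (g i))\<^sup>2) \<le> L2_inner h h"
proof -
  let ?p = "\<lambda>x. \<Sum>i=1..m. L2_inner h (g i) * g i x" and ?r = "\<lambda>x. h x - (\<Sum>i=1..m. L2_inner h (g i) * g i x)"
  have p: "bdd_meas ?p" by (intro bdd_meas_sum bdd_meas_cmult orthoD(1)[OF g])
  have r: "bdd_meas ?r" by (intro bdd_meas_diff h p)
  have rp: "L2_inner ?p ?r = 0"
  proof -
    have "L2_inner ?p ?r = (\<Sum>i=1..m. L2_inner h (g i) * L2_inner (g i) ?r)"
      using r orthoD(1)[OF g] by (subst L2_inner_sum) (auto simp: L2_inner_cmult bdd_meas_cmult)
    also have "\<dots> = 0" using L2_inner_residual[OF g h] by (intro sum.neutral ballI) (simp add: L2_inner_commute)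
    finally show ?thesis .
  qed
  have "L2_inner h ?p = (\<Sum>i=1..m. (L2_inner h (g i))\<^sup>2)"
  proof -
    have "L2_inner ?p h = (\<Sum>i=1..m. L2_inner h (g i) * L2_inner (g i) h)"
      using h orthoD(1)[OF g] by (subst L2_inner_sum) (auto simp: L2_inner_cmult bdd_meas_cmult)
    then show ?thesis by (simp add: L2_inner_commute power2_eq_square)
  qed
  moreover have "L2_inner ?p ?p = L2_inner h ?p"
    using rp L2_inner_diff[OF h p p] by (simp add: L2_inner_commute)
  moreover have "L2_inner ?r ?r = L2_inner h h - L2_inner h ?p"
  proof -
    have "L2_inner ?r ?r = L2_inner h ?r - L2_inner ?p ?r" by (rule L2_inner_diff[OF h p r])
    also have "L2_inner h ?r = L2_inner ?r h" by (rule L2_inner_commute)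
    also have "L2_inner ?r h = L2_inner h h - L2_inner ?p h" by (rule L2_inner_diff[OF h p h])
    finally show ?thesis using rp by (simp add: L2_inner_commute)
  qed
  ultimately show ?thesis using L2_inner_self_nonneg[of ?r] by simp
qed

text \<open>The representation holds almost everywhere only, since a residual of norm zero need not
  vanish at every point.\<close>

lemma gram_schmidt:
  assumes "\<And>i. i \<in> {1..m} \<Longrightarrow> bdd_meas (\<phi> i)"
  shows "\<exists>g. ortho m g \<and> (\<forall>i\<in>{1..m}. AE x in mu_X. \<phi> i x = (\<Sum>k=1..m. L2_inner (\<phi> i) (g k) * g k x))"
  using assms
proof (induction m)
  case 0
  then show ?case by (simp add: ortho_def)
next
  case (Suc m)
  have "\<exists>g. ortho m g \<and> (\<forall>i\<in>{1..m}. AE x in mu_X. \<phi> i x = (\<Sum>k=1..m. L2_inner (\<phi> i) (g k) * g k x))"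
    by (rule Suc.IH) (rule Suc.prems, simp)
  then obtain g where g': "ortho m g \<and> (\<forall>i\<in>{1..m}. AE x in mu_X. \<phi> i x = (\<Sum>k=1..m. L2_inner (\<phi> i) (g k) * g k x))"
    by (elim exE)
  have g: "ortho m g" using g' by (rule conjunct1)
  let ?\<phi> = "\<phi> (Suc m)"
  have f: "bdd_meas ?\<phi>" using Suc.prems by simp
  define h where "h x = ?\<phi> x - (\<Sum>i=1..m. L2_inner ?\<phi> (g i) * g i x)" for x
  have h: "bdd_meas h" unfolding h_def[abs_def] by (intro bdd_meas_diff f bdd_meas_sum bdd_meas_cmult orthoD(1)[OF g])
  have hg: "L2_inner h (g k) = 0" if "k \<in> {1..m}" for k
    unfolding h_def[abs_def] by (rule L2_inner_residual[OF g f that])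
  define e where "e = (if L2_inner h h = 0 then (\<lambda>_. 0) else (\<lambda>x. (1 / sqrt (L2_inner h h)) * h x))"
  have e: "bdd_meas e" using bdd_meas_cmult[OF h, of "1 / sqrt (L2_inner h h)"] bdd_meas_const[of 0] by (simp add: e_def)
  have eh: "L2_inner e f = (1 / sqrt (L2_inner h h)) * L2_inner h f" if "L2_inner h h \<noteq> 0" for f
    using that L2_inner_cmult[of "1 / sqrt (L2_inner h h)" h f] by (simp add: e_def)
  have eg: "L2_inner e (g k) = 0" if "k \<in> {1..m}" for k
    using hg[OF that] L2_inner_cmult[of "1 / sqrt (L2_inner h h)" h "g k"] by (simp add: e_def L2_inner_zero)
  have ee: "e = (\<lambda>_. 0) \<or> L2_inner e e = 1"
  proof (cases "L2_inner h h = 0")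
    case False
    then have pos: "L2_inner h h > 0" using L2_inner_self_nonneg[of h] by linarith
    have "L2_inner e e = (1 / sqrt (L2_inner h h)) * ((1 / sqrt (L2_inner h h)) * L2_inner h h)"
      using eh[OF False, of e] eh[OF False, of h] L2_inner_commute[of h e] by simp
    also have "\<dots> = 1" using pos by simp
    finally show ?thesis by simp
  qed (simp add: e_def)
  define g2 where "g2 = g(Suc m := e)"
  have g2: "g2 i = g i" if "i \<in> {1..m}" for i using that by (simp add: g2_def)
  have g2S: "g2 (Suc m) = e" by (simp add: g2_def)
  have cases: "i \<in> {1..m} \<or> i = Suc m" if "i \<in> {1..Suc m}" for i using that by auto
  have ortho2: "ortho (Suc m) g2"
    unfolding ortho_def
  proof (intro conjI ballI impI)
    fix i assume i: "i \<in> {1..Suc m}"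
    show "bdd_meas (g2 i)" using cases[OF i] orthoD(1)[OF g] e by (auto simp: g2 g2S)
    show "g2 i = (\<lambda>_. 0) \<or> L2_inner (g2 i) (g2 i) = 1" 
      using cases[OF i]
    proof
      assume a: "i \<in> {1..m}"
      show ?thesis unfolding g2[OF a] by (rule orthoD(2)[OF g a])
    qed (use ee in \<open>simp add: g2S\<close>)
    fix k assume k: "k \<in> {1..Suc m}" and ne: "i \<noteq> k"
    from cases[OF i] cases[OF k] show "L2_inner (g2 i) (g2 k) = 0"
    proof (elim disjE)
      assume a: "i \<in> {1..m}" "k \<in> {1..m}"
      show ?thesis unfolding g2[OF a(1)] g2[OF a(2)] by (rule orthoD(3)[OF g a ne])
    next
      assume a: "i \<in> {1..m}" "k = Suc m"
      show ?thesis unfolding a(2) g2[OF a(1)] g2S using eg[OF a(1)] by (simp add: L2_inner_commute)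
    next
      assume a: "i = Suc m" "k \<in> {1..m}"
      show ?thesis unfolding a(1) g2[OF a(2)] g2S by (rule eg[OF a(2)])
    qed (use ne in auto)
  qed
  have split: "(\<Sum>k=1..Suc m. L2_inner f (g2 k) * g2 k x) = (\<Sum>k=1..m. L2_inner f (g k) * g k x) + L2_inner f e * e x" for f x
    by (simp add: g2 g2S)
  have new: "AE x in mu_X. ?\<phi> x = (\<Sum>k=1..Suc m. L2_inner ?\<phi> (g2 k) * g2 k x)"
  proof -
    have fe: "L2_inner ?\<phi> e = L2_inner h e"
    proof -
      have "L2_inner h e = L2_inner ?\<phi> e - L2_inner (\<lambda>x. \<Sum>i=1..m. L2_inner ?\<phi> (g i) * g i x) e"
        unfolding h_def[abs_def] by (intro L2_inner_diff f e bdd_meas_sum bdd_meas_cmult orthoD(1)[OF g])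
      also have "L2_inner (\<lambda>x. \<Sum>i=1..m. L2_inner ?\<phi> (g i) * g i x) e = (\<Sum>i=1..m. L2_inner (\<lambda>x. L2_inner ?\<phi> (g i) * g i x) e)"
        by (intro L2_inner_sum bdd_meas_cmult orthoD(1)[OF g] e)
      also have "\<dots> = 0" using eg by (intro sum.neutral ballI) (simp add: L2_inner_cmult L2_inner_commute[of _ e])
      finally show ?thesis by simp
    qed
    have "AE x in mu_X. h x = L2_inner h e * e x"
    proof (cases "L2_inner h h = 0")
      case True
      then show ?thesis using L2_inner_self_eq_0[OF h True] by (simp add: e_def)
    next
      case False
      then have pos: "L2_inner h h > 0" using L2_inner_self_nonneg[of h] by linarith
      have "L2_inner h e = (1 / sqrt (L2_inner h h)) * L2_inner h h"
        using eh[OF False, of h] L2_inner_commute[of h e] by simp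
      then have "L2_inner h e * e x = h x" for x using pos False by (simp add: e_def)
      then show ?thesis by simp
    qed
    then show ?thesis
    proof eventually_elim
      case (elim x)
      then show ?case unfolding split fe using h_def[of x] by simp
    qed
  qed
  have old: "AE x in mu_X. \<phi> i x = (\<Sum>k=1..Suc m. L2_inner (\<phi> i) (g2 k) * g2 k x)" if i: "i \<in> {1..m}" for i
  proof -
    have ae: "AE x in mu_X. \<phi> i x = (\<Sum>k=1..m. L2_inner (\<phi> i) (g k) * g k x)" using g' i by blast
    have fi: "bdd_meas (\<phi> i)" using Suc.prems i by simp
    have "L2_inner (\<phi> i) e = L2_inner (\<lambda>x. \<Sum>k=1..m. L2_inner (\<phi> i) (g k) * g k x) e"
      by (rule L2_inner_cong_AE[OF fi _ e ae]) (intro bdd_meas_sum bdd_meas_cmult orthoD(1)[OF g])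
    also have "\<dots> = (\<Sum>k=1..m. L2_inner (\<lambda>x. L2_inner (\<phi> i) (g k) * g k x) e)"
      by (intro L2_inner_sum bdd_meas_cmult orthoD(1)[OF g] e)
    also have "\<dots> = 0" using eg by (intro sum.neutral ballI) (simp add: L2_inner_cmult L2_inner_commute[of _ e])
    finally show ?thesis using ae unfolding split by simp
  qed
  show ?case
    by (intro exI[of _ g2] conjI ortho2 ballI) (use old new cases in blast)
qed

lemma bdd_meas_B_spline: "bdd_meas (B_spline k q i)"
proof -
  obtain C where C: "\<And>x. x\<in>{0..1} \<Longrightarrow> \<bar>N_spline (knot k q) q i x\<bar> \<le> C" using N_spline_bounded by blast
  have "\<bar>B_spline k q i x\<bar> \<le> max C \<bar>B_spline k q i 1\<bar>" if "x \<in> {0..1}" for x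
    using C[OF that] by (cases "x = 1") (auto simp: B_spline_def)
  then show ?thesis by (intro bdd_measI measurable_mu_X_borel B_spline_measurable)
qed

text \<open>Split by sign: on each half the absolute value is injective, and a geometric series of
  ratio at most 1/2 contributes at most 2.\<close>

lemma sum_exp_int_le:
  fixes S :: "int set"
  assumes "finite S"
  shows "(\<Sum>z\<in>S. exp (- 2 * \<bar>real_of_int (z - c)\<bar>)) \<le> 4"
proof -
  have e2: "exp (- 2 :: real) \<le> 1 / 2"
  proof -
    have "(2::real) \<le> exp 2" using exp_ge_add_one_self[of "2::real"] by simp
    then show ?thesis by (simp add: exp_minus divide_simps)
  qed
  have half: "(\<Sum>z\<in>T. exp (- 2 * real (nat \<bar>z\<bar>))) \<le> 2" if T: "finite T" "inj_on (\<lambda>z. nat \<bar>z\<bar>) T" for T :: "int set"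
  proof -
    have sm: "summable (\<lambda>i. exp (- 2) ^ i :: real)" using e2 by (intro summable_geometric) simp
    have "(\<Sum>z\<in>T. exp (- 2 * real (nat \<bar>z\<bar>))) = (\<Sum>i\<in>(\<lambda>z. nat \<bar>z\<bar>) ` T. exp (- 2) ^ i)"
      unfolding sum.reindex[OF T(2)] comp_def by (intro sum.cong refl) (simp add: exp_of_nat_mult[symmetric] mult.commute)
    also have "\<dots> \<le> (\<Sum>i. exp (- 2) ^ i :: real)" by (rule sum_le_suminf[OF sm]) (use T in auto)
    also have "\<dots> = 1 / (1 - exp (- 2))" using e2 by (intro suminf_geometric) simp
    also have "\<dots> \<le> 2" using e2 by (simp add: divide_simps)
    finally show ?thesis .
  qed
  let ?T = "(\<lambda>z. z - c) ` S"
  have "(\<Sum>z\<in>S. exp (- 2 * \<bar>real_of_int (z - c)\<bar>)) = (\<Sum>z\<in>?T. exp (- 2 * real (nat \<bar>z\<bar>)))"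
    by (subst sum.reindex) (auto simp: inj_on_def)
  also have "?T = {z\<in>?T. z \<ge> 0} \<union> {z\<in>?T. z < 0}" by auto
  also have "(\<Sum>z\<in>{z\<in>?T. z \<ge> 0} \<union> {z\<in>?T. z < 0}. exp (- 2 * real (nat \<bar>z\<bar>)))
     = (\<Sum>z\<in>{z\<in>?T. z \<ge> 0}. exp (- 2 * real (nat \<bar>z\<bar>))) + (\<Sum>z\<in>{z\<in>?T. z < 0}. exp (- 2 * real (nat \<bar>z\<bar>)))"
    using assms by (intro sum.union_disjoint) auto
  also have "\<dots> \<le> 2 + 2"
    using assms by (intro add_mono half) (auto simp: inj_on_def)
  finally show ?thesis by simp
qed

context regression_law
begin

lemma bdd_meas_fo: "bdd_meas fo"
  by (rule bdd_measI[OF fo_meas fo_bound])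

lemma bdd_meas_f_spline: "bdd_meas (f_spline j \<theta>)"
proof -
  obtain k q L where j: "j = (k, q, L)" by (cases j) auto
  show ?thesis unfolding j f_spline.simps[abs_def] by (intro bdd_meas_sum bdd_meas_cmult bdd_meas_B_spline)
qed

text \<open>\<open>co i\<close> is the inner product with the i-th function of the orthonormalized
  B-splines. On splines the coordinates are isometric; \<open>fo\<close> need not lie in their span,
  so Bessel's inequality takes over. The last two facts serve to make the cells finite in number and
  measurable.\<close>

lemma spline_coordinates:
  obtains co :: "nat \<Rightarrow> (real \<Rightarrow> real) \<Rightarrow> real" where
    "\<And>\<theta> \<theta>'. (L2_norm (\<lambda>x. f_spline j \<theta> x - f_spline j \<theta>' x))\<^sup>2 = (\<Sum>i=1..mdim j. (co i (f_spline j \<theta>) - co i (f_spline j \<theta>'))\<^sup>2)"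
    "\<And>\<theta>. (\<Sum>i=1..mdim j. (co i (f_spline j \<theta>) - co i fo)\<^sup>2) \<le> (L2_norm (\<lambda>x. f_spline j \<theta> x - fo x))\<^sup>2"
    "\<And>\<theta> i. i \<in> {1..mdim j} \<Longrightarrow> (co i (f_spline j \<theta>))\<^sup>2 \<le> (L2_norm (f_spline j \<theta>))\<^sup>2"
    "\<And>i. (\<lambda>\<theta>. co i (f_spline j \<theta>)) \<in> borel_measurable (lebesgue_R (mdim j))"
proof -
  obtain k q L where j: "j = (k, q, L)" by (cases j) auto
  let ?m = "mdim j"
  define \<phi> where "\<phi> = B_spline k q"
  have \<phi>: "bdd_meas (\<phi> i)" for i unfolding \<phi>_def by (rule bdd_meas_B_spline)
  have m: "?m = k + q" using j by simp
  have fs: "f_spline j \<theta> = (\<lambda>x. \<Sum>i=1..?m. \<theta> i * \<phi> i x)" for \<theta>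
    unfolding j \<phi>_def by (rule ext) simp
  obtain g where g': "ortho ?m g \<and> (\<forall>i\<in>{1..?m}. AE x in mu_X. \<phi> i x = (\<Sum>k=1..?m. L2_inner (\<phi> i) (g k) * g k x))"
    using gram_schmidt[of ?m \<phi>, OF \<phi>] by (elim exE)
  have g: "ortho ?m g" using g' by (rule conjunct1)
  have L2_inner_fs: "L2_inner (f_spline j \<theta>) (g i) = (\<Sum>l=1..?m. \<theta> l * L2_inner (\<phi> l) (g i))" if "i \<in> {1..?m}" for \<theta> i
    unfolding fs using orthoD(1)[OF g that] \<phi> by (subst L2_inner_sum) (auto simp: L2_inner_cmult bdd_meas_cmult)
  have rep: "AE x in mu_X. f_spline j \<theta> x = (\<Sum>i=1..?m. L2_inner (f_spline j \<theta>) (g i) * g i x)" for \<theta>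
  proof -
    have "AE x in mu_X. \<forall>l\<in>{1..?m}. \<phi> l x = (\<Sum>k=1..?m. L2_inner (\<phi> l) (g k) * g k x)"
      using g' by (intro AE_finite_allI) auto
    then show ?thesis
    proof eventually_elim
      case (elim x)
      have "f_spline j \<theta> x = (\<Sum>l=1..?m. \<theta> l * (\<Sum>k=1..?m. L2_inner (\<phi> l) (g k) * g k x))"
        unfolding fs using elim by (intro sum.cong) auto
      also have "\<dots> = (\<Sum>k=1..?m. (\<Sum>l=1..?m. \<theta> l * L2_inner (\<phi> l) (g k)) * g k x)"
        unfolding sum_distrib_left sum_distrib_right by (subst sum.swap) (simp add: mult_ac)
      also have "\<dots> = (\<Sum>k=1..?m. L2_inner (f_spline j \<theta>) (g k) * g k x)"
        by (intro sum.cong refl) (simp add: L2_inner_fs)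
      finally show ?case .
    qed
  qed
  define co where "co i h = (if i \<in> {1..?m} then L2_inner h (g i) else 0)" for i h
  show ?thesis
  proof (rule that[of co])
    fix \<theta> \<theta>'
    let ?h = "\<lambda>x. f_spline j \<theta> x - f_spline j \<theta>' x"
    have h: "bdd_meas ?h" by (intro bdd_meas_diff bdd_meas_f_spline)
    have iph: "L2_inner ?h (g i) = L2_inner (f_spline j \<theta>) (g i) - L2_inner (f_spline j \<theta>') (g i)" if "i \<in> {1..?m}" for i
      by (intro L2_inner_diff bdd_meas_f_spline orthoD(1)[OF g that])
    have ae: "AE x in mu_X. ?h x = (\<Sum>i=1..?m. L2_inner ?h (g i) * g i x)"
      using rep[of \<theta>] rep[of \<theta>']
    proof eventually_elim
      case (elim x)
      have "(\<Sum>i=1..?m. L2_inner ?h (g i) * g i x) = (\<Sum>i=1..?m. L2_inner (f_spline j \<theta>) (g i) * g i x) - (\<Sum>i=1..?m. L2_inner (f_spline j \<theta>') (g i) * g i x)"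
        unfolding sum_subtractf[symmetric] by (intro sum.cong refl) (simp only: iph left_diff_distrib)
      then show ?case using elim by simp
    qed
    have "L2_inner ?h ?h = L2_inner (\<lambda>x. \<Sum>i=1..?m. L2_inner ?h (g i) * g i x) ?h"
      by (rule L2_inner_cong_AE[OF h _ h ae]) (intro bdd_meas_sum bdd_meas_cmult orthoD(1)[OF g])
    also have "\<dots> = (\<Sum>i=1..?m. L2_inner (\<lambda>x. L2_inner ?h (g i) * g i x) ?h)"
      by (intro L2_inner_sum bdd_meas_cmult orthoD(1)[OF g] h)
    also have "\<dots> = (\<Sum>i=1..?m. (co i (f_spline j \<theta>) - co i (f_spline j \<theta>'))\<^sup>2)"
    proof (intro sum.cong refl)
      fix i assume i: "i \<in> {1..?m}"
      have "L2_inner (\<lambda>x. L2_inner ?h (g i) * g i x) ?h = L2_inner ?h (g i) * L2_inner ?h (g i)"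
        by (simp only: L2_inner_cmult L2_inner_commute[of "g i"])
      then show "L2_inner (\<lambda>x. L2_inner ?h (g i) * g i x) ?h = (co i (f_spline j \<theta>) - co i (f_spline j \<theta>'))\<^sup>2"
        using i by (simp add: co_def iph power2_eq_square)
    qed
    finally show "(L2_norm ?h)\<^sup>2 = (\<Sum>i=1..?m. (co i (f_spline j \<theta>) - co i (f_spline j \<theta>'))\<^sup>2)"
      by (simp add: L2_norm_ip)
  next
    fix \<theta>
    let ?h = "\<lambda>x. f_spline j \<theta> x - fo x"
    have h: "bdd_meas ?h" by (intro bdd_meas_diff bdd_meas_f_spline bdd_meas_fo)
    have "(\<Sum>i=1..?m. (co i (f_spline j \<theta>) - co i fo)\<^sup>2) = (\<Sum>i=1..?m. (L2_inner ?h (g i))\<^sup>2)"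
    proof (intro sum.cong refl)
      fix i assume i: "i \<in> {1..?m}"
      have "L2_inner ?h (g i) = L2_inner (f_spline j \<theta>) (g i) - L2_inner fo (g i)"
        by (intro L2_inner_diff bdd_meas_f_spline bdd_meas_fo orthoD(1)[OF g i])
      then show "(co i (f_spline j \<theta>) - co i fo)\<^sup>2 = (L2_inner ?h (g i))\<^sup>2" using i by (simp add: co_def)
    qed
    also have "\<dots> \<le> L2_inner ?h ?h" by (rule bessel[OF g h])
    finally show "(\<Sum>i=1..?m. (co i (f_spline j \<theta>) - co i fo)\<^sup>2) \<le> (L2_norm ?h)\<^sup>2" by (simp add: L2_norm_ip)
  next
    fix \<theta> i assume i: "i \<in> {1..?m}"
    have "(L2_inner (f_spline j \<theta>) (g i))\<^sup>2 \<le> (\<Sum>i=1..?m. (L2_inner (f_spline j \<theta>) (g i))\<^sup>2)"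
      using i by (intro member_le_sum) auto
    also have "\<dots> \<le> L2_inner (f_spline j \<theta>) (f_spline j \<theta>)" by (rule bessel[OF g bdd_meas_f_spline])
    finally show "(co i (f_spline j \<theta>))\<^sup>2 \<le> (L2_norm (f_spline j \<theta>))\<^sup>2" using i by (simp add: co_def L2_norm_ip)
  next
    fix i
    show "(\<lambda>\<theta>. co i (f_spline j \<theta>)) \<in> borel_measurable (lebesgue_R ?m)"
    proof (cases "i \<in> {1..?m}")
      case True
      have "(\<lambda>\<theta>. \<Sum>l=1..?m. \<theta> l * L2_inner (\<phi> l) (g i)) \<in> borel_measurable (lebesgue_R ?m)"
        by (intro borel_measurable_sum borel_measurable_times lebesgue_R_component borel_measurable_const)
      then show ?thesis using True by (simp add: co_def L2_inner_fs)
    next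
      case False
      then have "(\<lambda>\<theta>. co i (f_spline j \<theta>)) = (\<lambda>_. 0)" by (auto simp: co_def)
      then show ?thesis by simp
    qed
  qed
qed

end

subsection \<open>Covering by cells\<close>

context regression_law
begin

lemma L2_norm_le:
  assumes f: "f \<in> borel_measurable mu_X" and b: "\<And>x. x \<in> {0..1} \<Longrightarrow> \<bar>f x\<bar> \<le> M"
  shows "(L2_norm f)\<^sup>2 \<le> M\<^sup>2"
proof -
  interpret X: prob_space mu_X by (rule prob_space_mu_X)
  have sq: "(f x)\<^sup>2 \<le> M\<^sup>2" if "x \<in> {0..1}" for x
    using power_mono[OF b[OF that], of 2] by simp
  have "(L2_norm f)\<^sup>2 = (\<integral>x. (f x)\<^sup>2 \<partial>mu_X)" by (rule L2_norm_sq)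
  also have "\<dots> \<le> (\<integral>x. M\<^sup>2 \<partial>mu_X)"
  proof (rule integral_mono)
    show "integrable mu_X (\<lambda>x. (f x)\<^sup>2)"
      by (rule integrable_bounded_mu_X[of _ "M\<^sup>2"]) (use f sq in auto)
  qed (use sq in auto)
  also have "\<dots> = M\<^sup>2" by (simp add: X.prob_space[simplified])
  finally show ?thesis .
qed

definition test_err :: "nat \<Rightarrow> (real \<Rightarrow> real) \<Rightarrow> real" where
  "test_err n f = exp (- (K2 / 2) * real n * (L2_norm (\<lambda>x. f x - fo x))\<^sup>2)"

text \<open>Index set, cells and test functions are packed into one triple, so that a single choice
  per model provides all of them.\<close>

definition cell_system :: "nat \<Rightarrow> real \<Rightarrow> idx \<Rightarrow>
    (nat \<Rightarrow> int) set \<times> ((nat \<Rightarrow> int) \<Rightarrow> (nat \<Rightarrow> real) set) \<times> ((nat \<Rightarrow> int) \<Rightarrow> real \<Rightarrow> real) \<Rightarrow> bool" where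
  "cell_system n r j = (\<lambda>(I, A, F). finite I \<and> (\<forall>c\<in>I. A c \<in> sets (lebesgue_R (mdim j)) \<and> A c \<subseteq> Theta M j) \<and>
     far r j \<subseteq> (\<Union>c\<in>I. A c) \<and> (\<forall>c\<in>I. F c \<in> borel_measurable borel) \<and>
     (\<forall>c\<in>I. (\<integral>\<^sup>+z. ennreal (TR n (F c) z) \<partial>P n) \<le> ennreal (test_err n (F c))) \<and>
     (\<forall>c\<in>I. \<forall>\<theta>\<in>A c. (\<integral>\<^sup>+z. ennreal (LR n (f_spline j \<theta>) z / TR n (F c) z) \<partial>P n) \<le> ennreal (test_err n (F c))) \<and>
     (\<Sum>c\<in>I. test_err n (F c)) \<le> exp (- (K2 / 4) * real n * r\<^sup>2) * (4 * exp 3) ^ mdim j)"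

text \<open>The cells are cubes in orthonormal coordinates whose side is proportional to \<open>r / sqrt m\<close>. The test
  error of a cell decays like a Gaussian in the cell index, so the sum over all cells factorizes
  into \<open>m\<close> bounded sums.\<close>
lemma cell_system_exists:
  assumes j: "j \<in> Jset" and r: "r > 0" and n: "8 * K1 * real (mdim j) \<le> K2\<^sup>2 * real n * r\<^sup>2"
  shows "\<exists>T. cell_system n r j T"
proof -
  let ?m = "mdim j"
  have m: "?m \<ge> 1" using j by (cases j) (auto simp: Jset_def)
  obtain co :: "nat \<Rightarrow> (real \<Rightarrow> real) \<Rightarrow> real" where
    co1: "\<And>\<theta> \<theta>'. (L2_norm (\<lambda>x. f_spline j \<theta> x - f_spline j \<theta>' x))\<^sup>2 = (\<Sum>i=1..?m. (co i (f_spline j \<theta>) - co i (f_spline j \<theta>'))\<^sup>2)"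
    and co2: "\<And>\<theta>. (\<Sum>i=1..?m. (co i (f_spline j \<theta>) - co i fo)\<^sup>2) \<le> (L2_norm (\<lambda>x. f_spline j \<theta> x - fo x))\<^sup>2"
    and co3: "\<And>\<theta> i. i \<in> {1..?m} \<Longrightarrow> (co i (f_spline j \<theta>))\<^sup>2 \<le> (L2_norm (f_spline j \<theta>))\<^sup>2"
    and co4: "\<And>i. (\<lambda>\<theta>. co i (f_spline j \<theta>)) \<in> borel_measurable (lebesgue_R ?m)"
    using spline_coordinates[of j] by blast
  \<comment> \<open>The squared diameter m w^2 of a cube equals K2 r^2 / (2 K1), exactly the
    deviation that a test at distance r tolerates.\<close>
  define w where "w = sqrt (K2 / (2 * K1 * real ?m)) * r"
  have w2: "w\<^sup>2 = K2 * r\<^sup>2 / (2 * K1 * real ?m)"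
    using K_pos m by (simp add: w_def power_mult_distrib)
  have w: "w > 0" using K_pos m r by (simp add: w_def)
  define cell where "cell \<theta> = (\<lambda>i\<in>{1..?m}. \<lfloor>co i (f_spline j \<theta>) / w\<rfloor>)" for \<theta>
  define Z where "Z = \<lceil>M / w\<rceil> + 1"
  define A where "A c = {\<theta> \<in> far r j. cell \<theta> = c}" for c
  \<comment> \<open>Empty cells are dropped, so each remaining one has a member, at distance more
    than r, from which its test is built.\<close>
  define I where "I = {c \<in> PiE {1..?m} (\<lambda>_. {- Z..Z}). A c \<noteq> {}}"
  define pick where "pick c = (SOME \<theta>. \<theta> \<in> A c)" for c
  define F where "F c = f_spline j (pick c)" for c
  have pick: "pick c \<in> A c" if "c \<in> I" for c
  proof -
    have "\<exists>\<theta>. \<theta> \<in> A c" using that by (auto simp: I_def)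
    then show ?thesis unfolding pick_def by (rule someI_ex)
  qed
  have Tb: "\<bar>f_spline j \<theta> x\<bar> \<le> M" if "\<theta> \<in> Theta M j" "x \<in> {0..1}" for \<theta> x
  proof -
    obtain k q L where jj: "j = (k, q, L)" "q \<ge> 1" using j by (cases j) (auto simp: Jset_def)
    show ?thesis using that Theta_iff[OF jj(2), of \<theta> M k L] unfolding jj(1) by blast
  qed
  have finP: "finite (PiE {1..?m} (\<lambda>_. {- Z..Z}))" by (intro finite_PiE) auto
  have finI: "finite I" unfolding I_def using finP by (rule finite_subset[rotated]) blast
  have A_Theta: "A c \<subseteq> Theta M j" for c by (auto simp: A_def far_def)
  have A_sets: "A c \<in> sets (lebesgue_R ?m)" if c: "c \<in> PiE {1..?m} (\<lambda>_. {- Z..Z})" for c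
  proof -
    have "{\<theta> \<in> space (lebesgue_R ?m). \<forall>i\<in>{1..?m}. \<lfloor>co i (f_spline j \<theta>) / w\<rfloor> = c i} \<in> sets (lebesgue_R ?m)"
    proof (intro sets.sets_Collect_countable_All' countable_finite)
      fix i
      have [measurable]: "(\<lambda>\<theta>. co i (f_spline j \<theta>)) \<in> borel_measurable (lebesgue_R ?m)" by (rule co4)
      show "{\<theta> \<in> space (lebesgue_R ?m). \<lfloor>co i (f_spline j \<theta>) / w\<rfloor> = c i} \<in> sets (lebesgue_R ?m)"
        by measurable
    qed simp
    then have "far r j \<inter> {\<theta> \<in> space (lebesgue_R ?m). \<forall>i\<in>{1..?m}. \<lfloor>co i (f_spline j \<theta>) / w\<rfloor> = c i} \<in> sets (lebesgue_R ?m)"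
      by (rule sets.Int[OF far_sets[OF j]])
    also have "far r j \<inter> {\<theta> \<in> space (lebesgue_R ?m). \<forall>i\<in>{1..?m}. \<lfloor>co i (f_spline j \<theta>) / w\<rfloor> = c i} = A c"
    proof -
      have "cell \<theta> = c \<longleftrightarrow> (\<forall>i\<in>{1..?m}. \<lfloor>co i (f_spline j \<theta>) / w\<rfloor> = c i)" for \<theta>
      proof
        assume "cell \<theta> = c"
        then show "\<forall>i\<in>{1..?m}. \<lfloor>co i (f_spline j \<theta>) / w\<rfloor> = c i" by (auto simp: cell_def)
      next
        assume a: "\<forall>i\<in>{1..?m}. \<lfloor>co i (f_spline j \<theta>) / w\<rfloor> = c i"
        show "cell \<theta> = c"
        proof
          fix i show "cell \<theta> i = c i"
            using a PiE_arb[OF c, of i] by (cases "i \<in> {1..?m}") (auto simp: cell_def)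
        qed
      qed
      then show ?thesis using sets.sets_into_space[OF far_sets[OF j]] by (auto simp: A_def)
    qed
    finally show ?thesis .
  qed
  have cover: "far r j \<subseteq> (\<Union>c\<in>I. A c)"
  proof
    fix \<theta> assume \<theta>: "\<theta> \<in> far r j"
    then have T: "\<theta> \<in> Theta M j" by (simp add: far_def)
    have "cell \<theta> \<in> PiE {1..?m} (\<lambda>_. {- Z..Z})"
    proof (rule PiE_I)
      fix i assume i: "i \<in> {1..?m}"
      have "(co i (f_spline j \<theta>))\<^sup>2 \<le> M\<^sup>2"
        using co3[OF i, of \<theta>] L2_norm_le[OF measurable_mu_X_borel[OF f_spline_measurable] Tb[OF T]] by (rule order_trans)
      then have "\<bar>co i (f_spline j \<theta>)\<bar> \<le> M" using M by (simp add: abs_le_square_iff[symmetric])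
      then have "\<bar>co i (f_spline j \<theta>) / w\<bar> \<le> M / w" using w by (simp add: divide_right_mono)
      then have "co i (f_spline j \<theta>) / w \<le> M / w" "- (M / w) \<le> co i (f_spline j \<theta>) / w" by linarith+
      then have "- Z \<le> \<lfloor>co i (f_spline j \<theta>) / w\<rfloor> \<and> \<lfloor>co i (f_spline j \<theta>) / w\<rfloor> \<le> Z" unfolding Z_def by linarith
      then show "cell \<theta> i \<in> {- Z..Z}" using i by (simp add: cell_def)
    qed (simp add: cell_def del: atLeastAtMost_iff)
    moreover have "\<theta> \<in> A (cell \<theta>)" using \<theta> by (simp add: A_def)
    ultimately show "\<theta> \<in> (\<Union>c\<in>I. A c)" unfolding I_def by blast
  qed
  have close: "K1 * (L2_norm (\<lambda>x. f_spline j \<theta> x - F c x))\<^sup>2 \<le> K2 / 2 * (L2_norm (\<lambda>x. F c x - fo x))\<^sup>2"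
    if c: "c \<in> I" and \<theta>: "\<theta> \<in> A c" for c \<theta>
  proof -
    have eq: "cell \<theta> = cell (pick c)" using pick[OF c] \<theta> by (simp add: A_def)
    have "(L2_norm (\<lambda>x. f_spline j \<theta> x - F c x))\<^sup>2 = (\<Sum>i=1..?m. (co i (f_spline j \<theta>) - co i (f_spline j (pick c)))\<^sup>2)"
      unfolding F_def by (rule co1)
    also have "\<dots> \<le> (\<Sum>i=1..?m. w\<^sup>2)"
    proof (rule sum_mono)
      fix i assume i: "i \<in> {1..?m}"
      have "\<lfloor>co i (f_spline j \<theta>) / w\<rfloor> = \<lfloor>co i (f_spline j (pick c)) / w\<rfloor>"
        using fun_cong[OF eq, of i] i by (simp add: cell_def)
      then have "\<bar>co i (f_spline j \<theta>) / w - co i (f_spline j (pick c)) / w\<bar> \<le> 1" by linarith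
      then have "\<bar>(co i (f_spline j \<theta>) - co i (f_spline j (pick c))) / w\<bar> \<le> 1" by (simp add: diff_divide_distrib)
      then have "\<bar>co i (f_spline j \<theta>) - co i (f_spline j (pick c))\<bar> \<le> w" using w by (simp add: abs_divide)
      then show "(co i (f_spline j \<theta>) - co i (f_spline j (pick c)))\<^sup>2 \<le> w\<^sup>2"
        using w by (simp add: abs_le_square_iff[symmetric])
    qed
    also have "\<dots> = K2 * r\<^sup>2 / (2 * K1)" using m by (simp add: w2)
    finally have "K1 * (L2_norm (\<lambda>x. f_spline j \<theta> x - F c x))\<^sup>2 \<le> K1 * (K2 * r\<^sup>2 / (2 * K1))"
      using K_pos by (intro mult_left_mono) auto
    also have "\<dots> = K2 / 2 * r\<^sup>2" using K_pos by simp
    also have "\<dots> \<le> K2 / 2 * (L2_norm (\<lambda>x. F c x - fo x))\<^sup>2"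
      using pick[OF c] K_pos r by (intro mult_left_mono power_mono) (auto simp: A_def far_def F_def)
    finally show ?thesis .
  qed
  have Fm: "F c \<in> borel_measurable borel" for c unfolding F_def by (rule f_spline_measurable)
  have Fb: "\<bar>F c x\<bar> \<le> M" if "c \<in> I" "x \<in> {0..1}" for c x
    unfolding F_def using pick[OF that(1)] A_Theta[of c] that(2) by (intro Tb) auto
  have err2: "(\<integral>\<^sup>+z. ennreal (LR n (f_spline j \<theta>) z / TR n (F c) z) \<partial>P n) \<le> ennreal (test_err n (F c))"
    if c: "c \<in> I" and \<theta>: "\<theta> \<in> A c" for c \<theta>
    unfolding test_err_def
  proof (rule test_errors(1)[OF Fm f_spline_measurable _ _ close[OF c \<theta>]])
    show "\<bar>F c x\<bar> \<le> M" if "x \<in> {0..1}" for x using Fb[OF c that] .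
    show "\<bar>f_spline j \<theta> x\<bar> \<le> M" if "x \<in> {0..1}" for x using Tb \<theta> A_Theta that by blast
  qed
  have err1: "(\<integral>\<^sup>+z. ennreal (TR n (F c) z) \<partial>P n) \<le> ennreal (test_err n (F c))" if c: "c \<in> I" for c
    unfolding test_err_def
  proof (rule test_errors(2)[OF Fm f_spline_measurable _ _ close[OF c pick[OF c]]])
    show "\<bar>F c x\<bar> \<le> M" if "x \<in> {0..1}" for x using Fb[OF c that] .
    show "\<bar>f_spline j (pick c) x\<bar> \<le> M" if "x \<in> {0..1}" for x using Fb[OF c that] by (simp add: F_def)
  qed
  define ctr where "ctr i = \<lfloor>co i fo / w\<rfloor>" for i
  define q where "q i z = exp 3 * exp (- 2 * \<bar>real_of_int (z - ctr i)\<bar>)" for i z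
  have sum: "(\<Sum>c\<in>I. test_err n (F c)) \<le> exp (- (K2 / 4) * real n * r\<^sup>2) * (4 * exp 3) ^ ?m"
  proof -
    have le: "test_err n (F c) \<le> exp (- (K2 / 4) * real n * r\<^sup>2) * (\<Prod>i\<in>{1..?m}. q i (c i))" if c: "c \<in> I" for c
    proof -
      let ?l = "(L2_norm (\<lambda>x. F c x - fo x))\<^sup>2" and ?f = "\<lambda>i. co i (F c)"
      have far: "r\<^sup>2 \<le> ?l" using pick[OF c] r by (intro power_mono) (auto simp: A_def far_def F_def)
      have bess: "(\<Sum>i=1..?m. (?f i - co i fo)\<^sup>2) \<le> ?l" unfolding F_def by (rule co2)
      \<comment> \<open>A restatement of the hypothesis on n: measured in cell sides, the Gaussian
        exponent has coefficient at least one.\<close>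
      have big: "1 \<le> K2 / 4 * real n * w\<^sup>2"
      proof -
        have "K2 / 4 * real n * w\<^sup>2 = K2\<^sup>2 * real n * r\<^sup>2 / (8 * K1 * real ?m)"
          unfolding w2 by (simp add: power2_eq_square mult_ac)
        moreover have "0 < 8 * K1 * real ?m" using K_pos m by simp
        then have "1 \<le> K2\<^sup>2 * real n * r\<^sup>2 / (8 * K1 * real ?m)" using n by (simp only: pos_le_divide_eq mult_1)
        ultimately show ?thesis by (simp only:)
      qed
      \<comment> \<open>Rounding both coordinates to indices changes their difference by at most 1;
        then 2|x| - 1 \<le> x^2 turns Gaussian into geometric decay. The constant 3 is 2 +
        1.\<close>
      have coord: "3 - 2 * \<bar>real_of_int (c i - ctr i)\<bar> \<ge> - (K2 / 4) * real n * (?f i - co i fo)\<^sup>2" if i: "i \<in> {1..?m}" for i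
      proof -
        define x where "x = ?f i / w - co i fo / w"
        have "cell (pick c) = c" using pick[OF c] by (simp add: A_def)
        from fun_cong[OF this, of i] i have ci: "\<lfloor>?f i / w\<rfloor> = c i" by (simp add: cell_def F_def)
        have ax: "\<bar>real_of_int (c i - ctr i)\<bar> - 1 \<le> \<bar>x\<bar>" unfolding x_def ctr_def ci[symmetric] by linarith
        have "0 \<le> (\<bar>x\<bar> - 1)\<^sup>2" by simp
        then have x2: "2 * \<bar>x\<bar> - 1 \<le> x\<^sup>2" by (simp add: power2_eq_square algebra_simps)
        have "x\<^sup>2 * w\<^sup>2 = (?f i - co i fo)\<^sup>2"
          using w by (simp add: x_def power_mult_distrib[symmetric] left_diff_distrib)
        then have "K2 / 4 * real n * (?f i - co i fo)\<^sup>2 = (K2 / 4 * real n * w\<^sup>2) * x\<^sup>2" by (simp add: mult_ac)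
        moreover have "1 * x\<^sup>2 \<le> (K2 / 4 * real n * w\<^sup>2) * x\<^sup>2" using big by (rule mult_right_mono) simp
        ultimately have "x\<^sup>2 \<le> K2 / 4 * real n * (?f i - co i fo)\<^sup>2" by linarith
        then have neg: "- (K2 / 4) * real n * (?f i - co i fo)\<^sup>2 \<le> - x\<^sup>2" by (simp only: minus_mult_left[symmetric] neg_le_iff_le)
        have "a \<le> 3 - 2 * d" if "a \<le> - b" "2 * y - 1 \<le> b" "d - 1 \<le> y" for a b d y :: real
          using that by linarith
        from this[OF neg x2 ax] show ?thesis .
      qed
      \<comment> \<open>Half of the exponent is kept for the distance r, the other half is spent on
        the coordinates through Bessel's inequality.\<close>
      have "- (K2 / 2) * real n * ?l = - (K2 / 4) * real n * ?l + - (K2 / 4) * real n * ?l" by (simp add: algebra_simps)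
      also have "\<dots> \<le> - (K2 / 4) * real n * r\<^sup>2 + - (K2 / 4) * real n * (\<Sum>i=1..?m. (?f i - co i fo)\<^sup>2)"
        using far bess K_pos by (intro add_mono mult_left_mono_neg) (auto intro: mult_nonneg_nonneg)
      also have "\<dots> \<le> - (K2 / 4) * real n * r\<^sup>2 + (\<Sum>i=1..?m. 3 - 2 * \<bar>real_of_int (c i - ctr i)\<bar>)"
        unfolding sum_distrib_left using coord by (intro add_left_mono sum_mono)
      finally have "test_err n (F c) \<le> exp (- (K2 / 4) * real n * r\<^sup>2 + (\<Sum>i=1..?m. 3 - 2 * \<bar>real_of_int (c i - ctr i)\<bar>))"
        unfolding test_err_def by simp
      also have "\<dots> = exp (- (K2 / 4) * real n * r\<^sup>2) * (\<Prod>i\<in>{1..?m}. exp (3 - 2 * \<bar>real_of_int (c i - ctr i)\<bar>))"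
        by (simp only: exp_add exp_sum finite_atLeastAtMost)
      also have "(\<Prod>i\<in>{1..?m}. exp (3 - 2 * \<bar>real_of_int (c i - ctr i)\<bar>)) = (\<Prod>i\<in>{1..?m}. q i (c i))"
        unfolding q_def by (intro prod.cong refl) (simp add: exp_add[symmetric])
      finally show ?thesis .
    qed
    have "(\<Sum>c\<in>I. test_err n (F c)) \<le> (\<Sum>c\<in>I. exp (- (K2 / 4) * real n * r\<^sup>2) * (\<Prod>i\<in>{1..?m}. q i (c i)))"
      by (rule sum_mono[OF le])
    also have "\<dots> \<le> (\<Sum>c\<in>PiE {1..?m} (\<lambda>_. {- Z..Z}). exp (- (K2 / 4) * real n * r\<^sup>2) * (\<Prod>i\<in>{1..?m}. q i (c i)))"
      by (rule sum_mono2[OF finP]) (auto simp: I_def q_def intro!: mult_nonneg_nonneg prod_nonneg)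
    also have "\<dots> = exp (- (K2 / 4) * real n * r\<^sup>2) * (\<Sum>c\<in>PiE {1..?m} (\<lambda>_. {- Z..Z}). \<Prod>i\<in>{1..?m}. q i (c i))"
      by (rule sum_distrib_left[symmetric])
    also have "(\<Sum>c\<in>PiE {1..?m} (\<lambda>_. {- Z..Z}). \<Prod>i\<in>{1..?m}. q i (c i)) = (\<Prod>i\<in>{1..?m}. \<Sum>z\<in>{- Z..Z}. q i z)"
      by (rule prod_sum_PiE[symmetric]) auto
    also have "\<dots> \<le> (\<Prod>i\<in>{1..?m}. 4 * exp 3)"
    proof (rule prod_mono, intro conjI)
      fix i
      show "0 \<le> (\<Sum>z\<in>{- Z..Z}. q i z)" by (intro sum_nonneg) (simp add: q_def)
      have "(\<Sum>z\<in>{- Z..Z}. q i z) = exp 3 * (\<Sum>z\<in>{- Z..Z}. exp (- 2 * \<bar>real_of_int (z - ctr i)\<bar>))"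
        unfolding q_def by (rule sum_distrib_left[symmetric])
      also have "\<dots> \<le> exp 3 * 4" by (intro mult_left_mono sum_exp_int_le) auto
      finally show "(\<Sum>z\<in>{- Z..Z}. q i z) \<le> 4 * exp 3" by simp
    qed
    finally show ?thesis by (simp add: mult_left_mono)
  qed
  have "cell_system n r j (I, A, F)"
    unfolding cell_system_def prod.case
  proof (intro conjI ballI finI cover Fm err1 err2 sum)
    fix c assume "c \<in> I"
    then show "A c \<in> sets (lebesgue_R ?m)" unfolding I_def by (intro A_sets) blast
  qed (use A_Theta in auto)
  then show ?thesis by blast
qed

end

subsection \<open>Model weights\<close>

lemma summable_exp_C_coef: "(\<lambda>j. exp (- C_coef j / 2)) summable_on Jset"
proof -
  let ?e = "\<lambda>k::nat. exp (- 1 / 2) ^ k :: real"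
  have s: "?e summable_on UNIV"
    by (subst summable_on_UNIV_nonneg_real_iff) (auto intro: summable_geometric)
  have s2: "(\<lambda>(q, L). ?e q * ?e L) summable_on UNIV"
    by (intro summable_on_times_nonneg s) auto
  have s3: "(\<lambda>(k, p). ?e k * (\<lambda>(q, L). ?e q * ?e L) p) summable_on UNIV"
    by (intro summable_on_times_nonneg s s2) auto
  have "(\<lambda>(k, p). ?e k * (\<lambda>(q, L). ?e q * ?e L) p) = (\<lambda>j. exp (- C_coef j / 2))"
  proof
    fix j :: idx
    obtain k q L where j: "j = (k, q, L)" by (cases j) auto
    have "exp (- C_coef j / 2) = exp (real k * (- 1 / 2)) * (exp (real q * (- 1 / 2)) * exp (real L * (- 1 / 2)))"
      unfolding j exp_add[symmetric] by (simp add: add_divide_distrib)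
    then show "(case j of (k, p) \<Rightarrow> ?e k * (\<lambda>(q, L). ?e q * ?e L) p) = exp (- C_coef j / 2)"
      unfolding exp_of_nat_mult j by simp
  qed
  then show ?thesis using summable_on_subset_banach[OF s3, of Jset] by simp
qed

lemma finite_Jset_le: "finite {j \<in> Jset. C_coef j \<le> B}"
proof (rule finite_subset)
  let ?b = "nat \<lfloor>B\<rfloor>"
  show "{j \<in> Jset. C_coef j \<le> B} \<subseteq> {..?b} \<times> ({..?b} \<times> {..?b})"
  proof
    fix j assume j: "j \<in> {j \<in> Jset. C_coef j \<le> B}"
    obtain k q L where jj: "j = (k, q, L)" by (cases j) auto
    have "real (k + q + L) \<le> B" using j by (simp add: jj)
    then have "k + q + L \<le> ?b" by (simp add: le_nat_floor)
    then show "j \<in> {..?b} \<times> ({..?b} \<times> {..?b})" by (simp add: jj)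
  qed
qed simp

lemma mdim_le_C_coef: "real (mdim j) \<le> C_coef j"
  by (cases j) auto

context regression_law
begin

lemma alpha_pos: "alpha_cst M \<sigma> > 0"
proof -
  have "alpha_cst M \<sigma> \<ge> 0"
    unfolding alpha_cst_def by (intro divide_nonneg_nonneg infsum_nonneg) (auto simp: weight0_def)
  moreover have "alpha_cst M \<sigma> \<noteq> 0"
  proof
    assume "alpha_cst M \<sigma> = 0"
    then have "weight M \<sigma> = (\<lambda>_. 0)" by (auto simp: weight_def)
    then have "((\<lambda>_. 0::real) has_sum 1) Jset" using weight_has_sum_1[OF M \<sigma>] by simp
    moreover have "((\<lambda>_. 0) has_sum (0::real)) Jset" by (rule has_sum_0) simp
    ultimately show False using has_sum_unique by fastforce
  qed
  ultimately show ?thesis by simp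
qed

lemma weight_pos: "weight M \<sigma> j > 0"
  using alpha_pos by (simp add: weight_def weight0_def)

lemma weight_le: "j \<in> Jset \<Longrightarrow> weight M \<sigma> j \<le> alpha_cst M \<sigma> * exp (- C_coef j)"
proof -
  assume j: "j \<in> Jset"
  obtain k q L where jj: "j = (k, q, L)" by (cases j) auto
  have "weight0 M \<sigma> j \<le> exp (-1) ^ k * (exp (-1) ^ q * exp (-1) ^ L)"
    using weight0_le[OF M \<sigma>, of k q L] j unfolding jj by simp
  also have "\<dots> = exp (- C_coef j)"
    unfolding jj by (simp add: exp_of_nat_mult[symmetric] exp_add[symmetric])
  finally show ?thesis unfolding weight_def using alpha_pos by (intro mult_left_mono) auto
qed

lemma sqrt_weight_le: "j \<in> Jset \<Longrightarrow> sqrt (weight M \<sigma> j) \<le> sqrt (alpha_cst M \<sigma>) * exp (- C_coef j / 2)"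
proof -
  assume j: "j \<in> Jset"
  have "sqrt (weight M \<sigma> j) \<le> sqrt (alpha_cst M \<sigma> * exp (- C_coef j))" using weight_le[OF j] by simp
  also have "exp (- C_coef j) = (exp (- C_coef j / 2))\<^sup>2" by (simp add: power2_eq_square exp_add[symmetric])
  also have "sqrt (alpha_cst M \<sigma> * (exp (- C_coef j / 2))\<^sup>2) = sqrt (alpha_cst M \<sigma>) * exp (- C_coef j / 2)"
    by (simp add: real_sqrt_mult)
  finally show ?thesis .
qed

definition S1 :: real where "S1 = (\<Sum>\<^sub>\<infinity>j\<in>Jset. exp (- C_coef j / 2))"

lemma S1_nonneg: "S1 \<ge> 0"
  unfolding S1_def by (intro infsum_nonneg) simp

text \<open>One half of the exponent in exp(-C_j) is evaluated at the threshold B, the other half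
  keeps the series summable.\<close>

lemma weight_tail:
  "(\<integral>\<^sup>+j. ennreal (weight M \<sigma> j) \<partial>count_space (Jset - {j \<in> Jset. C_coef j \<le> B})) \<le> ennreal (alpha_cst M \<sigma> * S1 * exp (- B / 2))"
proof -
  let ?J = "Jset - {j \<in> Jset. C_coef j \<le> B}" and ?h = "\<lambda>j. exp (- C_coef j / 2)"
  have sm: "?h summable_on Jset" by (rule summable_exp_C_coef)
  have smJ: "?h summable_on ?J" by (rule summable_on_subset_banach[OF sm]) auto
  have "(\<integral>\<^sup>+j. ennreal (weight M \<sigma> j) \<partial>count_space ?J) \<le> (\<integral>\<^sup>+j. ennreal (alpha_cst M \<sigma> * exp (- B / 2)) * ennreal (?h j) \<partial>count_space ?J)"
  proof (rule nn_integral_mono)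
    fix j assume "j \<in> space (count_space ?J)"
    then have j: "j \<in> Jset" "B < C_coef j" by auto
    have "weight M \<sigma> j \<le> alpha_cst M \<sigma> * exp (- C_coef j)" by (rule weight_le[OF j(1)])
    also have "exp (- C_coef j) \<le> exp (- B / 2) * ?h j" unfolding exp_add[symmetric] using j(2) by simp
    finally have "weight M \<sigma> j \<le> alpha_cst M \<sigma> * exp (- B / 2) * ?h j" using alpha_pos by (simp add: mult_left_mono mult.assoc)
    then have "ennreal (weight M \<sigma> j) \<le> ennreal (alpha_cst M \<sigma> * exp (- B / 2) * ?h j)" by (rule ennreal_leI)
    then show "ennreal (weight M \<sigma> j) \<le> ennreal (alpha_cst M \<sigma> * exp (- B / 2)) * ennreal (?h j)"
      using alpha_pos by (simp add: ennreal_mult)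
  qed
  also have "\<dots> = ennreal (alpha_cst M \<sigma> * exp (- B / 2)) * ennreal (infsum ?h ?J)"
    unfolding infsum_eq_nn_integral_count_space[OF smJ exp_ge_zero] by (rule nn_integral_cmult) simp
  also have "infsum ?h ?J \<le> S1"
    unfolding S1_def by (rule infsum_mono_neutral[OF smJ sm]) auto
  then have "ennreal (alpha_cst M \<sigma> * exp (- B / 2)) * ennreal (infsum ?h ?J) \<le> ennreal (alpha_cst M \<sigma> * exp (- B / 2)) * ennreal S1"
    by (intro mult_left_mono ennreal_leI) auto
  also have "\<dots> = ennreal (alpha_cst M \<sigma> * S1 * exp (- B / 2))"
    using alpha_pos S1_nonneg by (simp add: ennreal_mult[symmetric] mult_ac)
  finally show ?thesis by simp
qed

text \<open>\<open>A_coef\<close> depends on the order only, here s + 1, so the exponent of the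
  weight is linear in the dimension and L, hence O(N).\<close>

lemma weight_lower:
  assumes s: "s \<ge> 1"
  shows "\<exists>Cw\<ge>0. \<forall>N\<ge>1. weight M \<sigma> (s * N - 1, Suc s, L) \<ge> exp (- Cw * real N)"
proof -
  let ?den = "c1 M \<sigma> * (1 - 4 * gamma_cst M \<sigma>)"
  define a1 where "a1 = \<bar>4 / ?den * ln (1072.5 * A_coef (0, Suc s, L))\<bar>"
  define a2 where "a2 = max 1 (8 / ?den)"
  define cc where "cc = 1 + 1 / (2 * \<sigma>\<^sup>2) + 0.0056 / \<sigma>"
  have cc: "cc \<ge> 0" using \<sigma> by (simp add: cc_def)
  have a2: "a2 \<ge> 1" by (simp add: a2_def)
  define a3 where "a3 = 2 * real s * a1 + (2 * real s + real L) * a2"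
  define Cw where "Cw = \<bar>ln (alpha_cst M \<sigma>)\<bar> + cc * a3"
  have a3: "a3 \<ge> 0" using a2 by (simp add: a3_def a1_def)
  have "weight M \<sigma> (s * N - 1, Suc s, L) \<ge> exp (- Cw * real N)" if N: "N \<ge> 1" for N
  proof -
    let ?j = "(s * N - 1, Suc s, L)"
    have md: "mdim ?j = s * N + s" using s N by (simp add: Suc_le_eq)
    have "s * 1 \<le> s * N" using N by (intro mult_le_mono2)
    then have "mdim ?j \<le> 2 * (s * N)" unfolding md by simp
    then have m: "real (mdim ?j) \<le> 2 * real s * real N" by (metis of_nat_le_iff of_nat_mult of_nat_numeral mult.assoc)
    have A: "A_coef ?j = A_coef (0, Suc s, L)" by simp
    have "4 * real (mdim ?j) / ?den * ln (1072.5 * A_coef ?j) = real (mdim ?j) * (4 / ?den * ln (1072.5 * A_coef (0, Suc s, L)))"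
      unfolding A by simp
    also have "\<dots> \<le> real (mdim ?j) * a1" unfolding a1_def by (rule mult_left_mono[OF abs_ge_self of_nat_0_le_iff])
    also have "\<dots> \<le> 2 * real s * real N * a1" using m by (intro mult_right_mono) (auto simp: a1_def)
    finally have 1: "4 * real (mdim ?j) / ?den * ln (1072.5 * A_coef ?j) \<le> 2 * real s * real N * a1" .
    have "C_coef ?j = real (mdim ?j) + real L" by (simp only: C_coef.simps)
    also have "\<dots> \<le> (2 * real s + real L) * real N"
    proof -
      have "real L * 1 \<le> real L * real N" using N by (intro mult_left_mono) auto
      then show ?thesis using m by (simp add: distrib_right)
    qed
    finally have "C_coef ?j * a2 \<le> (2 * real s + real L) * real N * a2" using a2 by (intro mult_right_mono) auto
    then have "eta_coef M \<sigma> ?j \<le> 2 * real s * real N * a1 + (2 * real s + real L) * real N * a2"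
      unfolding eta_coef_def a2_def[symmetric] using 1 by (rule add_mono[rotated])
    also have "\<dots> = a3 * real N" by (simp add: a3_def algebra_simps)
    finally have "- cc * eta_coef M \<sigma> ?j \<ge> - cc * (a3 * real N)" using cc by (simp add: mult_left_mono)
    then have w0: "weight0 M \<sigma> ?j \<ge> exp (- cc * (a3 * real N))" unfolding weight0_def cc_def[symmetric] by simp
    let ?l = "ln (alpha_cst M \<sigma>)"
    have "- ?l \<le> \<bar>?l\<bar>" by (rule abs_ge_minus_self)
    also have "\<dots> = \<bar>?l\<bar> * 1" by simp
    also have "\<dots> \<le> \<bar>?l\<bar> * real N" using N by (intro mult_left_mono[OF _ abs_ge_zero]) simp
    finally have "- (\<bar>?l\<bar> * real N) \<le> ?l" by (subst minus_le_iff)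
    then have "exp (- \<bar>?l\<bar> * real N) \<le> exp ?l" unfolding exp_le_cancel_iff mult_minus_left .
    also have "\<dots> = alpha_cst M \<sigma>" using alpha_pos by simp
    finally have al: "exp (- \<bar>ln (alpha_cst M \<sigma>)\<bar> * real N) \<le> alpha_cst M \<sigma>" .
    have "exp (- Cw * real N) = exp (- \<bar>ln (alpha_cst M \<sigma>)\<bar> * real N) * exp (- cc * (a3 * real N))"
      unfolding exp_add[symmetric] by (simp add: Cw_def algebra_simps)
    also have "\<dots> \<le> alpha_cst M \<sigma> * weight0 M \<sigma> ?j" using al w0 alpha_pos by (intro mult_mono) auto
    finally show ?thesis by (simp add: weight_def)
  qed
  moreover have "Cw \<ge> 0" using cc a3 by (simp add: Cw_def)
  ultimately show ?thesis by (intro exI[of _ Cw] conjI allI impI)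
qed

text \<open>The nonasymptotic bound, with \<open>t = n powr (1 / (1 + 2 s))\<close> in the application.\<close>
lemma posterior_bound_at:
  assumes t: "t \<ge> 1" and n: "n \<ge> 1" and D1: "D1 \<ge> 0" and K: "K > 0" and \<delta>: "\<delta> > 0"
    and den: "emeasure (P n) {z \<in> space (P n). post_num n (Theta M) z < ennreal (exp (- D1 * t))} \<le> ennreal (exp (- t))"
    and B: "B = 2 * (D1 + 1)" and K1': "8 * K1 * B \<le> K2\<^sup>2 * K\<^sup>2" and K2': "D1 + 5 * B + 1 \<le> K2 / 4 * K\<^sup>2"
    and r: "r > 0" "real n * r\<^sup>2 = K\<^sup>2 * t"
  shows "measure (P n) {z \<in> space (P n). posterior_far M \<sigma> fo n r z > \<delta>}
     \<le> exp (- t) * (1 + (1 / \<delta>) * (alpha_cst M \<sigma> * S1 + 2 * sqrt (alpha_cst M \<sigma>) * S1))"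
proof -
  interpret Pn: prob_space "P n" by (rule prob_P)
  let ?al = "alpha_cst M \<sigma>"
  \<comment> \<open>Larger models carry total weight of order exp(- B t / 2), and B = 2 (D1 + 1)
    leaves exp(- t) after division by the evidence exp(- D1 t).\<close>
  define Js where "Js = {j \<in> Jset. C_coef j \<le> B * t}"
  have B0: "B > 0" using D1 B by simp
  have Js: "finite Js" "Js \<subseteq> Jset" unfolding Js_def using finite_Jset_le by auto
  have cs: "\<exists>T. cell_system n r j T" if j: "j \<in> Js" for j
  proof (rule cell_system_exists[OF _ r(1)])
    show "j \<in> Jset" using j Js by auto
    have "real (mdim j) \<le> B * t" using j mdim_le_C_coef[of j] by (simp add: Js_def)
    then have "8 * K1 * real (mdim j) \<le> 8 * K1 * (B * t)" using K_pos by (intro mult_left_mono) auto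
    also have "\<dots> = (8 * K1 * B) * t" by simp
    also have "\<dots> \<le> (K2\<^sup>2 * K\<^sup>2) * t" using K1' t by (intro mult_right_mono) auto
    also have "\<dots> = K2\<^sup>2 * real n * r\<^sup>2" using r(2) by (simp add: mult.assoc)
    finally show "8 * K1 * real (mdim j) \<le> K2\<^sup>2 * real n * r\<^sup>2" .
  qed
  define T where "T j = (SOME T. cell_system n r j T)" for j
  have T: "cell_system n r j (T j)" if "j \<in> Js" for j
    unfolding T_def by (rule someI_ex[OF cs[OF that]])
  define I where "I j = fst (T j)" for j
  define A where "A j = fst (snd (T j))" for j
  define F where "F j = snd (snd (T j))" for j
  have Teq: "T j = (I j, A j, F j)" for j by (simp add: I_def A_def F_def)
  have cell: "cell_system n r j (I j, A j, F j)" if "j \<in> Js" for j using T[OF that] unfolding Teq .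
  note cs' = cell[unfolded cell_system_def prod.case]
  let ?d = "exp (- D1 * t)"
  have d: "?d > 0" by simp
  have d1: "1 + 1 / ?d \<le> 2 * exp (D1 * t)"
  proof -
    have "0 \<le> D1 * t" using D1 t by simp
    then have "1 \<le> exp (D1 * t)" by simp
    moreover have "1 / ?d = exp (D1 * t)" by (simp add: exp_minus divide_inverse)
    ultimately show ?thesis by simp
  qed
  have main: "emeasure (P n) {z \<in> space (P n). posterior_far M \<sigma> fo n r z > \<delta>} \<le>
     emeasure (P n) {z \<in> space (P n). post_num n (Theta M) z < ennreal ?d} +
     ennreal (1 / \<delta>) * ((\<integral>\<^sup>+j. ennreal (weight M \<sigma> j) \<partial>count_space (Jset - Js)) * ennreal (1 / ?d) +
       (\<Sum>j\<in>Js. \<Sum>c\<in>I j. ennreal (sqrt (weight M \<sigma> j) * (1 + 1 / ?d) * test_err n (F j c))))"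
  proof (rule posterior_tail_bound[OF d \<delta> Js, where A=A and F=F and \<rho>="\<lambda>j c. test_err n (F j c)"])
    fix j assume j: "j \<in> Js"
    show "finite (I j)" using cs'[OF j] by blast
    show "far r j \<subseteq> (\<Union>c\<in>I j. A j c)" using cs'[OF j] by blast
    show "weight M \<sigma> j > 0" by (rule weight_pos)
    fix c assume c: "c \<in> I j"
    show "A j c \<in> sets (lebesgue_R (mdim j)) \<and> A j c \<subseteq> Theta M j" using cs'[OF j] c by blast
    show "F j c \<in> borel_measurable borel" using cs'[OF j] c by blast
    show "(\<integral>\<^sup>+z. ennreal (TR n (F j c) z) \<partial>P n) \<le> ennreal (test_err n (F j c))" using cs'[OF j] c by blast
    fix \<theta> assume "\<theta> \<in> A j c"
    then show "(\<integral>\<^sup>+z. ennreal (LR n (f_spline j \<theta>) z / TR n (F j c) z) \<partial>P n) \<le> ennreal (test_err n (F j c))"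
      using cs'[OF j] c by blast
  qed (simp add: test_err_def)
  have cells: "(\<Sum>j\<in>Js. \<Sum>c\<in>I j. ennreal (sqrt (weight M \<sigma> j) * (1 + 1 / ?d) * test_err n (F j c)))
     \<le> ennreal (2 * sqrt ?al * S1 * exp (- t))"
  proof -
    have nn: "0 \<le> sqrt (weight M \<sigma> j) * (1 + 1 / ?d) * test_err n (F j c)" for j c
      using weight_nonneg[of j] by (simp add: test_err_def)
    have toreal: "(\<Sum>j\<in>Js. \<Sum>c\<in>I j. ennreal (sqrt (weight M \<sigma> j) * (1 + 1 / ?d) * test_err n (F j c)))
      = ennreal (\<Sum>j\<in>Js. \<Sum>c\<in>I j. sqrt (weight M \<sigma> j) * (1 + 1 / ?d) * test_err n (F j c))"
      by (simp only: sum_ennreal sum_nonneg nn)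
    have "(\<Sum>j\<in>Js. \<Sum>c\<in>I j. sqrt (weight M \<sigma> j) * (1 + 1 / ?d) * test_err n (F j c)) \<le> (\<Sum>j\<in>Js. 2 * sqrt ?al * exp (- t) * exp (- C_coef j / 2))"
    proof (rule sum_mono)
      fix j assume j: "j \<in> Js"
      have jJ: "j \<in> Jset" using j Js by auto
      have "(\<Sum>c\<in>I j. test_err n (F j c)) \<le> exp (- (K2 / 4) * real n * r\<^sup>2) * (4 * exp 3) ^ mdim j" using cs'[OF j] by blast
      also have "exp (- (K2 / 4) * real n * r\<^sup>2) = exp (- (K2 / 4 * K\<^sup>2) * t)" using r(2) by (simp add: mult.assoc)
      \<comment> \<open>The sum over cells costs at most exp(5 m), with dimension m at most B t;
        this explains the summand 5 B in the condition on K.\<close>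
      also have "(4 * exp 3 :: real) ^ mdim j \<le> exp (5 * (B * t))"
      proof -
        have "(2::real) \<le> exp 1" using exp_ge_add_one_self[of "1::real"] by simp
        then have "(2::real) * 2 \<le> exp 1 * exp 1" by (intro mult_mono) auto
        then have "4 * exp 3 \<le> exp 1 * exp 1 * (exp 3 :: real)" by (intro mult_right_mono) auto
        also have "\<dots> = exp (5::real)" by (simp add: exp_add[symmetric])
        finally have "(4 * exp 3 :: real) ^ mdim j \<le> exp 5 ^ mdim j" by (intro power_mono) auto
        also have "\<dots> = exp (5 * real (mdim j))" by (simp add: exp_of_nat2_mult)
        also have "\<dots> \<le> exp (5 * (B * t))" using j mdim_le_C_coef[of j] by (simp add: Js_def)
        finally show ?thesis .
      qed
      finally have te: "(\<Sum>c\<in>I j. test_err n (F j c)) \<le> exp (- (K2 / 4 * K\<^sup>2) * t) * exp (5 * (B * t))"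
        by (simp add: mult_left_mono)
      have "(\<Sum>c\<in>I j. sqrt (weight M \<sigma> j) * (1 + 1 / ?d) * test_err n (F j c)) = sqrt (weight M \<sigma> j) * (1 + 1 / ?d) * (\<Sum>c\<in>I j. test_err n (F j c))"
        by (simp only: sum_distrib_left)
      also have "\<dots> \<le> (sqrt ?al * exp (- C_coef j / 2)) * (2 * exp (D1 * t)) * (exp (- (K2 / 4 * K\<^sup>2) * t) * exp (5 * (B * t)))"
        using alpha_pos by (intro mult_mono sqrt_weight_le[OF jJ] d1 te mult_nonneg_nonneg sum_nonneg) (auto simp: test_err_def weight_nonneg add_nonneg_nonneg)
      also have "\<dots> = 2 * sqrt ?al * exp (- C_coef j / 2) * exp ((D1 + 5 * B - K2 / 4 * K\<^sup>2) * t)"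
        by (simp add: exp_add[symmetric] algebra_simps)
      also have "\<dots> \<le> 2 * sqrt ?al * exp (- C_coef j / 2) * exp (- t)"
      proof -
        have "(D1 + 5 * B - K2 / 4 * K\<^sup>2) * t \<le> (- 1) * t" using K2' t by (intro mult_right_mono) auto
        then show ?thesis using alpha_pos by (intro mult_left_mono) auto
      qed
      finally show "(\<Sum>c\<in>I j. sqrt (weight M \<sigma> j) * (1 + 1 / ?d) * test_err n (F j c)) \<le> 2 * sqrt ?al * exp (- t) * exp (- C_coef j / 2)"
        by (simp add: mult_ac)
    qed
    also have "\<dots> = 2 * sqrt ?al * exp (- t) * (\<Sum>j\<in>Js. exp (- C_coef j / 2))"
      by (rule sum_distrib_left[symmetric])
    also have "\<dots> \<le> 2 * sqrt ?al * exp (- t) * S1"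
    proof (rule mult_left_mono)
      show "(\<Sum>j\<in>Js. exp (- C_coef j / 2)) \<le> S1"
        unfolding S1_def by (rule finite_sum_le_infsum[OF summable_exp_C_coef Js]) simp
    qed (use alpha_pos in simp)
    also have "\<dots> = 2 * sqrt ?al * S1 * exp (- t)" by (simp only: mult_ac)
    finally show ?thesis unfolding toreal by (rule ennreal_leI)
  qed
  have tail: "(\<integral>\<^sup>+j. ennreal (weight M \<sigma> j) \<partial>count_space (Jset - Js)) * ennreal (1 / ?d) \<le> ennreal (?al * S1 * exp (- t))"
  proof -
    have dinv: "1 / ?d = exp (D1 * t)" by (simp add: exp_minus divide_inverse)
    have "(\<integral>\<^sup>+j. ennreal (weight M \<sigma> j) \<partial>count_space (Jset - Js)) * ennreal (1 / ?d) \<le> ennreal (?al * S1 * exp (- (B * t) / 2)) * ennreal (1 / ?d)"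
      unfolding Js_def by (intro mult_right_mono weight_tail) simp
    also have "\<dots> = ennreal (?al * S1 * exp (- (B * t) / 2) * (1 / ?d))"
      using alpha_pos S1_nonneg by (intro ennreal_mult[symmetric] mult_nonneg_nonneg) auto
    also have "?al * S1 * exp (- (B * t) / 2) * (1 / ?d) = ?al * S1 * exp (- (B * t) / 2 + D1 * t)"
      by (simp only: dinv exp_add mult.assoc)
    also have "- (B * t) / 2 + D1 * t = - t" unfolding B by (simp add: field_simps)
    finally show ?thesis .
  qed
  have "emeasure (P n) {z \<in> space (P n). posterior_far M \<sigma> fo n r z > \<delta>} \<le>
      ennreal (exp (- t)) + ennreal (1 / \<delta>) * (ennreal (?al * S1 * exp (- t)) + ennreal (2 * sqrt ?al * S1 * exp (- t)))"
    by (rule order_trans[OF main]) (intro add_mono mult_left_mono den cells tail zero_le)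
  also have "\<dots> = ennreal (exp (- t) + 1 / \<delta> * (?al * S1 * exp (- t) + 2 * sqrt ?al * S1 * exp (- t)))"
    using \<delta> alpha_pos S1_nonneg by (simp add: ennreal_mult[symmetric] ennreal_plus[symmetric] del: ennreal_plus)
  also have "exp (- t) + 1 / \<delta> * (?al * S1 * exp (- t) + 2 * sqrt ?al * S1 * exp (- t))
     = exp (- t) * (1 + (1 / \<delta>) * (?al * S1 + 2 * sqrt ?al * S1))"
    by (simp add: algebra_simps)
  finally show ?thesis
    using \<delta> alpha_pos S1_nonneg unfolding Pn.emeasure_eq_measure
    by (subst (asm) ennreal_le_iff) (auto intro!: mult_nonneg_nonneg add_nonneg_nonneg)
qed

end

subsection \<open>Contraction\<close>

context regression_law
begin

text \<open>\<tau> is chosen to beat the approximation term: n = t^(1+2s) gives n \<Delta>^2 \<le>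
  C0^2 t, so that \<tau> exp(n \<Delta>^2 / \<sigma>^2) \<le> exp(- t). \<open>D1\<close> adds up
  the costs of the weight and of the prior mass, both with N \<le> 2t, and of \<tau>.\<close>

lemma evidence_lower_bound_rate:
  assumes s: "s \<ge> 1" and j: "mdim j = s * N + s" "j \<in> Jset"
    and t: "t \<ge> 1" "t \<le> real N" "real N \<le> 2 * t" and n: "real n = t ^ (1 + 2 * s)"
    and C: "C0 \<ge> 0" "Cw \<ge> 0" and w: "weight M \<sigma> j \<ge> exp (- Cw * real N)"
    and U: "U \<in> sets (lebesgue_R (mdim j))" "U \<subseteq> Theta M j" "emeasure (pi_prior M j) U \<ge> ennreal (exp (- C0 * real N))"
    and near: "\<And>\<theta> x. \<theta> \<in> U \<Longrightarrow> x \<in> {0<..<1} \<Longrightarrow> \<bar>f_spline j \<theta> x - fo x\<bar> \<le> C0 * (1 / real N) ^ s"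
    and D1: "D1 = 2 * (Cw + C0) + C0\<^sup>2 / \<sigma>\<^sup>2 + 1"
  shows "emeasure (P n) {z \<in> space (P n). post_num n (Theta M) z < ennreal (exp (- D1 * t))} \<le> ennreal (exp (- t))"
proof -
  let ?\<Delta> = "C0 * (1 / real N) ^ s" and ?u = "exp (- C0 * real N)" and ?\<tau> = "exp (- (C0\<^sup>2 / \<sigma>\<^sup>2 + 1) * t)"
  have \<Delta>: "?\<Delta> \<ge> 0" using C by simp
  have n\<Delta>: "real n * ?\<Delta>\<^sup>2 \<le> C0\<^sup>2 * t"
  proof -
    have "(1 / real N) ^ s \<le> (1 / t) ^ s" using t by (intro power_mono) (auto simp: frac_le)
    then have "?\<Delta> \<le> C0 * (1 / t) ^ s" using C(1) by (rule mult_left_mono)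
    then have "?\<Delta>\<^sup>2 \<le> (C0 * (1 / t) ^ s)\<^sup>2" using \<Delta> by (rule power_mono)
    then have "real n * ?\<Delta>\<^sup>2 \<le> real n * (C0 * (1 / t) ^ s)\<^sup>2" by (rule mult_left_mono) simp
    also have "\<dots> = C0\<^sup>2 * t" using t by (simp add: n power_add power_mult power_mult_distrib power_divide mult.commute[of 2] power2_eq_square)
    finally show ?thesis .
  qed
  have "weight M \<sigma> j * ?u * ?\<tau> \<ge> exp (- D1 * t)"
  proof -
    have "(Cw + C0) * real N \<le> (Cw + C0) * (2 * t)" using C t by (intro mult_left_mono) auto
    then have "- D1 * t \<le> - Cw * real N + - C0 * real N + - (C0\<^sup>2 / \<sigma>\<^sup>2 + 1) * t"
      unfolding D1 by (simp add: algebra_simps)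
    then have "exp (- D1 * t) \<le> exp (- Cw * real N) * ?u * ?\<tau>"
      unfolding exp_add[symmetric] by simp
    also have "\<dots> \<le> weight M \<sigma> j * ?u * ?\<tau>" using w by (intro mult_right_mono) auto
    finally show ?thesis .
  qed
  then have le: "ennreal (exp (- D1 * t)) \<le> ennreal (weight M \<sigma> j * ?u * ?\<tau>)" by (rule ennreal_leI)
  have mD: "post_num n (Theta M) \<in> borel_measurable (P n)" by (intro post_num_measurable Theta_measurable)
  have "emeasure (P n) {z \<in> space (P n). post_num n (Theta M) z < ennreal (exp (- D1 * t))}
     \<le> emeasure (P n) {z \<in> space (P n). post_num n (Theta M) z < ennreal (weight M \<sigma> j * ?u * ?\<tau>)}"
  proof (rule emeasure_mono)
    show "{z \<in> space (P n). post_num n (Theta M) z < ennreal (weight M \<sigma> j * ?u * ?\<tau>)} \<in> sets (P n)" using mD by measurable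
    show "{z \<in> space (P n). post_num n (Theta M) z < ennreal (exp (- D1 * t))} \<subseteq> {z \<in> space (P n). post_num n (Theta M) z < ennreal (weight M \<sigma> j * ?u * ?\<tau>)}"
      using less_le_trans[OF _ le] by blast
  qed
  also have "\<dots> \<le> ennreal (?\<tau> * exp (real n * ?\<Delta>\<^sup>2 / \<sigma>\<^sup>2))"
    by (rule evidence_lower_bound[OF j(2) U(1,2) exp_gt_zero U(3) exp_gt_zero \<Delta> near])
  also have "\<dots> \<le> ennreal (exp (- t))"
  proof (rule ennreal_leI)
    have "real n * ?\<Delta>\<^sup>2 / \<sigma>\<^sup>2 \<le> C0\<^sup>2 * t / \<sigma>\<^sup>2" using n\<Delta> by (rule divide_right_mono) simp
    then have "- (C0\<^sup>2 / \<sigma>\<^sup>2 + 1) * t + real n * ?\<Delta>\<^sup>2 / \<sigma>\<^sup>2 \<le> - t" by (simp add: algebra_simps)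
    then show "?\<tau> * exp (real n * ?\<Delta>\<^sup>2 / \<sigma>\<^sup>2) \<le> exp (- t)" unfolding exp_add[symmetric] by simp
  qed
  finally show ?thesis .
qed

lemma posterior_contraction:
  assumes s: "s \<ge> 1" and f: "fo \<in> W_inf s" and fM: "sup_norm fo < ereal M"
  shows "\<exists>K>0. \<forall>\<delta>>0. (\<lambda>n. measure (P n) {z \<in> space (P n). posterior_far M \<sigma> fo n (K * real n powr (- (real s / (1 + 2 * real s)))) z > \<delta>}) \<longlonglongrightarrow> 0"
proof -
  obtain L C0 N0 where L: "L \<ge> 1 \<and> C0 \<ge> 0 \<and>
    (\<forall>N\<ge>N0. N \<ge> 1 \<longrightarrow> (\<exists>U\<in>sets (lebesgue_R (mdim (s * N - 1, Suc s, L))).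
       U \<subseteq> Theta M (s * N - 1, Suc s, L) \<and>
       emeasure (pi_prior M (s * N - 1, Suc s, L)) U \<ge> ennreal (exp (- C0 * real N)) \<and>
       (\<forall>\<theta>\<in>U. \<forall>x\<in>{0<..<1}. \<bar>f_spline (s * N - 1, Suc s, L) \<theta> x - fo x\<bar> \<le> C0 * (1 / real N) ^ s)))"
    using prior_mass_near[OF s f fM] by (elim exE)
  then have C0: "C0 \<ge> 0" and L1: "L \<ge> 1" by (rule conjunct2[THEN conjunct1], rule conjunct1)
  obtain Cw where Cw': "Cw \<ge> 0 \<and> (\<forall>N\<ge>1. weight M \<sigma> (s * N - 1, Suc s, L) \<ge> exp (- Cw * real N))"
    using weight_lower[OF s, where L=L] by (elim exE)
  then have Cw: "Cw \<ge> 0" "\<And>N. N \<ge> 1 \<Longrightarrow> weight M \<sigma> (s * N - 1, Suc s, L) \<ge> exp (- Cw * real N)" by simp_all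
  define D1 where "D1 = 2 * (Cw + C0) + C0\<^sup>2 / \<sigma>\<^sup>2 + 1"
  define B where "B = 2 * (D1 + 1)"
  have D1: "D1 \<ge> 0" using Cw(1) C0 by (simp add: D1_def)
  have B: "B > 0" using D1 by (simp add: B_def)
  \<comment> \<open>The sum of two lower bounds for K^2: one makes the cells available, the other
    lets the test errors beat the evidence and the number of cells. Neither involves n or
    \<delta>.\<close>
  define W where "W = 4 / K2 * (D1 + 5 * B + 1) + 8 * K1 * B / K2\<^sup>2"
  define K where "K = sqrt W"
  have W: "8 * K1 * B / K2\<^sup>2 \<le> W" "4 / K2 * (D1 + 5 * B + 1) \<le> W" "W > 0"
    using K_pos D1 B by (auto simp: W_def intro!: add_pos_pos)
  have K: "K > 0" "K\<^sup>2 = W" using W by (auto simp: K_def)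
  have K1': "8 * K1 * B \<le> K2\<^sup>2 * K\<^sup>2" using W(1) K_pos unfolding K(2) by (simp add: pos_divide_le_eq mult.commute)
  have K2': "D1 + 5 * B + 1 \<le> K2 / 4 * K\<^sup>2"
  proof -
    have "K2 / 4 * (4 / K2 * (D1 + 5 * B + 1)) \<le> K2 / 4 * W" using W(2) K_pos by (intro mult_left_mono) auto
    then show ?thesis using K_pos unfolding K(2) by simp
  qed
  let ?e = "1 / (1 + 2 * real s)" and ?r = "\<lambda>n::nat. K * real n powr (- (real s / (1 + 2 * real s)))"
  have "(\<lambda>n. measure (P n) {z \<in> space (P n). posterior_far M \<sigma> fo n (?r n) z > \<delta>}) \<longlonglongrightarrow> 0" if \<delta>: "\<delta> > 0" for \<delta>
  proof -
    define Q where "Q = 1 + (1 / \<delta>) * (alpha_cst M \<sigma> * S1 + 2 * sqrt (alpha_cst M \<sigma>) * S1)"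
    have Q: "Q \<ge> 0" using \<delta> alpha_pos S1_nonneg by (simp add: Q_def)
    have bound: "measure (P n) {z \<in> space (P n). posterior_far M \<sigma> fo n (?r n) z > \<delta>} \<le> real n powr (- ?e) * Q"
      if n: "n \<ge> max 1 (N0 ^ (1 + 2 * s))" for n
    proof -
      define t where "t = real n powr ?e"
      have n1: "n \<ge> 1" using n by simp
      have t1: "t \<ge> 1" unfolding t_def using n1 by (intro ge_one_powr_ge_zero) auto
      have "t powr real (1 + 2 * s) = real n" unfolding t_def powr_powr using n1 by simp
      moreover have "t powr real (1 + 2 * s) = t ^ (1 + 2 * s)" using t1 by (intro powr_realpow) simp
      ultimately have nt: "real n = t ^ (1 + 2 * s)" by simp
      have rt: "?r n = K * (1 / t) ^ s"
      proof -
        have "real n powr (- (real s / (1 + 2 * real s))) = t powr (- real s)" unfolding t_def powr_powr by simp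
        also have "\<dots> = (1 / t) ^ s" using t1 by (simp add: powr_minus powr_realpow power_one_over divide_inverse power_inverse)
        finally show ?thesis by simp
      qed
      have r2: "real n * (?r n)\<^sup>2 = K\<^sup>2 * t"
        unfolding rt using t1 by (simp add: nt power_add power_mult power_mult_distrib power_divide mult.commute[of 2] power2_eq_square)
      have r0: "?r n > 0" using K n1 by simp
      define N where "N = nat \<lceil>t\<rceil>"
      have N: "t \<le> real N" "real N \<le> 2 * t" using t1 unfolding N_def by linarith+
      have N1: "N \<ge> 1" using N(1) t1 by linarith
      have N0: "N \<ge> N0"
      proof -
        have "real (N0 ^ (1 + 2 * s)) \<le> real n" using n by (simp only: of_nat_le_iff max.bounded_iff)
        then have "real N0 ^ (1 + 2 * s) \<le> t ^ (1 + 2 * s)" unfolding nt by simp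
        then have "real N0 \<le> t" using t1 by (subst (asm) power_mono_iff) auto
        then show ?thesis using N by linarith
      qed
      let ?j = "(s * N - 1, Suc s, L)"
      have j: "?j \<in> Jset" using L1 by (simp add: Jset_def)
      have md: "mdim ?j = s * N + s" using s N1 by (simp add: Suc_le_eq)
      from L N0 N1 have "\<exists>U\<in>sets (lebesgue_R (mdim ?j)).
       U \<subseteq> Theta M ?j \<and> emeasure (pi_prior M ?j) U \<ge> ennreal (exp (- C0 * real N)) \<and>
       (\<forall>\<theta>\<in>U. \<forall>x\<in>{0<..<1}. \<bar>f_spline ?j \<theta> x - fo x\<bar> \<le> C0 * (1 / real N) ^ s)" by (elim conjE allE impE)
      then obtain U where U: "U \<in> sets (lebesgue_R (mdim ?j))" "U \<subseteq> Theta M ?j"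
         "emeasure (pi_prior M ?j) U \<ge> ennreal (exp (- C0 * real N))"
       "\<forall>\<theta>\<in>U. \<forall>x\<in>{0<..<1}. \<bar>f_spline ?j \<theta> x - fo x\<bar> \<le> C0 * (1 / real N) ^ s" by (elim bexE conjE)
      have "emeasure (P n) {z \<in> space (P n). post_num n (Theta M) z < ennreal (exp (- D1 * t))} \<le> ennreal (exp (- t))"
        by (rule evidence_lower_bound_rate[OF s md j t1 N nt C0 Cw(1) Cw(2)[OF N1] U(1-3) _ D1_def]) (rule U(4)[rule_format])
      from posterior_bound_at[OF t1 n1 D1 K(1) \<delta> this B_def K1' K2' r0 r2]
      have "measure (P n) {z \<in> space (P n). posterior_far M \<sigma> fo n (?r n) z > \<delta>} \<le> exp (- t) * Q" unfolding Q_def .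
      also have "exp (- t) * Q \<le> real n powr (- ?e) * Q"
      proof (rule mult_right_mono[OF _ Q])
        \<comment> \<open>Any bound tending to zero will do; exp(- t) \<le> 1/t is already a
          negative power of n.\<close>
        have "t \<le> exp t" using exp_ge_add_one_self[of t] by linarith
        then have "inverse (exp t) \<le> inverse t" using t1 by (intro le_imp_inverse_le) auto
        then show "exp (- t) \<le> real n powr (- ?e)" unfolding powr_minus t_def[symmetric] exp_minus .
      qed
      finally show ?thesis .
    qed
    have "(\<lambda>n. real n powr (- ?e)) \<longlonglongrightarrow> 0"
      by (rule tendsto_neg_powr[OF _ filterlim_real_sequentially]) (simp add: add_pos_nonneg)
    from tendsto_mult_right[OF this, of Q] have lim: "(\<lambda>n. real n powr (- ?e) * Q) \<longlonglongrightarrow> 0" by simp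
    show ?thesis
    proof (rule tendsto_sandwich[OF _ _ tendsto_const lim])
      show "eventually (\<lambda>n. measure (P n) {z \<in> space (P n). posterior_far M \<sigma> fo n (?r n) z > \<delta>} \<le> real n powr (- ?e) * Q) sequentially"
        unfolding eventually_sequentially using bound by (intro exI[of _ "max 1 (N0 ^ (1 + 2 * s))"] allI impI)
    qed simp
  qed
  then show ?thesis using K(1) by (intro exI[of _ K] conjI allI impI)
qed

lemma posterior_far_nonneg: "z \<in> space (P n) \<Longrightarrow> posterior_far M \<sigma> fo n r z \<ge> 0"
  by (simp add: posterior_far_eq space_P)

end

text \<open>Within one observation, independence of design point and noise gives a product law, and
  the shift y = f(x) + e turns the noise density into the normal density around f(x). Independence
  across observations then yields the product formula. Positivity of M comes from the strict bound
  on the sup norm, measurability of f from continuity.\<close>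

lemma regression_law_joint_law:
  fixes \<Omega> :: "'w measure" and X \<epsilon> Y :: "nat \<Rightarrow> 'w \<Rightarrow> real"
  assumes \<Omega>: "prob_space \<Omega>" and \<sigma>: "\<sigma> > 0"
    and cont: "continuous_on {0..1} f" and fM: "sup_norm f < ereal M"
    and X: "\<And>i. i \<ge> 1 \<Longrightarrow> X i \<in> \<Omega> \<rightarrow>\<^sub>M mu_X"
    and X_law: "\<And>i. i \<ge> 1 \<Longrightarrow> distr \<Omega> mu_X (X i) = mu_X"
    and \<epsilon>_law: "\<And>i. i \<ge> 1 \<Longrightarrow> distributed \<Omega> lborel (\<epsilon> i) (normal_density 0 \<sigma>)"
    and X\<epsilon>: "\<And>i. i \<ge> 1 \<Longrightarrow> prob_space.indep_var \<Omega> mu_X (X i) borel (\<epsilon> i)"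
    and Y: "\<And>i w. i \<ge> 1 \<Longrightarrow> w \<in> space \<Omega> \<Longrightarrow> Y i w = f (X i w) + \<epsilon> i w"
    and ind: "prob_space.indep_vars \<Omega> (\<lambda>_. mu_X \<Otimes>\<^sub>M borel) (\<lambda>i w. (X i w, Y i w)) {1..}"
  shows "regression_law (joint_law \<Omega> X Y) f \<sigma> M"
proof -
  interpret prob_space \<Omega> by (rule \<Omega>)
  let ?Z = "\<lambda>i w. (X i w, Y i w)"
  have bd: "\<And>x. x \<in> {0..1} \<Longrightarrow> \<bar>f x\<bar> \<le> M"
    using less_imp_le[OF fM] unfolding sup_norm_le_iff by (rule bspec)
  have "ereal 0 \<le> sup_norm f" unfolding sup_norm_def by (rule SUP_upper2[of 0]) auto
  then have "ereal 0 < ereal M" using fM by (rule le_less_trans)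
  then have M: "M > 0" by simp
  have fmeas: "f \<in> borel_measurable mu_X"
    using borel_measurable_continuous_on_restrict[OF cont] unfolding measurable_cong_sets[OF sets_mu_X refl] .
  have Z: "?Z i \<in> measurable \<Omega> (mu_X \<Otimes>\<^sub>M borel)" if "i \<ge> 1" for i
    using ind that unfolding indep_vars_def by simp
  have J: "(\<lambda>w. \<lambda>i\<in>{1..n}. ?Z i w) \<in> measurable \<Omega> (data_space n)" for n
    unfolding data_space_def by (intro measurable_restrict Z) simp
  have one: "(\<integral>\<^sup>+w. g (?Z i w) \<partial>\<Omega>) = (\<integral>\<^sup>+x. \<integral>\<^sup>+y. g (x, y) * ennreal (normal_density (f x) \<sigma> y) \<partial>lborel \<partial>mu_X)"
    if i: "i \<ge> 1" and g: "g \<in> borel_measurable (mu_X \<Otimes>\<^sub>M borel)" for i and g :: "real \<times> real \<Rightarrow> ennreal"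
  proof -
    let ?E = "distr \<Omega> borel (\<epsilon> i)"
    let ?h = "\<lambda>p. g (fst p, f (fst p) + snd p)"
    have Em: "\<epsilon> i \<in> borel_measurable \<Omega>"
      and joint: "distr \<Omega> mu_X (X i) \<Otimes>\<^sub>M ?E = distr \<Omega> (mu_X \<Otimes>\<^sub>M borel) (\<lambda>w. (X i w, \<epsilon> i w))"
      using X\<epsilon>[OF i] unfolding indep_var_distribution_eq by blast+
    interpret E: prob_space ?E by (rule prob_space_distr[OF Em])
    have "?E = distr \<Omega> lborel (\<epsilon> i)" by (rule distr_cong) auto
    also have "\<dots> = density lborel (normal_density 0 \<sigma>)" by (rule distributed_distr_eq_density[OF \<epsilon>_law[OF i]])
    finally have E: "?E = density lborel (normal_density 0 \<sigma>)" .
    have h: "?h \<in> borel_measurable (mu_X \<Otimes>\<^sub>M borel)"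
    proof -
      have "(\<lambda>p. f (fst p) + snd p) \<in> borel_measurable (mu_X \<Otimes>\<^sub>M borel)"
        by (intro borel_measurable_add measurable_compose[OF measurable_fst fmeas] measurable_snd)
      from measurable_compose[OF measurable_Pair[OF measurable_fst this] g] show ?thesis .
    qed
    have eq: "sets (mu_X \<Otimes>\<^sub>M ?E) = sets (mu_X \<Otimes>\<^sub>M borel)" by (intro sets_pair_measure_cong) auto
    have h': "?h \<in> borel_measurable (mu_X \<Otimes>\<^sub>M ?E)" unfolding measurable_cong_sets[OF eq refl] by (rule h)
    have "(\<integral>\<^sup>+w. g (?Z i w) \<partial>\<Omega>) = (\<integral>\<^sup>+w. ?h (X i w, \<epsilon> i w) \<partial>\<Omega>)"
      by (intro nn_integral_cong) (simp add: Y[OF i])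
    also have "\<dots> = (\<integral>\<^sup>+p. ?h p \<partial>distr \<Omega> (mu_X \<Otimes>\<^sub>M borel) (\<lambda>w. (X i w, \<epsilon> i w)))"
      by (rule nn_integral_distr[symmetric, OF measurable_Pair[OF X[OF i] Em]]) (simp add: h)
    also have "\<dots> = (\<integral>\<^sup>+p. ?h p \<partial>(mu_X \<Otimes>\<^sub>M ?E))" unfolding joint[symmetric] X_law[OF i] ..
    also have "\<dots> = (\<integral>\<^sup>+x. \<integral>\<^sup>+e. ?h (x, e) \<partial>?E \<partial>mu_X)" by (rule E.nn_integral_fst[symmetric, OF h'])
    also have "\<dots> = (\<integral>\<^sup>+x. \<integral>\<^sup>+y. g (x, y) * ennreal (normal_density (f x) \<sigma> y) \<partial>lborel \<partial>mu_X)"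
    proof (rule nn_integral_cong)
      fix x assume x: "x \<in> space mu_X"
      have gx: "(\<lambda>y. g (x, y)) \<in> borel_measurable borel"
        by (rule measurable_compose[OF measurable_Pair1'[OF x] g])
      have gx': "(\<lambda>e. g (x, f x + e)) \<in> borel_measurable borel"
        by (rule measurable_compose[OF _ gx]) simp
      have nd: "(\<lambda>y. g (x, y) * ennreal (normal_density (f x) \<sigma> y)) \<in> borel_measurable borel"
        using gx by measurable
      have sh: "normal_density (f x) \<sigma> (f x + e) = normal_density 0 \<sigma> e" for e
        by (simp add: normal_density_def)
      have "(\<integral>\<^sup>+e. ?h (x, e) \<partial>?E) = (\<integral>\<^sup>+e. ennreal (normal_density 0 \<sigma> e) * g (x, f x + e) \<partial>lborel)"
        unfolding E fst_conv snd_conv using gx' by (intro nn_integral_density) auto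
      also have "\<dots> = (\<integral>\<^sup>+y. g (x, y) * ennreal (normal_density (f x) \<sigma> y) \<partial>lborel)"
        using nn_integral_real_affine[OF nd, of 1 "f x"] by (simp add: sh mult.commute)
      finally show "(\<integral>\<^sup>+e. ?h (x, e) \<partial>?E) = (\<integral>\<^sup>+y. g (x, y) * ennreal (normal_density (f x) \<sigma> y) \<partial>lborel)" .
    qed
    finally show ?thesis .
  qed
  have prod: "(\<integral>\<^sup>+z. (\<Prod>i\<in>{1..n}. g (z i)) \<partial>joint_law \<Omega> X Y n)
      = (\<integral>\<^sup>+x. \<integral>\<^sup>+y. g (x, y) * ennreal (normal_density (f x) \<sigma> y) \<partial>lborel \<partial>mu_X) ^ n"
    if g: "g \<in> borel_measurable (mu_X \<Otimes>\<^sub>M borel)" for n and g :: "real \<times> real \<Rightarrow> ennreal"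
  proof -
    have "(\<lambda>z. g (z i)) \<in> borel_measurable (data_space n)" if "i \<in> {1..n}" for i
      unfolding data_space_def by (rule measurable_compose[OF measurable_component_singleton[OF that] g])
    then have pm: "(\<lambda>z. \<Prod>i\<in>{1..n}. g (z i)) \<in> borel_measurable (data_space n)"
      by (rule borel_measurable_prod_ennreal)
    have "indep_vars (\<lambda>_. mu_X \<Otimes>\<^sub>M borel) ?Z {1..n}" by (rule indep_vars_subset[OF ind]) auto
    then have iv: "indep_vars (\<lambda>_. borel) (\<lambda>i w. g (?Z i w)) {1..n}"
      by (rule indep_vars_compose2[where Y="\<lambda>_. g"]) (rule g)
    have "(\<integral>\<^sup>+z. (\<Prod>i\<in>{1..n}. g (z i)) \<partial>joint_law \<Omega> X Y n) = (\<integral>\<^sup>+w. (\<Prod>i\<in>{1..n}. g (?Z i w)) \<partial>\<Omega>)"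
      unfolding joint_law_def by (subst nn_integral_distr[OF J]) (simp_all add: pm del: One_nat_def)
    also have "\<dots> = (\<Prod>i\<in>{1..n}. \<integral>\<^sup>+w. g (?Z i w) \<partial>\<Omega>)"
      by (rule indep_vars_nn_integral[OF _ iv]) auto
    also have "\<dots> = (\<Prod>i\<in>{1..n}. \<integral>\<^sup>+x. \<integral>\<^sup>+y. g (x, y) * ennreal (normal_density (f x) \<sigma> y) \<partial>lborel \<partial>mu_X)"
      by (intro prod.cong refl one g) simp
    finally show ?thesis by simp
  qed
  show ?thesis
  proof (rule regression_law.intro[OF \<sigma> M fmeas bd _ _ prod])
    show "prob_space (joint_law \<Omega> X Y n)" for n unfolding joint_law_def by (rule prob_space_distr[OF J])
    show "sets (joint_law \<Omega> X Y n) = sets (data_space n)" for n by (simp add: joint_law_def)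
  qed
qed

theorem lemma5:
  fixes \<Omega> :: "'w measure" and X \<epsilon> Y :: "nat \<Rightarrow> 'w \<Rightarrow> real"
    and f\<^sub>o :: "real \<Rightarrow> real" and \<sigma> M :: real and s :: nat
  assumes "prob_space \<Omega>"
    and "\<sigma> > 0"
    and "s \<ge> 1"
    and "f\<^sub>o \<in> W_inf s"
    and "sup_norm f\<^sub>o < ereal M"
    and "\<And>i. i \<ge> 1 \<Longrightarrow> X i \<in> \<Omega> \<rightarrow>\<^sub>M mu_X"
    and "\<And>i. i \<ge> 1 \<Longrightarrow> distr \<Omega> mu_X (X i) = mu_X"
    and "\<And>i. i \<ge> 1 \<Longrightarrow> distributed \<Omega> lborel (\<epsilon> i) (normal_density 0 \<sigma>)"
    and "\<And>i. i \<ge> 1 \<Longrightarrow> prob_space.indep_var \<Omega> mu_X (X i) borel (\<epsilon> i)"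
    and "\<And>i w. i \<ge> 1 \<Longrightarrow> w \<in> space \<Omega> \<Longrightarrow> Y i w = f\<^sub>o (X i w) + \<epsilon> i w"
    and "prob_space.indep_vars \<Omega> (\<lambda>_. mu_X \<Otimes>\<^sub>M borel) (\<lambda>i w. (X i w, Y i w)) {1..}"
  shows "\<exists>S :: nat \<Rightarrow> real.
    (\<exists>K>0. \<forall>n. S n = K * real n powr (- (real s / (1 + 2 * real s)))) \<and>
    tendsto_zero_in_prob (joint_law \<Omega> X Y) (\<lambda>n. posterior_far M \<sigma> f\<^sub>o n (S n))"
proof -
  have cont: "continuous_on {0..1} f\<^sub>o" using assms(4) by (simp add: W_inf_def)
  interpret regression_law "joint_law \<Omega> X Y" f\<^sub>o \<sigma> M
    by (rule regression_law_joint_law[OF assms(1,2) cont assms(5-11)])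
  obtain K where K: "K > 0" and lim: "\<forall>\<delta>>0. (\<lambda>n. measure (joint_law \<Omega> X Y n) {z \<in> space (joint_law \<Omega> X Y n).
      posterior_far M \<sigma> f\<^sub>o n (K * real n powr (- (real s / (1 + 2 * real s)))) z > \<delta>}) \<longlonglongrightarrow> 0"
    using posterior_contraction[OF assms(3-5)] by (elim exE conjE)
  show ?thesis
  proof (intro exI[of _ "\<lambda>n. K * real n powr (- (real s / (1 + 2 * real s)))"] conjI exI[of _ K] K allI refl)
    have "{z \<in> space (joint_law \<Omega> X Y n). \<bar>posterior_far M \<sigma> f\<^sub>o n r z\<bar> > \<delta>} = {z \<in> space (joint_law \<Omega> X Y n). posterior_far M \<sigma> f\<^sub>o n r z > \<delta>}" for n r \<delta>
      by (intro Collect_cong conj_cong refl) (simp add: posterior_far_nonneg)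
    then show "tendsto_zero_in_prob (joint_law \<Omega> X Y) (\<lambda>n. posterior_far M \<sigma> f\<^sub>o n (K * real n powr (- (real s / (1 + 2 * real s)))))"
      unfolding tendsto_zero_in_prob_def using lim posterior_far_measurable by simp
  qed
qed

end
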